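(* Let $R$ be a ring. Let $G$ be a group with an epimorphism $\phi\colon G\to\mathbb{Z}$ with kernel $K$. Let $\mathcal{H}$ be a (possibly empty) tuple of subgroups of $G$. Then there is a long exact sequence of $RK$-modules $$\cdots\to H^n(G,\mathcal{H};RG)\to H^n(G,\mathcal{H};\widehat{RG}^{\phi}\oplus\widehat{RG}^{-\phi})\to H^n(K,\mathcal{H}_\phi;RK)\to H^{n+1}(G,\mathcal{H};RG)\to\cdots .$$
   Context: Rings are associative, unital and non-zero. For a homomorphism $\phi\colon G\to\mathbb{R}$, the Novikov ring $\widehat{RG}^{\phi}$ is the set of functions $x\colon G\to R$ such that $\{g\in G: x(g)\neq 0,\ \phi(g)\leqslant\kappa\}$ is finite for every $\kappa\in\mathbb{R}$, with pointwise addition and convolution as multiplication. It contains $RG$ and is an $RG$-bimodule. Group pairs: a tuple $\mathcal{H}$ of subgroups of $G$ is a family indexed by some possibly infinite set. If $\mathcal{H}\neq\varnothing$, let $\Delta_{G/\mathcal{H}}$ be the kernel of the augmentation $\bigoplus_{H\in\mathcal{H}}RG/H\to R$, where $RG/H=RG\otimes_{RH}R$. For an $RG$-module $M$ put $H^i(G,\mathcal{H};M)=\mathrm{Ext}^{i-1}_{RG}(\Delta_{G/\mathcal{H}},M)$ if $\mathcal{H}\neq\varnothing$, and $H^i(G,\varnothing;M)=H^i(G;M)$. $\mathcal{H}_\phi$ denotes the tuple of subgroups of $K$ obtained from $\mathcal{H}$ by replacing each $H\in\mathcal{H}$ by the subgroups $x^{-1}Hx\cap K$, where $x$ runs over representatives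 of the double cosets $H\backslash G/K$. When the coefficients form a bimodule, the cohomology is computed with the left module structure, and the remaining right module structure (turned into a left one via $g\mapsto g^{-1}$) makes the cohomology groups into modules over $RG$ (hence over $RK$), respectively over $RK$. *)

theory Defs
  imports "HOL-Algebra.Module" "HOL-Algebra.AbelCoset" "HOL-Algebra.Left_Coset"
    "HOL-Algebra.Elementary_Groups" Complex_Main
begin

section \<open>Left modules over a not necessarily commutative ring\<close>

text \<open>The axioms are those of the locale \<^locale>\<open>module\<close>, whose base ring is commutative.
  As there, the multiplicative part of the record of a module is ignored.\<close>

locale left_module = S?: ring S + M?: abelian_group M
  for S :: "('s, 'c) ring_scheme" (structure) and M :: "('s, 'm, 'd) module_scheme" (structure) +
  assumes smult_closed [simp, intro]:
      "\<lbrakk>a \<in> carrier S; x \<in> carrier M\<rbrakk> \<Longrightarrow> a \<odot>\<^bsub>M\<^esub> x \<in> carrier M"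
    and smult_l_distr:
      "\<lbrakk>a \<in> carrier S; b \<in> carrier S; x \<in> carrier M\<rbrakk> \<Longrightarrow>
        (a \<oplus> b) \<odot>\<^bsub>M\<^esub> x = a \<odot>\<^bsub>M\<^esub> x \<oplus>\<^bsub>M\<^esub> b \<odot>\<^bsub>M\<^esub> x"
    and smult_r_distr:
      "\<lbrakk>a \<in> carrier S; x \<in> carrier M; y \<in> carrier M\<rbrakk> \<Longrightarrow>
        a \<odot>\<^bsub>M\<^esub> (x \<oplus>\<^bsub>M\<^esub> y) = a \<odot>\<^bsub>M\<^esub> x \<oplus>\<^bsub>M\<^esub> a \<odot>\<^bsub>M\<^esub> y"
    and smult_assoc:
      "\<lbrakk>a \<in> carrier S; b \<in> carrier S; x \<in> carrier M\<rbrakk> \<Longrightarrow>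
        (a \<otimes> b) \<odot>\<^bsub>M\<^esub> x = a \<odot>\<^bsub>M\<^esub> (b \<odot>\<^bsub>M\<^esub> x)"
    and smult_one [simp]:
      "x \<in> carrier M \<Longrightarrow> \<one> \<odot>\<^bsub>M\<^esub> x = x"

definition lmodule_hom ::
    "('s, 'c) ring_scheme \<Rightarrow> ('s, 'm, 'd) module_scheme \<Rightarrow> ('s, 'n, 'e) module_scheme \<Rightarrow> ('m \<Rightarrow> 'n) \<Rightarrow> bool"
  where "lmodule_hom S M N f \<longleftrightarrow>
    left_module S M \<and> left_module S N \<and> f \<in> carrier M \<rightarrow> carrier N \<and>
    (\<forall>x\<in>carrier M. \<forall>y\<in>carrier M. f (x \<oplus>\<^bsub>M\<^esub> y) = f x \<oplus>\<^bsub>N\<^esub> f y) \<and>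
    (\<forall>a\<in>carrier S. \<forall>x\<in>carrier M. f (a \<odot>\<^bsub>M\<^esub> x) = a \<odot>\<^bsub>N\<^esub> f x)"

definition exact_at ::
    "('s, 'c) ring_scheme \<Rightarrow> ('s, 'l) module \<Rightarrow> ('s, 'm) module \<Rightarrow> ('s, 'n) module \<Rightarrow>
      ('l \<Rightarrow> 'm) \<Rightarrow> ('m \<Rightarrow> 'n) \<Rightarrow> bool"
  where "exact_at S L M N f g \<longleftrightarrow>
    lmodule_hom S L M f \<and> lmodule_hom S M N g \<and> f ` carrier L = a_kernel M N g"

definition long_exact_sequence ::
    "('s, 'c) ring_scheme \<Rightarrow> (int \<Rightarrow> ('s, 'l) module) \<Rightarrow> (int \<Rightarrow> ('s, 'm) module) \<Rightarrow>
      (int \<Rightarrow> ('s, 'n) module) \<Rightarrow> bool"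
  where "long_exact_sequence S A B C \<longleftrightarrow>
    (\<exists>f g \<delta>. \<forall>n.
      exact_at S (A n) (B n) (C n) (f n) (g n) \<and>
      exact_at S (B n) (C n) (A (n + 1)) (g n) (\<delta> n) \<and>
      exact_at S (C n) (A (n + 1)) (B (n + 1)) (\<delta> n) (f (n + 1)))"

definition quotient_module :: "('s, 'm, 'd) module_scheme \<Rightarrow> 'm set \<Rightarrow> ('s, 'm set) module"
  where "quotient_module M N =
    \<lparr>carrier = a_rcosets\<^bsub>M\<^esub> N, mult = undefined, one = undefined, zero = N, add = set_add M,
     smult = (\<lambda>a X. \<Union>x\<in>X. N +>\<^bsub>M\<^esub> (a \<odot>\<^bsub>M\<^esub> x))\<rparr>"

definition direct_sum :: "'i set \<Rightarrow> ('i \<Rightarrow> ('s, 'm) module) \<Rightarrow> ('s, 'i \<Rightarrow> 'm) module"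
  where "direct_sum I M =
    \<lparr>carrier = {x. (\<forall>i\<in>I. x i \<in> carrier (M i)) \<and> x \<in> extensional I \<and>
                   finite {i \<in> I. x i \<noteq> \<zero>\<^bsub>M i\<^esub>}},
     mult = undefined, one = undefined,
     zero = (\<lambda>i\<in>I. \<zero>\<^bsub>M i\<^esub>),
     add = (\<lambda>x y. \<lambda>i\<in>I. x i \<oplus>\<^bsub>M i\<^esub> y i),
     smult = (\<lambda>a x. \<lambda>i\<in>I. a \<odot>\<^bsub>M i\<^esub> x i)\<rparr>"

definition free_module :: "('s, 'c) ring_scheme \<Rightarrow> 'b set \<Rightarrow> ('s, 'b \<Rightarrow> 's) module"
  where "free_module S B =
    \<lparr>carrier = {x. (\<forall>b\<in>B. x b \<in> carrier S) \<and> (\<forall>b. b \<notin> B \<longrightarrow> x b = \<zero>\<^bsub>S\<^esub>) \<and>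
                   finite {b. x b \<noteq> \<zero>\<^bsub>S\<^esub>}},
     mult = undefined, one = undefined,
     zero = (\<lambda>_. \<zero>\<^bsub>S\<^esub>),
     add = (\<lambda>x y b. x b \<oplus>\<^bsub>S\<^esub> y b),
     smult = (\<lambda>a x b. a \<otimes>\<^bsub>S\<^esub> x b)\<rparr>"

text \<open>The linear map on a free module which is given by \<open>f\<close> on the basis.\<close>

definition lin_ext ::
    "('s, 'c) ring_scheme \<Rightarrow> ('s, 'm, 'd) module_scheme \<Rightarrow> ('b \<Rightarrow> 'm) \<Rightarrow> ('b \<Rightarrow> 's) \<Rightarrow> 'm"
  where "lin_ext S M f x = (\<Oplus>\<^bsub>M\<^esub>b\<in>{b. x b \<noteq> \<zero>\<^bsub>S\<^esub>}. x b \<odot>\<^bsub>M\<^esub> f b)"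


section \<open>Ext\<close>

text \<open>
  Ext is computed with the free resolution \<open>\<dots> \<rightarrow> F\<^sub>1 \<rightarrow> F\<^sub>0 \<rightarrow> A \<rightarrow> 0\<close> in which \<open>F\<^sub>0\<close> has as basis all
  elements of \<open>A\<close>, and \<open>F\<^sub>n\<^sub>+\<^sub>1\<close> has as basis all formal linear combinations (lists of pairs of a
  coefficient and a basis element of \<open>F\<^sub>n\<close>) whose value in \<open>F\<^sub>n\<close> is a cycle.  The datatype provides
  one type containing the bases of all \<open>F\<^sub>n\<close>.  That this is a resolution is lemma \<open>free_resolution\<close>
  below.
\<close>

datatype ('s, 'a) syzygy = Gen 'a | Rel "('s \<times> ('s, 'a) syzygy) list"

definition formal_comb :: "('s, 'c) ring_scheme \<Rightarrow> ('s \<times> 'b) list \<Rightarrow> 'b \<Rightarrow> 's"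
  where "formal_comb S l = foldr (\<lambda>(s, b) x. x(b := s \<oplus>\<^bsub>S\<^esub> x b)) l (\<lambda>_. \<zero>\<^bsub>S\<^esub>)"

definition res_augmentation ::
    "('s, 'c) ring_scheme \<Rightarrow> ('s, 'a, 'd) module_scheme \<Rightarrow> (('s, 'a) syzygy \<Rightarrow> 's) \<Rightarrow> 'a"
  where "res_augmentation S A = lin_ext S A (case_syzygy (\<lambda>a. a) (\<lambda>_. \<zero>\<^bsub>A\<^esub>))"

text \<open>The differential vanishes on \<open>F\<^sub>0\<close>, so that it extends the complex by zero to negative degrees.\<close>

definition res_diff ::
    "('s, 'c) ring_scheme \<Rightarrow> (('s, 'a) syzygy \<Rightarrow> 's) \<Rightarrow> (('s, 'a) syzygy \<Rightarrow> 's)"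
  where "res_diff S =
    lin_ext S (free_module S UNIV) (case_syzygy (\<lambda>_ _. \<zero>\<^bsub>S\<^esub>) (formal_comb S))"

fun res_basis ::
    "('s, 'c) ring_scheme \<Rightarrow> ('s, 'a, 'd) module_scheme \<Rightarrow> nat \<Rightarrow> ('s, 'a) syzygy set"
  where
    "res_basis S A 0 = Gen ` carrier A"
  | "res_basis S A (Suc n) = Rel ` {l. set l \<subseteq> carrier S \<times> res_basis S A n \<and>
      (if n = 0 then res_augmentation S A (formal_comb S l) = \<zero>\<^bsub>A\<^esub>
       else res_diff S (formal_comb S l) = (\<lambda>_. \<zero>\<^bsub>S\<^esub>))}"

definition resolution ::
    "('s, 'c) ring_scheme \<Rightarrow> ('s, 'a, 'd) module_scheme \<Rightarrow> int \<Rightarrow> ('s, ('s, 'a) syzygy \<Rightarrow> 's) module"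
  where "resolution S A n = free_module S (if n < 0 then {} else res_basis S A (nat n))"

text \<open>
  The group of \<open>S\<close>-linear maps from \<open>P\<close> to \<open>M\<close>, on which scalars \<open>t\<close> of a second ring act through the
  endomorphisms \<open>\<alpha> t\<close> of \<open>M\<close>.
\<close>

definition hom_module ::
    "('s, 'c) ring_scheme \<Rightarrow> ('s, 'p, 'd) module_scheme \<Rightarrow> ('s, 'm, 'e) module_scheme \<Rightarrow>
      ('t \<Rightarrow> 'm \<Rightarrow> 'm) \<Rightarrow> ('t, 'p \<Rightarrow> 'm) module"
  where "hom_module S P M \<alpha> =
    \<lparr>carrier = {f \<in> extensional (carrier P). lmodule_hom S P M f},
     mult = undefined, one = undefined,
     zero = (\<lambda>x\<in>carrier P. \<zero>\<^bsub>M\<^esub>),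
     add = (\<lambda>f g. \<lambda>x\<in>carrier P. f x \<oplus>\<^bsub>M\<^esub> g x),
     smult = (\<lambda>t f. \<lambda>x\<in>carrier P. \<alpha> t (f x))\<rparr>"

definition cochains ::
    "('s, 'c) ring_scheme \<Rightarrow> ('s, 'a, 'd) module_scheme \<Rightarrow> ('s, 'm, 'e) module_scheme \<Rightarrow>
      ('t \<Rightarrow> 'm \<Rightarrow> 'm) \<Rightarrow> int \<Rightarrow> ('t, (('s, 'a) syzygy \<Rightarrow> 's) \<Rightarrow> 'm) module"
  where "cochains S A M \<alpha> n = hom_module S (resolution S A n) M \<alpha>"

definition coboundary ::
    "('s, 'c) ring_scheme \<Rightarrow> ('s, 'a, 'd) module_scheme \<Rightarrow> int \<Rightarrow>
      ((('s, 'a) syzygy \<Rightarrow> 's) \<Rightarrow> 'm) \<Rightarrow> ((('s, 'a) syzygy \<Rightarrow> 's) \<Rightarrow> 'm)"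
  where "coboundary S A n f = restrict (f \<circ> res_diff S) (carrier (resolution S A (n + 1)))"

definition Ext ::
    "('s, 'c) ring_scheme \<Rightarrow> ('s, 'a, 'd) module_scheme \<Rightarrow> ('s, 'm, 'e) module_scheme \<Rightarrow>
      ('t \<Rightarrow> 'm \<Rightarrow> 'm) \<Rightarrow> int \<Rightarrow> ('t, ((('s, 'a) syzygy \<Rightarrow> 's) \<Rightarrow> 'm) set) module"
  where "Ext S A M \<alpha> n =
    quotient_module
      ((cochains S A M \<alpha> n)
        \<lparr>carrier := a_kernel (cochains S A M \<alpha> n) (cochains S A M \<alpha> (n + 1)) (coboundary S A n)\<rparr>)
      (coboundary S A (n - 1) ` carrier (cochains S A M \<alpha> (n - 1)))"


lemma free_module_carrierI:
  assumes "\<And>b. b \<in> B \<Longrightarrow> x b \<in> carrier S" and "\<And>b. b \<notin> B \<Longrightarrow> x b = \<zero>\<^bsub>S\<^esub>"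
    and "finite F" and "\<And>b. b \<notin> F \<Longrightarrow> x b = \<zero>\<^bsub>S\<^esub>"
  shows "x \<in> carrier (free_module S B)"
  using assms by (auto simp: free_module_def intro: finite_subset[of _ F])

lemma free_module_mem [simp]:
  assumes "ring S" and "x \<in> carrier (free_module S B)"
  shows "x b \<in> carrier S"
proof -
  interpret ring S by fact
  show ?thesis using assms(2) by (cases "b \<in> B") (auto simp: free_module_def)
qed

lemma free_module_ops [simp]:
  "x \<oplus>\<^bsub>free_module S B\<^esub> y = (\<lambda>b. x b \<oplus>\<^bsub>S\<^esub> y b)"
  "a \<odot>\<^bsub>free_module S B\<^esub> x = (\<lambda>b. a \<otimes>\<^bsub>S\<^esub> x b)"
  "\<zero>\<^bsub>free_module S B\<^esub> = (\<lambda>_. \<zero>\<^bsub>S\<^esub>)"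
  by (simp_all add: free_module_def)

lemma left_module_free_module:
  assumes "ring S"
  shows "left_module S (free_module S B)"
proof -
  interpret S: ring S by fact
  note mem = free_module_mem[OF assms, where B = B]
  have add: "(\<lambda>b. x b \<oplus>\<^bsub>S\<^esub> y b) \<in> carrier (free_module S B)"
    if "x \<in> carrier (free_module S B)" "y \<in> carrier (free_module S B)" for x y
    using that mem[OF that(1)] mem[OF that(2)]
    by (intro free_module_carrierI[where F = "{b. x b \<noteq> \<zero>\<^bsub>S\<^esub>} \<union> {b. y b \<noteq> \<zero>\<^bsub>S\<^esub>}"])
       (auto simp: free_module_def)
  have smult: "(\<lambda>b. a \<otimes>\<^bsub>S\<^esub> x b) \<in> carrier (free_module S B)"
    if "a \<in> carrier S" "x \<in> carrier (free_module S B)" for a x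
    using that mem[OF that(2)]
    by (intro free_module_carrierI[where F = "{b. x b \<noteq> \<zero>\<^bsub>S\<^esub>}"]) (auto simp: free_module_def)
  have "abelian_group (free_module S B)"
  proof (rule abelian_groupI)
    fix x assume x: "x \<in> carrier (free_module S B)"
    have "(\<lambda>b. \<ominus>\<^bsub>S\<^esub> x b) \<in> carrier (free_module S B)"
      using x mem[OF x]
      by (intro free_module_carrierI[where F = "{b. x b \<noteq> \<zero>\<^bsub>S\<^esub>}"]) (auto simp: free_module_def)
    moreover have "(\<lambda>b. \<ominus>\<^bsub>S\<^esub> x b) \<oplus>\<^bsub>free_module S B\<^esub> x = \<zero>\<^bsub>free_module S B\<^esub>"
      using mem[OF x] by (simp add: S.l_neg)
    ultimately show "\<exists>y\<in>carrier (free_module S B). y \<oplus>\<^bsub>free_module S B\<^esub> x = \<zero>\<^bsub>free_module S B\<^esub>"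
      by blast
  next
    show "\<zero>\<^bsub>free_module S B\<^esub> \<in> carrier (free_module S B)"
      by (simp add: free_module_def)
  qed (use mem in \<open>simp_all add: add S.a_ac fun_eq_iff\<close>)
  then show ?thesis
    using assms
    by (intro left_module.intro left_module_axioms.intro)
       (use mem in \<open>simp_all add: smult S.l_distr S.r_distr S.m_assoc fun_eq_iff\<close>)
qed

context left_module
begin

lemma smult_zero_left [simp]: "x \<in> carrier M \<Longrightarrow> \<zero> \<odot>\<^bsub>M\<^esub> x = \<zero>\<^bsub>M\<^esub>"
  using smult_l_distr[of \<zero> \<zero> x] smult_closed[of \<zero> x]
  by (metis M.add.l_cancel_one' S.zero_closed S.add.l_one)

lemma smult_zero_right [simp]: "a \<in> carrier S \<Longrightarrow> a \<odot>\<^bsub>M\<^esub> \<zero>\<^bsub>M\<^esub> = \<zero>\<^bsub>M\<^esub>"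
  using smult_r_distr[of a "\<zero>\<^bsub>M\<^esub>" "\<zero>\<^bsub>M\<^esub>"] smult_closed[of a "\<zero>\<^bsub>M\<^esub>"]
  by (metis M.add.l_cancel_one' M.zero_closed M.add.l_one)

lemma finsum_smult:
  assumes "a \<in> carrier S" and "g \<in> F \<rightarrow> carrier M"
  shows "a \<odot>\<^bsub>M\<^esub> finsum M g F = (\<Oplus>\<^bsub>M\<^esub>b\<in>F. a \<odot>\<^bsub>M\<^esub> g b)"
  using assms(2)
proof (induction F rule: infinite_finite_induct)
  case (insert b F)
  then show ?case using assms(1) by (simp add: Pi_iff smult_r_distr)
qed (use assms(1) in \<open>simp_all\<close>)

lemma lin_ext_eq:
  assumes "x \<in> carrier (free_module S B)" and "f \<in> B \<rightarrow> carrier M"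
    and "finite F" and "{b. x b \<noteq> \<zero>} \<subseteq> F" and "F \<subseteq> B"
  shows "lin_ext S M f x = (\<Oplus>\<^bsub>M\<^esub>b\<in>F. x b \<odot>\<^bsub>M\<^esub> f b)"
  unfolding lin_ext_def
  by (rule M.add.finprod_mono_neutral_cong_left)
     (use assms free_module_mem[OF S.ring_axioms assms(1)] in \<open>auto simp: Pi_iff subset_iff\<close>)

lemma lin_ext_hom:
  assumes f: "f \<in> B \<rightarrow> carrier M"
  shows "lmodule_hom S (free_module S B) M (lin_ext S M f)"
proof -
  note mem = free_module_mem[OF S.ring_axioms, where B = B]
  interpret F: left_module S "free_module S B"
    by (rule left_module_free_module) (rule S.ring_axioms)
  have supp: "{b. x b \<noteq> \<zero>} \<subseteq> B" "finite {b. x b \<noteq> \<zero>}" if "x \<in> carrier (free_module S B)" for x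
    using that by (auto simp: free_module_def)
  have "lin_ext S M f (x \<oplus>\<^bsub>free_module S B\<^esub> y) = lin_ext S M f x \<oplus>\<^bsub>M\<^esub> lin_ext S M f y"
    if xy: "x \<in> carrier (free_module S B)" "y \<in> carrier (free_module S B)" for x y
  proof -
    let ?F = "{b. x b \<noteq> \<zero>} \<union> {b. y b \<noteq> \<zero>}"
    have F: "finite ?F" "?F \<subseteq> B" using supp xy by auto
    have "x \<oplus>\<^bsub>free_module S B\<^esub> y \<in> carrier (free_module S B)" using xy by blast
    moreover have "{b. (x \<oplus>\<^bsub>free_module S B\<^esub> y) b \<noteq> \<zero>} \<subseteq> ?F"
      by auto
    ultimately have "lin_ext S M f (x \<oplus>\<^bsub>free_module S B\<^esub> y)
        = (\<Oplus>\<^bsub>M\<^esub>b\<in>?F. (x \<oplus>\<^bsub>free_module S B\<^esub> y) b \<odot>\<^bsub>M\<^esub> f b)"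
      using F f by (intro lin_ext_eq) auto
    also have "\<dots> = (\<Oplus>\<^bsub>M\<^esub>b\<in>?F. x b \<odot>\<^bsub>M\<^esub> f b \<oplus>\<^bsub>M\<^esub> y b \<odot>\<^bsub>M\<^esub> f b)"
      using F f by (intro M.finsum_cong') (auto simp: smult_l_distr Pi_iff subset_iff mem[OF xy(1)] mem[OF xy(2)])
    also have "\<dots> = (\<Oplus>\<^bsub>M\<^esub>b\<in>?F. x b \<odot>\<^bsub>M\<^esub> f b) \<oplus>\<^bsub>M\<^esub> (\<Oplus>\<^bsub>M\<^esub>b\<in>?F. y b \<odot>\<^bsub>M\<^esub> f b)"
      using F f by (intro M.finsum_addf) (auto simp: Pi_iff subset_iff mem[OF xy(1)] mem[OF xy(2)])
    also have "\<dots> = lin_ext S M f x \<oplus>\<^bsub>M\<^esub> lin_ext S M f y"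
      using lin_ext_eq[OF xy(1) f F(1) _ F(2)] lin_ext_eq[OF xy(2) f F(1) _ F(2)] by simp
    finally show ?thesis .
  qed
  moreover have "lin_ext S M f (a \<odot>\<^bsub>free_module S B\<^esub> x) = a \<odot>\<^bsub>M\<^esub> lin_ext S M f x"
    if ax: "a \<in> carrier S" "x \<in> carrier (free_module S B)" for a x
  proof -
    let ?F = "{b. x b \<noteq> \<zero>}"
    have F: "finite ?F" "?F \<subseteq> B" using supp ax by auto
    have "a \<odot>\<^bsub>free_module S B\<^esub> x \<in> carrier (free_module S B)" using ax by blast
    moreover have "{b. (a \<odot>\<^bsub>free_module S B\<^esub> x) b \<noteq> \<zero>} \<subseteq> ?F"
      using ax by auto
    ultimately have "lin_ext S M f (a \<odot>\<^bsub>free_module S B\<^esub> x)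
        = (\<Oplus>\<^bsub>M\<^esub>b\<in>?F. (a \<odot>\<^bsub>free_module S B\<^esub> x) b \<odot>\<^bsub>M\<^esub> f b)"
      using F f by (intro lin_ext_eq) auto
    also have "\<dots> = (\<Oplus>\<^bsub>M\<^esub>b\<in>?F. a \<odot>\<^bsub>M\<^esub> (x b \<odot>\<^bsub>M\<^esub> f b))"
      using F f by (intro M.finsum_cong') (auto simp: smult_assoc Pi_iff subset_iff mem[OF ax(2)] ax(1))
    also have "\<dots> = a \<odot>\<^bsub>M\<^esub> lin_ext S M f x"
      unfolding lin_ext_def
      using F f by (intro finsum_smult[symmetric]) (auto simp: Pi_iff subset_iff mem[OF ax(2)] ax(1))
    finally show ?thesis .
  qed
  moreover have "lin_ext S M f \<in> carrier (free_module S B) \<rightarrow> carrier M"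
    using supp f mem unfolding lin_ext_def
    by (intro Pi_I M.finsum_closed) (auto simp: Pi_iff subset_iff)
  ultimately show ?thesis
    by (simp add: lmodule_hom_def left_module_axioms F.left_module_axioms)
qed

lemma lin_ext_basis:
  assumes "f b \<in> carrier M"
  shows "lin_ext S M f (\<lambda>c. if c = b then \<one> else \<zero>) = f b"
proof (cases "\<one> = \<zero>")
  case True
  then have "f b = \<zero>\<^bsub>M\<^esub>" using smult_one[OF assms] smult_zero_left[OF assms] by simp
  then show ?thesis using True by (simp add: lin_ext_def)
next
  case False
  then have "{c. (if c = b then \<one> else \<zero>) \<noteq> \<zero>} = {b}" by auto
  then show ?thesis using assms by (simp add: lin_ext_def)
qed

end

lemma basis_mem_free_module:
  assumes "ring S" and "b \<in> B"
  shows "(\<lambda>c. if c = b then \<one>\<^bsub>S\<^esub> else \<zero>\<^bsub>S\<^esub>) \<in> carrier (free_module S B)"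
proof -
  interpret ring S by fact
  show ?thesis using assms(2) by (intro free_module_carrierI[where F = "{b}"]) auto
qed

lemma lmodule_hom_zero:
  assumes "lmodule_hom S M N h"
  shows "h \<zero>\<^bsub>M\<^esub> = \<zero>\<^bsub>N\<^esub>"
proof -
  interpret M: left_module S M using assms by (simp add: lmodule_hom_def)
  interpret N: left_module S N using assms by (simp add: lmodule_hom_def)
  have "h \<zero>\<^bsub>M\<^esub> \<in> carrier N" and "h (\<zero>\<^bsub>M\<^esub> \<oplus>\<^bsub>M\<^esub> \<zero>\<^bsub>M\<^esub>) = h \<zero>\<^bsub>M\<^esub> \<oplus>\<^bsub>N\<^esub> h \<zero>\<^bsub>M\<^esub>"
    using assms M.zero_closed unfolding lmodule_hom_def by blast+
  then show ?thesis
    by (metis M.zero_closed M.add.l_one N.add.l_cancel_one')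
qed

lemma lmodule_hom_finsum:
  assumes h: "lmodule_hom S M N h" and "g \<in> F \<rightarrow> carrier M"
  shows "h (finsum M g F) = (\<Oplus>\<^bsub>N\<^esub>b\<in>F. h (g b))"
proof -
  interpret M: left_module S M using h by (simp add: lmodule_hom_def)
  interpret N: left_module S N using h by (simp add: lmodule_hom_def)
  have clo: "h x \<in> carrier N" if "x \<in> carrier M" for x
    using h that unfolding lmodule_hom_def by blast
  have add: "h (x \<oplus>\<^bsub>M\<^esub> y) = h x \<oplus>\<^bsub>N\<^esub> h y" if "x \<in> carrier M" "y \<in> carrier M" for x y
    using h that unfolding lmodule_hom_def by blast
  show ?thesis
    using assms(2)
  proof (induction F rule: infinite_finite_induct)
    case (insert b F)
    then show ?case by (simp add: Pi_iff add clo)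
  qed (use lmodule_hom_zero[OF h] in \<open>simp_all\<close>)
qed

lemma lmodule_hom_lin_ext_zero:
  assumes h: "lmodule_hom S M N h" and f: "f \<in> B \<rightarrow> carrier M" and hf: "\<And>b. b \<in> B \<Longrightarrow> h (f b) = \<zero>\<^bsub>N\<^esub>"
    and x: "x \<in> carrier (free_module S B)"
  shows "h (lin_ext S M f x) = \<zero>\<^bsub>N\<^esub>"
proof -
  interpret M: left_module S M using h by (simp add: lmodule_hom_def)
  interpret N: left_module S N using h by (simp add: lmodule_hom_def)
  have mem: "x b \<in> carrier S" for b by (rule free_module_mem[OF M.S.ring_axioms x])
  have B: "{b. x b \<noteq> \<zero>\<^bsub>S\<^esub>} \<subseteq> B" using x by (auto simp: free_module_def)
  have "h (lin_ext S M f x) = (\<Oplus>\<^bsub>N\<^esub>b\<in>{b. x b \<noteq> \<zero>\<^bsub>S\<^esub>}. h (x b \<odot>\<^bsub>M\<^esub> f b))"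
    unfolding lin_ext_def using B f mem
    by (intro lmodule_hom_finsum[OF h]) (auto simp: Pi_iff subset_iff)
  also have "\<dots> = (\<Oplus>\<^bsub>N\<^esub>b\<in>{b. x b \<noteq> \<zero>\<^bsub>S\<^esub>}. \<zero>\<^bsub>N\<^esub>)"
  proof (rule N.finsum_cong')
    fix b assume "b \<in> {b. x b \<noteq> \<zero>\<^bsub>S\<^esub>}"
    then have b: "b \<in> B" using B by blast
    then have "h (x b \<odot>\<^bsub>M\<^esub> f b) = x b \<odot>\<^bsub>N\<^esub> h (f b)"
      using h f mem unfolding lmodule_hom_def by blast
    then show "h (x b \<odot>\<^bsub>M\<^esub> f b) = \<zero>\<^bsub>N\<^esub>" using hf[OF b] mem by simp
  qed auto
  also have "\<dots> = \<zero>\<^bsub>N\<^esub>" by simp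
  finally show ?thesis .
qed

lemma lmodule_hom_free_module_cod:
  assumes h: "lmodule_hom S M (free_module S C) h" and "h ` carrier M \<subseteq> carrier (free_module S B)"
  shows "lmodule_hom S M (free_module S B) h"
proof -
  have "ring S" using h by (simp add: lmodule_hom_def left_module_def)
  then show ?thesis
    using assms by (auto simp: lmodule_hom_def left_module_free_module)
qed

lemma free_module_mono:
  assumes S: "ring S" and BC: "B \<subseteq> C"
  shows "carrier (free_module S B) \<subseteq> carrier (free_module S C)"
proof
  fix x assume x: "x \<in> carrier (free_module S B)"
  have "x b \<in> carrier S" for b by (rule free_module_mem[OF S x])
  then show "x \<in> carrier (free_module S C)"
    using BC x by (auto simp: free_module_def)
qed

lemma finsum_free_module_closed:
  assumes "ring S" and "g \<in> F \<rightarrow> carrier (free_module S B)"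
  shows "finsum (free_module S UNIV) g F \<in> carrier (free_module S B)"
proof -
  interpret U: left_module S "free_module S UNIV" by (rule left_module_free_module) fact
  interpret B: left_module S "free_module S B" by (rule left_module_free_module) fact
  have UNIV: "carrier (free_module S B) \<subseteq> carrier (free_module S UNIV)"
    by (rule free_module_mono) (simp_all add: assms(1))
  show ?thesis
    using assms(2)
  proof (induction F rule: infinite_finite_induct)
    case (insert b F)
    then have "finsum (free_module S UNIV) g (insert b F)
        = g b \<oplus>\<^bsub>free_module S UNIV\<^esub> finsum (free_module S UNIV) g F"
      using UNIV by (intro U.finsum_insert) (auto simp: Pi_iff)
    also have "\<dots> = g b \<oplus>\<^bsub>free_module S B\<^esub> finsum (free_module S UNIV) g F" by simp
    also have "\<dots> \<in> carrier (free_module S B)"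
      using insert by (intro B.add.m_closed) (auto simp: Pi_iff)
    finally show ?case .
  next
    case empty
    then show ?case using B.zero_closed by simp
  next
    case (infinite F)
    then show ?case using B.zero_closed by (simp add: U.M.add.finprod_infinite)
  qed
qed

lemma formal_comb_closed:
  assumes "ring S" and "set l \<subseteq> carrier S \<times> B"
  shows "formal_comb S l \<in> carrier (free_module S B)"
  using assms(2)
proof (induction l)
  case Nil
  interpret ring S by fact
  show ?case by (simp add: formal_comb_def free_module_def)
next
  case (Cons p l)
  interpret ring S by fact
  obtain s b where p: "p = (s, b)" by (cases p)
  let ?x = "formal_comb S l"
  have x: "?x \<in> carrier (free_module S B)" and sb: "s \<in> carrier S" "b \<in> B"
    using Cons p by auto
  have "formal_comb S (p # l) = ?x(b := s \<oplus>\<^bsub>S\<^esub> ?x b)"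
    by (simp add: formal_comb_def p)
  also have "\<dots> \<in> carrier (free_module S B)"
    using x sb free_module_mem[OF assms(1) x]
    by (intro free_module_carrierI[where F = "insert b {c. ?x c \<noteq> \<zero>\<^bsub>S\<^esub>}"])
       (auto simp: free_module_def)
  finally show ?case .
qed

lemma formal_comb_surj:
  assumes "ring S" and x: "x \<in> carrier (free_module S B)"
  obtains l where "set l \<subseteq> carrier S \<times> B" and "formal_comb S l = x"
proof -
  interpret ring S by fact
  have mem: "x b \<in> carrier S" for b by (rule free_module_mem[OF assms])
  obtain bs where bs: "set bs = {b. x b \<noteq> \<zero>\<^bsub>S\<^esub>}" "distinct bs"
    using x finite_distinct_list[of "{b. x b \<noteq> \<zero>\<^bsub>S\<^esub>}"] by (auto simp: free_module_def)
  have "distinct cs \<Longrightarrow> formal_comb S (map (\<lambda>b. (x b, b)) cs)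
      = (\<lambda>b. if b \<in> set cs then x b else \<zero>\<^bsub>S\<^esub>)" for cs
    by (induction cs) (auto simp: formal_comb_def mem fun_eq_iff)
  then have "formal_comb S (map (\<lambda>b. (x b, b)) bs) = x"
    using bs by (auto simp: fun_eq_iff)
  moreover have "set (map (\<lambda>b. (x b, b)) bs) \<subseteq> carrier S \<times> B"
    using bs x mem by (auto simp: free_module_def)
  ultimately show ?thesis using that by blast
qed

lemma exact_at_free_cover:
  assumes S: "ring S" and h: "lmodule_hom S (free_module S B) N h"
  defines "C \<equiv> Rel ` {l. set l \<subseteq> carrier S \<times> B \<and> h (formal_comb S l) = \<zero>\<^bsub>N\<^esub>}"
  shows "exact_at S (free_module S C) (free_module S B) N (res_diff S) h"
proof -
  let ?f = "case_syzygy (\<lambda>_ _. \<zero>\<^bsub>S\<^esub>) (formal_comb S)"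
  interpret U: left_module S "free_module S UNIV" by (rule left_module_free_module) fact
  interpret B: left_module S "free_module S B" by (rule left_module_free_module) fact
  have fB: "?f \<in> C \<rightarrow> carrier (free_module S B)"
    using formal_comb_closed[OF S] by (auto simp: C_def)
  have fU: "?f \<in> C \<rightarrow> carrier (free_module S UNIV)"
    using fB free_module_mono[OF S, of B UNIV] by blast
  have dU: "lmodule_hom S (free_module S C) (free_module S UNIV) (res_diff S)"
    unfolding res_diff_def by (rule U.lin_ext_hom[OF fU])
  have closed: "res_diff S x = lin_ext S (free_module S B) ?f x" "res_diff S x \<in> carrier (free_module S B)"
    if x: "x \<in> carrier (free_module S C)" for x
  proof -
    let ?g = "\<lambda>b. x b \<odot>\<^bsub>free_module S UNIV\<^esub> ?f b"
    have g: "?g \<in> {b. x b \<noteq> \<zero>\<^bsub>S\<^esub>} \<rightarrow> carrier (free_module S B)"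
    proof
      fix b assume "b \<in> {b. x b \<noteq> \<zero>\<^bsub>S\<^esub>}"
      then have "b \<in> C" using x by (auto simp: free_module_def)
      then have "x b \<odot>\<^bsub>free_module S B\<^esub> ?f b \<in> carrier (free_module S B)"
        using fB free_module_mem[OF S x] by (intro B.smult_closed) auto
      then show "?g b \<in> carrier (free_module S B)" by simp
    qed
    have "finsum (free_module S UNIV) ?g F = finsum (free_module S B) ?g F"
      if "?g \<in> F \<rightarrow> carrier (free_module S B)" for F
      using that
    proof (induction F rule: infinite_finite_induct)
      case (insert b F)
      have "?g \<in> F \<rightarrow> carrier (free_module S UNIV)" "?g b \<in> carrier (free_module S UNIV)"
        using insert.prems free_module_mono[OF S, of B UNIV] by (auto simp: Pi_iff)
      then have "finsum (free_module S UNIV) ?g (insert b F)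
          = ?g b \<oplus>\<^bsub>free_module S UNIV\<^esub> finsum (free_module S UNIV) ?g F"
        using insert.hyps by (intro U.finsum_insert)
      also have "\<dots> = ?g b \<oplus>\<^bsub>free_module S B\<^esub> finsum (free_module S B) ?g F"
        using insert by (simp add: Pi_iff)
      also have "\<dots> = finsum (free_module S B) ?g (insert b F)"
        using insert.prems insert.hyps by (intro B.finsum_insert[symmetric]) (auto simp: Pi_iff)
      finally show ?case .
    next
      case (infinite F)
      then show ?case by (simp add: U.M.add.finprod_infinite B.M.add.finprod_infinite)
    qed simp
    from this[OF g] show "res_diff S x = lin_ext S (free_module S B) ?f x"
      by (simp add: res_diff_def lin_ext_def)
    show "res_diff S x \<in> carrier (free_module S B)"
      unfolding res_diff_def lin_ext_def by (rule finsum_free_module_closed[OF S g])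
  qed
  have d: "lmodule_hom S (free_module S C) (free_module S B) (res_diff S)"
    using closed by (intro lmodule_hom_free_module_cod[OF dU]) auto
  have "h (res_diff S x) = \<zero>\<^bsub>N\<^esub>" if x: "x \<in> carrier (free_module S C)" for x
    unfolding closed(1)[OF x]
    by (rule lmodule_hom_lin_ext_zero[OF h fB _ x]) (auto simp: C_def)
  moreover have "y \<in> res_diff S ` carrier (free_module S C)"
    if y: "y \<in> carrier (free_module S B)" and hy: "h y = \<zero>\<^bsub>N\<^esub>" for y
  proof -
    obtain l where l: "set l \<subseteq> carrier S \<times> B" "formal_comb S l = y"
      using formal_comb_surj[OF S y] .
    then have C: "Rel l \<in> C" using hy by (auto simp: C_def)
    let ?e = "\<lambda>c. if c = Rel l then \<one>\<^bsub>S\<^esub> else \<zero>\<^bsub>S\<^esub>"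
    have "y \<in> carrier (free_module S UNIV)" using y free_module_mono[OF S, of B UNIV] by blast
    then have "res_diff S ?e = y"
      unfolding res_diff_def by (subst U.lin_ext_basis) (simp_all add: l)
    then show ?thesis using basis_mem_free_module[OF S C] by force
  qed
  ultimately show ?thesis
    using closed(2) d h
    by (auto simp: exact_at_def a_kernel_def' )
qed

lemma free_resolution:
  assumes A: "left_module S A"
  shows "lmodule_hom S (resolution S A 0) A (res_augmentation S A)"
    and "res_augmentation S A ` carrier (resolution S A 0) = carrier A"
    and "exact_at S (resolution S A 1) (resolution S A 0) A (res_diff S) (res_augmentation S A)"
    and "n > 0 \<Longrightarrow> exact_at S (resolution S A (n + 1)) (resolution S A n) (resolution S A (n - 1))
          (res_diff S) (res_diff S)"
proof -
  interpret A: left_module S A by fact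
  have S: "ring S" by (rule A.S.ring_axioms)
  let ?g = "case_syzygy (\<lambda>a. a) (\<lambda>_. \<zero>\<^bsub>A\<^esub>)"
  have g: "?g \<in> res_basis S A 0 \<rightarrow> carrier A" by auto
  show eps: "lmodule_hom S (resolution S A 0) A (res_augmentation S A)"
    unfolding resolution_def res_augmentation_def using A.lin_ext_hom[OF g] by simp
  show "res_augmentation S A ` carrier (resolution S A 0) = carrier A"
  proof
    show "res_augmentation S A ` carrier (resolution S A 0) \<subseteq> carrier A"
      using eps by (auto simp: lmodule_hom_def)
    show "carrier A \<subseteq> res_augmentation S A ` carrier (resolution S A 0)"
    proof
      fix a assume a: "a \<in> carrier A"
      let ?e = "\<lambda>c. if c = Gen a then \<one>\<^bsub>S\<^esub> else \<zero>\<^bsub>S\<^esub>"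
      have "res_augmentation S A ?e = a"
        unfolding res_augmentation_def by (subst A.lin_ext_basis) (simp_all add: a)
      moreover have "?e \<in> carrier (resolution S A 0)"
        using a by (auto simp: resolution_def intro: basis_mem_free_module[OF S])
      ultimately show "a \<in> res_augmentation S A ` carrier (resolution S A 0)" by force
    qed
  qed
  show ex1: "exact_at S (resolution S A 1) (resolution S A 0) A (res_diff S) (res_augmentation S A)"
    using exact_at_free_cover[OF S eps[unfolded resolution_def]]
    by (simp add: resolution_def)
  have ex: "exact_at S (free_module S (res_basis S A (Suc (Suc m)))) (free_module S (res_basis S A (Suc m)))
      (free_module S (res_basis S A m)) (res_diff S) (res_diff S)" for m
  proof (induction m)
    case 0
    have "lmodule_hom S (free_module S (res_basis S A 1)) (free_module S (res_basis S A 0)) (res_diff S)"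
      using ex1 by (simp add: exact_at_def resolution_def)
    from exact_at_free_cover[OF S this] show ?case by simp
  next
    case (Suc m)
    then have "lmodule_hom S (free_module S (res_basis S A (Suc (Suc m))))
        (free_module S (res_basis S A (Suc m))) (res_diff S)"
      by (simp add: exact_at_def)
    from exact_at_free_cover[OF S this] show ?case by simp
  qed
  show "exact_at S (resolution S A (n + 1)) (resolution S A n) (resolution S A (n - 1))
          (res_diff S) (res_diff S)" if "n > 0"
  proof -
    define m where "m = nat (n - 1)"
    then have "nat n = Suc m" "nat (n + 1) = Suc (Suc m)" "nat (n - 1) = m" using that by auto
    then show ?thesis using ex[of m] that by (simp add: resolution_def)
  qed
qed


section \<open>Group rings and Novikov rings\<close>

definition opposite_ring :: "('r, 'c) ring_scheme \<Rightarrow> ('r, 'c) ring_scheme"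
  where "opposite_ring R = R\<lparr>mult := (\<lambda>x y. y \<otimes>\<^bsub>R\<^esub> x)\<rparr>"

text \<open>Functions on the group are extended by zero outside of its carrier; hence the elements of the
  group ring of a subgroup are elements of the group ring of the group.\<close>

definition convolution ::
    "('r, 'c) ring_scheme \<Rightarrow> ('g, 'd) monoid_scheme \<Rightarrow> ('g \<Rightarrow> 'r) \<Rightarrow> ('g \<Rightarrow> 'r) \<Rightarrow> 'g \<Rightarrow> 'r"
  where "convolution R G x y = (\<lambda>g. if g \<in> carrier G
    then \<Oplus>\<^bsub>R\<^esub>h\<in>{h \<in> carrier G. x h \<noteq> \<zero>\<^bsub>R\<^esub> \<and> y (inv\<^bsub>G\<^esub> h \<otimes>\<^bsub>G\<^esub> g) \<noteq> \<zero>\<^bsub>R\<^esub>}.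
           x h \<otimes>\<^bsub>R\<^esub> y (inv\<^bsub>G\<^esub> h \<otimes>\<^bsub>G\<^esub> g)
    else \<zero>\<^bsub>R\<^esub>)"

definition convolution_ring ::
    "('r, 'c) ring_scheme \<Rightarrow> ('g, 'd) monoid_scheme \<Rightarrow> ('g set \<Rightarrow> bool) \<Rightarrow> ('g \<Rightarrow> 'r) ring"
  where "convolution_ring R G P =
    \<lparr>carrier = {x. (\<forall>g\<in>carrier G. x g \<in> carrier R) \<and> (\<forall>g. g \<notin> carrier G \<longrightarrow> x g = \<zero>\<^bsub>R\<^esub>) \<and>
                   P {g \<in> carrier G. x g \<noteq> \<zero>\<^bsub>R\<^esub>}},
     mult = convolution R G,
     one = (\<lambda>g. if g = \<one>\<^bsub>G\<^esub> then \<one>\<^bsub>R\<^esub> else \<zero>\<^bsub>R\<^esub>),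
     zero = (\<lambda>_. \<zero>\<^bsub>R\<^esub>),
     add = (\<lambda>x y g. x g \<oplus>\<^bsub>R\<^esub> y g)\<rparr>"

definition group_ring :: "('r, 'c) ring_scheme \<Rightarrow> ('g, 'd) monoid_scheme \<Rightarrow> ('g \<Rightarrow> 'r) ring"
  where "group_ring R G = convolution_ring R G finite"

definition novikov_ring ::
    "('r, 'c) ring_scheme \<Rightarrow> ('g, 'd) monoid_scheme \<Rightarrow> ('g \<Rightarrow> real) \<Rightarrow> ('g \<Rightarrow> 'r) ring"
  where "novikov_ring R G \<chi> = convolution_ring R G (\<lambda>X. \<forall>\<kappa>. finite {g \<in> X. \<chi> g \<le> \<kappa>})"

definition gr_star ::
    "('r, 'c) ring_scheme \<Rightarrow> ('g, 'd) monoid_scheme \<Rightarrow> ('g \<Rightarrow> 'r) \<Rightarrow> 'g \<Rightarrow> 'r"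
  where "gr_star R G a = (\<lambda>g. if g \<in> carrier G then a (inv\<^bsub>G\<^esub> g) else \<zero>\<^bsub>R\<^esub>)"

record ('s, 't, 'm) bimodule = "('s, 'm) module" +
  rsmult :: "'m \<Rightarrow> 't \<Rightarrow> 'm"

text \<open>A ring as a bimodule over any of its subrings.\<close>

definition ring_bimodule :: "('m, 'c) ring_scheme \<Rightarrow> ('m, 'm, 'm) bimodule"
  where "ring_bimodule A =
    \<lparr>carrier = carrier A, mult = mult A, one = one A, zero = zero A, add = add A,
     smult = mult A, rsmult = mult A\<rparr>"

definition bimodule_sum ::
    "('s, 't, 'm) bimodule \<Rightarrow> ('s, 't, 'n) bimodule \<Rightarrow> ('s, 't, 'm \<times> 'n) bimodule"
  where "bimodule_sum M N =
    \<lparr>carrier = carrier M \<times> carrier N, mult = undefined, one = undefined,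
     zero = (\<zero>\<^bsub>M\<^esub>, \<zero>\<^bsub>N\<^esub>),
     add = (\<lambda>(x, y) (x', y'). (x \<oplus>\<^bsub>M\<^esub> x', y \<oplus>\<^bsub>N\<^esub> y')),
     smult = (\<lambda>a (x, y). (a \<odot>\<^bsub>M\<^esub> x, a \<odot>\<^bsub>N\<^esub> y)),
     rsmult = (\<lambda>(x, y) a. (rsmult M x a, rsmult N y a))\<rparr>"

text \<open>
  The right module structure of a bimodule over \<open>RG\<close>, turned into a left one via \<open>g \<mapsto> g\<^sup>-\<^sup>1\<close>.  Since
  \<open>a \<mapsto> gr_star R G a\<close> reverses products in \<open>G\<close> but not in \<open>R\<close>, this is a left module over the group
  ring of \<open>G\<close> with coefficients in \<^term>\<open>opposite_ring R\<close>, that is, over \<open>RG\<close> itself if \<open>R\<close> is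
  commutative.
\<close>

definition turned_action ::
    "('r, 'c) ring_scheme \<Rightarrow> ('g, 'd) monoid_scheme \<Rightarrow> ('g \<Rightarrow> 'r, 'g \<Rightarrow> 'r, 'm) bimodule \<Rightarrow>
      ('g \<Rightarrow> 'r) \<Rightarrow> 'm \<Rightarrow> 'm"
  where "turned_action R G M a m = rsmult M m (gr_star R G a)"


section \<open>Cohomology of groups and of group pairs\<close>

definition trivial_module ::
    "('r, 'c) ring_scheme \<Rightarrow> ('g, 'd) monoid_scheme \<Rightarrow> ('g \<Rightarrow> 'r, 'r) module"
  where "trivial_module R G =
    \<lparr>carrier = carrier R, mult = mult R, one = one R, zero = zero R, add = add R,
     smult = (\<lambda>a r. (\<Oplus>\<^bsub>R\<^esub>g\<in>{g \<in> carrier G. a g \<noteq> \<zero>\<^bsub>R\<^esub>}. a g) \<otimes>\<^bsub>R\<^esub> r)\<rparr>"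

definition group_cohomology ::
    "('r, 'c) ring_scheme \<Rightarrow> ('g, 'd) monoid_scheme \<Rightarrow> ('g \<Rightarrow> 'r, 'g \<Rightarrow> 'r, 'm) bimodule \<Rightarrow> int \<Rightarrow>
      ('g \<Rightarrow> 'r, ((('g \<Rightarrow> 'r, 'r) syzygy \<Rightarrow> 'g \<Rightarrow> 'r) \<Rightarrow> 'm) set) module"
  where "group_cohomology R G M n =
    Ext (group_ring R G) (trivial_module R G) M (turned_action R G M) n"

text \<open>
  \<open>RG/H = RG \<otimes>\<^bsub>RH\<^esub> R\<close> as the free \<open>R\<close>-module on the left cosets of \<open>H\<close>, permuted by \<open>G\<close>.  The tensor
  \<open>a \<otimes> r\<close> is \<open>coset_tensor R G H a r\<close>; see lemma \<open>coset_module_tensor_product\<close> below.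
\<close>

definition coset_module ::
    "('r, 'c) ring_scheme \<Rightarrow> ('g, 'd) monoid_scheme \<Rightarrow> 'g set \<Rightarrow> ('g \<Rightarrow> 'r, 'g set \<Rightarrow> 'r) module"
  where "coset_module R G H =
    \<lparr>carrier = carrier (free_module R (lcosets\<^bsub>G\<^esub> H)), mult = undefined, one = undefined,
     zero = zero (free_module R (lcosets\<^bsub>G\<^esub> H)),
     add = add (free_module R (lcosets\<^bsub>G\<^esub> H)),
     smult = (\<lambda>a x C. if C \<in> lcosets\<^bsub>G\<^esub> H
       then \<Oplus>\<^bsub>R\<^esub>g\<in>{g \<in> carrier G. a g \<noteq> \<zero>\<^bsub>R\<^esub>}. a g \<otimes>\<^bsub>R\<^esub> x (inv\<^bsub>G\<^esub> g <#\<^bsub>G\<^esub> C)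
       else \<zero>\<^bsub>R\<^esub>)\<rparr>"

definition coset_tensor ::
    "('r, 'c) ring_scheme \<Rightarrow> ('g, 'd) monoid_scheme \<Rightarrow> 'g set \<Rightarrow> ('g \<Rightarrow> 'r) \<Rightarrow> 'r \<Rightarrow> 'g set \<Rightarrow> 'r"
  where "coset_tensor R G H a r = (\<lambda>C. if C \<in> lcosets\<^bsub>G\<^esub> H
    then \<Oplus>\<^bsub>R\<^esub>g\<in>{g \<in> C. a g \<noteq> \<zero>\<^bsub>R\<^esub>}. a g \<otimes>\<^bsub>R\<^esub> r
    else \<zero>\<^bsub>R\<^esub>)"

text \<open>The biadditive and balanced maps \<open>RG \<times> R \<rightarrow> N\<close>, through which \<open>RG \<otimes>\<^bsub>RH\<^esub> R\<close> is defined.\<close>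

definition balanced_map ::
    "('r, 'c) ring_scheme \<Rightarrow> ('g, 'd) monoid_scheme \<Rightarrow> 'g set \<Rightarrow> ('n, 'e) ring_scheme \<Rightarrow>
      (('g \<Rightarrow> 'r) \<Rightarrow> 'r \<Rightarrow> 'n) \<Rightarrow> bool"
  where "balanced_map R G H N \<beta> \<longleftrightarrow>
    (\<forall>a\<in>carrier (group_ring R G). \<forall>r\<in>carrier R. \<beta> a r \<in> carrier N) \<and>
    (\<forall>a\<in>carrier (group_ring R G). \<forall>b\<in>carrier (group_ring R G). \<forall>r\<in>carrier R.
      \<beta> (a \<oplus>\<^bsub>group_ring R G\<^esub> b) r = \<beta> a r \<oplus>\<^bsub>N\<^esub> \<beta> b r) \<and>
    (\<forall>a\<in>carrier (group_ring R G). \<forall>r\<in>carrier R. \<forall>s\<in>carrier R.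
      \<beta> a (r \<oplus>\<^bsub>R\<^esub> s) = \<beta> a r \<oplus>\<^bsub>N\<^esub> \<beta> a s) \<and>
    (\<forall>a\<in>carrier (group_ring R G). \<forall>b\<in>carrier (group_ring R (G\<lparr>carrier := H\<rparr>)). \<forall>r\<in>carrier R.
      \<beta> (a \<otimes>\<^bsub>group_ring R G\<^esub> b) r = \<beta> a (b \<odot>\<^bsub>trivial_module R (G\<lparr>carrier := H\<rparr>)\<^esub> r))"

definition monomial :: "('r, 'c) ring_scheme \<Rightarrow> 'r \<Rightarrow> 'b \<Rightarrow> 'b \<Rightarrow> 'r"
  where "monomial R s b = (\<lambda>c. if c = b then s else \<zero>\<^bsub>R\<^esub>)"

lemma monomial_closed:
  assumes "ring R" and "s \<in> carrier R" and "b \<in> B"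
  shows "monomial R s b \<in> carrier (free_module R B)"
proof -
  interpret ring R by fact
  show ?thesis using assms(2,3)
    by (intro free_module_carrierI[where F = "{b}"]) (auto simp: monomial_def)
qed

lemma free_module_induct [consumes 2, case_names zero monomial add]:
  assumes R: "ring R" and x: "x \<in> carrier (free_module R B)"
    and zero: "P (\<lambda>_. \<zero>\<^bsub>R\<^esub>)"
    and mono: "\<And>s b. s \<in> carrier R \<Longrightarrow> b \<in> B \<Longrightarrow> P (monomial R s b)"
    and add: "\<And>x y. x \<in> carrier (free_module R B) \<Longrightarrow> y \<in> carrier (free_module R B) \<Longrightarrow>
      P x \<Longrightarrow> P y \<Longrightarrow> P (\<lambda>b. x b \<oplus>\<^bsub>R\<^esub> y b)"
  shows "P x"
proof -
  interpret R: ring R by fact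
  have "P x" if "finite F" "x \<in> carrier (free_module R B)" "{b. x b \<noteq> \<zero>\<^bsub>R\<^esub>} \<subseteq> F" for F x
    using that
  proof (induction F arbitrary: x rule: finite_induct)
    case empty
    then have "x = (\<lambda>_. \<zero>\<^bsub>R\<^esub>)" by auto
    then show ?case using zero by simp
  next
    case (insert c F)
    have mem: "x b \<in> carrier R" for b by (rule free_module_mem[OF R insert.prems(1)])
    let ?y = "x(c := \<zero>\<^bsub>R\<^esub>)"
    have y: "?y \<in> carrier (free_module R B)"
      using insert.prems(1) mem
      by (intro free_module_carrierI[where F = "{b. x b \<noteq> \<zero>\<^bsub>R\<^esub>}"]) (auto simp: free_module_def)
    have Py: "P ?y" by (rule insert.IH[OF y]) (use insert.prems(2) in auto)
    show ?case
    proof (cases "c \<in> B")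
      case True
      have "P (\<lambda>b. monomial R (x c) c b \<oplus>\<^bsub>R\<^esub> ?y b)"
        using True y Py mem by (intro add mono monomial_closed[OF R])
      also have "(\<lambda>b. monomial R (x c) c b \<oplus>\<^bsub>R\<^esub> ?y b) = x"
        using mem by (auto simp: monomial_def)
      finally show ?thesis .
    next
      case False
      then have "?y = x" using insert.prems(1) by (auto simp: free_module_def)
      then show ?thesis using Py by simp
    qed
  qed
  from this[of "{b. x b \<noteq> \<zero>\<^bsub>R\<^esub>}" x] show ?thesis
    using x by (simp add: free_module_def)
qed

lemma carrier_group_ring: "carrier (group_ring R G) = carrier (free_module R (carrier G))"
proof -
  have "(\<forall>g. g \<notin> carrier G \<longrightarrow> x g = \<zero>\<^bsub>R\<^esub>) \<Longrightarrow> {g \<in> carrier G. x g \<noteq> \<zero>\<^bsub>R\<^esub>} = {g. x g \<noteq> \<zero>\<^bsub>R\<^esub>}" for x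
    by auto
  then show ?thesis
    by (force simp: group_ring_def convolution_ring_def free_module_def)
qed

lemma group_ring_ops:
  "x \<oplus>\<^bsub>group_ring R G\<^esub> y = (\<lambda>g. x g \<oplus>\<^bsub>R\<^esub> y g)"
  "x \<otimes>\<^bsub>group_ring R G\<^esub> y = convolution R G x y"
  by (simp_all add: group_ring_def convolution_ring_def)

lemma coset_module_simps:
  "carrier (coset_module R G H) = carrier (free_module R (lcosets\<^bsub>G\<^esub> H))"
  "x \<oplus>\<^bsub>coset_module R G H\<^esub> y = (\<lambda>C. x C \<oplus>\<^bsub>R\<^esub> y C)"
  by (simp_all add: coset_module_def)

lemma (in abelian_monoid) finsum_support_eq:
  assumes "finite F" and "S \<subseteq> F" and "f \<in> F \<rightarrow> carrier G" and "\<And>i. i \<in> F - S \<Longrightarrow> f i = \<zero>"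
  shows "finsum G f S = finsum G f F"
  by (rule add.finprod_mono_neutral_cong_left) (use assms in auto)

locale coset_module_setting = R: ring R + G: group G + subgroup H G
  for R :: "('r, 'c) ring_scheme" (structure) and G :: "('g, 'd) monoid_scheme" (structure) and H
begin

lemmas mem = free_module_mem[OF R.ring_axioms]
lemmas monoclosed = monomial_closed[OF R.ring_axioms]

lemma add_closed:
  assumes "x \<in> carrier (free_module R B)" and "y \<in> carrier (free_module R B)"
  shows "(\<lambda>b. x b \<oplus> y b) \<in> carrier (free_module R B)"
proof -
  interpret left_module R "free_module R B" by (rule left_module_free_module) (rule R.ring_axioms)
  show ?thesis using M.add.m_closed[OF assms] by simp
qed

lemma zero_closed: "(\<lambda>_. \<zero>) \<in> carrier (free_module R B)"
  by (simp add: free_module_def)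

lemma convolution_eq:
  assumes "x \<in> carrier (free_module R (carrier G))" and "y \<in> carrier (free_module R (carrier G))"
    and "finite F" and "{g. x g \<noteq> \<zero>} \<subseteq> F" and "F \<subseteq> carrier G" and "g \<in> carrier G"
  shows "convolution R G x y g = (\<Oplus>h\<in>F. x h \<otimes> y (inv\<^bsub>G\<^esub> h \<otimes>\<^bsub>G\<^esub> g))"
  unfolding convolution_def
  using assms mem[OF assms(1)] mem[OF assms(2)]
  by (simp, intro R.finsum_support_eq) auto

lemma convolution_add_left:
  assumes x: "x \<in> carrier (free_module R (carrier G))" and x': "x' \<in> carrier (free_module R (carrier G))"
    and y: "y \<in> carrier (free_module R (carrier G))"
  shows "convolution R G (\<lambda>g. x g \<oplus> x' g) y = (\<lambda>g. convolution R G x y g \<oplus> convolution R G x' y g)"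
proof
  fix g
  let ?F = "{g. x g \<noteq> \<zero>} \<union> {g. x' g \<noteq> \<zero>}"
  have F: "finite ?F" "?F \<subseteq> carrier G" using x x' by (auto simp: free_module_def)
  show "convolution R G (\<lambda>g. x g \<oplus> x' g) y g = convolution R G x y g \<oplus> convolution R G x' y g"
  proof (cases "g \<in> carrier G")
    case True
    have "convolution R G (\<lambda>g. x g \<oplus> x' g) y g
        = (\<Oplus>h\<in>?F. (x h \<oplus> x' h) \<otimes> y (inv\<^bsub>G\<^esub> h \<otimes>\<^bsub>G\<^esub> g))"
      using F True by (intro convolution_eq add_closed x x' y) auto
    also have "\<dots> = (\<Oplus>h\<in>?F. x h \<otimes> y (inv\<^bsub>G\<^esub> h \<otimes>\<^bsub>G\<^esub> g) \<oplus> x' h \<otimes> y (inv\<^bsub>G\<^esub> h \<otimes>\<^bsub>G\<^esub> g))"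
      using mem[OF x] mem[OF x'] mem[OF y] by (simp add: R.l_distr)
    also have "\<dots> = (\<Oplus>h\<in>?F. x h \<otimes> y (inv\<^bsub>G\<^esub> h \<otimes>\<^bsub>G\<^esub> g)) \<oplus> (\<Oplus>h\<in>?F. x' h \<otimes> y (inv\<^bsub>G\<^esub> h \<otimes>\<^bsub>G\<^esub> g))"
      using mem[OF x] mem[OF x'] mem[OF y] by (intro R.finsum_addf) auto
    also have "\<dots> = convolution R G x y g \<oplus> convolution R G x' y g"
      using convolution_eq[OF x y F(1) _ F(2) True] convolution_eq[OF x' y F(1) _ F(2) True] by simp
    finally show ?thesis .
  qed (simp add: convolution_def)
qed

lemma convolution_add_right:
  assumes x: "x \<in> carrier (free_module R (carrier G))" and y: "y \<in> carrier (free_module R (carrier G))"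
    and y': "y' \<in> carrier (free_module R (carrier G))"
  shows "convolution R G x (\<lambda>g. y g \<oplus> y' g) = (\<lambda>g. convolution R G x y g \<oplus> convolution R G x y' g)"
proof
  fix g
  let ?F = "{g. x g \<noteq> \<zero>}"
  have F: "finite ?F" "?F \<subseteq> carrier G" using x by (auto simp: free_module_def)
  show "convolution R G x (\<lambda>g. y g \<oplus> y' g) g = convolution R G x y g \<oplus> convolution R G x y' g"
  proof (cases "g \<in> carrier G")
    case True
    have "convolution R G x (\<lambda>g. y g \<oplus> y' g) g
        = (\<Oplus>h\<in>?F. x h \<otimes> (y (inv\<^bsub>G\<^esub> h \<otimes>\<^bsub>G\<^esub> g) \<oplus> y' (inv\<^bsub>G\<^esub> h \<otimes>\<^bsub>G\<^esub> g)))"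
      using F True by (intro convolution_eq add_closed x y y') auto
    also have "\<dots> = (\<Oplus>h\<in>?F. x h \<otimes> y (inv\<^bsub>G\<^esub> h \<otimes>\<^bsub>G\<^esub> g) \<oplus> x h \<otimes> y' (inv\<^bsub>G\<^esub> h \<otimes>\<^bsub>G\<^esub> g))"
      using mem[OF x] mem[OF y'] mem[OF y] by (simp add: R.r_distr)
    also have "\<dots> = (\<Oplus>h\<in>?F. x h \<otimes> y (inv\<^bsub>G\<^esub> h \<otimes>\<^bsub>G\<^esub> g)) \<oplus> (\<Oplus>h\<in>?F. x h \<otimes> y' (inv\<^bsub>G\<^esub> h \<otimes>\<^bsub>G\<^esub> g))"
      using mem[OF x] mem[OF y'] mem[OF y] by (intro R.finsum_addf) auto
    also have "\<dots> = convolution R G x y g \<oplus> convolution R G x y' g"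
      using convolution_eq[OF x y F(1) _ F(2) True] convolution_eq[OF x y' F(1) _ F(2) True] by simp
    finally show ?thesis .
  qed (simp add: convolution_def)
qed

lemma convolution_monomial:
  assumes "s \<in> carrier R" "g \<in> carrier G" "t \<in> carrier R" "k \<in> carrier G"
  shows "convolution R G (monomial R s g) (monomial R t k) = monomial R (s \<otimes> t) (g \<otimes>\<^bsub>G\<^esub> k)"
proof
  fix j
  show "convolution R G (monomial R s g) (monomial R t k) j = monomial R (s \<otimes> t) (g \<otimes>\<^bsub>G\<^esub> k) j"
  proof (cases "j \<in> carrier G")
    case True
    have "convolution R G (monomial R s g) (monomial R t k) j
        = (\<Oplus>h\<in>{g}. monomial R s g h \<otimes> monomial R t k (inv\<^bsub>G\<^esub> h \<otimes>\<^bsub>G\<^esub> j))"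
      using assms True by (intro convolution_eq monoclosed) (auto simp: monomial_def)
    also have "\<dots> = s \<otimes> monomial R t k (inv\<^bsub>G\<^esub> g \<otimes>\<^bsub>G\<^esub> j)"
      using assms True by (subst R.finsum_insert) (auto simp: monomial_def)
    also have "\<dots> = monomial R (s \<otimes> t) (g \<otimes>\<^bsub>G\<^esub> k) j"
      using assms True by (auto simp: monomial_def G.inv_solve_left')
    finally show ?thesis .
  next
    case False
    then show ?thesis using assms G.m_closed[of g k] by (auto simp: convolution_def monomial_def)
  qed
qed

lemma convolution_closed:
  assumes "x \<in> carrier (free_module R (carrier G))" and "y \<in> carrier (free_module R (carrier G))"
  shows "convolution R G x y \<in> carrier (free_module R (carrier G))"
  using R.ring_axioms assms(1)
proof (induction x rule: free_module_induct)
  case zero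
  then show ?case by (simp add: convolution_def free_module_def)
next
  case (monomial s g)
  show ?case
    using R.ring_axioms assms(2)
  proof (induction y rule: free_module_induct)
    case zero
    then show ?case by (simp add: convolution_def free_module_def)
  next
    case (monomial t k)
    then show ?case
      using \<open>s \<in> carrier R\<close> \<open>g \<in> carrier G\<close> by (simp add: convolution_monomial monoclosed)
  next
    case (add y y')
    then show ?case
      using \<open>s \<in> carrier R\<close> \<open>g \<in> carrier G\<close> by (simp add: convolution_add_right monoclosed add_closed)
  qed
next
  case (add x x')
  then show ?case using assms(2) by (simp add: convolution_add_left add_closed)
qed

lemma l_coset_in_lcosets: "g \<in> carrier G \<Longrightarrow> g <#\<^bsub>G\<^esub> H \<in> lcosets\<^bsub>G\<^esub> H"
  by (auto simp: LCOSETS_def)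

lemma l_coset_eq_iff:
  assumes "g \<in> carrier G" and "k \<in> carrier G"
  shows "g <#\<^bsub>G\<^esub> H = k <#\<^bsub>G\<^esub> H \<longleftrightarrow> g \<in> k <#\<^bsub>G\<^esub> H"
  using assms G.l_repr_independence[OF _ assms(2) subgroup_axioms] G.lcos_self[OF assms(1) subgroup_axioms]
  by (metis)

lemma mem_lcoset_iff:
  assumes "g \<in> carrier G" and "C \<in> lcosets\<^bsub>G\<^esub> H"
  shows "g \<in> C \<longleftrightarrow> C = g <#\<^bsub>G\<^esub> H"
  using assms l_coset_eq_iff by (auto simp: LCOSETS_def)

lemma coset_tensor_eq:
  assumes a: "a \<in> carrier (free_module R (carrier G))" and r: "r \<in> carrier R"
    and F: "finite F" "{g. a g \<noteq> \<zero>} \<subseteq> F" and C: "C \<in> lcosets\<^bsub>G\<^esub> H"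
  shows "coset_tensor R G H a r C = (\<Oplus>g\<in>F \<inter> C. a g \<otimes> r)"
proof -
  have "(\<Oplus>g\<in>{g \<in> C. a g \<noteq> \<zero>}. a g \<otimes> r) = (\<Oplus>g\<in>F \<inter> C. a g \<otimes> r)"
    using F r mem[OF a] by (intro R.finsum_support_eq) auto
  then show ?thesis using C by (simp add: coset_tensor_def)
qed

lemma coset_tensor_add_left:
  assumes a: "a \<in> carrier (free_module R (carrier G))" and b: "b \<in> carrier (free_module R (carrier G))"
    and r: "r \<in> carrier R"
  shows "coset_tensor R G H (\<lambda>g. a g \<oplus> b g) r
    = (\<lambda>C. coset_tensor R G H a r C \<oplus> coset_tensor R G H b r C)"
proof
  fix C
  let ?F = "{g. a g \<noteq> \<zero>} \<union> {g. b g \<noteq> \<zero>}"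
  have F: "finite ?F" using a b by (auto simp: free_module_def)
  show "coset_tensor R G H (\<lambda>g. a g \<oplus> b g) r C
    = coset_tensor R G H a r C \<oplus> coset_tensor R G H b r C"
  proof (cases "C \<in> lcosets\<^bsub>G\<^esub> H")
    case True
    have "coset_tensor R G H (\<lambda>g. a g \<oplus> b g) r C = (\<Oplus>g\<in>?F \<inter> C. (a g \<oplus> b g) \<otimes> r)"
      using F True by (intro coset_tensor_eq add_closed a b r) auto
    also have "\<dots> = (\<Oplus>g\<in>?F \<inter> C. a g \<otimes> r \<oplus> b g \<otimes> r)"
      using mem[OF a] mem[OF b] r by (simp add: R.l_distr)
    also have "\<dots> = (\<Oplus>g\<in>?F \<inter> C. a g \<otimes> r) \<oplus> (\<Oplus>g\<in>?F \<inter> C. b g \<otimes> r)"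
      using mem[OF a] mem[OF b] r by (intro R.finsum_addf) auto
    also have "\<dots> = coset_tensor R G H a r C \<oplus> coset_tensor R G H b r C"
      using coset_tensor_eq[OF a r F _ True] coset_tensor_eq[OF b r F _ True] by simp
    finally show ?thesis .
  qed (simp add: coset_tensor_def)
qed

lemma coset_tensor_add_right:
  assumes a: "a \<in> carrier (free_module R (carrier G))" and r: "r \<in> carrier R" and s: "s \<in> carrier R"
  shows "coset_tensor R G H a (r \<oplus> s)
    = (\<lambda>C. coset_tensor R G H a r C \<oplus> coset_tensor R G H a s C)"
  using r s mem[OF a] by (auto simp: coset_tensor_def fun_eq_iff R.r_distr intro!: R.finsum_addf)

lemma coset_tensor_monomial:
  assumes "s \<in> carrier R" and "g \<in> carrier G" and "r \<in> carrier R"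
  shows "coset_tensor R G H (monomial R s g) r = monomial R (s \<otimes> r) (g <#\<^bsub>G\<^esub> H)"
proof
  fix C
  show "coset_tensor R G H (monomial R s g) r C = monomial R (s \<otimes> r) (g <#\<^bsub>G\<^esub> H) C"
  proof (cases "C \<in> lcosets\<^bsub>G\<^esub> H")
    case True
    have "coset_tensor R G H (monomial R s g) r C = (\<Oplus>h\<in>{g} \<inter> C. monomial R s g h \<otimes> r)"
      using assms True by (intro coset_tensor_eq monoclosed) (auto simp: monomial_def)
    also have "\<dots> = monomial R (s \<otimes> r) (g <#\<^bsub>G\<^esub> H) C"
      using assms mem_lcoset_iff[OF assms(2) True] by (cases "g \<in> C") (auto simp: monomial_def)
    finally show ?thesis .
  next
    case False
    then show ?thesis using assms l_coset_in_lcosets by (auto simp: coset_tensor_def monomial_def)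
  qed
qed

lemma coset_tensor_zero: "coset_tensor R G H (\<lambda>_. \<zero>) r = (\<lambda>_. \<zero>)"
  by (simp add: coset_tensor_def fun_eq_iff)

lemma coset_tensor_closed:
  assumes "a \<in> carrier (free_module R (carrier G))" and r: "r \<in> carrier R"
  shows "coset_tensor R G H a r \<in> carrier (free_module R (lcosets\<^bsub>G\<^esub> H))"
  using R.ring_axioms assms(1)
proof (induction a rule: free_module_induct)
  case zero
  then show ?case by (simp add: coset_tensor_zero free_module_def)
next
  case (monomial s g)
  then show ?case using r by (simp add: coset_tensor_monomial monoclosed l_coset_in_lcosets)
next
  case (add a b)
  then show ?case using r by (simp add: coset_tensor_add_left add_closed)
qed

lemma augmentation_eq:
  assumes b: "b \<in> carrier (free_module R H)" and r: "r \<in> carrier R"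
    and F: "finite F" "{g. b g \<noteq> \<zero>} \<subseteq> F"
  shows "b \<odot>\<^bsub>trivial_module R (G\<lparr>carrier := H\<rparr>)\<^esub> r = (\<Oplus>g\<in>F. b g) \<otimes> r"
proof -
  have "(\<Oplus>g\<in>{g \<in> H. b g \<noteq> \<zero>}. b g) = (\<Oplus>g\<in>F. b g)"
    using F mem[OF b] b by (intro R.finsum_support_eq) (auto simp: free_module_def)
  then show ?thesis by (simp add: trivial_module_def)
qed

lemma augmentation_closed:
  assumes b: "b \<in> carrier (free_module R H)" and r: "r \<in> carrier R"
  shows "b \<odot>\<^bsub>trivial_module R (G\<lparr>carrier := H\<rparr>)\<^esub> r \<in> carrier R"
  using mem[OF b] r by (simp add: trivial_module_def)

lemma augmentation_add:
  assumes b: "b \<in> carrier (free_module R H)" and c: "c \<in> carrier (free_module R H)" and r: "r \<in> carrier R"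
  shows "(\<lambda>g. b g \<oplus> c g) \<odot>\<^bsub>trivial_module R (G\<lparr>carrier := H\<rparr>)\<^esub> r
    = b \<odot>\<^bsub>trivial_module R (G\<lparr>carrier := H\<rparr>)\<^esub> r \<oplus> c \<odot>\<^bsub>trivial_module R (G\<lparr>carrier := H\<rparr>)\<^esub> r"
proof -
  let ?F = "{g. b g \<noteq> \<zero>} \<union> {g. c g \<noteq> \<zero>}"
  have F: "finite ?F" using b c by (auto simp: free_module_def)
  have "(\<lambda>g. b g \<oplus> c g) \<odot>\<^bsub>trivial_module R (G\<lparr>carrier := H\<rparr>)\<^esub> r = (\<Oplus>g\<in>?F. b g \<oplus> c g) \<otimes> r"
    using F by (intro augmentation_eq add_closed b c r) auto
  also have "(\<Oplus>g\<in>?F. b g \<oplus> c g) = (\<Oplus>g\<in>?F. b g) \<oplus> (\<Oplus>g\<in>?F. c g)"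
    using mem[OF b] mem[OF c] by (intro R.finsum_addf) auto
  also have "\<dots> \<otimes> r = (\<Oplus>g\<in>?F. b g) \<otimes> r \<oplus> (\<Oplus>g\<in>?F. c g) \<otimes> r"
    using mem[OF b] mem[OF c] r by (intro R.l_distr) auto
  finally show ?thesis
    using augmentation_eq[OF b r F] augmentation_eq[OF c r F] by simp
qed

lemma augmentation_monomial:
  assumes "s \<in> carrier R" and "k \<in> H" and "r \<in> carrier R"
  shows "monomial R s k \<odot>\<^bsub>trivial_module R (G\<lparr>carrier := H\<rparr>)\<^esub> r = s \<otimes> r"
  using assms
  by (subst augmentation_eq[OF monoclosed, where F = "{k}"]) (auto simp: monomial_def)

lemma free_module_H: "b \<in> carrier (free_module R H) \<Longrightarrow> b \<in> carrier (free_module R (carrier G))"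
  using free_module_mono[OF R.ring_axioms subset] by blast

lemma convolution_zero:
  "convolution R G (\<lambda>_. \<zero>) y = (\<lambda>_. \<zero>)" "convolution R G x (\<lambda>_. \<zero>) = (\<lambda>_. \<zero>)"
  by (simp_all add: convolution_def fun_eq_iff)

lemma coset_tensor_balanced:
  assumes a: "a \<in> carrier (free_module R (carrier G))" and b: "b \<in> carrier (free_module R H)"
    and r: "r \<in> carrier R"
  shows "coset_tensor R G H (convolution R G a b) r
    = coset_tensor R G H a (b \<odot>\<^bsub>trivial_module R (G\<lparr>carrier := H\<rparr>)\<^esub> r)"
  using R.ring_axioms a
proof (induction a rule: free_module_induct)
  case zero
  then show ?case by (simp add: convolution_zero coset_tensor_zero)
next
  case (monomial s g)
  note sg = this
  show ?case
    using R.ring_axioms b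
  proof (induction b rule: free_module_induct)
    case zero
    have "(\<lambda>_. \<zero>) \<odot>\<^bsub>trivial_module R (G\<lparr>carrier := H\<rparr>)\<^esub> r = \<zero>"
      using r by (simp add: trivial_module_def)
    then show ?case
      using sg by (simp add: convolution_zero coset_tensor_zero coset_tensor_monomial fun_eq_iff)
        (simp add: monomial_def)
  next
    case (monomial t k)
    have "g \<otimes>\<^bsub>G\<^esub> k <#\<^bsub>G\<^esub> H = g <#\<^bsub>G\<^esub> H"
      using sg monomial by (subst l_coset_eq_iff) (auto simp: l_coset_def)
    then show ?case
      using sg monomial r
      by (simp add: convolution_monomial coset_tensor_monomial augmentation_monomial R.m_assoc)
  next
    case (add b c)
    then show ?case
      using sg r by (simp add: convolution_add_right coset_tensor_add_left coset_tensor_add_right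
          augmentation_add augmentation_closed convolution_closed monoclosed free_module_H)
  qed
next
  case (add a a')
  then show ?case
    using b r by (simp add: convolution_add_left coset_tensor_add_left
        augmentation_closed convolution_closed free_module_H)
qed

lemma action_eq:
  assumes a: "a \<in> carrier (free_module R (carrier G))" and x: "x \<in> carrier (free_module R (lcosets\<^bsub>G\<^esub> H))"
    and F: "finite F" "{g. a g \<noteq> \<zero>} \<subseteq> F" and C: "C \<in> lcosets\<^bsub>G\<^esub> H"
  shows "(a \<odot>\<^bsub>coset_module R G H\<^esub> x) C = (\<Oplus>g\<in>F. a g \<otimes> x (inv\<^bsub>G\<^esub> g <#\<^bsub>G\<^esub> C))"
proof -
  have "(\<Oplus>g\<in>{g \<in> carrier G. a g \<noteq> \<zero>}. a g \<otimes> x (inv\<^bsub>G\<^esub> g <#\<^bsub>G\<^esub> C))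
      = (\<Oplus>g\<in>F. a g \<otimes> x (inv\<^bsub>G\<^esub> g <#\<^bsub>G\<^esub> C))"
    using F mem[OF a] mem[OF x] a by (intro R.finsum_support_eq) (auto simp: free_module_def)
  then show ?thesis using C by (simp add: coset_module_def)
qed

lemma action_add_left:
  assumes a: "a \<in> carrier (free_module R (carrier G))" and b: "b \<in> carrier (free_module R (carrier G))"
    and x: "x \<in> carrier (free_module R (lcosets\<^bsub>G\<^esub> H))"
  shows "(\<lambda>g. a g \<oplus> b g) \<odot>\<^bsub>coset_module R G H\<^esub> x
    = (\<lambda>C. (a \<odot>\<^bsub>coset_module R G H\<^esub> x) C \<oplus> (b \<odot>\<^bsub>coset_module R G H\<^esub> x) C)"
proof
  fix C
  let ?F = "{g. a g \<noteq> \<zero>} \<union> {g. b g \<noteq> \<zero>}"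
  have F: "finite ?F" using a b by (auto simp: free_module_def)
  show "((\<lambda>g. a g \<oplus> b g) \<odot>\<^bsub>coset_module R G H\<^esub> x) C
    = (a \<odot>\<^bsub>coset_module R G H\<^esub> x) C \<oplus> (b \<odot>\<^bsub>coset_module R G H\<^esub> x) C"
  proof (cases "C \<in> lcosets\<^bsub>G\<^esub> H")
    case True
    have "((\<lambda>g. a g \<oplus> b g) \<odot>\<^bsub>coset_module R G H\<^esub> x) C
        = (\<Oplus>g\<in>?F. (a g \<oplus> b g) \<otimes> x (inv\<^bsub>G\<^esub> g <#\<^bsub>G\<^esub> C))"
      using F True by (intro action_eq add_closed a b x) auto
    also have "\<dots> = (\<Oplus>g\<in>?F. a g \<otimes> x (inv\<^bsub>G\<^esub> g <#\<^bsub>G\<^esub> C) \<oplus> b g \<otimes> x (inv\<^bsub>G\<^esub> g <#\<^bsub>G\<^esub> C))"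
      using mem[OF a] mem[OF b] mem[OF x] by (simp add: R.l_distr)
    also have "\<dots> = (\<Oplus>g\<in>?F. a g \<otimes> x (inv\<^bsub>G\<^esub> g <#\<^bsub>G\<^esub> C)) \<oplus> (\<Oplus>g\<in>?F. b g \<otimes> x (inv\<^bsub>G\<^esub> g <#\<^bsub>G\<^esub> C))"
      using mem[OF a] mem[OF b] mem[OF x] by (intro R.finsum_addf) auto
    also have "\<dots> = (a \<odot>\<^bsub>coset_module R G H\<^esub> x) C \<oplus> (b \<odot>\<^bsub>coset_module R G H\<^esub> x) C"
      using action_eq[OF a x F _ True] action_eq[OF b x F _ True] by simp
    finally show ?thesis .
  qed (simp add: coset_module_def)
qed

lemma action_add_right:
  assumes a: "a \<in> carrier (free_module R (carrier G))" and x: "x \<in> carrier (free_module R (lcosets\<^bsub>G\<^esub> H))"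
    and y: "y \<in> carrier (free_module R (lcosets\<^bsub>G\<^esub> H))"
  shows "a \<odot>\<^bsub>coset_module R G H\<^esub> (\<lambda>C. x C \<oplus> y C)
    = (\<lambda>C. (a \<odot>\<^bsub>coset_module R G H\<^esub> x) C \<oplus> (a \<odot>\<^bsub>coset_module R G H\<^esub> y) C)"
  using mem[OF a] mem[OF x] mem[OF y]
  by (auto simp: coset_module_def fun_eq_iff R.r_distr intro!: R.finsum_addf)

lemma action_monomial:
  assumes "s \<in> carrier R" "g \<in> carrier G" "t \<in> carrier R" "k \<in> carrier G"
  shows "monomial R s g \<odot>\<^bsub>coset_module R G H\<^esub> monomial R t (k <#\<^bsub>G\<^esub> H)
    = monomial R (s \<otimes> t) (g \<otimes>\<^bsub>G\<^esub> k <#\<^bsub>G\<^esub> H)"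
proof
  fix C
  show "(monomial R s g \<odot>\<^bsub>coset_module R G H\<^esub> monomial R t (k <#\<^bsub>G\<^esub> H)) C
    = monomial R (s \<otimes> t) (g \<otimes>\<^bsub>G\<^esub> k <#\<^bsub>G\<^esub> H) C"
  proof (cases "C \<in> lcosets\<^bsub>G\<^esub> H")
    case True
    then obtain j where j: "j \<in> carrier G" "C = j <#\<^bsub>G\<^esub> H" by (auto simp: LCOSETS_def)
    have "(monomial R s g \<odot>\<^bsub>coset_module R G H\<^esub> monomial R t (k <#\<^bsub>G\<^esub> H)) C
        = (\<Oplus>h\<in>{g}. monomial R s g h \<otimes> monomial R t (k <#\<^bsub>G\<^esub> H) (inv\<^bsub>G\<^esub> h <#\<^bsub>G\<^esub> C))"
      using assms True by (intro action_eq monoclosed l_coset_in_lcosets) (auto simp: monomial_def)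
    also have "\<dots> = s \<otimes> monomial R t (k <#\<^bsub>G\<^esub> H) (inv\<^bsub>G\<^esub> g <#\<^bsub>G\<^esub> C)"
      using assms by (subst R.finsum_insert) (auto simp: monomial_def)
    also have "inv\<^bsub>G\<^esub> g <#\<^bsub>G\<^esub> C = k <#\<^bsub>G\<^esub> H \<longleftrightarrow> C = g \<otimes>\<^bsub>G\<^esub> k <#\<^bsub>G\<^esub> H"
    proof -
      have "g <#\<^bsub>G\<^esub> (inv\<^bsub>G\<^esub> g <#\<^bsub>G\<^esub> C) = C" "inv\<^bsub>G\<^esub> g <#\<^bsub>G\<^esub> (g \<otimes>\<^bsub>G\<^esub> k <#\<^bsub>G\<^esub> H) = k <#\<^bsub>G\<^esub> H"
        "g <#\<^bsub>G\<^esub> (k <#\<^bsub>G\<^esub> H) = g \<otimes>\<^bsub>G\<^esub> k <#\<^bsub>G\<^esub> H"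
        using assms j subset
        by (simp_all add: G.lcos_m_assoc flip: G.m_assoc)
      then show ?thesis by metis
    qed
    then have "s \<otimes> monomial R t (k <#\<^bsub>G\<^esub> H) (inv\<^bsub>G\<^esub> g <#\<^bsub>G\<^esub> C)
        = monomial R (s \<otimes> t) (g \<otimes>\<^bsub>G\<^esub> k <#\<^bsub>G\<^esub> H) C"
      using assms by (simp add: monomial_def)
    finally show ?thesis .
  next
    case False
    then show ?thesis
      using assms l_coset_in_lcosets[of "g \<otimes>\<^bsub>G\<^esub> k"] by (auto simp: coset_module_def monomial_def)
  qed
qed

lemma action_zero:
  "(\<lambda>_. \<zero>) \<odot>\<^bsub>coset_module R G H\<^esub> x = (\<lambda>_. \<zero>)"
  "a \<in> carrier (free_module R (carrier G)) \<Longrightarrow> a \<odot>\<^bsub>coset_module R G H\<^esub> (\<lambda>_. \<zero>) = (\<lambda>_. \<zero>)"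
proof -
  show "(\<lambda>_. \<zero>) \<odot>\<^bsub>coset_module R G H\<^esub> x = (\<lambda>_. \<zero>)"
    by (simp add: coset_module_def fun_eq_iff)
  assume "a \<in> carrier (free_module R (carrier G))"
  from mem[OF this] show "a \<odot>\<^bsub>coset_module R G H\<^esub> (\<lambda>_. \<zero>) = (\<lambda>_. \<zero>)"
    by (simp add: coset_module_def fun_eq_iff)
qed

lemma coset_tensor_linear:
  assumes a: "a \<in> carrier (free_module R (carrier G))" and b: "b \<in> carrier (free_module R (carrier G))"
    and r: "r \<in> carrier R"
  shows "coset_tensor R G H (convolution R G a b) r = a \<odot>\<^bsub>coset_module R G H\<^esub> coset_tensor R G H b r"
  using R.ring_axioms a
proof (induction a rule: free_module_induct)
  case zero
  then show ?case by (simp add: convolution_zero coset_tensor_zero action_zero)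
next
  case (monomial s g)
  note sg = this
  show ?case
    using R.ring_axioms b
  proof (induction b rule: free_module_induct)
    case zero
    then show ?case
      using sg by (simp add: convolution_zero coset_tensor_zero action_zero monoclosed)
  next
    case (monomial t k)
    then show ?case
      using sg r by (simp add: convolution_monomial coset_tensor_monomial action_monomial R.m_assoc)
  next
    case (add b c)
    then show ?case
      using sg r by (simp add: convolution_add_right coset_tensor_add_left action_add_right
          convolution_closed monoclosed coset_tensor_closed)
  qed
next
  case (add a a')
  then show ?case
    using b r by (simp add: convolution_add_left coset_tensor_add_left action_add_left
        convolution_closed coset_tensor_closed)
qed

lemma carrier_RH: "carrier (group_ring R (G\<lparr>carrier := H\<rparr>)) = carrier (free_module R H)"
  by (simp add: carrier_group_ring)

text \<open>\<^term>\<open>coset_module R G H\<close> is the tensor product \<open>RG \<otimes>\<^bsub>RH\<^esub> R\<close>: its universal property, and the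
  compatibility with the left action of \<open>RG\<close>.\<close>

lemma coset_module_tensor_product:
  shows "balanced_map R G H (coset_module R G H) (coset_tensor R G H)"
    and "\<lbrakk>a \<in> carrier (group_ring R G); b \<in> carrier (group_ring R G); r \<in> carrier R\<rbrakk> \<Longrightarrow>
      coset_tensor R G H (a \<otimes>\<^bsub>group_ring R G\<^esub> b) r = a \<odot>\<^bsub>coset_module R G H\<^esub> coset_tensor R G H b r"
    and "\<lbrakk>abelian_group N; balanced_map R G H N \<beta>\<rbrakk> \<Longrightarrow>
      \<exists>!f. f \<in> extensional (carrier (coset_module R G H)) \<and>
        f \<in> hom (add_monoid (coset_module R G H)) (add_monoid N) \<and>
        (\<forall>a\<in>carrier (group_ring R G). \<forall>r\<in>carrier R. f (coset_tensor R G H a r) = \<beta> a r)"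
proof -
  show "balanced_map R G H (coset_module R G H) (coset_tensor R G H)"
    unfolding balanced_map_def carrier_RH
    by (simp add: carrier_group_ring group_ring_ops coset_module_simps coset_tensor_closed
        coset_tensor_add_left coset_tensor_add_right coset_tensor_balanced)
  show "coset_tensor R G H (a \<otimes>\<^bsub>group_ring R G\<^esub> b) r = a \<odot>\<^bsub>coset_module R G H\<^esub> coset_tensor R G H b r"
    if "a \<in> carrier (group_ring R G)" "b \<in> carrier (group_ring R G)" "r \<in> carrier R"
    using that by (simp add: carrier_group_ring group_ring_ops coset_tensor_linear)
  assume N: "abelian_group N" and \<beta>: "balanced_map R G H N \<beta>"
  interpret N: abelian_group N by fact
  let ?RG = "carrier (free_module R (carrier G))"
  let ?L = "lcosets\<^bsub>G\<^esub> H"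
  let ?M = "carrier (free_module R ?L)"
  have \<beta>_closed: "\<beta> a r \<in> carrier N" if "a \<in> ?RG" "r \<in> carrier R" for a r
    using \<beta> that by (simp add: balanced_map_def carrier_group_ring)
  have \<beta>_add: "\<beta> (\<lambda>g. a g \<oplus> b g) r = \<beta> a r \<oplus>\<^bsub>N\<^esub> \<beta> b r"
    if "a \<in> ?RG" "b \<in> ?RG" "r \<in> carrier R" for a b r
    using \<beta> that by (simp add: balanced_map_def carrier_group_ring group_ring_ops)
  have \<beta>_bal: "\<beta> (convolution R G a b) r = \<beta> a (b \<odot>\<^bsub>trivial_module R (G\<lparr>carrier := H\<rparr>)\<^esub> r)"
    if "a \<in> ?RG" "b \<in> carrier (free_module R H)" "r \<in> carrier R" for a b r
    using \<beta> that unfolding balanced_map_def by (simp add: carrier_group_ring group_ring_ops)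
  have \<beta>_zero: "\<beta> (\<lambda>_. \<zero>) r = \<zero>\<^bsub>N\<^esub>" if "r \<in> carrier R" for r
    using \<beta>_add[OF zero_closed zero_closed that] \<beta>_closed[OF zero_closed that] by simp
  define rep where "rep C = (SOME g. g \<in> carrier G \<and> C = g <#\<^bsub>G\<^esub> H)" for C
  have rep: "rep C \<in> carrier G \<and> C = rep C <#\<^bsub>G\<^esub> H" if "C \<in> ?L" for C
    unfolding rep_def by (rule someI_ex) (use that in \<open>auto simp: LCOSETS_def\<close>)
  define w where "w s C = \<beta> (monomial R s (rep C)) \<one>" for s C
  have w_closed: "w s C \<in> carrier N" if "s \<in> carrier R" "C \<in> ?L" for s C
    using that rep by (simp add: w_def \<beta>_closed monoclosed)
  have w_zero: "w \<zero> C = \<zero>\<^bsub>N\<^esub>" for C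
    using \<beta>_zero[OF R.one_closed] by (simp add: w_def monomial_def)
  have w_add: "w (s \<oplus> t) C = w s C \<oplus>\<^bsub>N\<^esub> w t C" if "s \<in> carrier R" "t \<in> carrier R" "C \<in> ?L" for s t C
  proof -
    have "monomial R (s \<oplus> t) (rep C) = (\<lambda>g. monomial R s (rep C) g \<oplus> monomial R t (rep C) g)"
      using that by (auto simp: monomial_def)
    then show ?thesis using that rep by (simp add: w_def \<beta>_add monoclosed)
  qed
  define f where "f = (\<lambda>x\<in>?M. \<Oplus>\<^bsub>N\<^esub>C\<in>{C. x C \<noteq> \<zero>}. w (x C) C)"
  have f_eq: "f x = (\<Oplus>\<^bsub>N\<^esub>C\<in>F. w (x C) C)"
    if "x \<in> ?M" "finite F" "{C. x C \<noteq> \<zero>} \<subseteq> F" "F \<subseteq> ?L" for x F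
  proof -
    have "(\<Oplus>\<^bsub>N\<^esub>C\<in>{C. x C \<noteq> \<zero>}. w (x C) C) = (\<Oplus>\<^bsub>N\<^esub>C\<in>F. w (x C) C)"
      using that mem[OF that(1)] w_closed w_zero by (intro N.finsum_support_eq) auto
    then show ?thesis using that(1) by (simp add: f_def)
  qed
  have f_add: "f (\<lambda>C. x C \<oplus> y C) = f x \<oplus>\<^bsub>N\<^esub> f y" if xy: "x \<in> ?M" "y \<in> ?M" for x y
  proof -
    let ?F = "{C. x C \<noteq> \<zero>} \<union> {C. y C \<noteq> \<zero>}"
    have F: "finite ?F" "?F \<subseteq> ?L" using xy by (auto simp: free_module_def)
    have "f (\<lambda>C. x C \<oplus> y C) = (\<Oplus>\<^bsub>N\<^esub>C\<in>?F. w (x C \<oplus> y C) C)"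
      using F by (intro f_eq add_closed xy) auto
    also have "\<dots> = (\<Oplus>\<^bsub>N\<^esub>C\<in>?F. w (x C) C \<oplus>\<^bsub>N\<^esub> w (y C) C)"
      using mem[OF xy(1)] mem[OF xy(2)] F(2) w_closed w_add
      by (intro N.finsum_cong' refl) (auto simp: subset_iff)
    also have "\<dots> = (\<Oplus>\<^bsub>N\<^esub>C\<in>?F. w (x C) C) \<oplus>\<^bsub>N\<^esub> (\<Oplus>\<^bsub>N\<^esub>C\<in>?F. w (y C) C)"
      using mem[OF xy(1)] mem[OF xy(2)] F(2) w_closed by (intro N.finsum_addf) auto
    also have "\<dots> = f x \<oplus>\<^bsub>N\<^esub> f y"
      using f_eq[OF xy(1) F(1) _ F(2)] f_eq[OF xy(2) F(1) _ F(2)] by simp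
    finally show ?thesis .
  qed
  have f_closed: "f x \<in> carrier N" if "x \<in> ?M" for x
    using that mem[OF that] w_closed by (auto simp: f_def free_module_def intro!: N.finsum_closed)
  have f_monomial: "f (monomial R s C) = w s C" if "s \<in> carrier R" "C \<in> ?L" for s C
    using that w_closed
    by (subst f_eq[OF monoclosed, where F = "{C}"]) (auto simp: monomial_def)
  have w_eq: "w (s \<otimes> r) (g <#\<^bsub>G\<^esub> H) = \<beta> (monomial R s g) r"
    if sgr: "s \<in> carrier R" "g \<in> carrier G" "r \<in> carrier R" for s g r
  proof -
    let ?C = "g <#\<^bsub>G\<^esub> H"
    have C: "?C \<in> ?L" using sgr by (rule_tac l_coset_in_lcosets)
    have "rep ?C \<in> ?C" using rep[OF C] mem_lcoset_iff[OF _ C] by blast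
    then obtain k where k: "k \<in> H" "rep ?C = g \<otimes>\<^bsub>G\<^esub> k" by (auto simp: l_coset_def)
    have "w (s \<otimes> r) ?C = \<beta> (convolution R G (monomial R s g) (monomial R r k)) \<one>"
      using sgr k by (simp add: w_def convolution_monomial)
    also have "\<dots> = \<beta> (monomial R s g) r"
      using sgr k by (simp add: \<beta>_bal monoclosed augmentation_monomial)
    finally show ?thesis .
  qed
  have f_tensor: "f (coset_tensor R G H a r) = \<beta> a r" if a: "a \<in> ?RG" and r: "r \<in> carrier R" for a r
    using R.ring_axioms a
  proof (induction a rule: free_module_induct)
    case zero
    have "f (\<lambda>_. \<zero>) = \<zero>\<^bsub>N\<^esub>" by (simp add: f_def zero_closed)
    then show ?case using r by (simp add: coset_tensor_zero \<beta>_zero)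
  next
    case (monomial s g)
    then show ?case
      using r by (simp add: coset_tensor_monomial f_monomial l_coset_in_lcosets w_eq)
  next
    case (add a b)
    then show ?case
      using r by (simp add: coset_tensor_add_left f_add coset_tensor_closed \<beta>_add)
  qed
  show "\<exists>!f. f \<in> extensional (carrier (coset_module R G H)) \<and>
        f \<in> hom (add_monoid (coset_module R G H)) (add_monoid N) \<and>
        (\<forall>a\<in>carrier (group_ring R G). \<forall>r\<in>carrier R. f (coset_tensor R G H a r) = \<beta> a r)"
  proof (rule ex1I[of _ f], intro conjI)
    show "f \<in> extensional (carrier (coset_module R G H))"
      by (simp add: f_def coset_module_simps)
    show "f \<in> hom (add_monoid (coset_module R G H)) (add_monoid N)"
      using f_closed f_add by (auto simp: hom_def coset_module_simps)
    show "\<forall>a\<in>carrier (group_ring R G). \<forall>r\<in>carrier R. f (coset_tensor R G H a r) = \<beta> a r"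
      using f_tensor by (simp add: carrier_group_ring)
  next
    fix f'
    assume f': "f' \<in> extensional (carrier (coset_module R G H)) \<and>
        f' \<in> hom (add_monoid (coset_module R G H)) (add_monoid N) \<and>
        (\<forall>a\<in>carrier (group_ring R G). \<forall>r\<in>carrier R. f' (coset_tensor R G H a r) = \<beta> a r)"
    have f'_add: "f' (\<lambda>C. x C \<oplus> y C) = f' x \<oplus>\<^bsub>N\<^esub> f' y" if "x \<in> ?M" "y \<in> ?M" for x y
      using f' that by (simp add: hom_def coset_module_simps)
    have f'_tensor: "f' (coset_tensor R G H a r) = \<beta> a r" if "a \<in> ?RG" "r \<in> carrier R" for a r
      using f' that by (simp add: carrier_group_ring)
    have "f' x = f x" if "x \<in> ?M" for x
      using R.ring_axioms that
    proof (induction x rule: free_module_induct)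
      case zero
      have "(\<lambda>_. \<zero>) \<in> ?RG" by (rule zero_closed)
      from f'_tensor[OF this R.one_closed] f_tensor[OF this R.one_closed] show ?case
        by (simp add: coset_tensor_zero)
    next
      case (monomial s C)
      then have "monomial R s C = coset_tensor R G H (monomial R s (rep C)) \<one>"
        using rep[OF monomial(2)] by (simp add: coset_tensor_monomial)
      then show ?case
        using f'_tensor f_tensor monomial rep by (simp add: monoclosed)
    next
      case (add x y)
      then show ?case by (simp add: f'_add f_add)
    qed
    then show "f' = f"
      using f' by (intro extensionalityI[of _ "?M"]) (auto simp: coset_module_simps f_def)
  qed
qed

end

text \<open>A tuple of subgroups is a family \<open>H\<close> with index set \<open>I\<close>.\<close>

definition coset_sum ::
    "('r, 'c) ring_scheme \<Rightarrow> ('g, 'd) monoid_scheme \<Rightarrow> 'i set \<Rightarrow> ('i \<Rightarrow> 'g set) \<Rightarrow>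
      ('g \<Rightarrow> 'r, 'i \<Rightarrow> 'g set \<Rightarrow> 'r) module"
  where "coset_sum R G I H = direct_sum I (\<lambda>i. coset_module R G (H i))"

definition coset_augmentation ::
    "('r, 'c) ring_scheme \<Rightarrow> ('g, 'd) monoid_scheme \<Rightarrow> 'i set \<Rightarrow> ('i \<Rightarrow> 'g set) \<Rightarrow>
      ('i \<Rightarrow> 'g set \<Rightarrow> 'r) \<Rightarrow> 'r"
  where "coset_augmentation R G I H x =
    (\<Oplus>\<^bsub>R\<^esub>i\<in>{i \<in> I. x i \<noteq> \<zero>\<^bsub>coset_module R G (H i)\<^esub>}. \<Oplus>\<^bsub>R\<^esub>C\<in>{C. x i C \<noteq> \<zero>\<^bsub>R\<^esub>}. x i C)"

definition Delta ::
    "('r, 'c) ring_scheme \<Rightarrow> ('g, 'd) monoid_scheme \<Rightarrow> 'i set \<Rightarrow> ('i \<Rightarrow> 'g set) \<Rightarrow>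
      ('g \<Rightarrow> 'r, 'i \<Rightarrow> 'g set \<Rightarrow> 'r) module"
  where "Delta R G I H = (coset_sum R G I H)
    \<lparr>carrier := a_kernel (coset_sum R G I H) (trivial_module R G) (coset_augmentation R G I H)\<rparr>"

text \<open>To be used for non-empty tuples only; for the empty tuple, the cohomology of the pair is
  \<^const>\<open>group_cohomology\<close>.\<close>

definition pair_cohomology ::
    "('r, 'c) ring_scheme \<Rightarrow> ('g, 'd) monoid_scheme \<Rightarrow> 'i set \<Rightarrow> ('i \<Rightarrow> 'g set) \<Rightarrow>
      ('g \<Rightarrow> 'r, 'g \<Rightarrow> 'r, 'm) bimodule \<Rightarrow> int \<Rightarrow>
      ('g \<Rightarrow> 'r, ((('g \<Rightarrow> 'r, 'i \<Rightarrow> 'g set \<Rightarrow> 'r) syzygy \<Rightarrow> 'g \<Rightarrow> 'r) \<Rightarrow> 'm) set) module"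
  where "pair_cohomology R G I H M n =
    Ext (group_ring R G) (Delta R G I H) M (turned_action R G M) (n - 1)"

definition double_coset_reps ::
    "('g, 'd) monoid_scheme \<Rightarrow> 'g set \<Rightarrow> 'g set \<Rightarrow> 'g set \<Rightarrow> bool"
  where "double_coset_reps G H K T \<longleftrightarrow>
    T \<subseteq> carrier G \<and> (\<forall>g\<in>carrier G. \<exists>!x. x \<in> T \<and> g \<in> (H #>\<^bsub>G\<^esub> x) <#>\<^bsub>G\<^esub> K)"

text \<open>The tuple induced on a subgroup \<open>K\<close> is indexed by the pairs of an index \<open>i\<close> and one of the
  chosen representatives of \<open>H i \ G / K\<close>.\<close>

definition induced_tuple ::
    "('g, 'd) monoid_scheme \<Rightarrow> ('i \<Rightarrow> 'g set) \<Rightarrow> 'g set \<Rightarrow> 'i \<times> 'g \<Rightarrow> 'g set"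
  where "induced_tuple G H K = (\<lambda>(i, x). (inv\<^bsub>G\<^esub> x <#\<^bsub>G\<^esub> (H i #>\<^bsub>G\<^esub> x)) \<inter> K)"

end

theory Submission
  imports Defs
begin

text \<open>
  Let \<open>L\<close> be the bimodule of functions \<open>G \<rightarrow> R\<close> with finite support on every level set of \<open>\<phi>\<close>.  Cutting a
  function at level zero shows that \<open>L\<close> is the sum of the two Novikov rings inside the bimodule of all
  functions, and their intersection is \<open>RG\<close>.  Hence there is a short exact sequence of bimodules
  from \<open>RG\<close> over the direct sum of the Novikov rings to \<open>L\<close>, whose long exact Ext sequence has the first
  two terms of the claim.  Restriction of functions to \<open>K\<close> exhibits \<open>L\<close> as the coinduced module of
  \<open>RK\<close>, so the third term \<open>Ext\<^bsub>RG\<^esub>(A, L)\<close> is \<open>Ext\<^bsub>RK\<^esub>(A, RK)\<close> by Shapiro's lemma; here a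
  free resolution over \<open>RG\<close> stays free over \<open>RK\<close> and is compared with the resolution over \<open>RK\<close> which
  defines the right-hand side.  Finally, the Mackey decomposition of the \<open>K\<close>-sets \<open>G/H\<close> identifies the
  restriction of \<open>\<Delta>\<^bsub>G/H\<^esub>\<close> to \<open>K\<close> with the corresponding module of the induced tuple.
\<close>

section \<open>Modules\<close>

text \<open>Two points shape the construction. The first is the support condition of
  \<open>L\<close>. The cosets of \<open>K\<close> are the level sets of \<phi>, infinitely many,
  and coinduction is a product over them; so supports are finite on each level separately, with no
  relation between levels. That the values of \<phi> are integers reconciles this with the Novikov
  conditions: between zero and a bound \<kappa> there are only finitely many levels.

  The second is linearity. Ext uses up the left structure of the coefficients, and the scalars of
  the sequence act through the right one, turned around. Since \<open>R\<close> may be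
  noncommutative, these scalars form the group ring over the opposite ring. Every coefficient module
  therefore carries a second action, by a ring \<open>T\<close>, that commutes with the first, and
  every map between coefficients is equivariant for it.

  The resolution that defines Ext over \<open>RK\<close> has the elements of another module as
  generators. The comparison is thus only an equivalence up to homotopy, and it is carried through
  the coinduction correspondence on cochains.\<close>

lemma left_moduleI:
  fixes S :: "('s, 'c) ring_scheme" and M :: "('s, 'm, 'd) module_scheme"
  assumes "ring S"
    and "\<And>x y. \<lbrakk>x \<in> carrier M; y \<in> carrier M\<rbrakk> \<Longrightarrow> x \<oplus>\<^bsub>M\<^esub> y \<in> carrier M"
    and "\<zero>\<^bsub>M\<^esub> \<in> carrier M"
    and "\<And>x y z. \<lbrakk>x \<in> carrier M; y \<in> carrier M; z \<in> carrier M\<rbrakk> \<Longrightarrow>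
      (x \<oplus>\<^bsub>M\<^esub> y) \<oplus>\<^bsub>M\<^esub> z = x \<oplus>\<^bsub>M\<^esub> (y \<oplus>\<^bsub>M\<^esub> z)"
    and "\<And>x y. \<lbrakk>x \<in> carrier M; y \<in> carrier M\<rbrakk> \<Longrightarrow> x \<oplus>\<^bsub>M\<^esub> y = y \<oplus>\<^bsub>M\<^esub> x"
    and "\<And>x. x \<in> carrier M \<Longrightarrow> \<zero>\<^bsub>M\<^esub> \<oplus>\<^bsub>M\<^esub> x = x"
    and "\<And>x. x \<in> carrier M \<Longrightarrow> \<exists>y\<in>carrier M. y \<oplus>\<^bsub>M\<^esub> x = \<zero>\<^bsub>M\<^esub>"
    and "\<And>a x. \<lbrakk>a \<in> carrier S; x \<in> carrier M\<rbrakk> \<Longrightarrow> a \<odot>\<^bsub>M\<^esub> x \<in> carrier M"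
    and "\<And>a b x. \<lbrakk>a \<in> carrier S; b \<in> carrier S; x \<in> carrier M\<rbrakk> \<Longrightarrow>
      (a \<oplus>\<^bsub>S\<^esub> b) \<odot>\<^bsub>M\<^esub> x = a \<odot>\<^bsub>M\<^esub> x \<oplus>\<^bsub>M\<^esub> b \<odot>\<^bsub>M\<^esub> x"
    and "\<And>a x y. \<lbrakk>a \<in> carrier S; x \<in> carrier M; y \<in> carrier M\<rbrakk> \<Longrightarrow>
      a \<odot>\<^bsub>M\<^esub> (x \<oplus>\<^bsub>M\<^esub> y) = a \<odot>\<^bsub>M\<^esub> x \<oplus>\<^bsub>M\<^esub> a \<odot>\<^bsub>M\<^esub> y"
    and "\<And>a b x. \<lbrakk>a \<in> carrier S; b \<in> carrier S; x \<in> carrier M\<rbrakk> \<Longrightarrow>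
      (a \<otimes>\<^bsub>S\<^esub> b) \<odot>\<^bsub>M\<^esub> x = a \<odot>\<^bsub>M\<^esub> (b \<odot>\<^bsub>M\<^esub> x)"
    and "\<And>x. x \<in> carrier M \<Longrightarrow> \<one>\<^bsub>S\<^esub> \<odot>\<^bsub>M\<^esub> x = x"
  shows "left_module S M"
  by (intro left_module.intro left_module_axioms.intro abelian_groupI) (rule assms; assumption)+

context left_module
begin

lemma smult_minus_one_l:
  assumes "x \<in> carrier M"
  shows "(\<ominus> \<one>) \<odot>\<^bsub>M\<^esub> x = \<ominus>\<^bsub>M\<^esub> x"
proof -
  have "(\<ominus> \<one>) \<odot>\<^bsub>M\<^esub> x \<oplus>\<^bsub>M\<^esub> x = (\<ominus> \<one> \<oplus> \<one>) \<odot>\<^bsub>M\<^esub> x"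
    using assms by (simp only: smult_l_distr S.a_inv_closed S.one_closed smult_one)
  also have "\<dots> = \<zero>\<^bsub>M\<^esub>" using assms by (simp add: S.l_neg)
  finally show ?thesis using assms by (metis M.minus_equality S.a_inv_closed S.one_closed smult_closed)
qed

text \<open>Subtraction is a linear combination with the scalar \<open>\<ominus> \<one>\<close>.
  Closure under sums and scalar multiples therefore includes differences, so submodules and
  correspondences do without a separate axiom for negatives.\<close>

lemma minus_eq_smult:
  assumes "x \<in> carrier M" "y \<in> carrier M"
  shows "x \<ominus>\<^bsub>M\<^esub> y = x \<oplus>\<^bsub>M\<^esub> (\<ominus> \<one>) \<odot>\<^bsub>M\<^esub> y"
  using assms by (simp add: smult_minus_one_l a_minus_def)

lemma diff_eq_zero_iff:
  "\<lbrakk>x \<in> carrier M; y \<in> carrier M\<rbrakk> \<Longrightarrow> x \<ominus>\<^bsub>M\<^esub> y = \<zero>\<^bsub>M\<^esub> \<longleftrightarrow> x = y"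
  using M.add.inv_solve_right'[of "\<zero>\<^bsub>M\<^esub>" x y] by (auto simp: a_minus_def a_inv_def)

lemma diff_diff_cancel: "\<lbrakk>x \<in> carrier M; y \<in> carrier M\<rbrakk> \<Longrightarrow> x \<ominus>\<^bsub>M\<^esub> (x \<ominus>\<^bsub>M\<^esub> y) = y"
  by (simp add: a_minus_def M.minus_add M.r_neg flip: M.a_assoc)

lemma diff_zero: "x \<in> carrier M \<Longrightarrow> x \<ominus>\<^bsub>M\<^esub> \<zero>\<^bsub>M\<^esub> = x"
  using diff_diff_cancel[of x x] diff_eq_zero_iff[of x x] by simp

lemma diff_add_cancel:
  "\<lbrakk>x \<in> carrier M; y \<in> carrier M\<rbrakk> \<Longrightarrow> x \<ominus>\<^bsub>M\<^esub> y \<oplus>\<^bsub>M\<^esub> y = x"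
  by (simp add: a_minus_def M.a_assoc M.l_neg)

end

lemma lmodule_homD:
  assumes "lmodule_hom S M N f"
  shows "left_module S M" "left_module S N" "x \<in> carrier M \<Longrightarrow> f x \<in> carrier N"
    "\<lbrakk>x \<in> carrier M; y \<in> carrier M\<rbrakk> \<Longrightarrow> f (x \<oplus>\<^bsub>M\<^esub> y) = f x \<oplus>\<^bsub>N\<^esub> f y"
    "\<lbrakk>a \<in> carrier S; x \<in> carrier M\<rbrakk> \<Longrightarrow> f (a \<odot>\<^bsub>M\<^esub> x) = a \<odot>\<^bsub>N\<^esub> f x"
  using assms unfolding lmodule_hom_def by blast+

lemma lmodule_homI:
  assumes "left_module S M" "left_module S N" "\<And>x. x \<in> carrier M \<Longrightarrow> f x \<in> carrier N"
    "\<And>x y. \<lbrakk>x \<in> carrier M; y \<in> carrier M\<rbrakk> \<Longrightarrow> f (x \<oplus>\<^bsub>M\<^esub> y) = f x \<oplus>\<^bsub>N\<^esub> f y"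
    "\<And>a x. \<lbrakk>a \<in> carrier S; x \<in> carrier M\<rbrakk> \<Longrightarrow> f (a \<odot>\<^bsub>M\<^esub> x) = a \<odot>\<^bsub>N\<^esub> f x"
  shows "lmodule_hom S M N f"
  using assms unfolding lmodule_hom_def by blast

lemma lmodule_hom_diff:
  assumes f: "lmodule_hom S M N f" and x: "x \<in> carrier M" and y: "y \<in> carrier M"
  shows "f (x \<ominus>\<^bsub>M\<^esub> y) = f x \<ominus>\<^bsub>N\<^esub> f y"
proof -
  interpret M: left_module S M by (rule lmodule_homD(1)[OF f])
  interpret N: left_module S N by (rule lmodule_homD(2)[OF f])
  have "\<ominus>\<^bsub>S\<^esub> \<one>\<^bsub>S\<^esub> \<in> carrier S" by simp
  then show ?thesis
    using x y lmodule_homD(3-5)[OF f] by (simp add: M.minus_eq_smult N.minus_eq_smult)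
qed

lemma lmodule_hom_comp:
  assumes "lmodule_hom S L M f" and "lmodule_hom S M N g"
  shows "lmodule_hom S L N (\<lambda>x. g (f x))"
  using lmodule_homD[OF assms(1)] lmodule_homD[OF assms(2)] by (intro lmodule_homI) auto

lemma lmodule_hom_cong:
  assumes f: "lmodule_hom S M N f" and "\<And>x. x \<in> carrier M \<Longrightarrow> g x = f x"
  shows "lmodule_hom S M N g"
proof -
  interpret M: left_module S M by (rule lmodule_homD(1)[OF f])
  show ?thesis using lmodule_homD[OF f] assms(2) by (intro lmodule_homI) auto
qed

lemma lmodule_hom_zero_map:
  assumes "left_module S M" "left_module S N"
  shows "lmodule_hom S M N (\<lambda>_. \<zero>\<^bsub>N\<^esub>)"
proof -
  interpret N: left_module S N by fact
  show ?thesis by (rule lmodule_homI) (simp_all add: assms)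
qed

lemma lmodule_hom_add:
  assumes f: "lmodule_hom S M N f" and g: "lmodule_hom S M N g"
  shows "lmodule_hom S M N (\<lambda>x. f x \<oplus>\<^bsub>N\<^esub> g x)"
proof -
  interpret N: left_module S N by (rule lmodule_homD(2)[OF f])
  show ?thesis
    by (rule lmodule_homI)
       (simp_all add: lmodule_homD[OF f] lmodule_homD[OF g] N.M.a_ac N.smult_r_distr)
qed

lemma lmodule_hom_minus:
  assumes f: "lmodule_hom S M N f" and g: "lmodule_hom S M N g"
  shows "lmodule_hom S M N (\<lambda>x. f x \<ominus>\<^bsub>N\<^esub> g x)"
proof -
  interpret M: left_module S M by (rule lmodule_homD(1)[OF f])
  interpret N: left_module S N by (rule lmodule_homD(2)[OF f])
  have neg: "\<ominus>\<^bsub>N\<^esub> (a \<odot>\<^bsub>N\<^esub> x) = a \<odot>\<^bsub>N\<^esub> (\<ominus>\<^bsub>N\<^esub> x)" if "a \<in> carrier S" "x \<in> carrier N" for a x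
    using that by (metis N.M.add.inv_closed N.M.l_neg N.M.minus_equality N.smult_closed N.smult_r_distr N.smult_zero_right)
  show ?thesis
    by (rule lmodule_homI)
       (simp_all add: lmodule_homD[OF f] lmodule_homD[OF g] a_minus_def N.M.a_ac N.smult_r_distr
          N.M.minus_add neg)
qed

lemma lmodule_hom_inverse:
  assumes f: "lmodule_hom S M N f"
    and g: "\<And>y. y \<in> carrier N \<Longrightarrow> g y \<in> carrier M" "\<And>y. y \<in> carrier N \<Longrightarrow> f (g y) = y"
      "\<And>x. x \<in> carrier M \<Longrightarrow> g (f x) = x"
  shows "lmodule_hom S N M g"
proof -
  interpret M: left_module S M by (rule lmodule_homD(1)[OF f])
  show ?thesis
  proof (rule lmodule_homI)
    fix x y assume "x \<in> carrier N" "y \<in> carrier N"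
    then show "g (x \<oplus>\<^bsub>N\<^esub> y) = g x \<oplus>\<^bsub>M\<^esub> g y"
      using lmodule_homD(4)[OF f, of "g x" "g y"] g(1,2) g(3)[of "g x \<oplus>\<^bsub>M\<^esub> g y"] by simp
  next
    fix a x assume "a \<in> carrier S" "x \<in> carrier N"
    then show "g (a \<odot>\<^bsub>N\<^esub> x) = a \<odot>\<^bsub>M\<^esub> g x"
      using lmodule_homD(5)[OF f, of a "g x"] g(1,2) g(3)[of "a \<odot>\<^bsub>M\<^esub> g x"] by simp
  qed (use lmodule_homD(1,2)[OF f] g(1) in auto)
qed

section \<open>Submodules, quotient modules and maps between quotients\<close>

lemma left_module_subset:
  assumes "left_module S M" and N: "N \<subseteq> carrier M" "\<zero>\<^bsub>M\<^esub> \<in> N"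
    and "\<And>x y. \<lbrakk>x \<in> N; y \<in> N\<rbrakk> \<Longrightarrow> x \<oplus>\<^bsub>M\<^esub> y \<in> N"
    and smult: "\<And>a x. \<lbrakk>a \<in> carrier S; x \<in> N\<rbrakk> \<Longrightarrow> a \<odot>\<^bsub>M\<^esub> x \<in> N"
  shows "left_module S (M\<lparr>carrier := N\<rparr>)"
proof -
  interpret left_module S M by fact
  have "\<exists>y\<in>N. y \<oplus>\<^bsub>M\<^esub> x = \<zero>\<^bsub>M\<^esub>" if "x \<in> N" for x
    using smult[of "\<ominus>\<^bsub>S\<^esub> \<one>\<^bsub>S\<^esub>" x] that N(1) M.l_neg[of x]
    by (intro bexI[of _ "\<ominus>\<^bsub>M\<^esub> x"]) (auto simp: smult_minus_one_l subset_iff)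
  then show ?thesis
    using assms
    by (intro left_moduleI)
       (auto simp: S.ring_axioms subset_iff M.a_ac smult_l_distr smult_r_distr smult_assoc)
qed

text \<open>The additive inverse of a record is selected from its carrier, so that shrinking the
  carrier might change differences. Expressed through the scalar -1, a difference involves only
  operations that the update leaves alone.\<close>

lemma minus_carrier_update:
  assumes M: "left_module S M" and N: "left_module S (M\<lparr>carrier := N\<rparr>)" "N \<subseteq> carrier M"
    and xy: "x \<in> N" "y \<in> N"
  shows "x \<ominus>\<^bsub>M\<lparr>carrier := N\<rparr>\<^esub> y = x \<ominus>\<^bsub>M\<^esub> y"
  using left_module.minus_eq_smult[OF M subsetD[OF N(2) xy(1)] subsetD[OF N(2) xy(2)]]
    left_module.minus_eq_smult[OF N(1), of x y] xy
  by simp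

locale left_submodule = left_module +
  fixes N
  assumes sub_carrier: "N \<subseteq> carrier M"
    and sub_zero: "\<zero>\<^bsub>M\<^esub> \<in> N"
    and sub_add: "\<lbrakk>x \<in> N; y \<in> N\<rbrakk> \<Longrightarrow> x \<oplus>\<^bsub>M\<^esub> y \<in> N"
    and sub_smult: "\<lbrakk>a \<in> carrier S; x \<in> N\<rbrakk> \<Longrightarrow> a \<odot>\<^bsub>M\<^esub> x \<in> N"
begin

lemma abelian_subgroup_sub: "abelian_subgroup N M"
proof (rule abelian_subgroupI3)
  have "\<ominus>\<^bsub>M\<^esub> x \<in> N" if "x \<in> N" for x
    using sub_smult[OF _ that, of "\<ominus> \<one>"] that sub_carrier by (auto simp: smult_minus_one_l subset_iff)
  then show "additive_subgroup N M"
    using sub_carrier sub_zero sub_add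
    by (intro additive_subgroupI M.add.subgroupI) (auto simp: a_inv_def)
qed (rule M.abelian_group_axioms)

sublocale sub: abelian_subgroup N M by (rule abelian_subgroup_sub)

lemma coset_eq_iff:
  assumes "x \<in> carrier M" "y \<in> carrier M"
  shows "N +>\<^bsub>M\<^esub> x = N +>\<^bsub>M\<^esub> y \<longleftrightarrow> x \<ominus>\<^bsub>M\<^esub> y \<in> N"
proof -
  have "N +>\<^bsub>M\<^esub> x = N +>\<^bsub>M\<^esub> y \<longleftrightarrow> x \<in> N +>\<^bsub>M\<^esub> y"
    using sub.a_repr_independence'[of x y] sub.a_repr_independenceD[of x y] assms by auto
  then show ?thesis using assms by (simp add: sub.a_rcos_module a_minus_def)
qed

lemma coset_eq_self_iff: "x \<in> carrier M \<Longrightarrow> N +>\<^bsub>M\<^esub> x = N \<longleftrightarrow> x \<in> N"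
  using coset_eq_iff[of x "\<zero>\<^bsub>M\<^esub>"] sub_carrier M.a_coset_add_zero[of N]
    M.minus_equality[of "\<zero>\<^bsub>M\<^esub>" "\<zero>\<^bsub>M\<^esub>"]
  by (simp add: a_minus_def)

lemma carrier_quotient: "carrier (quotient_module M N) = (\<lambda>x. N +>\<^bsub>M\<^esub> x) ` carrier M"
  by (auto simp: quotient_module_def A_RCOSETS_def')

lemma quotient_zero: "\<zero>\<^bsub>quotient_module M N\<^esub> = N"
  by (simp add: quotient_module_def)

lemma quotient_add:
  "\<lbrakk>x \<in> carrier M; y \<in> carrier M\<rbrakk> \<Longrightarrow>
    (N +>\<^bsub>M\<^esub> x) \<oplus>\<^bsub>quotient_module M N\<^esub> (N +>\<^bsub>M\<^esub> y) = N +>\<^bsub>M\<^esub> (x \<oplus>\<^bsub>M\<^esub> y)"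
  by (simp add: quotient_module_def sub.a_rcos_sum)

text \<open>In \<open>quotient_module\<close> a scalar acts by a union over all representatives of
  the coset. Two representatives differ by an element of \<open>N\<close>, whose multiples stay in
  \<open>N\<close>, so the union is one of equal cosets.\<close>

lemma quotient_smult:
  assumes a: "a \<in> carrier S" and x: "x \<in> carrier M"
  shows "a \<odot>\<^bsub>quotient_module M N\<^esub> (N +>\<^bsub>M\<^esub> x) = N +>\<^bsub>M\<^esub> (a \<odot>\<^bsub>M\<^esub> x)"
proof -
  have const: "N +>\<^bsub>M\<^esub> (a \<odot>\<^bsub>M\<^esub> y) = N +>\<^bsub>M\<^esub> (a \<odot>\<^bsub>M\<^esub> x)" if "y \<in> N +>\<^bsub>M\<^esub> x" for y
  proof -
    obtain n where n: "n \<in> N" "y = n \<oplus>\<^bsub>M\<^esub> x" using \<open>y \<in> N +>\<^bsub>M\<^esub> x\<close> by (auto simp: a_r_coset_def')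
    then have "n \<in> carrier M" "a \<odot>\<^bsub>M\<^esub> n \<in> N" using sub_carrier sub_smult a by auto
    then show ?thesis
      using n a x by (simp add: smult_r_distr coset_eq_iff) (simp add: a_minus_def M.a_assoc M.r_neg)
  qed
  have "(\<Union>y\<in>N +>\<^bsub>M\<^esub> x. N +>\<^bsub>M\<^esub> (a \<odot>\<^bsub>M\<^esub> y)) = N +>\<^bsub>M\<^esub> (a \<odot>\<^bsub>M\<^esub> x)"
    using sub.a_rcos_self[OF x] by (intro SUP_eq_const const) blast+
  then show ?thesis by (simp add: quotient_module_def)
qed

lemma left_module_quotient: "left_module S (quotient_module M N)"
proof (rule left_moduleI)
  have zero: "\<zero>\<^bsub>quotient_module M N\<^esub> = N +>\<^bsub>M\<^esub> \<zero>\<^bsub>M\<^esub>"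
    using sub_carrier by (simp add: quotient_zero)
  show "\<zero>\<^bsub>quotient_module M N\<^esub> \<in> carrier (quotient_module M N)"
    using zero by (auto simp: carrier_quotient)
  show "\<And>x. x \<in> carrier (quotient_module M N) \<Longrightarrow> \<zero>\<^bsub>quotient_module M N\<^esub> \<oplus>\<^bsub>quotient_module M N\<^esub> x = x"
    unfolding zero by (auto simp: carrier_quotient quotient_add)
  fix x assume "x \<in> carrier (quotient_module M N)"
  then obtain y where "y \<in> carrier M" "x = N +>\<^bsub>M\<^esub> y" by (auto simp: carrier_quotient)
  then show "\<exists>y\<in>carrier (quotient_module M N). y \<oplus>\<^bsub>quotient_module M N\<^esub> x = \<zero>\<^bsub>quotient_module M N\<^esub>"
    unfolding zero
    by (intro bexI[of _ "N +>\<^bsub>M\<^esub> (\<ominus>\<^bsub>M\<^esub> y)"]) (auto simp: carrier_quotient quotient_add M.l_neg)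
qed (auto simp: S.ring_axioms carrier_quotient quotient_add quotient_smult M.a_ac
       smult_l_distr smult_r_distr smult_assoc)

end

text \<open>
  A submodule of \<open>M\<^sub>1 \<times> M\<^sub>2\<close> that projects onto \<open>M\<^sub>1\<close> and whose image of \<open>N\<^sub>1\<close> lies in \<open>N\<^sub>2\<close> is the graph of
  a linear map \<open>M\<^sub>1 / N\<^sub>1 \<rightarrow> M\<^sub>2 / N\<^sub>2\<close>.  Connecting homomorphisms and maps induced by chain maps are
  both of this form.
\<close>

locale quotient_correspondence =
  dom: left_submodule S M1 N1 + cod: left_submodule S M2 N2
  for S :: "('s, 'c) ring_scheme" (structure)
    and M1 :: "('s, 'm, 'd) module_scheme" and N1
    and M2 :: "('s, 'n, 'e) module_scheme" and N2 +
  fixes r :: "'m \<Rightarrow> 'n \<Rightarrow> bool"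
  assumes rel_carrier: "r x y \<Longrightarrow> x \<in> carrier M1 \<and> y \<in> carrier M2"
    and rel_total: "x \<in> carrier M1 \<Longrightarrow> \<exists>y. r x y"
    and rel_add: "\<lbrakk>r x y; r x' y'\<rbrakk> \<Longrightarrow> r (x \<oplus>\<^bsub>M1\<^esub> x') (y \<oplus>\<^bsub>M2\<^esub> y')"
    and rel_smult: "\<lbrakk>a \<in> carrier S; r x y\<rbrakk> \<Longrightarrow> r (a \<odot>\<^bsub>M1\<^esub> x) (a \<odot>\<^bsub>M2\<^esub> y)"
    and rel_zero: "\<lbrakk>r x y; x \<in> N1\<rbrakk> \<Longrightarrow> y \<in> N2"
begin

lemma quotientE:
  assumes "X \<in> carrier (quotient_module M1 N1)"
  obtains x y where "X = N1 +>\<^bsub>M1\<^esub> x" "r x y" "x \<in> carrier M1" "y \<in> carrier M2"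
proof -
  obtain x where x: "x \<in> carrier M1" "X = N1 +>\<^bsub>M1\<^esub> x"
    using assms unfolding dom.carrier_quotient by (rule imageE)
  moreover obtain y where "r x y" using rel_total[OF x(1)] ..
  ultimately show ?thesis using that rel_carrier by blast
qed

definition induced where
  "induced X = N2 +>\<^bsub>M2\<^esub> (SOME y. \<exists>x. X = N1 +>\<^bsub>M1\<^esub> x \<and> r x y)"

text \<open>The choice in \<open>induced\<close> is harmless: two pairs over the same coset have as
  difference a pair whose first entry lies in \<open>N1\<close>, and \<open>rel_zero\<close> puts
  the second entry into \<open>N2\<close>.\<close>

lemma induced_eq:
  assumes "r x y"
  shows "induced (N1 +>\<^bsub>M1\<^esub> x) = N2 +>\<^bsub>M2\<^esub> y"
proof -
  let ?y = "SOME y. \<exists>x'. N1 +>\<^bsub>M1\<^esub> x = N1 +>\<^bsub>M1\<^esub> x' \<and> r x' y"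
  have "\<exists>x'. N1 +>\<^bsub>M1\<^esub> x = N1 +>\<^bsub>M1\<^esub> x' \<and> r x' ?y"
    by (rule someI_ex) (use assms in blast)
  then obtain x' where x': "N1 +>\<^bsub>M1\<^esub> x = N1 +>\<^bsub>M1\<^esub> x'" "r x' ?y" by blast
  have "x' \<ominus>\<^bsub>M1\<^esub> x \<in> N1"
    using x'(1)[symmetric] rel_carrier[OF assms] rel_carrier[OF x'(2)] dom.coset_eq_iff by simp
  moreover have "r (x' \<oplus>\<^bsub>M1\<^esub> (\<ominus> \<one>) \<odot>\<^bsub>M1\<^esub> x) (?y \<oplus>\<^bsub>M2\<^esub> (\<ominus> \<one>) \<odot>\<^bsub>M2\<^esub> y)"
    using x' assms by (intro rel_add rel_smult) simp_all
  ultimately have "?y \<ominus>\<^bsub>M2\<^esub> y \<in> N2"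
    using rel_carrier[OF assms] rel_carrier[OF x'(2)] rel_zero
    by (simp add: dom.minus_eq_smult cod.minus_eq_smult)
  then show ?thesis
    using rel_carrier[OF assms] rel_carrier[OF x'(2)] by (simp add: induced_def cod.coset_eq_iff)
qed

lemma induced_hom: "lmodule_hom S (quotient_module M1 N1) (quotient_module M2 N2) induced"
proof (rule lmodule_homI)
  show "left_module S (quotient_module M1 N1)" "left_module S (quotient_module M2 N2)"
    by (rule dom.left_module_quotient, rule cod.left_module_quotient)
next
  fix X assume "X \<in> carrier (quotient_module M1 N1)"
  then obtain x y where x: "x \<in> carrier M1" "X = N1 +>\<^bsub>M1\<^esub> x" "r x y"
    by (rule quotientE)
  then show "induced X \<in> carrier (quotient_module M2 N2)"
    using rel_carrier[OF x(3)] by (auto simp: induced_eq cod.carrier_quotient)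
  fix a assume a: "a \<in> carrier S"
  show "induced (a \<odot>\<^bsub>quotient_module M1 N1\<^esub> X) = a \<odot>\<^bsub>quotient_module M2 N2\<^esub> induced X"
    using rel_carrier[OF x(3)] x a rel_smult[OF a x(3)]
    by (simp add: dom.quotient_smult cod.quotient_smult induced_eq)
next
  fix X X' assume X: "X \<in> carrier (quotient_module M1 N1)" "X' \<in> carrier (quotient_module M1 N1)"
  obtain x y where x: "X = N1 +>\<^bsub>M1\<^esub> x" "r x y" by (rule quotientE[OF X(1)])
  obtain x' y' where x': "X' = N1 +>\<^bsub>M1\<^esub> x'" "r x' y'" by (rule quotientE[OF X(2)])
  show "induced (X \<oplus>\<^bsub>quotient_module M1 N1\<^esub> X') = induced X \<oplus>\<^bsub>quotient_module M2 N2\<^esub> induced X'"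
    using rel_carrier[OF x(2)] rel_carrier[OF x'(2)] rel_add[OF x(2) x'(2)] x x'
    by (simp add: dom.quotient_add cod.quotient_add induced_eq)
qed

lemma induced_eq_zero_iff: "r x y \<Longrightarrow> induced (N1 +>\<^bsub>M1\<^esub> x) = N2 \<longleftrightarrow> y \<in> N2"
  using rel_carrier by (simp add: induced_eq cod.coset_eq_self_iff)

text \<open>As the relation is closed under differences, injectivity reduces to the zero class.
  Surjectivity is asked for only modulo \<open>N2\<close>, because an inverse up to homotopy
  delivers no more.\<close>

lemma induced_bij:
  assumes inj: "\<And>x y. \<lbrakk>r x y; y \<in> N2\<rbrakk> \<Longrightarrow> x \<in> N1"
    and surj: "\<And>y. y \<in> carrier M2 \<Longrightarrow> \<exists>x y'. r x y' \<and> y \<ominus>\<^bsub>M2\<^esub> y' \<in> N2"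
  shows "bij_betw induced (carrier (quotient_module M1 N1)) (carrier (quotient_module M2 N2))"
proof (rule bij_betw_imageI)
  show "inj_on induced (carrier (quotient_module M1 N1))"
  proof (rule inj_onI)
    fix X X' assume X: "X \<in> carrier (quotient_module M1 N1)" "X' \<in> carrier (quotient_module M1 N1)"
      and eq: "induced X = induced X'"
    obtain x y where x: "X = N1 +>\<^bsub>M1\<^esub> x" "r x y" by (rule quotientE[OF X(1)])
    obtain x' y' where x': "X' = N1 +>\<^bsub>M1\<^esub> x'" "r x' y'" by (rule quotientE[OF X(2)])
    note c = rel_carrier[OF x(2)] rel_carrier[OF x'(2)]
    have "y \<ominus>\<^bsub>M2\<^esub> y' \<in> N2"
      using eq x x' c by (simp add: induced_eq cod.coset_eq_iff)
    moreover have "r (x \<oplus>\<^bsub>M1\<^esub> (\<ominus> \<one>) \<odot>\<^bsub>M1\<^esub> x') (y \<oplus>\<^bsub>M2\<^esub> (\<ominus> \<one>) \<odot>\<^bsub>M2\<^esub> y')"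
      using x x' by (intro rel_add rel_smult) simp_all
    ultimately have "x \<ominus>\<^bsub>M1\<^esub> x' \<in> N1"
      using c inj by (simp add: dom.minus_eq_smult cod.minus_eq_smult)
    then show "X = X'" using x x' c by (simp add: dom.coset_eq_iff)
  qed
  show "induced ` carrier (quotient_module M1 N1) = carrier (quotient_module M2 N2)"
  proof
    show "induced ` carrier (quotient_module M1 N1) \<subseteq> carrier (quotient_module M2 N2)"
      using lmodule_homD(3)[OF induced_hom] by blast
    show "carrier (quotient_module M2 N2) \<subseteq> induced ` carrier (quotient_module M1 N1)"
    proof
      fix Y assume "Y \<in> carrier (quotient_module M2 N2)"
      then obtain y where y: "y \<in> carrier M2" "Y = N2 +>\<^bsub>M2\<^esub> y" by (auto simp: cod.carrier_quotient)
      then obtain x y' where r: "r x y'" "y \<ominus>\<^bsub>M2\<^esub> y' \<in> N2" using surj by blast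
      then have "Y = induced (N1 +>\<^bsub>M1\<^esub> x)"
        using y rel_carrier[OF r(1)] by (simp add: induced_eq cod.coset_eq_iff)
      then show "Y \<in> induced ` carrier (quotient_module M1 N1)"
        using rel_carrier[OF r(1)] by (auto simp: dom.carrier_quotient)
    qed
  qed
qed

end

text \<open>Exactness of the induced maps in terms of representatives. The preimage in
  \<open>ex\<close> is required only modulo \<open>N2\<close>, which is the form in which the
  diagram chases below produce it.\<close>

lemma quotient_correspondence_exact:
  assumes r: "quotient_correspondence S M1 N1 M2 N2 r" and s: "quotient_correspondence S M2 N2 M3 N3 s"
    and comp: "\<And>x y z. \<lbrakk>r x y; s y z\<rbrakk> \<Longrightarrow> z \<in> N3"
    and ex: "\<And>y z. \<lbrakk>s y z; z \<in> N3\<rbrakk> \<Longrightarrow> \<exists>x y'. r x y' \<and> y \<ominus>\<^bsub>M2\<^esub> y' \<in> N2"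
  shows "exact_at S (quotient_module M1 N1) (quotient_module M2 N2) (quotient_module M3 N3)
    (quotient_correspondence.induced M1 N1 M2 N2 r) (quotient_correspondence.induced M2 N2 M3 N3 s)"
proof -
  interpret r: quotient_correspondence S M1 N1 M2 N2 r by fact
  interpret s: quotient_correspondence S M2 N2 M3 N3 s by fact
  have "s.induced (r.induced X) = N3" if "X \<in> carrier (quotient_module M1 N1)" for X
  proof -
    obtain x y where x: "X = N1 +>\<^bsub>M1\<^esub> x" "r x y"
      by (rule r.quotientE[OF \<open>X \<in> _\<close>])
    then obtain z where z: "s y z" using r.rel_carrier s.rel_total by blast
    then have "z \<in> N3" using comp x by blast
    with x z show ?thesis by (simp add: r.induced_eq s.induced_eq_zero_iff)
  qed
  moreover have "Y \<in> r.induced ` carrier (quotient_module M1 N1)"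
    if Y: "Y \<in> carrier (quotient_module M2 N2)" "s.induced Y = N3" for Y
  proof -
    obtain y z where y: "Y = N2 +>\<^bsub>M2\<^esub> y" "s y z"
      by (rule s.quotientE[OF Y(1)])
    then have "z \<in> N3" using Y(2) by (simp add: s.induced_eq_zero_iff)
    then obtain x y' where x: "r x y'" "y \<ominus>\<^bsub>M2\<^esub> y' \<in> N2" using ex y by blast
    then have "Y = r.induced (N1 +>\<^bsub>M1\<^esub> x)"
      using y r.rel_carrier[OF x(1)] s.rel_carrier[OF y(2)] by (simp add: r.induced_eq r.cod.coset_eq_iff)
    then show ?thesis using r.rel_carrier[OF x(1)] by (auto simp: r.dom.carrier_quotient)
  qed
  ultimately show ?thesis
    using r.induced_hom s.induced_hom lmodule_homD(3)[OF r.induced_hom]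
    by (auto simp: exact_at_def a_kernel_def' s.cod.quotient_zero)
qed

section \<open>The long exact sequence of a short exact sequence of cochain complexes\<close>

text \<open>Shaped like the quotient in \<open>Ext\<close>, so that \<open>Ext\<close> is by
  definition the cohomology of a complex of homomorphisms.\<close>

definition cohomology ::
    "(int \<Rightarrow> ('s, 'm) module) \<Rightarrow> (int \<Rightarrow> 'm \<Rightarrow> 'm) \<Rightarrow> int \<Rightarrow> ('s, 'm set) module"
  where "cohomology C d n =
    quotient_module ((C n)\<lparr>carrier := a_kernel (C n) (C (n + 1)) (d n)\<rparr>) (d (n - 1) ` carrier (C (n - 1)))"

locale cochain_complex =
  fixes S :: "('s, 'c) ring_scheme" (structure) and C :: "int \<Rightarrow> ('s, 'm) module"
    and d :: "int \<Rightarrow> 'm \<Rightarrow> 'm"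
  assumes d_hom: "lmodule_hom S (C n) (C (n + 1)) (d n)"
    and d_d: "x \<in> carrier (C n) \<Longrightarrow> d (n + 1) (d n x) = \<zero>\<^bsub>C (n + 1 + 1)\<^esub>"
begin

abbreviation "cocycles n \<equiv> a_kernel (C n) (C (n + 1)) (d n)"
abbreviation "cocycle_module n \<equiv> (C n)\<lparr>carrier := cocycles n\<rparr>"
abbreviation "coboundaries n \<equiv> d (n - 1) ` carrier (C (n - 1))"

lemma cocycles_iff: "x \<in> cocycles n \<longleftrightarrow> x \<in> carrier (C n) \<and> d n x = \<zero>\<^bsub>C (n + 1)\<^esub>"
  by (simp add: a_kernel_def')

lemma module: "left_module S (C n)"
  by (rule lmodule_homD(1)[OF d_hom])

lemmas d_simps = lmodule_homD(3-5)[OF d_hom] lmodule_hom_zero[OF d_hom] lmodule_hom_diff[OF d_hom]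

lemma d_prev: "lmodule_hom S (C (n - 1)) (C n) (d (n - 1))"
  using d_hom[of "n - 1"] by simp

lemma d_d_prev: "x \<in> carrier (C (n - 1)) \<Longrightarrow> d n (d (n - 1) x) = \<zero>\<^bsub>C (n + 1)\<^esub>"
  using d_d[of x "n - 1"] by simp

lemma cocycle_submodule: "left_module S (cocycle_module n)"
proof -
  interpret C: left_module S "C n" by (rule module)
  interpret C': left_module S "C (n + 1)" by (rule module)
  show ?thesis
    by (rule left_module_subset) (auto simp: cocycles_iff d_simps C.left_module_axioms)
qed

lemma coboundary_submodule: "left_submodule S (cocycle_module n) (coboundaries n)"
proof -
  interpret C: left_module S "C n" by (rule module)
  interpret C': left_module S "C (n - 1)" by (rule module)
  interpret Z: left_module S "cocycle_module n" by (rule cocycle_submodule)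
  note p = lmodule_homD[OF d_prev]
  show ?thesis
  proof
    show "coboundaries n \<subseteq> carrier (cocycle_module n)"
      using p(3) d_d_prev by (auto simp: cocycles_iff)
    show "\<zero>\<^bsub>cocycle_module n\<^esub> \<in> coboundaries n"
      using lmodule_hom_zero[OF d_prev, of n] by (auto intro!: image_eqI[of _ _ "\<zero>\<^bsub>C (n - 1)\<^esub>"])
    show "x \<oplus>\<^bsub>cocycle_module n\<^esub> y \<in> coboundaries n"
      if xy: "x \<in> coboundaries n" "y \<in> coboundaries n" for x y
    proof -
      obtain x' y' where "x = d (n - 1) x'" "y = d (n - 1) y'"
        "x' \<in> carrier (C (n - 1))" "y' \<in> carrier (C (n - 1))"
        using xy by blast
      then show ?thesis
        using p(4)[of x' n y'] by (auto intro!: image_eqI[of _ _ "x' \<oplus>\<^bsub>C (n - 1)\<^esub> y'"])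
    qed
    show "a \<odot>\<^bsub>cocycle_module n\<^esub> x \<in> coboundaries n"
      if a: "a \<in> carrier S" and x: "x \<in> coboundaries n" for a x
    proof -
      obtain x' where "x = d (n - 1) x'" "x' \<in> carrier (C (n - 1))"
        using x by blast
      then show ?thesis
        using a p(5)[of a x' n] by (auto intro!: image_eqI[of _ _ "a \<odot>\<^bsub>C (n - 1)\<^esub> x'"])
    qed
  qed
qed

lemma cocycle_minus:
  assumes "x \<in> cocycles n" "y \<in> cocycles n"
  shows "x \<ominus>\<^bsub>cocycle_module n\<^esub> y = x \<ominus>\<^bsub>C n\<^esub> y"
  by (rule minus_carrier_update[OF module cocycle_submodule]) (use assms in \<open>auto simp: cocycles_iff\<close>)

end

locale cochain_map =
  dom: cochain_complex S C dC + cod: cochain_complex S D dD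
  for S :: "('s, 'c) ring_scheme" (structure) and C :: "int \<Rightarrow> ('s, 'm) module" and dC
    and D :: "int \<Rightarrow> ('s, 'n) module" and dD +
  fixes f :: "int \<Rightarrow> 'm \<Rightarrow> 'n"
  assumes map_hom: "lmodule_hom S (C n) (D n) (f n)"
    and map_d: "x \<in> carrier (C n) \<Longrightarrow> f (n + 1) (dC n x) = dD n (f n x)"
begin

lemmas map_simps = lmodule_homD(3-5)[OF map_hom] lmodule_hom_zero[OF map_hom]
  lmodule_hom_diff[OF map_hom]

lemma map_d_prev: "x \<in> carrier (C (n - 1)) \<Longrightarrow> f n (dC (n - 1) x) = dD (n - 1) (f (n - 1) x)"
  using map_d[of x "n - 1"] by simp

lemma map_cocycle: "x \<in> dom.cocycles n \<Longrightarrow> f n x \<in> cod.cocycles n"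
  using map_d[of x n] by (simp add: dom.cocycles_iff cod.cocycles_iff map_simps)

text \<open>The map on cocycles as a correspondence, so that induced maps and connecting maps fall
  under the same exactness criterion.\<close>

definition graph where "graph n x y \<longleftrightarrow> x \<in> dom.cocycles n \<and> y = f n x"

lemma graph_correspondence:
  "quotient_correspondence S (dom.cocycle_module n) (dom.coboundaries n)
    (cod.cocycle_module n) (cod.coboundaries n) (graph n)"
proof -
  interpret dom: left_submodule S "dom.cocycle_module n" "dom.coboundaries n"
    by (rule dom.coboundary_submodule)
  interpret cod: left_submodule S "cod.cocycle_module n" "cod.coboundaries n"
    by (rule cod.coboundary_submodule)
  show ?thesis
  proof
    show "graph n x y \<Longrightarrow> x \<in> carrier (dom.cocycle_module n) \<and> y \<in> carrier (cod.cocycle_module n)" for x y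
      using map_cocycle by (simp add: graph_def)
    show "x \<in> carrier (dom.cocycle_module n) \<Longrightarrow> \<exists>y. graph n x y" for x
      by (simp add: graph_def)
    show "graph n (x \<oplus>\<^bsub>dom.cocycle_module n\<^esub> x') (y \<oplus>\<^bsub>cod.cocycle_module n\<^esub> y')"
      if "graph n x y" "graph n x' y'" for x y x' y'
      using that dom.M.add.m_closed[of x x'] map_simps(2)[of x n x']
      by (simp add: graph_def dom.cocycles_iff)
    show "graph n (a \<odot>\<^bsub>dom.cocycle_module n\<^esub> x) (a \<odot>\<^bsub>cod.cocycle_module n\<^esub> y)"
      if "a \<in> carrier S" "graph n x y" for a x y
      using that dom.smult_closed[of a x] map_simps(3)[of a x n]
      by (simp add: graph_def dom.cocycles_iff)
    show "y \<in> cod.coboundaries n" if "graph n x y" "x \<in> dom.coboundaries n" for x y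
      using that map_d_prev[of _ n] map_simps(1)[of _ "n - 1"] by (auto simp: graph_def)
  qed
qed

text \<open>Both conditions concern single cocycles modulo coboundaries, as fits a cochain map that
  is invertible only up to homotopy.\<close>

lemma cohomology_iso:
  assumes inj: "\<And>x. \<lbrakk>x \<in> dom.cocycles n; f n x \<in> cod.coboundaries n\<rbrakk> \<Longrightarrow> x \<in> dom.coboundaries n"
    and surj: "\<And>y. y \<in> cod.cocycles n \<Longrightarrow> \<exists>x\<in>dom.cocycles n. y \<ominus>\<^bsub>D n\<^esub> f n x \<in> cod.coboundaries n"
  shows "\<exists>h. lmodule_hom S (cohomology C dC n) (cohomology D dD n) h \<and>
    bij_betw h (carrier (cohomology C dC n)) (carrier (cohomology D dD n))"
proof -
  interpret quotient_correspondence S "dom.cocycle_module n" "dom.coboundaries n"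
    "cod.cocycle_module n" "cod.coboundaries n" "graph n"
    by (rule graph_correspondence)
  have "bij_betw induced (carrier (cohomology C dC n)) (carrier (cohomology D dD n))"
    unfolding cohomology_def
  proof (rule induced_bij)
    show "\<lbrakk>graph n x y; y \<in> cod.coboundaries n\<rbrakk> \<Longrightarrow> x \<in> dom.coboundaries n" for x y
      using inj by (simp add: graph_def)
    fix y assume "y \<in> carrier (cod.cocycle_module n)"
    then have y: "y \<in> cod.cocycles n" by simp
    then obtain x where x: "x \<in> dom.cocycles n" "y \<ominus>\<^bsub>D n\<^esub> f n x \<in> cod.coboundaries n"
      using surj by blast
    then have "graph n x (f n x)" "y \<ominus>\<^bsub>cod.cocycle_module n\<^esub> f n x \<in> cod.coboundaries n"
      using y map_cocycle[OF x(1)] by (simp_all add: graph_def cod.cocycle_minus)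
    then show "\<exists>x y'. graph n x y' \<and> y \<ominus>\<^bsub>cod.cocycle_module n\<^esub> y' \<in> cod.coboundaries n" by blast
  qed
  then show ?thesis using induced_hom unfolding cohomology_def by blast
qed

end

locale short_exact_sequence_of_complexes =
  f: cochain_map S A dA B dB f + g: cochain_map S B dB C dC g
  for S :: "('s, 'c) ring_scheme" (structure) and A :: "int \<Rightarrow> ('s, 'l) module" and dA
    and B :: "int \<Rightarrow> ('s, 'm) module" and dB and C :: "int \<Rightarrow> ('s, 'n) module" and dC and f g +
  assumes f_inj: "\<lbrakk>x \<in> carrier (A n); f n x = \<zero>\<^bsub>B n\<^esub>\<rbrakk> \<Longrightarrow> x = \<zero>\<^bsub>A n\<^esub>"
    and g_f: "x \<in> carrier (A n) \<Longrightarrow> g n (f n x) = \<zero>\<^bsub>C n\<^esub>"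
    and g_kernel: "\<lbrakk>y \<in> carrier (B n); g n y = \<zero>\<^bsub>C n\<^esub>\<rbrakk> \<Longrightarrow> \<exists>x\<in>carrier (A n). f n x = y"
    and g_surj: "z \<in> carrier (C n) \<Longrightarrow> \<exists>y\<in>carrier (B n). g n y = z"
begin

text \<open>The zigzag of the snake lemma. The lift \<open>y\<close> of \<open>z\<close> is
  quantified rather than chosen, which makes additivity and linearity of the relation
  immediate.\<close>

definition connecting where
  "connecting n z x \<longleftrightarrow> z \<in> g.cod.cocycles n \<and> x \<in> f.dom.cocycles (n + 1) \<and>
    (\<exists>y\<in>carrier (B n). g n y = z \<and> f (n + 1) x = dB n y)"

text \<open>This is injectivity of \<open>f\<close> one degree higher, applied to
  \<open>dA n x\<close>.\<close>

lemma f_reflects_cocycles: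
  assumes x: "x \<in> carrier (A n)" and "dB n (f n x) = \<zero>\<^bsub>B (n + 1)\<^esub>"
  shows "x \<in> f.dom.cocycles n"
proof -
  have "f (n + 1) (dA n x) = \<zero>\<^bsub>B (n + 1)\<^esub>" using assms by (simp add: f.map_d)
  then show ?thesis using x f_inj[of "dA n x"] by (simp add: f.dom.cocycles_iff f.dom.d_simps)
qed

lemma f_eqD:
  assumes "x \<in> carrier (A n)" "x' \<in> carrier (A n)" "f n x = f n x'"
  shows "x = x'"
proof -
  interpret A: left_module S "A n" by (rule f.dom.module)
  interpret B: left_module S "B n" by (rule f.cod.module)
  have "f n (x \<ominus>\<^bsub>A n\<^esub> x') = \<zero>\<^bsub>B n\<^esub>"
    using assms f.map_simps(1)[of x' n] by (simp add: f.map_simps B.diff_eq_zero_iff)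
  then show ?thesis using assms f_inj[of "x \<ominus>\<^bsub>A n\<^esub> x'" n] A.diff_eq_zero_iff[of x x'] by simp
qed

text \<open>This is the well-definedness of the connecting map. Lift a primitive of \<open>z\<close>
  to \<open>y'\<close>. Then \<open>y\<close> minus the coboundary of \<open>y'\<close> is killed by
  \<open>g\<close> and comes from some \<open>x'\<close>; applying the differential removes the
  correction, and injectivity of \<open>f\<close> gives that \<open>x\<close> is the coboundary of
  \<open>x'\<close>.\<close>

lemma connecting_coboundary:
  assumes zx: "connecting n z x" and z: "z \<in> g.cod.coboundaries n"
  shows "x \<in> f.dom.coboundaries (n + 1)"
proof -
  obtain y where x: "x \<in> carrier (A (n + 1))" and y: "y \<in> carrier (B n)" "g n y = z" "f (n + 1) x = dB n y"
    using zx unfolding connecting_def f.dom.cocycles_iff by blast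
  interpret B: left_module S "B n" by (rule f.cod.module)
  interpret B': left_module S "B (n + 1)" by (rule f.cod.module)
  interpret C: left_module S "C n" by (rule g.cod.module)
  obtain y' where y': "y' \<in> carrier (B (n - 1))" "z = g n (dB (n - 1) y')"
    using z g_surj g.map_d_prev by (metis (no_types, lifting) imageE)
  have dy': "dB (n - 1) y' \<in> carrier (B n)"
    using y'(1) by (rule lmodule_homD(3)[OF f.cod.d_prev])
  then have "g n (y \<ominus>\<^bsub>B n\<^esub> dB (n - 1) y') = \<zero>\<^bsub>C n\<^esub>"
    using y y' g.map_simps(1)[OF y(1)] by (simp add: g.map_simps C.diff_eq_zero_iff)
  then obtain x' where x': "x' \<in> carrier (A n)" "f n x' = y \<ominus>\<^bsub>B n\<^esub> dB (n - 1) y'"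
    using g_kernel y(1) dy' by (metis B.M.minus_closed)
  have "f (n + 1) (dA n x') = dB n y \<ominus>\<^bsub>B (n + 1)\<^esub> dB n (dB (n - 1) y')"
    using x' y dy' by (simp add: f.map_d f.cod.d_simps)
  also have "\<dots> = f (n + 1) x"
    using y y' dy' f.cod.d_simps(1)[of y n] by (simp add: f.cod.d_d_prev B'.diff_zero)
  finally have "dA n x' = x" using x x' by (intro f_eqD) (auto simp: f.dom.d_simps)
  then show ?thesis using x' by auto
qed

lemma connecting_correspondence:
  "quotient_correspondence S (g.cod.cocycle_module n) (g.cod.coboundaries n)
    (f.dom.cocycle_module (n + 1)) (f.dom.coboundaries (n + 1)) (connecting n)"
proof -
  interpret B: left_module S "B n" by (rule f.cod.module)
  interpret Z: left_submodule S "g.cod.cocycle_module n" "g.cod.coboundaries n"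
    by (rule g.cod.coboundary_submodule)
  interpret X: left_submodule S "f.dom.cocycle_module (n + 1)" "f.dom.coboundaries (n + 1)"
    by (rule f.dom.coboundary_submodule)
  show ?thesis
  proof
    show "connecting n z x \<Longrightarrow>
        z \<in> carrier (g.cod.cocycle_module n) \<and> x \<in> carrier (f.dom.cocycle_module (n + 1))" for z x
      by (simp add: connecting_def)
    fix z assume "z \<in> carrier (g.cod.cocycle_module n)"
    then have z: "z \<in> carrier (C n)" "dC n z = \<zero>\<^bsub>C (n + 1)\<^esub>" by (auto simp: g.cod.cocycles_iff)
    then obtain y where y: "y \<in> carrier (B n)" "g n y = z" using g_surj by blast
    have dy: "dB n y \<in> carrier (B (n + 1))" "g (n + 1) (dB n y) = \<zero>\<^bsub>C (n + 1)\<^esub>"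
      using y z by (simp_all add: g.map_d f.cod.d_simps)
    then obtain x where x: "x \<in> carrier (A (n + 1))" "f (n + 1) x = dB n y" using g_kernel by blast
    then have "x \<in> f.dom.cocycles (n + 1)" using y by (intro f_reflects_cocycles) (simp_all add: f.cod.d_d)
    with x y z show "\<exists>x. connecting n z x" by (auto simp: connecting_def g.cod.cocycles_iff)
  next
    fix z x z' x' assume zx: "connecting n z x" "connecting n z' x'"
    then obtain y y' where "y \<in> carrier (B n)" "g n y = z" "f (n + 1) x = dB n y"
        "y' \<in> carrier (B n)" "g n y' = z'" "f (n + 1) x' = dB n y'"
      unfolding connecting_def by blast
    then show "connecting n (z \<oplus>\<^bsub>g.cod.cocycle_module n\<^esub> z') (x \<oplus>\<^bsub>f.dom.cocycle_module (n + 1)\<^esub> x')"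
      using zx Z.M.add.m_closed[of z z'] X.M.add.m_closed[of x x']
      by (auto simp: connecting_def a_kernel_def' f.cod.d_simps f.map_simps g.map_simps
          intro!: bexI[of _ "y \<oplus>\<^bsub>B n\<^esub> y'"])
  next
    fix a z x assume a: "a \<in> carrier S" and zx: "connecting n z x"
    then obtain y where "y \<in> carrier (B n)" "g n y = z" "f (n + 1) x = dB n y"
      unfolding connecting_def by blast
    then show "connecting n (a \<odot>\<^bsub>g.cod.cocycle_module n\<^esub> z) (a \<odot>\<^bsub>f.dom.cocycle_module (n + 1)\<^esub> x)"
      using zx a Z.smult_closed[of a z] X.smult_closed[of a x]
      by (auto simp: connecting_def a_kernel_def' f.cod.d_simps f.map_simps g.map_simps
          intro!: bexI[of _ "a \<odot>\<^bsub>B n\<^esub> y"])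
  next
    show "\<lbrakk>connecting n z x; z \<in> g.cod.coboundaries n\<rbrakk> \<Longrightarrow> x \<in> f.dom.coboundaries (n + 1)" for z x
      by (rule connecting_coboundary)
  qed
qed

text \<open>Subtracting the coboundary of a lift of a primitive of \<open>g n y\<close> moves the
  cocycle into the kernel of \<open>g\<close>, hence into the image of \<open>f\<close>.\<close>

lemma exact_middle:
  assumes y: "y \<in> f.cod.cocycles n" and gy: "g n y \<in> g.cod.coboundaries n"
  shows "\<exists>x\<in>f.dom.cocycles n. y \<ominus>\<^bsub>B n\<^esub> f n x \<in> f.cod.coboundaries n"
proof -
  interpret B: left_module S "B n" by (rule f.cod.module)
  interpret B': left_module S "B (n + 1)" by (rule f.cod.module)
  interpret C: left_module S "C n" by (rule g.cod.module)
  obtain y' where y': "y' \<in> carrier (B (n - 1))" "g n y = g n (dB (n - 1) y')"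
    using gy g_surj g.map_d_prev by (metis (no_types, lifting) imageE)
  have dy': "dB (n - 1) y' \<in> carrier (B n)"
    using y'(1) by (rule lmodule_homD(3)[OF f.cod.d_prev])
  have yB: "y \<in> carrier (B n)" "dB n y = \<zero>\<^bsub>B (n + 1)\<^esub>" using y by (auto simp: f.cod.cocycles_iff)
  have "g n (y \<ominus>\<^bsub>B n\<^esub> dB (n - 1) y') = \<zero>\<^bsub>C n\<^esub>"
    using yB y' dy' g.map_simps(1)[OF yB(1)] by (simp add: g.map_simps C.diff_eq_zero_iff)
  then obtain x where x: "x \<in> carrier (A n)" "f n x = y \<ominus>\<^bsub>B n\<^esub> dB (n - 1) y'"
    using g_kernel yB(1) dy' by (metis B.M.minus_closed)
  have "dB n (f n x) = \<zero>\<^bsub>B (n + 1)\<^esub>"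
    using x yB dy' y'(1) by (simp add: f.cod.d_simps f.cod.d_d_prev B'.diff_eq_zero_iff)
  then have "x \<in> f.dom.cocycles n" by (rule f_reflects_cocycles[OF x(1)])
  moreover have "y \<ominus>\<^bsub>B n\<^esub> f n x = dB (n - 1) y'"
    using x yB dy' by (simp add: B.diff_diff_cancel)
  ultimately show ?thesis using y' by auto
qed

theorem long_exact_cohomology_sequence:
  "long_exact_sequence S (cohomology A dA) (cohomology B dB) (cohomology C dC)"
proof -
  let ?f = "\<lambda>n. quotient_correspondence.induced (f.dom.cocycle_module n) (f.dom.coboundaries n)
    (f.cod.cocycle_module n) (f.cod.coboundaries n) (f.graph n)"
  let ?g = "\<lambda>n. quotient_correspondence.induced (f.cod.cocycle_module n) (f.cod.coboundaries n)
    (g.cod.cocycle_module n) (g.cod.coboundaries n) (g.graph n)"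
  let ?\<delta> = "\<lambda>n. quotient_correspondence.induced (g.cod.cocycle_module n) (g.cod.coboundaries n)
    (f.dom.cocycle_module (n + 1)) (f.dom.coboundaries (n + 1)) (connecting n)"
  have e1: "exact_at S (cohomology A dA n) (cohomology B dB n) (cohomology C dC n) (?f n) (?g n)" for n
    unfolding cohomology_def
  proof (rule quotient_correspondence_exact[OF f.graph_correspondence g.graph_correspondence])
    interpret C: left_submodule S "g.cod.cocycle_module n" "g.cod.coboundaries n"
      by (rule g.cod.coboundary_submodule)
    show "\<lbrakk>f.graph n x y; g.graph n y z\<rbrakk> \<Longrightarrow> z \<in> g.cod.coboundaries n" for x y z
      using C.sub_zero by (auto simp: f.graph_def g.graph_def g_f f.dom.cocycles_iff)
    show "\<exists>x y'. f.graph n x y' \<and> y \<ominus>\<^bsub>f.cod.cocycle_module n\<^esub> y' \<in> f.cod.coboundaries n"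
      if yz: "g.graph n y z" "z \<in> g.cod.coboundaries n" for y z
    proof -
      have y: "y \<in> f.cod.cocycles n" "g n y \<in> g.cod.coboundaries n"
        using yz by (auto simp: g.graph_def)
      then obtain x where "x \<in> f.dom.cocycles n" "y \<ominus>\<^bsub>B n\<^esub> f n x \<in> f.cod.coboundaries n"
        using exact_middle by blast
      then show ?thesis
        using f.cod.cocycle_minus[OF y(1) f.map_cocycle] by (auto simp: f.graph_def)
    qed
  qed
  have e2: "exact_at S (cohomology B dB n) (cohomology C dC n) (cohomology A dA (n + 1)) (?g n) (?\<delta> n)" for n
    unfolding cohomology_def
  proof (rule quotient_correspondence_exact[OF g.graph_correspondence connecting_correspondence])
    interpret A': left_submodule S "f.dom.cocycle_module (n + 1)" "f.dom.coboundaries (n + 1)"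
      by (rule f.dom.coboundary_submodule)
    interpret C: left_module S "C n" by (rule g.cod.module)
    interpret Z: left_submodule S "g.cod.cocycle_module n" "g.cod.coboundaries n"
      by (rule g.cod.coboundary_submodule)
    interpret B: left_module S "B n" by (rule f.cod.module)
    interpret B': left_module S "B (n + 1)" by (rule f.cod.module)
    interpret A: left_module S "A (n + 1)" by (rule f.dom.module)
    \<comment> \<open>The cocycle \<open>y\<close> is itself a lift of its image, and its coboundary
      vanishes.\<close>
    have zero: "connecting n (g n y) \<zero>\<^bsub>A (n + 1)\<^esub>" if "y \<in> f.cod.cocycles n" for y
      using that g.map_cocycle[OF that]
      by (auto simp: connecting_def a_kernel_def' f.map_simps f.dom.d_simps)
    interpret \<delta>: quotient_correspondence S "g.cod.cocycle_module n" "g.cod.coboundaries n"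
      "f.dom.cocycle_module (n + 1)" "f.dom.coboundaries (n + 1)" "connecting n"
      by (rule connecting_correspondence)
    show "z \<in> f.dom.coboundaries (n + 1)" if yz: "g.graph n x y" "connecting n y z" for x y z
    proof -
      have y: "connecting n y \<zero>\<^bsub>A (n + 1)\<^esub>" using zero yz(1) by (simp add: g.graph_def)
      have "\<zero>\<^bsub>A (n + 1)\<^esub> \<in> f.dom.coboundaries (n + 1)" using A'.sub_zero by simp
      \<comment> \<open>The class attached to \<open>y\<close> can be computed from any related
        element. Computed from zero it is trivial, so every other related element is a
        coboundary.\<close>
      then have "\<delta>.induced (g.cod.coboundaries n +>\<^bsub>g.cod.cocycle_module n\<^esub> y) = f.dom.coboundaries (n + 1)"
        using y \<delta>.induced_eq_zero_iff by blast
      then show ?thesis using \<delta>.induced_eq_zero_iff[OF yz(2)] by blast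
    qed
    show "\<exists>x y'. g.graph n x y' \<and> z \<ominus>\<^bsub>g.cod.cocycle_module n\<^esub> y' \<in> g.cod.coboundaries n"
      if zx: "connecting n z x" "x \<in> f.dom.coboundaries (n + 1)" for z x
    proof -
      obtain y where y: "y \<in> carrier (B n)" "g n y = z" "f (n + 1) x = dB n y" and z: "z \<in> g.cod.cocycles n"
        using zx by (auto simp: connecting_def)
      obtain x' where x': "x' \<in> carrier (A n)" "x = dA n x'" using zx(2) by auto
      \<comment> \<open>Correcting the lift by \<open>f n x'\<close> turns it into a cocycle and
        does not change its image under \<open>g\<close>.\<close>
      let ?y = "y \<ominus>\<^bsub>B n\<^esub> f n x'"
      have fx': "f n x' \<in> carrier (B n)" using x' by (simp add: f.map_simps)
      have "dB n ?y = \<zero>\<^bsub>B (n + 1)\<^esub>"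
        using y x' fx' f.cod.d_simps(1)[OF y(1)] f.map_d[OF x'(1)]
        by (simp add: f.cod.d_simps B'.diff_eq_zero_iff)
      moreover have "g n ?y = z"
        using y x' fx' g.map_simps(1)[OF y(1)] by (simp add: g.map_simps g_f C.diff_zero)
      moreover have "z \<ominus>\<^bsub>g.cod.cocycle_module n\<^esub> z \<in> g.cod.coboundaries n"
        using z Z.sub_zero Z.diff_eq_zero_iff[of z z] by simp
      ultimately show ?thesis
        using y fx' by (intro exI[of _ ?y] exI[of _ z]) (auto simp: g.graph_def f.cod.cocycles_iff)
    qed
  qed
  have e3: "exact_at S (cohomology C dC n) (cohomology A dA (n + 1)) (cohomology B dB (n + 1)) (?\<delta> n) (?f (n + 1))" for n
    unfolding cohomology_def
  proof (rule quotient_correspondence_exact[OF connecting_correspondence f.graph_correspondence])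
    show "y \<in> f.cod.coboundaries (n + 1)" if "connecting n z x" "f.graph (n + 1) x y" for z x y
      using that by (auto simp: connecting_def f.graph_def)
    show "\<exists>z x'. connecting n z x' \<and> x \<ominus>\<^bsub>f.dom.cocycle_module (n + 1)\<^esub> x' \<in> f.dom.coboundaries (n + 1)"
      if xy: "f.graph (n + 1) x y" "y \<in> f.cod.coboundaries (n + 1)" for x y
    proof -
      interpret X: left_submodule S "f.dom.cocycle_module (n + 1)" "f.dom.coboundaries (n + 1)"
        by (rule f.dom.coboundary_submodule)
      have x: "x \<in> f.dom.cocycles (n + 1)" using xy by (simp add: f.graph_def)
      then have xA: "x \<in> carrier (A (n + 1))" using f.dom.cocycles_iff by blast
      \<comment> \<open>A primitive \<open>b\<close> of the image of \<open>x\<close> plays the part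
        of the lift in the zigzag: \<open>g n b\<close> is a cocycle because \<open>g\<close> kills
        the image of \<open>f\<close>, and it is connected to \<open>x\<close>.\<close>
      obtain b where b: "b \<in> carrier (B n)" "f (n + 1) x = dB n b"
        using xy by (auto simp: f.graph_def)
      have "dC n (g n b) = \<zero>\<^bsub>C (n + 1)\<^esub>"
        using b g_f[OF xA] by (simp flip: g.map_d)
      then have "connecting n (g n b) x"
        using b x g.map_simps(1)[OF b(1)] by (auto simp: connecting_def g.cod.cocycles_iff)
      moreover have "x \<ominus>\<^bsub>f.dom.cocycle_module (n + 1)\<^esub> x \<in> f.dom.coboundaries (n + 1)"
        using x X.sub_zero X.diff_eq_zero_iff[of x x] by simp
      ultimately show ?thesis by blast
    qed
  qed
  show ?thesis
    unfolding long_exact_sequence_def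
    by (intro exI[of _ ?f] exI[of _ ?g] exI[of _ ?\<delta>] allI conjI e1 e2 e3)
qed

end

text \<open>The isomorphisms may be chosen in each degree independently: the maps into and out of
  the third term are obtained by composing with \<open>h\<close> and with its inverse.\<close>

lemma long_exact_sequence_iso:
  assumes les: "long_exact_sequence S A B C"
    and iso: "\<And>n. \<exists>h. lmodule_hom S (C n) (D n) h \<and> bij_betw h (carrier (C n)) (carrier (D n))"
  shows "long_exact_sequence S A B D"
proof -
  obtain f g \<delta> where ex: "\<And>n. exact_at S (A n) (B n) (C n) (f n) (g n)"
      "\<And>n. exact_at S (B n) (C n) (A (n + 1)) (g n) (\<delta> n)"
      "\<And>n. exact_at S (C n) (A (n + 1)) (B (n + 1)) (\<delta> n) (f (n + 1))"
    using les unfolding long_exact_sequence_def by blast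
  obtain h where h: "\<And>n. lmodule_hom S (C n) (D n) (h n)"
      "\<And>n. bij_betw (h n) (carrier (C n)) (carrier (D n))"
    using iso by metis
  define k where "k n = inv_into (carrier (C n)) (h n)" for n
  have k: "k n (h n x) = x" if "x \<in> carrier (C n)" for n x
    using h(2)[of n] that by (simp add: k_def bij_betw_def)
  have D: "\<exists>x\<in>carrier (C n). y = h n x" if "y \<in> carrier (D n)" for n y
    using h(2)[of n] that by (auto simp: bij_betw_def)
  have hk: "k n y \<in> carrier (C n)" "h n (k n y) = y" if "y \<in> carrier (D n)" for n y
    using D[OF that] k by auto
  have k_hom: "lmodule_hom S (D n) (C n) (k n)" for n
    by (rule lmodule_hom_inverse[OF h(1)]) (fact hk k)+
  have h_zero: "h n x = \<zero>\<^bsub>D n\<^esub> \<longleftrightarrow> x = \<zero>\<^bsub>C n\<^esub>" if "x \<in> carrier (C n)" for n x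
    using that k[of x n] lmodule_hom_zero[OF h(1)[of n]] lmodule_hom_zero[OF k_hom[of n]] by metis
  have e1: "exact_at S (A n) (B n) (D n) (f n) (\<lambda>x. h n (g n x))" for n
    using ex(1)[of n] h_zero lmodule_homD(3)[of S "B n" "C n" "g n"]
    by (auto simp: exact_at_def a_kernel_def' lmodule_hom_comp[OF _ h(1)])
  have e2: "exact_at S (B n) (D n) (A (n + 1)) (\<lambda>x. h n (g n x)) (\<lambda>y. \<delta> n (k n y))" for n
  proof -
    have gh: "lmodule_hom S (B n) (C n) (g n)" "lmodule_hom S (C n) (A (n + 1)) (\<delta> n)"
      and im: "g n ` carrier (B n) = {x \<in> carrier (C n). \<delta> n x = \<zero>\<^bsub>A (n + 1)\<^esub>}"
      using ex(2)[of n] by (auto simp: exact_at_def a_kernel_def')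
    have "(\<lambda>x. h n (g n x)) ` carrier (B n) = h n ` {x \<in> carrier (C n). \<delta> n x = \<zero>\<^bsub>A (n + 1)\<^esub>}"
      by (simp flip: im add: image_image)
    also have "\<dots> = {y \<in> carrier (D n). \<delta> n (k n y) = \<zero>\<^bsub>A (n + 1)\<^esub>}"
      using hk[of _ n] k[of _ n] lmodule_homD(3)[OF h(1)[of n]] by (force simp: image_iff)
    finally show ?thesis
      using lmodule_hom_comp[OF gh(1) h(1)] lmodule_hom_comp[OF k_hom gh(2)]
      by (simp add: exact_at_def a_kernel_def')
  qed
  have e3: "exact_at S (D n) (A (n + 1)) (B (n + 1)) (\<lambda>y. \<delta> n (k n y)) (f (n + 1))" for n
  proof -
    have "(\<lambda>y. \<delta> n (k n y)) ` carrier (D n) = \<delta> n ` carrier (C n)"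
      using hk[of _ n] k[of _ n] lmodule_homD(3)[OF h(1)[of n]] by (force simp: image_iff)
    then show ?thesis
      using ex(3)[of n] lmodule_hom_comp[OF k_hom] by (auto simp: exact_at_def)
  qed
  show ?thesis
    unfolding long_exact_sequence_def
    by (intro exI[of _ f] exI[of _ "\<lambda>n x. h n (g n x)"] exI[of _ "\<lambda>n y. \<delta> n (k n y)"] allI conjI e1 e2 e3)
qed

section \<open>Resolutions and cochains\<close>

text \<open>The uniqueness half of the universal property of a free module.\<close>

lemma lmodule_hom_free_module_eq:
  assumes f: "lmodule_hom S (free_module S B) M f" and g: "lmodule_hom S (free_module S B) M g"
    and eq: "\<And>b. b \<in> B \<Longrightarrow> f (monomial S \<one>\<^bsub>S\<^esub> b) = g (monomial S \<one>\<^bsub>S\<^esub> b)"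
    and x: "x \<in> carrier (free_module S B)"
  shows "f x = g x"
proof -
  interpret M: left_module S M by (rule lmodule_homD(2)[OF f])
  note S = M.S.ring_axioms
  show ?thesis
    using S x
  proof (induction x rule: free_module_induct)
    case zero
    then show ?case using lmodule_hom_zero[OF f] lmodule_hom_zero[OF g] by simp
  next
    case (monomial s b)
    have "monomial S s b = s \<odot>\<^bsub>free_module S B\<^esub> monomial S \<one>\<^bsub>S\<^esub> b"
      using monomial by (auto simp: monomial_def)
    then show ?case
      using monomial lmodule_homD(5)[OF f] lmodule_homD(5)[OF g] eq
        monomial_closed[OF S M.S.one_closed monomial(2)]
      by metis
  next
    case (add x y)
    then show ?case using lmodule_homD(4)[OF f, of x y] lmodule_homD(4)[OF g, of x y] by simp
  qed
qed

text \<open>Projectivity without a quantifier over modules of all types. A free module over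
  \<open>RG\<close> becomes over \<open>RK\<close> isomorphic, but not equal, to a
  \<open>free_module\<close> record; being a retract covers this case as well.\<close>

definition retract_of_free ::
    "('s, 'c) ring_scheme \<Rightarrow> ('s, 'p, 'd) module_scheme \<Rightarrow> 'b set \<Rightarrow> ('p \<Rightarrow> 'b \<Rightarrow> 's) \<Rightarrow>
      (('b \<Rightarrow> 's) \<Rightarrow> 'p) \<Rightarrow> bool"
  where "retract_of_free S P B u v \<longleftrightarrow>
    lmodule_hom S P (free_module S B) u \<and> lmodule_hom S (free_module S B) P v \<and>
    (\<forall>x\<in>carrier P. v (u x) = x)"

text \<open>The values on the basis are lifted one by one and extended linearly, and the result is
  composed with the inclusion \<open>u\<close> of the retract.\<close>

lemma retract_of_free_lift:
  assumes P: "retract_of_free S P B u v" and p: "lmodule_hom S P Y p" and g: "lmodule_hom S X Y g"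
    and im: "\<And>x. x \<in> carrier P \<Longrightarrow> p x \<in> g ` carrier X"
  obtains q where "lmodule_hom S P X q" and "\<And>x. x \<in> carrier P \<Longrightarrow> g (q x) = p x"
proof -
  interpret X: left_module S X by (rule lmodule_homD(1)[OF g])
  note S = X.S.ring_axioms
  have u: "lmodule_hom S P (free_module S B) u" and v: "lmodule_hom S (free_module S B) P v"
    and vu: "\<And>x. x \<in> carrier P \<Longrightarrow> v (u x) = x"
    using P by (auto simp: retract_of_free_def)
  have "\<exists>w\<in>carrier X. g w = p (v (monomial S \<one>\<^bsub>S\<^esub> b))" if "b \<in> B" for b
    using im[OF lmodule_homD(3)[OF v monomial_closed[OF S X.S.one_closed that]]] by (metis imageE)
  then obtain w where w: "w \<in> B \<rightarrow> carrier X"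
    and gw: "\<And>b. b \<in> B \<Longrightarrow> g (w b) = p (v (monomial S \<one>\<^bsub>S\<^esub> b))"
    unfolding Pi_iff by metis
  note q = X.lin_ext_hom[OF w]
  have "g (lin_ext S X w x) = p (v x)" if "x \<in> carrier (free_module S B)" for x
  proof (rule lmodule_hom_free_module_eq[OF lmodule_hom_comp[OF q g] lmodule_hom_comp[OF v p] _ that])
    fix b assume b: "b \<in> B"
    then have "lin_ext S X w (monomial S \<one>\<^bsub>S\<^esub> b) = w b"
      using X.lin_ext_basis[of w b] w by (auto simp: monomial_def)
    then show "g (lin_ext S X w (monomial S \<one>\<^bsub>S\<^esub> b)) = p (v (monomial S \<one>\<^bsub>S\<^esub> b))"
      using gw[OF b] by simp
  qed
  then show ?thesis
    using that[OF lmodule_hom_comp[OF u q]] lmodule_homD(3)[OF u] vu by metis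
qed

text \<open>A single map \<open>d\<close> serves all degrees, as \<open>res_diff\<close> does. The
  complex is continued by zero to negative degrees, so that its Hom complexes are indexed by all
  integers as in \<open>Ext\<close>.\<close>

locale projective_resolution =
  fixes S :: "('s, 'c) ring_scheme" and P :: "int \<Rightarrow> ('s, 'p) module" and d :: "'p \<Rightarrow> 'p"
    and A :: "('s, 'a, 'e) module_scheme" and \<epsilon> :: "'p \<Rightarrow> 'a" and basis :: "int \<Rightarrow> 'b set"
  assumes d_hom: "lmodule_hom S (P n) (P (n - 1)) d"
    and d_d: "x \<in> carrier (P n) \<Longrightarrow> d (d x) = \<zero>\<^bsub>P (n - 1 - 1)\<^esub>"
    and d_nonpos: "\<lbrakk>x \<in> carrier (P n); n \<le> 0\<rbrakk> \<Longrightarrow> d x = \<zero>\<^bsub>P (n - 1)\<^esub>"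
    and trivial_neg: "\<lbrakk>x \<in> carrier (P n); n < 0\<rbrakk> \<Longrightarrow> x = \<zero>\<^bsub>P n\<^esub>"
    and \<epsilon>_hom: "lmodule_hom S (P 0) A \<epsilon>"
    and \<epsilon>_surj: "a \<in> carrier A \<Longrightarrow> \<exists>x\<in>carrier (P 0). \<epsilon> x = a"
    and \<epsilon>_d: "x \<in> carrier (P 1) \<Longrightarrow> \<epsilon> (d x) = \<zero>\<^bsub>A\<^esub>"
    and exact_zero: "\<lbrakk>x \<in> carrier (P 0); \<epsilon> x = \<zero>\<^bsub>A\<^esub>\<rbrakk> \<Longrightarrow> x \<in> d ` carrier (P 1)"
    and exact: "\<lbrakk>n > 0; x \<in> carrier (P n); d x = \<zero>\<^bsub>P (n - 1)\<^esub>\<rbrakk> \<Longrightarrow> x \<in> d ` carrier (P (n + 1))"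
    and projective: "\<exists>u v. retract_of_free S (P n) (basis n) u v"
begin

lemma module: "left_module S (P n)"
  by (rule lmodule_homD(1)[OF d_hom])

lemma module_target: "left_module S A"
  by (rule lmodule_homD(2)[OF \<epsilon>_hom])

lemma d_hom_Suc: "lmodule_hom S (P (n + 1)) (P n) d"
  using d_hom[of "n + 1"] by simp

lemma d_closed_Suc: "x \<in> carrier (P (n + 1)) \<Longrightarrow> d x \<in> carrier (P n)"
  by (rule lmodule_homD(3)[OF d_hom_Suc])

lemma d_d_Suc: "x \<in> carrier (P (n + 1)) \<Longrightarrow> d (d x) = \<zero>\<^bsub>P (n - 1)\<^esub>"
  using d_d[of x "n + 1"] by simp

lemma lift:
  assumes "lmodule_hom S (P n) Y p" and "lmodule_hom S X Y g"
    and "\<And>x. x \<in> carrier (P n) \<Longrightarrow> p x \<in> g ` carrier X"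
  obtains q where "lmodule_hom S (P n) X q" and "\<And>x. x \<in> carrier (P n) \<Longrightarrow> g (q x) = p x"
  using projective retract_of_free_lift[OF _ assms] by metis

end

lemma projective_resolution_resolution:
  fixes S :: "('s, 'c) ring_scheme" and A :: "('s, 'a) module"
  assumes A: "left_module S A"
  shows "projective_resolution S (resolution S A) (res_diff S) A (res_augmentation S A)
    (\<lambda>n. if n < 0 then {} else res_basis S A (nat n))"
proof -
  interpret A: left_module S A by fact
  note S = A.S.ring_axioms
  interpret U: left_module S "free_module S UNIV" by (rule left_module_free_module) (rule S)
  have mod: "left_module S (resolution S A n)" for n
    unfolding resolution_def by (rule left_module_free_module) (rule S)
  have zero: "\<zero>\<^bsub>resolution S A n\<^esub> = (\<lambda>_. \<zero>\<^bsub>S\<^esub>)" for n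
    by (simp add: resolution_def)
  \<comment> \<open>Elements of degree at most zero are supported on generators of the form
    \<open>Gen\<close>, and these the differential sends to zero.\<close>
  have nonpos: "res_diff S x = (\<lambda>_. \<zero>\<^bsub>S\<^esub>)" if "x \<in> carrier (resolution S A n)" "n \<le> 0" for x n
  proof -
    let ?B = "if n < 0 then {} else res_basis S A (nat n)"
    have x: "x \<in> carrier (free_module S ?B)" and B: "?B \<subseteq> range Gen"
      using that by (auto simp: resolution_def)
    have "x b \<in> carrier S" "x b \<noteq> \<zero>\<^bsub>S\<^esub> \<Longrightarrow> b \<in> range Gen" for b
    proof -
      show "x b \<in> carrier S" by (rule free_module_mem[OF S x])
      show "x b \<noteq> \<zero>\<^bsub>S\<^esub> \<Longrightarrow> b \<in> range Gen"
        using x B unfolding free_module_def by fastforce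
    qed
    then have "res_diff S x = (\<Oplus>\<^bsub>free_module S UNIV\<^esub>b\<in>{b. x b \<noteq> \<zero>\<^bsub>S\<^esub>}. \<zero>\<^bsub>free_module S UNIV\<^esub>)"
      unfolding res_diff_def lin_ext_def using U.M.zero_closed by (intro U.finsum_cong') (auto split: syzygy.split)
    also have "\<dots> = \<zero>\<^bsub>free_module S UNIV\<^esub>" by (rule U.M.finsum_zero)
    finally show ?thesis by simp
  qed
  note r = free_resolution[OF A]
  have hom: "lmodule_hom S (resolution S A n) (resolution S A (n - 1)) (res_diff S)" for n
  proof (cases "n > 0")
    case True
    then show ?thesis using r(3) r(4)[of n] by (auto simp: exact_at_def)
  next
    case False
    then show ?thesis
      using lmodule_hom_zero_map[OF mod[of n] mod[of "n - 1"]] nonpos[of _ n]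
      by (auto simp: zero elim!: lmodule_hom_cong)
  qed
  have ker: "res_diff S ` carrier (resolution S A (n + 1)) =
      {x \<in> carrier (resolution S A n). res_diff S x = \<zero>\<^bsub>resolution S A (n - 1)\<^esub>}" if "n > 0" for n
    using r(4)[OF that] by (simp add: exact_at_def a_kernel_def')
  have ker0: "res_diff S ` carrier (resolution S A 1) =
      {x \<in> carrier (resolution S A 0). res_augmentation S A x = \<zero>\<^bsub>A\<^esub>}"
    using r(3) by (simp add: exact_at_def a_kernel_def')
  show ?thesis
  proof
    show "lmodule_hom S (resolution S A n) (resolution S A (n - 1)) (res_diff S)" for n
      by (rule hom)
    show "res_diff S (res_diff S x) = \<zero>\<^bsub>resolution S A (n - 1 - 1)\<^esub>" if "x \<in> carrier (resolution S A n)" for n x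
    proof (cases "n > 1")
      case True
      then show ?thesis using ker[of "n - 1"] that by auto
    next
      case False
      then show ?thesis
        using lmodule_homD(3)[OF hom that] nonpos[of _ "n - 1"] by (simp add: zero)
    qed
    show "res_diff S x = \<zero>\<^bsub>resolution S A (n - 1)\<^esub>" if "x \<in> carrier (resolution S A n)" "n \<le> 0" for n x
      using nonpos that by (simp add: zero)
    show "x = \<zero>\<^bsub>resolution S A n\<^esub>" if "x \<in> carrier (resolution S A n)" "n < 0" for n x
      using that by (auto simp: resolution_def free_module_def)
    show "lmodule_hom S (resolution S A 0) A (res_augmentation S A)"
      by (rule r(1))
    show "a \<in> carrier A \<Longrightarrow> \<exists>x\<in>carrier (resolution S A 0). res_augmentation S A x = a" for a
      using r(2) by (metis imageE)
    show "x \<in> carrier (resolution S A 1) \<Longrightarrow> res_augmentation S A (res_diff S x) = \<zero>\<^bsub>A\<^esub>" for x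
      using ker0 by blast
    show "\<lbrakk>x \<in> carrier (resolution S A 0); res_augmentation S A x = \<zero>\<^bsub>A\<^esub>\<rbrakk> \<Longrightarrow>
        x \<in> res_diff S ` carrier (resolution S A 1)" for x
      using ker0 by blast
    show "\<lbrakk>n > 0; x \<in> carrier (resolution S A n); res_diff S x = \<zero>\<^bsub>resolution S A (n - 1)\<^esub>\<rbrakk> \<Longrightarrow>
        x \<in> res_diff S ` carrier (resolution S A (n + 1))" for n x
      using ker by blast
    have "lmodule_hom S (resolution S A n) (resolution S A n) (\<lambda>x. x)" for n
      by (rule lmodule_homI) (auto simp: mod)
    then have "retract_of_free S (resolution S A n) (if n < 0 then {} else res_basis S A (nat n)) (\<lambda>x. x) (\<lambda>x. x)" for n
      unfolding retract_of_free_def resolution_def by blast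
    then show "\<exists>u v. retract_of_free S (resolution S A n) (if n < 0 then {} else res_basis S A (nat n)) u v" for n
      by blast
  qed
qed

section \<open>Comparison of projective resolutions up to homotopy\<close>

locale projective_resolution_pair =
  P: projective_resolution S P dP A \<epsilon>P basisP + Q: projective_resolution S Q dQ B \<epsilon>Q basisQ
  for S :: "('s, 'c) ring_scheme" and P :: "int \<Rightarrow> ('s, 'p) module" and dP
    and A :: "('s, 'a, 'e) module_scheme" and \<epsilon>P and basisP :: "int \<Rightarrow> 'x set"
    and Q :: "int \<Rightarrow> ('s, 'q) module" and dQ
    and B :: "('s, 'b, 'f) module_scheme" and \<epsilon>Q and basisQ :: "int \<Rightarrow> 'y set"
begin

text \<open>The existence half of the comparison theorem. Each degree is one lift, by projectivity
  of \<open>P\<close>, into an image that is identified by exactness of \<open>Q\<close>.\<close>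

lemma chain_map_exists:
  assumes f: "lmodule_hom S A B f"
  shows "\<exists>\<theta>. (\<forall>n. lmodule_hom S (P n) (Q n) (\<theta> n)) \<and>
    (\<forall>n. \<forall>x\<in>carrier (P n). dQ (\<theta> n x) = \<theta> (n - 1) (dP x)) \<and>
    (\<forall>x\<in>carrier (P 0). \<epsilon>Q (\<theta> 0 x) = f (\<epsilon>P x))"
proof -
  \<comment> \<open>The invariant already contains the condition under which the next lift exists.
    The clause for degree zero keeps the compatibility with the augmentations through the
    recursion.\<close>
  define liftable where "liftable n t \<longleftrightarrow> lmodule_hom S (P n) (Q n) t \<and>
      (\<forall>x\<in>carrier (P (n + 1)). t (dP x) \<in> dQ ` carrier (Q (n + 1))) \<and>
      (n = 0 \<longrightarrow> (\<forall>x\<in>carrier (P 0). \<epsilon>Q (t x) = f (\<epsilon>P x)))" for n :: int and t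
  have start: "\<exists>t. liftable 0 t"
  proof -
    have "f (\<epsilon>P x) \<in> \<epsilon>Q ` carrier (Q 0)" if "x \<in> carrier (P 0)" for x
      using Q.\<epsilon>_surj[OF lmodule_homD(3)[OF f lmodule_homD(3)[OF P.\<epsilon>_hom that]]] by (metis imageI)
    then obtain t where t: "lmodule_hom S (P 0) (Q 0) t" "\<And>x. x \<in> carrier (P 0) \<Longrightarrow> \<epsilon>Q (t x) = f (\<epsilon>P x)"
      using P.lift[OF lmodule_hom_comp[OF P.\<epsilon>_hom f] Q.\<epsilon>_hom] by blast
    have "t (dP x) \<in> dQ ` carrier (Q 1)" if x: "x \<in> carrier (P 1)" for x
    proof -
      have dx: "dP x \<in> carrier (P 0)" using P.d_closed_Suc[of x 0] x by simp
      then have "\<epsilon>Q (t (dP x)) = \<zero>\<^bsub>B\<^esub>" using t P.\<epsilon>_d[OF x] lmodule_hom_zero[OF f] by simp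
      then show ?thesis by (rule Q.exact_zero[OF lmodule_homD(3)[OF t(1) dx]])
    qed
    then show ?thesis using t by (auto simp: liftable_def)
  qed
  have step: "\<exists>t'. liftable (n + 1) t' \<and> (\<forall>x\<in>carrier (P (n + 1)). dQ (t' x) = t (dP x))"
    if n: "n \<ge> 0" and t: "liftable n t" for n t
  proof -
    have hom: "lmodule_hom S (P n) (Q n) t" using t by (simp add: liftable_def)
    have "t (dP x) \<in> dQ ` carrier (Q (n + 1))" if "x \<in> carrier (P (n + 1))" for x
      using t that by (simp add: liftable_def)
    then obtain t' where t': "lmodule_hom S (P (n + 1)) (Q (n + 1)) t'"
        "\<And>x. x \<in> carrier (P (n + 1)) \<Longrightarrow> dQ (t' x) = t (dP x)"
      using P.lift[OF lmodule_hom_comp[OF P.d_hom_Suc hom] Q.d_hom_Suc] by blast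
    have "t' (dP x) \<in> dQ ` carrier (Q (n + 1 + 1))" if x: "x \<in> carrier (P (n + 1 + 1))" for x
    proof (rule Q.exact)
      show "t' (dP x) \<in> carrier (Q (n + 1))"
        by (intro lmodule_homD(3)[OF t'(1)] P.d_closed_Suc x)
      show "dQ (t' (dP x)) = \<zero>\<^bsub>Q (n + 1 - 1)\<^esub>"
        using t'(2)[OF P.d_closed_Suc[OF x]] P.d_d_Suc[OF x] lmodule_hom_zero[OF hom] by simp
    qed (use n in simp)
    then show ?thesis using t' n by (auto simp: liftable_def)
  qed
  \<comment> \<open>Each map depends on the choice made one degree lower, hence dependent choice
    over the naturals. Negative degrees receive zero maps afterwards.\<close>
  have "\<exists>\<theta>. \<forall>n. liftable (int n) (\<theta> n) \<and>
      (\<forall>x\<in>carrier (P (int n + 1)). dQ (\<theta> (Suc n) x) = \<theta> n (dP x))"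
  proof (rule dependent_nat_choice)
    show "\<exists>t. liftable (int 0) t" using start by simp
    show "\<exists>t'. liftable (int (Suc n)) t' \<and> (\<forall>x\<in>carrier (P (int n + 1)). dQ (t' x) = t (dP x))"
      if "liftable (int n) t" for n t
      using step[OF _ that] by (simp add: add.commute)
  qed
  then obtain \<theta> where \<theta>: "\<And>n. liftable (int n) (\<theta> n)"
      "\<And>n x. x \<in> carrier (P (int n + 1)) \<Longrightarrow> dQ (\<theta> (Suc n) x) = \<theta> n (dP x)"
    by blast
  define \<Theta> where "\<Theta> n = (if n < 0 then (\<lambda>_. \<zero>\<^bsub>Q n\<^esub>) else \<theta> (nat n))" for n :: int
  have hom: "lmodule_hom S (P n) (Q n) (\<Theta> n)" for n
    using \<theta>(1)[of "nat n"] lmodule_hom_zero_map[OF P.module[of n] Q.module[of n]]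
    by (cases "n < 0") (simp_all add: \<Theta>_def liftable_def)
  have "dQ (\<Theta> n x) = \<Theta> (n - 1) (dP x)" if x: "x \<in> carrier (P n)" for n x
  proof (cases "n > 0")
    case True
    define m where "m = nat (n - 1)"
    then have m: "n = int m + 1" using True by simp
    then show ?thesis using \<theta>(2)[of x m] x by (simp add: \<Theta>_def nat_add_distrib)
  next
    case False
    then show ?thesis
      using Q.d_nonpos[OF lmodule_homD(3)[OF hom x]] by (simp add: \<Theta>_def)
  qed
  moreover have "\<forall>x\<in>carrier (P 0). \<epsilon>Q (\<Theta> 0 x) = f (\<epsilon>P x)"
    using \<theta>(1)[of 0] by (simp add: \<Theta>_def liftable_def)
  ultimately show ?thesis using hom by blast
qed

text \<open>The uniqueness half of the comparison theorem, for lifts of the zero map. What the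
  homotopy constructed so far leaves unexplained is a cycle, hence a boundary, and lifting it gives
  the homotopy in the next degree.\<close>

lemma null_homotopic:
  assumes \<theta>: "\<And>n. lmodule_hom S (P n) (Q n) (\<theta> n)"
    and \<theta>_d: "\<And>n x. x \<in> carrier (P n) \<Longrightarrow> dQ (\<theta> n x) = \<theta> (n - 1) (dP x)"
    and \<theta>_\<epsilon>: "\<And>x. x \<in> carrier (P 0) \<Longrightarrow> \<epsilon>Q (\<theta> 0 x) = \<zero>\<^bsub>B\<^esub>"
  shows "\<exists>s. (\<forall>n. lmodule_hom S (P n) (Q (n + 1)) (s n)) \<and>
    (\<forall>n. \<forall>x\<in>carrier (P n). \<theta> n x = dQ (s n x) \<oplus>\<^bsub>Q n\<^esub> s (n - 1) (dP x))"
proof -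
  have \<theta>_d_Suc: "dQ (\<theta> (n + 1) x) = \<theta> n (dP x)" if "x \<in> carrier (P (n + 1))" for n x
    using \<theta>_d[OF that] by simp
  \<comment> \<open>The part of \<theta> in degree \<open>n + 1\<close> that the homotopy
    \<open>t\<close> in degree \<open>n\<close> does not account for. The next component of the
    homotopy has to have it as its boundary.\<close>
  define defect where "defect n t x = \<theta> (n + 1) x \<ominus>\<^bsub>Q (n + 1)\<^esub> t (dP x)" for n :: int and t x
  have defect_hom: "lmodule_hom S (P (n + 1)) (Q (n + 1)) (defect n t)"
    if "lmodule_hom S (P n) (Q (n + 1)) t" for n t
    unfolding defect_def by (intro lmodule_hom_minus \<theta> lmodule_hom_comp[OF P.d_hom_Suc that])
  define liftable where "liftable n t \<longleftrightarrow> lmodule_hom S (P n) (Q (n + 1)) t \<and>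
      (\<forall>x\<in>carrier (P (n + 1)). defect n t x \<in> dQ ` carrier (Q (n + 1 + 1))) \<and>
      (n = 0 \<longrightarrow> (\<forall>x\<in>carrier (P 0). dQ (t x) = \<theta> 0 x))" for n :: int and t
  have liftableI: "liftable n t"
    if n: "n \<ge> 0" and t: "lmodule_hom S (P n) (Q (n + 1)) t"
      and t_d: "\<And>x. x \<in> carrier (P (n + 1)) \<Longrightarrow> dQ (t (dP x)) = \<theta> n (dP x)"
      and t0: "n = 0 \<Longrightarrow> (\<forall>x\<in>carrier (P 0). dQ (t x) = \<theta> 0 x)" for n t
  proof -
    interpret Qn: left_module S "Q n" by (rule Q.module)
    have "defect n t x \<in> dQ ` carrier (Q (n + 1 + 1))" if x: "x \<in> carrier (P (n + 1))" for x
    proof (rule Q.exact)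
      show "defect n t x \<in> carrier (Q (n + 1))" by (rule lmodule_homD(3)[OF defect_hom[OF t] x])
      \<comment> \<open>The two terms cancel: \<open>dQ\<close> applied to \<theta> gives \<theta>
        after \<open>dP\<close>, as \<theta> is a chain map, and \<open>t_d\<close> gives the same
        value for the second term.\<close>
      have "dQ (defect n t x) = dQ (\<theta> (n + 1) x) \<ominus>\<^bsub>Q n\<^esub> dQ (t (dP x))"
        unfolding defect_def
        by (intro lmodule_hom_diff[OF Q.d_hom_Suc] lmodule_homD(3)[OF \<theta>] lmodule_homD(3)[OF t] x P.d_closed_Suc)
      then show "dQ (defect n t x) = \<zero>\<^bsub>Q (n + 1 - 1)\<^esub>"
        using x t_d \<theta>_d_Suc[OF x] lmodule_homD(3)[OF \<theta> P.d_closed_Suc[OF x]]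
        by (simp add: Qn.diff_eq_zero_iff)
    qed (use n in simp)
    then show ?thesis using t t0 by (simp add: liftable_def)
  qed
  have start: "\<exists>t. liftable 0 t"
  proof -
    have "\<theta> 0 x \<in> dQ ` carrier (Q 1)" if "x \<in> carrier (P 0)" for x
      by (rule Q.exact_zero[OF lmodule_homD(3)[OF \<theta> that] \<theta>_\<epsilon>[OF that]])
    then obtain t where "lmodule_hom S (P 0) (Q 1) t" "\<And>x. x \<in> carrier (P 0) \<Longrightarrow> dQ (t x) = \<theta> 0 x"
      using P.lift[OF \<theta>[of 0] Q.d_hom_Suc[of 0]] by auto
    then show ?thesis using P.d_closed_Suc[of _ 0] by (intro exI[of _ t] liftableI) auto
  qed
  have step: "\<exists>t'. liftable (n + 1) t' \<and> (\<forall>x\<in>carrier (P (n + 1)). dQ (t' x) = defect n t x)"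
    if n: "n \<ge> 0" and t: "liftable n t" for n t
  proof -
    interpret Q': left_module S "Q (n + 1)" by (rule Q.module)
    have hom: "lmodule_hom S (P n) (Q (n + 1)) t" using t by (simp add: liftable_def)
    have "defect n t x \<in> dQ ` carrier (Q (n + 1 + 1))" if "x \<in> carrier (P (n + 1))" for x
      using t that unfolding liftable_def by blast
    then obtain t' where t': "lmodule_hom S (P (n + 1)) (Q (n + 1 + 1)) t'"
        "\<And>x. x \<in> carrier (P (n + 1)) \<Longrightarrow> dQ (t' x) = defect n t x"
      using P.lift[OF defect_hom[OF hom] Q.d_hom_Suc] by blast
    have "dQ (t' (dP x)) = \<theta> (n + 1) (dP x)" if x: "x \<in> carrier (P (n + 1 + 1))" for x
    proof -
      have dx: "dP x \<in> carrier (P (n + 1))" by (rule P.d_closed_Suc[OF x])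
      have "t (dP (dP x)) = \<zero>\<^bsub>Q (n + 1)\<^esub>"
        using P.d_d_Suc[OF x] lmodule_hom_zero[OF hom] by simp
      then show ?thesis
        using t'(2)[OF dx] lmodule_homD(3)[OF \<theta> dx] by (simp add: defect_def Q'.diff_zero)
    qed
    then have "liftable (n + 1) t'" using n t'(1) by (intro liftableI) auto
    then show ?thesis using t'(2) by blast
  qed
  have "\<exists>s. \<forall>n. liftable (int n) (s n) \<and>
      (\<forall>x\<in>carrier (P (int n + 1)). dQ (s (Suc n) x) = defect (int n) (s n) x)"
  proof (rule dependent_nat_choice)
    show "\<exists>t. liftable (int 0) t" using start by simp
    show "\<exists>t'. liftable (int (Suc n)) t' \<and> (\<forall>x\<in>carrier (P (int n + 1)). dQ (t' x) = defect (int n) t x)"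
      if "liftable (int n) t" for n t
      using step[OF _ that] by (simp add: add.commute)
  qed
  then obtain s where s: "\<And>n. liftable (int n) (s n)"
      "\<And>n x. x \<in> carrier (P (int n + 1)) \<Longrightarrow> dQ (s (Suc n) x) = defect (int n) (s n) x"
    by blast
  define \<sigma> where "\<sigma> n = (if n < 0 then (\<lambda>_. \<zero>\<^bsub>Q (n + 1)\<^esub>) else s (nat n))" for n :: int
  have hom: "lmodule_hom S (P n) (Q (n + 1)) (\<sigma> n)" for n
    using s(1)[of "nat n"] lmodule_hom_zero_map[OF P.module[of n] Q.module[of "n + 1"]]
    by (cases "n < 0") (simp_all add: \<sigma>_def liftable_def)
  have "\<theta> n x = dQ (\<sigma> n x) \<oplus>\<^bsub>Q n\<^esub> \<sigma> (n - 1) (dP x)" if x: "x \<in> carrier (P n)" for n x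
  proof -
    interpret Q: left_module S "Q n" by (rule Q.module)
    interpret P: left_module S "P n" by (rule P.module)
    have \<theta>x: "\<theta> n x \<in> carrier (Q n)" by (rule lmodule_homD(3)[OF \<theta> x])
    consider "n < 0" | "n = 0" | "n > 0" by linarith
    then show ?thesis
    proof cases
      case 1
      then have "\<theta> n x = \<zero>\<^bsub>Q n\<^esub>" using P.trivial_neg[OF x] lmodule_hom_zero[OF \<theta>] by simp
      then show ?thesis using 1 lmodule_hom_zero[OF Q.d_hom_Suc[of n]] by (simp add: \<sigma>_def)
    next
      case 2
      then show ?thesis using x \<theta>x s(1)[of 0] Q.M.r_zero[OF \<theta>x] by (simp add: \<sigma>_def liftable_def)
    next
      case 3
      define m where "m = nat (n - 1)"
      then have m: "n = int m + 1" "nat n = Suc m" "nat (n - 1) = m" using 3 by auto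
      have sdx: "s m (dP x) \<in> carrier (Q n)"
        using lmodule_homD(3)[OF hom[of "n - 1"] lmodule_homD(3)[OF P.d_hom x]] 3 m(3) by (simp add: \<sigma>_def)
      then show ?thesis
        using s(2)[of x m] x Q.diff_add_cancel[OF \<theta>x sdx] 3 m by (simp add: \<sigma>_def defect_def)
    qed
  qed
  then show ?thesis using hom by blast
qed

end

lemma projective_resolution_id:
  assumes "projective_resolution S P d A \<epsilon> basis"
  shows "lmodule_hom S (P n) (P n) (\<lambda>x. x)"
  using projective_resolution.module[OF assms, of n] by (intro lmodule_homI) auto

text \<open>The identity minus the round trip covers zero on \<open>A\<close>, so
  \<open>null_homotopic\<close> applies with \<open>P\<close> in both roles. The result is used
  twice, with the two resolutions exchanged.\<close>

lemma homotopy_of_lifts: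
  assumes P: "projective_resolution_pair S P dP A \<epsilon>P basisP Q dQ B \<epsilon>Q basisQ"
    and \<theta>: "\<And>n. lmodule_hom S (P n) (Q n) (\<theta> n)" "\<And>n x. x \<in> carrier (P n) \<Longrightarrow> dQ (\<theta> n x) = \<theta> (n - 1) (dP x)"
    and \<eta>: "\<And>n. lmodule_hom S (Q n) (P n) (\<eta> n)" "\<And>n x. x \<in> carrier (Q n) \<Longrightarrow> dP (\<eta> n x) = \<eta> (n - 1) (dQ x)"
    and \<epsilon>: "\<And>x. x \<in> carrier (P 0) \<Longrightarrow> \<epsilon>P (\<eta> 0 (\<theta> 0 x)) = \<epsilon>P x"
  shows "\<exists>s. (\<forall>n. lmodule_hom S (P n) (P (n + 1)) (s n)) \<and>
    (\<forall>n. \<forall>x\<in>carrier (P n). x \<ominus>\<^bsub>P n\<^esub> \<eta> n (\<theta> n x) = dP (s n x) \<oplus>\<^bsub>P n\<^esub> s (n - 1) (dP x))"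
proof -
  interpret projective_resolution_pair S P dP A \<epsilon>P basisP Q dQ B \<epsilon>Q basisQ by fact
  interpret PP: projective_resolution_pair S P dP A \<epsilon>P basisP P dP A \<epsilon>P basisP
    by unfold_locales
  interpret A: left_module S A by (rule P.module_target)
  let ?h = "\<lambda>n x. x \<ominus>\<^bsub>P n\<^esub> \<eta> n (\<theta> n x)"
  note comp = lmodule_hom_comp[OF \<theta>(1) \<eta>(1)]
  have c: "\<eta> n (\<theta> n x) \<in> carrier (P n)" if "x \<in> carrier (P n)" for n x
    by (rule lmodule_homD(3)[OF comp that])
  show ?thesis
  proof (rule PP.null_homotopic)
    show "lmodule_hom S (P n) (P n) (?h n)" for n
      by (intro lmodule_hom_minus projective_resolution_id[OF P.projective_resolution_axioms] comp)
    show "dP (?h n x) = ?h (n - 1) (dP x)" if x: "x \<in> carrier (P n)" for n x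
      using lmodule_hom_diff[OF P.d_hom x c[OF x]] \<eta>(2)[OF lmodule_homD(3)[OF \<theta>(1) x]] \<theta>(2)[OF x] by simp
    show "\<epsilon>P (?h 0 x) = \<zero>\<^bsub>A\<^esub>" if x: "x \<in> carrier (P 0)" for x
      using lmodule_hom_diff[OF P.\<epsilon>_hom x c[OF x]] \<epsilon>[OF x] lmodule_homD(3)[OF P.\<epsilon>_hom x]
      by (simp add: A.diff_eq_zero_iff)
  qed
qed

section \<open>Complexes of homomorphisms and their second module structure\<close>

definition with_action :: "('m, 'e) ring_scheme \<Rightarrow> ('t \<Rightarrow> 'm \<Rightarrow> 'm) \<Rightarrow> ('t, 'm) module"
  where "with_action M \<alpha> =
    \<lparr>carrier = carrier M, mult = undefined, one = undefined, zero = \<zero>\<^bsub>M\<^esub>, add = add M, smult = \<alpha>\<rparr>"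

lemma with_action_simps [simp]:
  "carrier (with_action M \<alpha>) = carrier M" "\<zero>\<^bsub>with_action M \<alpha>\<^esub> = \<zero>\<^bsub>M\<^esub>"
  "x \<oplus>\<^bsub>with_action M \<alpha>\<^esub> y = x \<oplus>\<^bsub>M\<^esub> y" "t \<odot>\<^bsub>with_action M \<alpha>\<^esub> x = \<alpha> t x"
  by (simp_all add: with_action_def)

text \<open>A bimodule with both structures written on the left. Commutation makes each
  \<open>\<alpha> t\<close> an \<open>S\<close>-linear endomorphism, so that \<open>T\<close> acts
  on \<open>S\<close>-linear maps into \<open>M\<close> by composition; \<open>with_action\<close>
  packages the second structure as a module record.\<close>

locale commuting_action =
  M: left_module S M + act: left_module T "with_action M \<alpha>"
  for S :: "('s, 'c) ring_scheme" and M :: "('s, 'm, 'e) module_scheme"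
    and T :: "('t, 'h) ring_scheme" and \<alpha> :: "'t \<Rightarrow> 'm \<Rightarrow> 'm" +
  assumes commute: "\<lbrakk>a \<in> carrier S; t \<in> carrier T; x \<in> carrier M\<rbrakk> \<Longrightarrow> \<alpha> t (a \<odot>\<^bsub>M\<^esub> x) = a \<odot>\<^bsub>M\<^esub> \<alpha> t x"
begin

lemmas act_simps =
  act.smult_closed[simplified] act.smult_l_distr[simplified] act.smult_r_distr[simplified]
  act.smult_assoc[simplified] act.smult_one[simplified]

lemma action_hom: "t \<in> carrier T \<Longrightarrow> lmodule_hom S M M (\<alpha> t)"
  by (intro lmodule_homI M.left_module_axioms) (simp_all add: act_simps commute)

end

lemma hom_module_simps:
  "f \<in> carrier (hom_module S P M \<alpha>) \<longleftrightarrow> f \<in> extensional (carrier P) \<and> lmodule_hom S P M f"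
  "\<zero>\<^bsub>hom_module S P M \<alpha>\<^esub> = (\<lambda>x\<in>carrier P. \<zero>\<^bsub>M\<^esub>)"
  "f \<oplus>\<^bsub>hom_module S P M \<alpha>\<^esub> g = (\<lambda>x\<in>carrier P. f x \<oplus>\<^bsub>M\<^esub> g x)"
  "t \<odot>\<^bsub>hom_module S P M \<alpha>\<^esub> f = (\<lambda>x\<in>carrier P. \<alpha> t (f x))"
  by (simp_all add: hom_module_def)

lemma restrict_in_hom_module:
  "lmodule_hom S P M f \<Longrightarrow> restrict f (carrier P) \<in> carrier (hom_module S P M \<alpha>)"
  by (auto simp: hom_module_simps elim: lmodule_hom_cong)

lemma hom_module_eqI:
  assumes "f \<in> carrier (hom_module S P M \<alpha>)" "g \<in> carrier (hom_module S P M \<alpha>)"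
    and "\<And>x. x \<in> carrier P \<Longrightarrow> f x = g x"
  shows "f = g"
  using assms by (intro extensionalityI[of _ "carrier P"]) (auto simp: hom_module_simps)

lemma left_module_hom_module:
  assumes P: "left_module S P" and "commuting_action S M T \<alpha>"
  shows "left_module T (hom_module S P M \<alpha>)"
proof -
  interpret P: left_module S P by fact
  interpret commuting_action S M T \<alpha> by fact
  have val: "f x \<in> carrier M" if "f \<in> carrier (hom_module S P M \<alpha>)" "x \<in> carrier P" for f x
    using that lmodule_homD(3)[of S P M f] by (simp add: hom_module_simps)
  show ?thesis
  proof (rule left_moduleI)
    show "f \<oplus>\<^bsub>hom_module S P M \<alpha>\<^esub> g \<in> carrier (hom_module S P M \<alpha>)"
      if "f \<in> carrier (hom_module S P M \<alpha>)" "g \<in> carrier (hom_module S P M \<alpha>)" for f g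
      unfolding hom_module_simps(3)
      by (intro restrict_in_hom_module lmodule_hom_add) (use that in \<open>auto simp: hom_module_simps\<close>)
    show "\<zero>\<^bsub>hom_module S P M \<alpha>\<^esub> \<in> carrier (hom_module S P M \<alpha>)"
      unfolding hom_module_simps(2)
      by (intro restrict_in_hom_module lmodule_hom_zero_map P.left_module_axioms M.left_module_axioms)
    show "t \<odot>\<^bsub>hom_module S P M \<alpha>\<^esub> f \<in> carrier (hom_module S P M \<alpha>)"
      if "t \<in> carrier T" "f \<in> carrier (hom_module S P M \<alpha>)" for t f
      unfolding hom_module_simps(4)
      by (intro restrict_in_hom_module lmodule_hom_comp[OF _ action_hom])
         (use that in \<open>auto simp: hom_module_simps\<close>)
    show "\<exists>g\<in>carrier (hom_module S P M \<alpha>). g \<oplus>\<^bsub>hom_module S P M \<alpha>\<^esub> f = \<zero>\<^bsub>hom_module S P M \<alpha>\<^esub>"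
      if f: "f \<in> carrier (hom_module S P M \<alpha>)" for f
    proof (rule bexI)
      let ?g = "\<lambda>x\<in>carrier P. \<zero>\<^bsub>M\<^esub> \<ominus>\<^bsub>M\<^esub> f x"
      show "?g \<in> carrier (hom_module S P M \<alpha>)"
        by (intro restrict_in_hom_module lmodule_hom_minus lmodule_hom_zero_map P.left_module_axioms
            M.left_module_axioms) (use f in \<open>auto simp: hom_module_simps\<close>)
      show "?g \<oplus>\<^bsub>hom_module S P M \<alpha>\<^esub> f = \<zero>\<^bsub>hom_module S P M \<alpha>\<^esub>"
        using val[OF f] by (auto simp: hom_module_simps M.diff_add_cancel)
    qed
    show "\<zero>\<^bsub>hom_module S P M \<alpha>\<^esub> \<oplus>\<^bsub>hom_module S P M \<alpha>\<^esub> f = f"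
      if f: "f \<in> carrier (hom_module S P M \<alpha>)" for f
      using f val[OF f] by (auto simp: hom_module_simps fun_eq_iff extensional_def)
    show "\<one>\<^bsub>T\<^esub> \<odot>\<^bsub>hom_module S P M \<alpha>\<^esub> f = f"
      if f: "f \<in> carrier (hom_module S P M \<alpha>)" for f
      using f val[OF f] act_simps(5) by (auto simp: hom_module_simps fun_eq_iff extensional_def)
  qed (use val in \<open>auto simp: hom_module_simps fun_eq_iff M.M.a_ac act_simps act.S.ring_axioms\<close>)
qed

definition hom_coboundary ::
    "(int \<Rightarrow> ('s, 'p) module) \<Rightarrow> ('p \<Rightarrow> 'p) \<Rightarrow> int \<Rightarrow> ('p \<Rightarrow> 'm) \<Rightarrow> 'p \<Rightarrow> 'm"
  where "hom_coboundary P d n f = restrict (f \<circ> d) (carrier (P (n + 1)))"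

lemma coboundary_eq_hom_coboundary: "coboundary S A = hom_coboundary (resolution S A) (res_diff S)"
  by (simp add: fun_eq_iff coboundary_def hom_coboundary_def)

lemma Ext_eq_cohomology:
  "Ext S A M \<alpha> = cohomology (\<lambda>n. hom_module S (resolution S A n) M \<alpha>)
    (hom_coboundary (resolution S A) (res_diff S))"
  by (intro ext) (simp add: Ext_def cohomology_def cochains_def coboundary_eq_hom_coboundary)

context projective_resolution
begin

lemma hom_coboundary_hom:
  assumes "lmodule_hom S (P n) M f"
  shows "lmodule_hom S (P (n + 1)) M (\<lambda>x. f (d x))"
  by (rule lmodule_hom_comp[OF d_hom_Suc assms])

lemma cochain_complex_hom:
  assumes M: "commuting_action S M T \<alpha>"
  shows "cochain_complex T (\<lambda>n. hom_module S (P n) M \<alpha>) (hom_coboundary P d)"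
proof
  interpret commuting_action S M T \<alpha> by fact
  let ?C = "\<lambda>n. hom_module S (P n) M \<alpha>"
  have closed: "hom_coboundary P d n f \<in> carrier (?C (n + 1))" if "f \<in> carrier (?C n)" for n f
    using that unfolding hom_coboundary_def comp_def
    by (intro restrict_in_hom_module hom_coboundary_hom) (simp add: hom_module_simps)
  show "lmodule_hom T (?C n) (?C (n + 1)) (hom_coboundary P d n)" for n
  proof (rule lmodule_homI)
    show "left_module T (?C n)" "left_module T (?C (n + 1))"
      by (rule left_module_hom_module[OF module M])+
  qed (use closed d_closed_Suc[of _ n] in \<open>auto simp: hom_coboundary_def hom_module_simps\<close>)
  show "hom_coboundary P d (n + 1) (hom_coboundary P d n f) = \<zero>\<^bsub>?C (n + 1 + 1)\<^esub>"
    if f: "f \<in> carrier (?C n)" for n f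
  proof -
    have "f \<zero>\<^bsub>P n\<^esub> = \<zero>\<^bsub>M\<^esub>"
      using f lmodule_hom_zero[of S "P n" M f] by (simp add: hom_module_simps)
    then show ?thesis
      using d_closed_Suc[of _ "n + 1"] d_d_Suc[of _ "n + 1"]
      by (auto simp: hom_coboundary_def hom_module_simps fun_eq_iff add.assoc[symmetric] simp del: add.assoc)
  qed
qed

lemma cochain_map_postcompose:
  assumes M: "commuting_action S M T \<alpha>" and N: "commuting_action S N T \<beta>"
    and f: "lmodule_hom S M N f"
    and equivariant: "\<And>t x. \<lbrakk>t \<in> carrier T; x \<in> carrier M\<rbrakk> \<Longrightarrow> f (\<alpha> t x) = \<beta> t (f x)"
  shows "cochain_map T (\<lambda>n. hom_module S (P n) M \<alpha>) (hom_coboundary P d)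
    (\<lambda>n. hom_module S (P n) N \<beta>) (hom_coboundary P d) (\<lambda>n \<phi>. restrict (f \<circ> \<phi>) (carrier (P n)))"
proof -
  interpret M: cochain_complex T "\<lambda>n. hom_module S (P n) M \<alpha>" "hom_coboundary P d"
    by (rule cochain_complex_hom[OF M])
  interpret N: cochain_complex T "\<lambda>n. hom_module S (P n) N \<beta>" "hom_coboundary P d"
    by (rule cochain_complex_hom[OF N])
  let ?f = "\<lambda>n \<phi>. restrict (f \<circ> \<phi>) (carrier (P n))"
  show ?thesis
  proof
    show "lmodule_hom T (hom_module S (P n) M \<alpha>) (hom_module S (P n) N \<beta>) (?f n)" for n
    proof (rule lmodule_homI)
      interpret P: left_module S "P n" by (rule module)
      show "?f n \<phi> \<in> carrier (hom_module S (P n) N \<beta>)" if "\<phi> \<in> carrier (hom_module S (P n) M \<alpha>)" for \<phi>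
        using that unfolding comp_def
        by (intro restrict_in_hom_module lmodule_hom_comp[OF _ f]) (simp add: hom_module_simps)
      fix \<phi> assume \<phi>: "\<phi> \<in> carrier (hom_module S (P n) M \<alpha>)"
      have val: "\<phi> x \<in> carrier M" if "\<phi> \<in> carrier (hom_module S (P n) M \<alpha>)" "x \<in> carrier (P n)" for \<phi> x
        using that lmodule_homD(3)[of S "P n" M \<phi>] by (simp add: hom_module_simps)
      show "?f n (a \<odot>\<^bsub>hom_module S (P n) M \<alpha>\<^esub> \<phi>) = a \<odot>\<^bsub>hom_module S (P n) N \<beta>\<^esub> ?f n \<phi>"
        if "a \<in> carrier T" for a
        using that val[OF \<phi>] by (auto simp: hom_module_simps equivariant)
      fix \<psi> assume \<psi>: "\<psi> \<in> carrier (hom_module S (P n) M \<alpha>)"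
      show "?f n (\<phi> \<oplus>\<^bsub>hom_module S (P n) M \<alpha>\<^esub> \<psi>) = ?f n \<phi> \<oplus>\<^bsub>hom_module S (P n) N \<beta>\<^esub> ?f n \<psi>"
        using val[OF \<phi>] val[OF \<psi>] by (auto simp: hom_module_simps lmodule_homD(4)[OF f])
    qed (fact M.module N.module)+
    show "?f (n + 1) (hom_coboundary P d n \<phi>) = hom_coboundary P d n (?f n \<phi>)" for n \<phi>
      using d_closed_Suc[of _ n] by (auto simp: hom_coboundary_def)
  qed
qed

text \<open>Homomorphisms out of a projective module preserve short exact sequences, so each degree
  of the Hom complexes is short exact. Projectivity is used twice: to lift along the surjection
  \<open>g\<close>, and to lift a map with values in the kernel of \<open>g\<close> through
  \<open>f\<close>.\<close>

lemma long_exact_sequence_hom: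
  assumes M1: "commuting_action S M1 T \<alpha>1" and M2: "commuting_action S M2 T \<alpha>2"
    and M3: "commuting_action S M3 T \<alpha>3"
    and f: "lmodule_hom S M1 M2 f" and g: "lmodule_hom S M2 M3 g"
    and f_eq: "\<And>t x. \<lbrakk>t \<in> carrier T; x \<in> carrier M1\<rbrakk> \<Longrightarrow> f (\<alpha>1 t x) = \<alpha>2 t (f x)"
    and g_eq: "\<And>t x. \<lbrakk>t \<in> carrier T; x \<in> carrier M2\<rbrakk> \<Longrightarrow> g (\<alpha>2 t x) = \<alpha>3 t (g x)"
    and inj: "\<And>x. \<lbrakk>x \<in> carrier M1; f x = \<zero>\<^bsub>M2\<^esub>\<rbrakk> \<Longrightarrow> x = \<zero>\<^bsub>M1\<^esub>"
    and gf: "\<And>x. x \<in> carrier M1 \<Longrightarrow> g (f x) = \<zero>\<^bsub>M3\<^esub>"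
    and ker: "\<And>y. \<lbrakk>y \<in> carrier M2; g y = \<zero>\<^bsub>M3\<^esub>\<rbrakk> \<Longrightarrow> y \<in> f ` carrier M1"
    and surj: "\<And>z. z \<in> carrier M3 \<Longrightarrow> z \<in> g ` carrier M2"
  shows "long_exact_sequence T (cohomology (\<lambda>n. hom_module S (P n) M1 \<alpha>1) (hom_coboundary P d))
    (cohomology (\<lambda>n. hom_module S (P n) M2 \<alpha>2) (hom_coboundary P d))
    (cohomology (\<lambda>n. hom_module S (P n) M3 \<alpha>3) (hom_coboundary P d))"
proof -
  interpret F: cochain_map T "\<lambda>n. hom_module S (P n) M1 \<alpha>1" "hom_coboundary P d"
    "\<lambda>n. hom_module S (P n) M2 \<alpha>2" "hom_coboundary P d" "\<lambda>n \<phi>. restrict (f \<circ> \<phi>) (carrier (P n))"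
    by (rule cochain_map_postcompose) (use M1 M2 f f_eq in blast)+
  interpret G: cochain_map T "\<lambda>n. hom_module S (P n) M2 \<alpha>2" "hom_coboundary P d"
    "\<lambda>n. hom_module S (P n) M3 \<alpha>3" "hom_coboundary P d" "\<lambda>n \<phi>. restrict (g \<circ> \<phi>) (carrier (P n))"
    by (rule cochain_map_postcompose) (use M2 M3 g g_eq in blast)+
  interpret short_exact_sequence_of_complexes T "\<lambda>n. hom_module S (P n) M1 \<alpha>1" "hom_coboundary P d"
    "\<lambda>n. hom_module S (P n) M2 \<alpha>2" "hom_coboundary P d" "\<lambda>n. hom_module S (P n) M3 \<alpha>3" "hom_coboundary P d"
    "\<lambda>n \<phi>. restrict (f \<circ> \<phi>) (carrier (P n))" "\<lambda>n \<phi>. restrict (g \<circ> \<phi>) (carrier (P n))"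
  proof
    fix n and \<phi> assume \<phi>: "\<phi> \<in> carrier (hom_module S (P n) M1 \<alpha>1)"
    have val: "\<phi> x \<in> carrier M1" if "x \<in> carrier (P n)" for x
      using that \<phi> lmodule_homD(3)[of S "P n" M1 \<phi>] by (simp add: hom_module_simps)
    show "restrict (g \<circ> restrict (f \<circ> \<phi>) (carrier (P n))) (carrier (P n)) = \<zero>\<^bsub>hom_module S (P n) M3 \<alpha>3\<^esub>"
      using val gf by (auto simp: hom_module_simps)
    assume 0: "restrict (f \<circ> \<phi>) (carrier (P n)) = \<zero>\<^bsub>hom_module S (P n) M2 \<alpha>2\<^esub>"
    have "\<phi> x = \<zero>\<^bsub>M1\<^esub>" if "x \<in> carrier (P n)" for x
      using fun_cong[OF 0, of x] that val inj by (simp add: hom_module_simps)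
    then show "\<phi> = \<zero>\<^bsub>hom_module S (P n) M1 \<alpha>1\<^esub>"
      using \<phi> by (auto simp: hom_module_simps fun_eq_iff extensional_def)
  next
    fix n and \<phi> assume \<phi>: "\<phi> \<in> carrier (hom_module S (P n) M2 \<alpha>2)"
      and 0: "restrict (g \<circ> \<phi>) (carrier (P n)) = \<zero>\<^bsub>hom_module S (P n) M3 \<alpha>3\<^esub>"
    have hom: "lmodule_hom S (P n) M2 \<phi>" using \<phi> by (simp add: hom_module_simps)
    have "\<phi> x \<in> f ` carrier M1" if x: "x \<in> carrier (P n)" for x
      using fun_cong[OF 0, of x] x lmodule_homD(3)[OF hom x] ker by (simp add: hom_module_simps)
    then obtain \<psi> where \<psi>: "lmodule_hom S (P n) M1 \<psi>" "\<And>x. x \<in> carrier (P n) \<Longrightarrow> f (\<psi> x) = \<phi> x"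
      using lift[OF hom f] by blast
    then have "restrict (f \<circ> restrict \<psi> (carrier (P n))) (carrier (P n)) = \<phi>"
      using \<phi> by (auto simp: hom_module_simps fun_eq_iff extensional_def)
    then show "\<exists>\<psi>\<in>carrier (hom_module S (P n) M1 \<alpha>1). restrict (f \<circ> \<psi>) (carrier (P n)) = \<phi>"
      using restrict_in_hom_module[OF \<psi>(1)] by blast
  next
    fix n and \<phi> assume \<phi>: "\<phi> \<in> carrier (hom_module S (P n) M3 \<alpha>3)"
    then have hom: "lmodule_hom S (P n) M3 \<phi>" by (simp add: hom_module_simps)
    then obtain \<psi> where \<psi>: "lmodule_hom S (P n) M2 \<psi>" "\<And>x. x \<in> carrier (P n) \<Longrightarrow> g (\<psi> x) = \<phi> x"
      using lift[OF hom g] surj lmodule_homD(3)[OF hom] by blast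
    then have "restrict (g \<circ> restrict \<psi> (carrier (P n))) (carrier (P n)) = \<phi>"
      using \<phi> by (auto simp: hom_module_simps fun_eq_iff extensional_def)
    then show "\<exists>\<psi>\<in>carrier (hom_module S (P n) M2 \<alpha>2). restrict (g \<circ> \<psi>) (carrier (P n)) = \<phi>"
      using restrict_in_hom_module[OF \<psi>(1)] by blast
  qed
  show ?thesis by (rule long_exact_cohomology_sequence)
qed

end

text \<open>
  Shapiro's lemma: \<open>L\<close> is coinduced from the \<open>S\<close>-module \<open>D\<close> along \<open>S \<subseteq> S\<^sub>0\<close>, as far as maps from
  the resolution \<open>P\<close> can tell.
\<close>

locale coinduction_setting =
  P0: projective_resolution S0 P d A0 \<epsilon>0 basis0 +
  projective_resolution_pair S P d A \<epsilon>P basisP Q dQ B \<epsilon>Q basisQ +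
  L: commuting_action S0 L T \<alpha> + D: commuting_action S D T \<beta>
  for S0 :: "('s, 'c) ring_scheme" and P :: "int \<Rightarrow> ('s, 'p) module" and d
    and A0 :: "('s, 'a0, 'e0) module_scheme" and \<epsilon>0 and basis0 :: "int \<Rightarrow> 'z set"
    and S :: "('s, 'c) ring_scheme"
    and A :: "('s, 'a, 'e) module_scheme" and \<epsilon>P and basisP :: "int \<Rightarrow> 'x set"
    and Q :: "int \<Rightarrow> ('s, 'q) module" and dQ
    and B :: "('s, 'b, 'f) module_scheme" and \<epsilon>Q and basisQ :: "int \<Rightarrow> 'y set"
    and L :: "('s, 'l, 'g) module_scheme" and T :: "('t, 'h) ring_scheme" and \<alpha>
    and D :: "('s, 'k, 'i) module_scheme" and \<beta> +
  fixes \<rho> :: "'l \<Rightarrow> 'k" and j :: "'a \<Rightarrow> 'b" and j' :: "'b \<Rightarrow> 'a"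
  assumes \<rho>_hom: "lmodule_hom S L D \<rho>"
    and \<rho>_equivariant: "\<lbrakk>t \<in> carrier T; x \<in> carrier L\<rbrakk> \<Longrightarrow> \<rho> (\<alpha> t x) = \<beta> t (\<rho> x)"
    and restriction: "lmodule_hom S0 (P n) L f \<Longrightarrow> lmodule_hom S (P n) L f"
    and coinduced_exists: "lmodule_hom S (P n) D h \<Longrightarrow>
      \<exists>f. lmodule_hom S0 (P n) L f \<and> (\<forall>x\<in>carrier (P n). \<rho> (f x) = h x)"
    and coinduced_unique: "\<lbrakk>lmodule_hom S0 (P n) L f; lmodule_hom S0 (P n) L f';
      \<And>x. x \<in> carrier (P n) \<Longrightarrow> \<rho> (f x) = \<rho> (f' x); p \<in> carrier (P n)\<rbrakk> \<Longrightarrow> f p = f' p"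
    and j_hom: "lmodule_hom S A B j" and j'_hom: "lmodule_hom S B A j'"
    and j'_j: "a \<in> carrier A \<Longrightarrow> j' (j a) = a" and j_j': "b \<in> carrier B \<Longrightarrow> j (j' b) = b"
begin

text \<open>A cochain \<open>f\<close> over \<open>S0\<close> goes to \<rho> after \<open>f\<close>
  after \<theta>. Composition with \<rho> identifies \<open>S0\<close>-maps into \<open>L\<close>
  with \<open>S\<close>-maps into \<open>D\<close>, and \<theta> is a homotopy equivalence over
  \<open>S\<close>. The homotopies are merely \<open>S\<close>-linear, so they can be used only
  after composing with \<rho>; the results are then carried back to \<open>L\<close>.\<close>

theorem cohomology_iso_coinduced:
  "\<exists>h. lmodule_hom T (cohomology (\<lambda>n. hom_module S0 (P n) L \<alpha>) (hom_coboundary P d) n)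
      (cohomology (\<lambda>n. hom_module S (Q n) D \<beta>) (hom_coboundary Q dQ) n) h \<and>
    bij_betw h (carrier (cohomology (\<lambda>n. hom_module S0 (P n) L \<alpha>) (hom_coboundary P d) n))
      (carrier (cohomology (\<lambda>n. hom_module S (Q n) D \<beta>) (hom_coboundary Q dQ) n))"
proof -
  interpret QP: projective_resolution_pair S Q dQ B \<epsilon>Q basisQ P d A \<epsilon>P basisP
    by unfold_locales
  obtain \<theta> where \<theta>: "\<And>n. lmodule_hom S (Q n) (P n) (\<theta> n)"
      "\<And>n y. y \<in> carrier (Q n) \<Longrightarrow> d (\<theta> n y) = \<theta> (n - 1) (dQ y)"
      "\<And>y. y \<in> carrier (Q 0) \<Longrightarrow> \<epsilon>P (\<theta> 0 y) = j' (\<epsilon>Q y)"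
    using QP.chain_map_exists[OF j'_hom] by blast
  obtain \<eta> where \<eta>: "\<And>n. lmodule_hom S (P n) (Q n) (\<eta> n)"
      "\<And>n x. x \<in> carrier (P n) \<Longrightarrow> dQ (\<eta> n x) = \<eta> (n - 1) (d x)"
      "\<And>x. x \<in> carrier (P 0) \<Longrightarrow> \<epsilon>Q (\<eta> 0 x) = j (\<epsilon>P x)"
    using chain_map_exists[OF j_hom] by blast
  have \<epsilon>: "\<epsilon>P (\<theta> 0 (\<eta> 0 x)) = \<epsilon>P x" if "x \<in> carrier (P 0)" for x
    using that \<theta>(3)[OF lmodule_homD(3)[OF \<eta>(1)]] \<eta>(3) j'_j lmodule_homD(3)[OF P.\<epsilon>_hom] by simp
  obtain s where s: "\<And>n. lmodule_hom S (P n) (P (n + 1)) (s n)"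
      "\<And>n x. x \<in> carrier (P n) \<Longrightarrow> x \<ominus>\<^bsub>P n\<^esub> \<theta> n (\<eta> n x) = d (s n x) \<oplus>\<^bsub>P n\<^esub> s (n - 1) (d x)"
    using homotopy_of_lifts[where \<theta> = \<eta> and \<eta> = \<theta>, OF projective_resolution_pair_axioms \<eta>(1,2) \<theta>(1,2) \<epsilon>]
    by blast
  have \<epsilon>': "\<epsilon>Q (\<eta> 0 (\<theta> 0 y)) = \<epsilon>Q y" if "y \<in> carrier (Q 0)" for y
    using that \<eta>(3)[OF lmodule_homD(3)[OF \<theta>(1)]] \<theta>(3) j_j' lmodule_homD(3)[OF Q.\<epsilon>_hom] by simp
  obtain s' where s': "\<And>n. lmodule_hom S (Q n) (Q (n + 1)) (s' n)"
      "\<And>n y. y \<in> carrier (Q n) \<Longrightarrow> y \<ominus>\<^bsub>Q n\<^esub> \<eta> n (\<theta> n y) = dQ (s' n y) \<oplus>\<^bsub>Q n\<^esub> s' (n - 1) (dQ y)"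
    using homotopy_of_lifts[where \<theta> = \<theta> and \<eta> = \<eta>, OF QP.projective_resolution_pair_axioms \<theta>(1,2) \<eta>(1,2) \<epsilon>']
    by blast
  let ?C = "\<lambda>n. hom_module S0 (P n) L \<alpha>" and ?D = "\<lambda>n. hom_module S (Q n) D \<beta>"
  let ?dC = "hom_coboundary P d" and ?dD = "hom_coboundary Q dQ"
  interpret C: cochain_complex T ?C ?dC by (rule P0.cochain_complex_hom[OF L.commuting_action_axioms])
  interpret D': cochain_complex T ?D ?dD by (rule Q.cochain_complex_hom[OF D.commuting_action_axioms])
  define \<psi> where "\<psi> n f = (\<lambda>y\<in>carrier (Q n). \<rho> (f (\<theta> n y)))" for n f
  have C_hom: "lmodule_hom S (P n) D (\<lambda>x. \<rho> (f x))" if "f \<in> carrier (?C n)" for f n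
    using that by (intro lmodule_hom_comp[OF restriction \<rho>_hom]) (simp add: hom_module_simps)
  have C_val: "f x \<in> carrier L" if "f \<in> carrier (?C n)" "x \<in> carrier (P n)" for f n x
    using that lmodule_homD(3)[of S0 "P n" L f] by (simp add: hom_module_simps)
  note \<theta>_closed = lmodule_homD(3)[OF \<theta>(1)]
  interpret cochain_map T ?C ?dC ?D ?dD \<psi>
  proof
    show "lmodule_hom T (?C n) (?D n) (\<psi> n)" for n
    proof (rule lmodule_homI)
      show "\<psi> n f \<in> carrier (?D n)" if "f \<in> carrier (?C n)" for f
        unfolding \<psi>_def by (intro restrict_in_hom_module lmodule_hom_comp[OF \<theta>(1) C_hom] that)
    qed (use C_val[of _ n] \<theta>_closed[of _ n]
      in \<open>auto simp: \<psi>_def hom_module_simps lmodule_homD(4)[OF \<rho>_hom] \<rho>_equivariant C.module D'.module\<close>)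
    show "\<psi> (n + 1) (?dC n f) = ?dD n (\<psi> n f)" for n f
      using \<theta>_closed[of _ "n + 1"] \<theta>(2)[of _ "n + 1"] Q.d_closed_Suc[of _ n]
      by (auto simp: \<psi>_def hom_coboundary_def)
  qed
  show ?thesis
  proof (rule cohomology_iso)
    fix z assume z: "z \<in> C.cocycles n" and "\<psi> n z \<in> D'.coboundaries n"
    then obtain h where h: "h \<in> carrier (?D (n - 1))" "\<psi> n z = ?dD (n - 1) h" by blast
    have zC: "z \<in> carrier (?C n)" and dz: "?dC n z = \<zero>\<^bsub>?C (n + 1)\<^esub>"
      using z by (auto simp: C.cocycles_iff)
    have z_hom: "lmodule_hom S0 (P n) L z" using zC by (simp add: hom_module_simps)
    have h_hom: "lmodule_hom S (Q (n - 1)) D h" using h by (simp add: hom_module_simps)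
    have s_prev: "lmodule_hom S (P (n - 1)) (P n) (s (n - 1))" using s(1)[of "n - 1"] by simp
    \<comment> \<open>The origin of this map: the homotopy formula writes \<rho> after the cocycle
      \<open>z\<close> as a term through \<open>s (n - 1)\<close> plus the value on the round trip,
      and the latter equals \<open>h\<close> after \<eta> after \<open>d\<close> because the image
      of \<open>z\<close> is the coboundary of \<open>h\<close>. Hence \<rho> after \<open>z\<close>
      is this map after \<open>d\<close>.\<close>
    have k: "lmodule_hom S (P (n - 1)) D (\<lambda>x. \<rho> (z (s (n - 1) x)) \<oplus>\<^bsub>D\<^esub> h (\<eta> (n - 1) x))"
      by (rule lmodule_hom_add[OF lmodule_hom_comp[OF s_prev C_hom[OF zC]] lmodule_hom_comp[OF \<eta>(1) h_hom]])
    obtain f where f: "lmodule_hom S0 (P (n - 1)) L f"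
        "\<And>x. x \<in> carrier (P (n - 1)) \<Longrightarrow> \<rho> (f x) = \<rho> (z (s (n - 1) x)) \<oplus>\<^bsub>D\<^esub> h (\<eta> (n - 1) x)"
      using coinduced_exists[OF k] by blast
    \<comment> \<open>Both sides are \<open>S0\<close>-linear in \<open>x\<close>, so comparing them
      after \<rho> suffices, where the \<open>S\<close>-linear homotopy may be used.\<close>
    have "z x = f (d x)" if x: "x \<in> carrier (P n)" for x
    proof (rule coinduced_unique[OF z_hom lmodule_hom_comp[OF P0.d_hom f(1)] _ x])
      fix x assume x: "x \<in> carrier (P n)"
      interpret Pn: left_module S "P n" by (rule P.module)
      note \<rho>z = C_hom[OF zC]
      have c: "\<theta> n (\<eta> n x) \<in> carrier (P n)" "d x \<in> carrier (P (n - 1))" "s (n - 1) (d x) \<in> carrier (P n)"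
        "d (s n x) \<in> carrier (P n)" "\<rho> (z x) \<in> carrier D" "\<rho> (z (\<theta> n (\<eta> n x))) \<in> carrier D"
        "\<rho> (z (s (n - 1) (d x))) \<in> carrier D"
        by (rule x \<theta>_closed lmodule_homD(3)[OF \<eta>(1)] lmodule_homD(3)[OF P.d_hom] lmodule_homD(3)[OF s_prev]
            P.d_closed_Suc lmodule_homD(3)[OF s(1)] lmodule_homD(3)[OF \<rho>z])+
      have "z (d (s n x)) = \<zero>\<^bsub>L\<^esub>"
        using fun_cong[OF dz, of "s n x"] lmodule_homD(3)[OF s(1) x]
        by (simp add: hom_coboundary_def hom_module_simps)
      then have "\<rho> (z (d (s n x))) = \<zero>\<^bsub>D\<^esub>" using lmodule_hom_zero[OF \<rho>_hom] by simp
      moreover have "\<rho> (z (x \<ominus>\<^bsub>P n\<^esub> \<theta> n (\<eta> n x))) = \<rho> (z x) \<ominus>\<^bsub>D\<^esub> \<rho> (z (\<theta> n (\<eta> n x)))"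
        by (rule lmodule_hom_diff[OF \<rho>z x c(1)])
      moreover have "\<rho> (z (d (s n x) \<oplus>\<^bsub>P n\<^esub> s (n - 1) (d x)))
          = \<rho> (z (d (s n x))) \<oplus>\<^bsub>D\<^esub> \<rho> (z (s (n - 1) (d x)))"
        by (rule lmodule_homD(4)[OF \<rho>z c(4) c(3)])
      ultimately have "\<rho> (z x) \<ominus>\<^bsub>D\<^esub> \<rho> (z (\<theta> n (\<eta> n x))) = \<rho> (z (s (n - 1) (d x)))"
        using s(2)[OF x] c by simp
      then have "\<rho> (z x) = \<rho> (z (s (n - 1) (d x))) \<oplus>\<^bsub>D\<^esub> \<rho> (z (\<theta> n (\<eta> n x)))"
        using D.M.diff_add_cancel[OF c(5,6)] by simp
      also have "\<rho> (z (\<theta> n (\<eta> n x))) = h (\<eta> (n - 1) (d x))"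
        using fun_cong[OF h(2), of "\<eta> n x"] lmodule_homD(3)[OF \<eta>(1) x] \<eta>(2)[OF x]
        by (simp add: \<psi>_def hom_coboundary_def)
      finally show "\<rho> (z x) = \<rho> (f (d x))" using f(2)[OF c(2)] by simp
    qed
    then have "z = ?dC (n - 1) (restrict f (carrier (P (n - 1))))"
      using zC lmodule_homD(3)[OF P.d_hom[of n]]
      by (auto simp: hom_coboundary_def hom_module_simps fun_eq_iff extensional_def)
    then show "z \<in> C.coboundaries n" using restrict_in_hom_module[OF f(1)] by blast
  next
    fix w assume w: "w \<in> D'.cocycles n"
    then have wD: "w \<in> carrier (?D n)" and dw: "?dD n w = \<zero>\<^bsub>?D (n + 1)\<^esub>"
      by (auto simp: D'.cocycles_iff)
    have w_hom: "lmodule_hom S (Q n) D w" using wD by (simp add: hom_module_simps)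
    have w_d: "w (dQ y) = \<zero>\<^bsub>D\<^esub>" if "y \<in> carrier (Q (n + 1))" for y
      using fun_cong[OF dw, of y] that by (simp add: hom_coboundary_def hom_module_simps)
    \<comment> \<open>A preimage of the class of \<open>w\<close>: pull \<open>w\<close> back to
      \<open>P\<close> along \<eta> and pass to the coinduced map.\<close>
    obtain f where f: "lmodule_hom S0 (P n) L f" "\<And>x. x \<in> carrier (P n) \<Longrightarrow> \<rho> (f x) = w (\<eta> n x)"
      using coinduced_exists[OF lmodule_hom_comp[OF \<eta>(1) w_hom]] by blast
    let ?f = "restrict f (carrier (P n))"
    have fC: "?f \<in> carrier (?C n)" by (rule restrict_in_hom_module[OF f(1)])
    have "f (d x) = \<zero>\<^bsub>L\<^esub>" if x: "x \<in> carrier (P (n + 1))" for x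
    proof (rule coinduced_unique[OF lmodule_hom_comp[OF P0.d_hom_Suc f(1)]
          lmodule_hom_zero_map[OF P0.module L.M.left_module_axioms] _ x])
      fix x assume x: "x \<in> carrier (P (n + 1))"
      have "\<rho> (f (d x)) = w (dQ (\<eta> (n + 1) x))" using f(2)[OF P.d_closed_Suc[OF x]] \<eta>(2)[OF x] by simp
      then show "\<rho> (f (d x)) = \<rho> \<zero>\<^bsub>L\<^esub>"
        using w_d[OF lmodule_homD(3)[OF \<eta>(1) x]] lmodule_hom_zero[OF \<rho>_hom] by simp
    qed
    then have fZ: "?f \<in> C.cocycles n"
      using fC P.d_closed_Suc[of _ n] by (auto simp: C.cocycles_iff hom_coboundary_def hom_module_simps)
    have s'_prev: "lmodule_hom S (Q (n - 1)) (Q n) (s' (n - 1))" using s'(1)[of "n - 1"] by simp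
    let ?h = "\<lambda>y\<in>carrier (Q (n - 1)). w (s' (n - 1) y)"
    have h: "?h \<in> carrier (?D (n - 1))"
      by (rule restrict_in_hom_module[OF lmodule_hom_comp[OF s'_prev w_hom]])
    interpret Dn: left_module T "?D n" by (rule D'.module)
    interpret Qn: left_module S "Q n" by (rule Q.module)
    have \<psi>f: "\<psi> n ?f \<in> carrier (?D n)" by (rule map_simps(1)[OF fC])
    have dh: "?dD (n - 1) ?h \<in> carrier (?D n)" by (rule lmodule_homD(3)[OF D'.d_prev h])
    \<comment> \<open>The homotopy on \<open>Q\<close> expresses \<open>w\<close> as the coboundary
      of \<open>w\<close> after \<open>s'\<close> plus the value on the round trip, which is the
      image of \<open>f\<close>; the term through \<open>dQ\<close> after \<open>s'\<close> vanishes
      on a cocycle.\<close>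
    have w_eq: "w = ?dD (n - 1) ?h \<oplus>\<^bsub>?D n\<^esub> \<psi> n ?f"
    proof (rule hom_module_eqI[OF wD])
      show "?dD (n - 1) ?h \<oplus>\<^bsub>?D n\<^esub> \<psi> n ?f \<in> carrier (?D n)" using \<psi>f dh by simp
      fix y assume y: "y \<in> carrier (Q n)"
      have c: "\<theta> n y \<in> carrier (P n)" "\<eta> n (\<theta> n y) \<in> carrier (Q n)" "dQ y \<in> carrier (Q (n - 1))"
        "s' n y \<in> carrier (Q (n + 1))" "dQ (s' n y) \<in> carrier (Q n)" "s' (n - 1) (dQ y) \<in> carrier (Q n)"
        by (rule y \<theta>_closed lmodule_homD(3)[OF \<eta>(1)] lmodule_homD(3)[OF Q.d_hom] lmodule_homD(3)[OF s'_prev]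
            Q.d_closed_Suc lmodule_homD(3)[OF s'(1)])+
      note wv = lmodule_homD(3)[OF w_hom]
      have "w (y \<ominus>\<^bsub>Q n\<^esub> \<eta> n (\<theta> n y)) = w y \<ominus>\<^bsub>D\<^esub> w (\<eta> n (\<theta> n y))"
        by (rule lmodule_hom_diff[OF w_hom y c(2)])
      moreover have "w (dQ (s' n y) \<oplus>\<^bsub>Q n\<^esub> s' (n - 1) (dQ y)) = w (s' (n - 1) (dQ y))"
        using lmodule_homD(4)[OF w_hom c(5,6)] w_d[OF c(4)] wv[OF c(6)] by simp
      ultimately have "w y \<ominus>\<^bsub>D\<^esub> w (\<eta> n (\<theta> n y)) = w (s' (n - 1) (dQ y))"
        using s'(2)[OF y] by simp
      then have "w y = w (s' (n - 1) (dQ y)) \<oplus>\<^bsub>D\<^esub> w (\<eta> n (\<theta> n y))"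
        using D.M.diff_add_cancel[OF wv[OF y] wv[OF c(2)]] by simp
      then show "w y = (?dD (n - 1) ?h \<oplus>\<^bsub>?D n\<^esub> \<psi> n ?f) y"
        using y c f(2)[OF c(1)] by (simp add: hom_module_simps hom_coboundary_def \<psi>_def)
    qed
    have "w \<ominus>\<^bsub>?D n\<^esub> \<psi> n ?f = (?dD (n - 1) ?h \<oplus>\<^bsub>?D n\<^esub> \<psi> n ?f) \<ominus>\<^bsub>?D n\<^esub> \<psi> n ?f"
      using w_eq by (rule arg_cong[where f = "\<lambda>v. v \<ominus>\<^bsub>?D n\<^esub> \<psi> n ?f"])
    also have "\<dots> = ?dD (n - 1) ?h"
      using \<psi>f dh by (simp add: a_minus_def Dn.M.a_assoc Dn.M.r_neg)
    finally show "\<exists>x\<in>C.cocycles n. w \<ominus>\<^bsub>?D n\<^esub> \<psi> n x \<in> D'.coboundaries n"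
      using fZ h by auto
  qed
qed

end

section \<open>Functions on a group as bimodules over the group ring\<close>

lemma opposite_ring_simps [simp]:
  "carrier (opposite_ring R) = carrier R" "\<zero>\<^bsub>opposite_ring R\<^esub> = \<zero>\<^bsub>R\<^esub>" "\<one>\<^bsub>opposite_ring R\<^esub> = \<one>\<^bsub>R\<^esub>"
  "x \<oplus>\<^bsub>opposite_ring R\<^esub> y = x \<oplus>\<^bsub>R\<^esub> y" "x \<otimes>\<^bsub>opposite_ring R\<^esub> y = y \<otimes>\<^bsub>R\<^esub> x"
  by (simp_all add: opposite_ring_def)

lemma finsum_opposite_ring [simp]: "finsum (opposite_ring R) = finsum R"
  by (simp add: finsum_def opposite_ring_def fun_eq_iff)

lemma ring_opposite_ring:
  assumes "ring R"
  shows "ring (opposite_ring R)"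
proof -
  interpret ring R by fact
  show ?thesis
  proof (rule ringI)
    show "abelian_group (opposite_ring R)"
      by (rule abelian_groupI) (auto simp: a_ac intro: bexI[of _ "\<ominus>\<^bsub>R\<^esub> _"] l_neg)
    show "monoid (opposite_ring R)"
      by (rule monoidI) (auto simp: m_assoc)
  qed (auto simp: l_distr r_distr)
qed

lemma free_module_opposite_ring [simp]: "carrier (free_module (opposite_ring R) B) = carrier (free_module R B)"
  by (simp add: free_module_def)

lemma monomial_opposite_ring [simp]: "monomial (opposite_ring R) = monomial R"
  by (simp add: monomial_def fun_eq_iff)

text \<open>Convolution is applied only when one factor lies in \<open>RG\<close>. The sums are then
  finite whatever the support of the other factor, so all functions form one ambient
  bimodule.\<close>

definition group_functions :: "('r, 'c) ring_scheme \<Rightarrow> ('g, 'd) monoid_scheme \<Rightarrow> ('g \<Rightarrow> 'r) set"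
  where "group_functions R G = {x. (\<forall>g\<in>carrier G. x g \<in> carrier R) \<and> (\<forall>g. g \<notin> carrier G \<longrightarrow> x g = \<zero>\<^bsub>R\<^esub>)}"

lemma group_functions_opposite_ring [simp]: "group_functions (opposite_ring R) G = group_functions R G"
  by (simp add: group_functions_def)

lemma gr_star_opposite_ring [simp]: "gr_star (opposite_ring R) G = gr_star R G"
  by (simp add: gr_star_def fun_eq_iff)

locale ring_group = R: ring R + G: group G
  for R :: "('r, 'c) ring_scheme" (structure) and G :: "('g, 'd) monoid_scheme" (structure)
begin

sublocale coset_module_setting R G "carrier G"
  by (intro coset_module_setting.intro R.ring_axioms G.group_axioms G.subgroup_self)

abbreviation "RG \<equiv> carrier (free_module R (carrier G))"
abbreviation "Fun \<equiv> group_functions R G"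

lemma opposite: "ring_group (opposite_ring R) G"
  by (intro ring_group.intro ring_opposite_ring R.ring_axioms G.group_axioms)

lemma fun_mem: "x \<in> Fun \<Longrightarrow> x g \<in> carrier R"
  by (cases "g \<in> carrier G") (auto simp: group_functions_def)

lemma fun_outside: "x \<in> Fun \<Longrightarrow> g \<notin> carrier G \<Longrightarrow> x g = \<zero>"
  by (simp add: group_functions_def)

lemma RG_Fun: "a \<in> RG \<Longrightarrow> a \<in> Fun"
  by (simp add: free_module_def group_functions_def)

lemma fun_eqI: "\<lbrakk>x \<in> Fun; y \<in> Fun; \<And>g. g \<in> carrier G \<Longrightarrow> x g = y g\<rbrakk> \<Longrightarrow> x = y"
  by (rule ext) (metis fun_outside)

lemma fun_add: "\<lbrakk>x \<in> Fun; y \<in> Fun\<rbrakk> \<Longrightarrow> (\<lambda>g. x g \<oplus> y g) \<in> Fun"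
  by (simp add: group_functions_def)

lemma RG_support: "a \<in> RG \<Longrightarrow> finite {g. a g \<noteq> \<zero>} \<and> {g. a g \<noteq> \<zero>} \<subseteq> carrier G"
  by (auto simp: free_module_def)

lemma convolution_sum:
  assumes "a \<in> RG" and "x \<in> Fun" and "finite F" and "{g. a g \<noteq> \<zero>} \<subseteq> F" and "F \<subseteq> carrier G" and "g \<in> carrier G"
  shows "convolution R G a x g = (\<Oplus>h\<in>F. a h \<otimes> x (inv\<^bsub>G\<^esub> h \<otimes>\<^bsub>G\<^esub> g))"
  unfolding convolution_def
  using assms mem[OF assms(1)] fun_mem[OF assms(2)]
  by (simp, intro R.finsum_support_eq) auto

lemma convolution_monomial_left:
  assumes "s \<in> carrier R" and "h \<in> carrier G" and "x \<in> Fun" and "g \<in> carrier G"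
  shows "convolution R G (monomial R s h) x g = s \<otimes> x (inv\<^bsub>G\<^esub> h \<otimes>\<^bsub>G\<^esub> g)"
proof -
  have "convolution R G (monomial R s h) x g = (\<Oplus>k\<in>{h}. monomial R s h k \<otimes> x (inv\<^bsub>G\<^esub> k \<otimes>\<^bsub>G\<^esub> g))"
    using assms by (intro convolution_sum monoclosed) (auto simp: monomial_def)
  then show ?thesis using assms fun_mem[OF assms(3)] by (simp add: monomial_def)
qed

lemma convolution_fun:
  assumes "a \<in> RG" and "x \<in> Fun"
  shows "convolution R G a x \<in> Fun"
proof -
  have "convolution R G a x g \<in> carrier R" for g
    unfolding convolution_def using mem[OF assms(1)] fun_mem[OF assms(2)]
    by (auto intro!: R.finsum_closed)
  then show ?thesis by (simp add: group_functions_def) (simp add: convolution_def)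
qed

lemma convolution_fun_add_left:
  assumes a: "a \<in> RG" and b: "b \<in> RG" and x: "x \<in> Fun"
  shows "convolution R G (\<lambda>g. a g \<oplus> b g) x = (\<lambda>g. convolution R G a x g \<oplus> convolution R G b x g)"
proof (rule fun_eqI)
  let ?F = "{g. a g \<noteq> \<zero>} \<union> {g. b g \<noteq> \<zero>}"
  have F: "finite ?F" "?F \<subseteq> carrier G" using RG_support[OF a] RG_support[OF b] by auto
  fix g assume g: "g \<in> carrier G"
  note [simp] = mem[OF a] mem[OF b] fun_mem[OF x]
  have "convolution R G (\<lambda>g. a g \<oplus> b g) x g
      = (\<Oplus>h\<in>?F. (a h \<oplus> b h) \<otimes> x (inv\<^bsub>G\<^esub> h \<otimes>\<^bsub>G\<^esub> g))"
    using F by (intro convolution_sum add_closed a b x g) auto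
  also have "\<dots> = (\<Oplus>h\<in>?F. a h \<otimes> x (inv\<^bsub>G\<^esub> h \<otimes>\<^bsub>G\<^esub> g)) \<oplus> (\<Oplus>h\<in>?F. b h \<otimes> x (inv\<^bsub>G\<^esub> h \<otimes>\<^bsub>G\<^esub> g))"
    by (simp add: R.l_distr R.finsum_addf)
  also have "\<dots> = convolution R G a x g \<oplus> convolution R G b x g"
    using convolution_sum[OF a x F(1) _ F(2) g] convolution_sum[OF b x F(1) _ F(2) g] by simp
  finally show "convolution R G (\<lambda>g. a g \<oplus> b g) x g = convolution R G a x g \<oplus> convolution R G b x g" .
qed (intro convolution_fun fun_add add_closed a b x)+

lemma convolution_fun_add_right:
  assumes a: "a \<in> RG" and x: "x \<in> Fun" and y: "y \<in> Fun"
  shows "convolution R G a (\<lambda>g. x g \<oplus> y g) = (\<lambda>g. convolution R G a x g \<oplus> convolution R G a y g)"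
proof (rule fun_eqI)
  let ?F = "{g. a g \<noteq> \<zero>}"
  note F = RG_support[OF a, THEN conjunct1] RG_support[OF a, THEN conjunct2]
  note [simp] = mem[OF a] fun_mem[OF x] fun_mem[OF y]
  fix g assume g: "g \<in> carrier G"
  show "convolution R G a (\<lambda>g. x g \<oplus> y g) g = convolution R G a x g \<oplus> convolution R G a y g"
    using convolution_sum[OF a x F(1) subset_refl F(2) g] convolution_sum[OF a y F(1) subset_refl F(2) g]
      convolution_sum[OF a fun_add[OF x y] F(1) subset_refl F(2) g]
    by (simp add: R.r_distr R.finsum_addf)
qed (intro convolution_fun fun_add a x y)+

text \<open>Additivity in \<open>a\<close> and \<open>b\<close> reduces the identity to monomials,
  whose convolution is a translation followed by a scaling. No induction is possible on
  \<open>x\<close>, which has arbitrary support and is treated pointwise.\<close>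

lemma convolution_fun_assoc:
  assumes a: "a \<in> RG" and b: "b \<in> RG" and x: "x \<in> Fun"
  shows "convolution R G (convolution R G a b) x = convolution R G a (convolution R G b x)"
  using R.ring_axioms a
proof (induction a rule: free_module_induct)
  case zero
  show ?case by (simp add: convolution_zero)
next
  case (monomial s g)
  note sg = this
  show ?case
    using R.ring_axioms b
  proof (induction b rule: free_module_induct)
    case zero
    show ?case by (simp add: convolution_zero)
  next
    case (monomial t k)
    show ?case
    proof (rule fun_eqI)
      fix h assume h: "h \<in> carrier G"
      have "inv\<^bsub>G\<^esub> (g \<otimes>\<^bsub>G\<^esub> k) \<otimes>\<^bsub>G\<^esub> h = inv\<^bsub>G\<^esub> k \<otimes>\<^bsub>G\<^esub> (inv\<^bsub>G\<^esub> g \<otimes>\<^bsub>G\<^esub> h)"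
        using sg monomial h by (simp add: G.inv_mult_group G.m_assoc)
      then show "convolution R G (convolution R G (monomial R s g) (monomial R t k)) x h =
          convolution R G (monomial R s g) (convolution R G (monomial R t k) x) h"
        using sg monomial h x fun_mem[OF x]
        by (simp add: convolution_monomial convolution_monomial_left convolution_fun monoclosed R.m_assoc)
    qed (use sg monomial x in \<open>simp_all add: convolution_fun convolution_closed monoclosed\<close>)
  next
    case (add b c)
    then show ?case
      using sg x by (simp add: convolution_add_right convolution_fun_add_left convolution_fun_add_right
          convolution_closed convolution_fun monoclosed)
  qed
next
  case (add a a')
  then show ?case
    using b x by (simp add: convolution_add_left convolution_fun_add_left convolution_closed convolution_fun)
qed

lemma convolution_one_left: "x \<in> Fun \<Longrightarrow> convolution R G (monomial R \<one> \<one>\<^bsub>G\<^esub>) x = x"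
  by (rule fun_eqI) (simp_all add: convolution_fun monoclosed convolution_monomial_left fun_mem)

lemma convolution_one_right:
  assumes "a \<in> RG"
  shows "convolution R G a (monomial R \<one> \<one>\<^bsub>G\<^esub>) = a"
  using R.ring_axioms assms
proof (induction a rule: free_module_induct)
  case (add a b)
  then show ?case by (simp add: convolution_add_left monoclosed)
qed (simp_all add: convolution_zero convolution_monomial)

lemma group_ring_one: "\<one>\<^bsub>group_ring R G\<^esub> = monomial R \<one> \<one>\<^bsub>G\<^esub>"
  by (simp add: group_ring_def convolution_ring_def monomial_def)

lemma group_ring_zero: "\<zero>\<^bsub>group_ring R G\<^esub> = (\<lambda>_. \<zero>)"
  by (simp add: group_ring_def convolution_ring_def)

lemma ring_group_ring: "ring (group_ring R G)"
proof (rule ringI)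
  interpret left_module R "free_module R (carrier G)"
    by (rule left_module_free_module) (rule R.ring_axioms)
  show "abelian_group (group_ring R G)"
  proof (rule abelian_groupI)
    fix x assume "x \<in> carrier (group_ring R G)"
    then show "\<exists>y\<in>carrier (group_ring R G). y \<oplus>\<^bsub>group_ring R G\<^esub> x = \<zero>\<^bsub>group_ring R G\<^esub>"
      using M.l_neg[of x] M.add.inv_closed[of x]
      by (auto simp: carrier_group_ring group_ring_ops group_ring_zero)
  next
    show "\<zero>\<^bsub>group_ring R G\<^esub> \<in> carrier (group_ring R G)"
      by (simp add: carrier_group_ring group_ring_zero free_module_def)
  qed (auto simp: carrier_group_ring group_ring_ops group_ring_zero add_closed fun_eq_iff mem R.a_ac)
  show "monoid (group_ring R G)"
    by (rule monoidI)
       (simp_all add: carrier_group_ring group_ring_ops group_ring_one convolution_closed monoclosed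
          convolution_fun_assoc RG_Fun convolution_one_left convolution_one_right)
qed (simp_all add: carrier_group_ring group_ring_ops convolution_add_left convolution_add_right)

text \<open>Multiplication by a group ring element spreads a support over finitely many of its
  translates. This dictates the closure properties demanded in
  \<open>support_family\<close>.\<close>

lemma convolution_support:
  assumes a: "a \<in> RG" and x: "x \<in> Fun"
  shows "{g \<in> carrier G. convolution R G a x g \<noteq> \<zero>} \<subseteq>
    (\<Union>h\<in>{h. a h \<noteq> \<zero>}. (\<lambda>k. h \<otimes>\<^bsub>G\<^esub> k) ` {k \<in> carrier G. x k \<noteq> \<zero>})"
proof
  fix g assume "g \<in> {g \<in> carrier G. convolution R G a x g \<noteq> \<zero>}"
  then have g: "g \<in> carrier G" "convolution R G a x g \<noteq> \<zero>" by auto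
  note F = RG_support[OF a, THEN conjunct1] RG_support[OF a, THEN conjunct2]
  have "\<exists>h\<in>{h. a h \<noteq> \<zero>}. a h \<otimes> x (inv\<^bsub>G\<^esub> h \<otimes>\<^bsub>G\<^esub> g) \<noteq> \<zero>"
  proof (rule ccontr)
    assume "\<not> ?thesis"
    then have "(\<Oplus>h\<in>{h. a h \<noteq> \<zero>}. a h \<otimes> x (inv\<^bsub>G\<^esub> h \<otimes>\<^bsub>G\<^esub> g)) = \<zero>"
      by (intro R.add.finprod_one_eqI) blast
    then show False using g(2) convolution_sum[OF a x F(1) subset_refl F(2) g(1)] by simp
  qed
  then obtain h where h: "a h \<noteq> \<zero>" "x (inv\<^bsub>G\<^esub> h \<otimes>\<^bsub>G\<^esub> g) \<noteq> \<zero>"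
    using R.r_null[OF mem[OF a]] by (metis (mono_tags, lifting) mem_Collect_eq)
  then have "h \<in> carrier G" using F(2) by auto
  then show "g \<in> (\<Union>h\<in>{h. a h \<noteq> \<zero>}. (\<lambda>k. h \<otimes>\<^bsub>G\<^esub> k) ` {k \<in> carrier G. x k \<noteq> \<zero>})"
    using h g(1) by (auto intro!: bexI[of _ h] image_eqI[of _ _ "inv\<^bsub>G\<^esub> h \<otimes>\<^bsub>G\<^esub> g"] simp: G.m_assoc[symmetric])
qed

section \<open>The right action, turned into a left action of the opposite group ring\<close>

lemma star_apply: "g \<in> carrier G \<Longrightarrow> gr_star R G x g = x (inv\<^bsub>G\<^esub> g)"
  by (simp add: gr_star_def)

lemma star_fun: "x \<in> Fun \<Longrightarrow> gr_star R G x \<in> Fun"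
  by (auto simp: group_functions_def gr_star_def)

lemma star_star: "x \<in> Fun \<Longrightarrow> gr_star R G (gr_star R G x) = x"
  by (rule fun_eqI) (simp_all add: star_fun, simp add: gr_star_def)

lemma star_add:
  "gr_star R G (\<lambda>g. x g \<oplus> y g) = (\<lambda>g. gr_star R G x g \<oplus> gr_star R G y g)"
  by (auto simp: gr_star_def fun_eq_iff)

definition turned :: "('g \<Rightarrow> 'r) \<Rightarrow> ('g \<Rightarrow> 'r) \<Rightarrow> 'g \<Rightarrow> 'r"
  where "turned a x = convolution R G x (gr_star R G a)"

text \<open>
  The involution \<^const>\<open>gr_star\<close> carries right multiplication over \<open>R\<close> to left multiplication over the
  opposite ring, so that the module axioms for the former follow from those for the latter.
\<close>

lemma turned_eq_star:
  assumes "a \<in> Fun" and "x \<in> Fun"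
  shows "turned a x = gr_star R G (convolution (opposite_ring R) G a (gr_star R G x))"
proof
  fix g
  show "turned a x g = gr_star R G (convolution (opposite_ring R) G a (gr_star R G x)) g"
  proof (cases "g \<in> carrier G")
    case True
    let ?A = "{h \<in> carrier G. x h \<noteq> \<zero> \<and> gr_star R G a (inv\<^bsub>G\<^esub> h \<otimes>\<^bsub>G\<^esub> g) \<noteq> \<zero>}"
    let ?B = "{h \<in> carrier G. a h \<noteq> \<zero> \<and> gr_star R G x (inv\<^bsub>G\<^esub> h \<otimes>\<^bsub>G\<^esub> inv\<^bsub>G\<^esub> g) \<noteq> \<zero>}"
    have star: "gr_star R G a (inv\<^bsub>G\<^esub> h \<otimes>\<^bsub>G\<^esub> g) = a (inv\<^bsub>G\<^esub> g \<otimes>\<^bsub>G\<^esub> h)"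
      "gr_star R G x (inv\<^bsub>G\<^esub> h \<otimes>\<^bsub>G\<^esub> inv\<^bsub>G\<^esub> g) = x (g \<otimes>\<^bsub>G\<^esub> h)"
      and cancel: "g \<otimes>\<^bsub>G\<^esub> (inv\<^bsub>G\<^esub> g \<otimes>\<^bsub>G\<^esub> h) = h" "inv\<^bsub>G\<^esub> g \<otimes>\<^bsub>G\<^esub> (g \<otimes>\<^bsub>G\<^esub> h) = h"
      if "h \<in> carrier G" for h
    proof -
      show "gr_star R G a (inv\<^bsub>G\<^esub> h \<otimes>\<^bsub>G\<^esub> g) = a (inv\<^bsub>G\<^esub> g \<otimes>\<^bsub>G\<^esub> h)"
        "gr_star R G x (inv\<^bsub>G\<^esub> h \<otimes>\<^bsub>G\<^esub> inv\<^bsub>G\<^esub> g) = x (g \<otimes>\<^bsub>G\<^esub> h)"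
        using True that by (simp_all add: gr_star_def G.inv_mult_group)
      show "g \<otimes>\<^bsub>G\<^esub> (inv\<^bsub>G\<^esub> g \<otimes>\<^bsub>G\<^esub> h) = h" "inv\<^bsub>G\<^esub> g \<otimes>\<^bsub>G\<^esub> (g \<otimes>\<^bsub>G\<^esub> h) = h"
        using True that by (simp_all flip: G.m_assoc)
    qed
    \<comment> \<open>Left translation by \<open>g\<close> matches the index sets of the two
      convolutions and thereby the sums.\<close>
    have B: "?A = (\<lambda>h. g \<otimes>\<^bsub>G\<^esub> h) ` ?B"
    proof (intro subset_antisym subsetI)
      fix h assume h: "h \<in> ?A"
      then have "h \<in> carrier G" by simp
      then show "h \<in> (\<lambda>h. g \<otimes>\<^bsub>G\<^esub> h) ` ?B"
        using True h by (intro image_eqI[of _ _ "inv\<^bsub>G\<^esub> g \<otimes>\<^bsub>G\<^esub> h"]) (simp_all add: star cancel)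
    next
      fix h assume "h \<in> (\<lambda>h. g \<otimes>\<^bsub>G\<^esub> h) ` ?B"
      then show "h \<in> ?A" using True by (auto simp: star cancel)
    qed
    have "turned a x g = (\<Oplus>h\<in>?A. x h \<otimes> gr_star R G a (inv\<^bsub>G\<^esub> h \<otimes>\<^bsub>G\<^esub> g))"
      using True by (simp add: turned_def convolution_def)
    also have "\<dots> = (\<Oplus>h\<in>?B. x (g \<otimes>\<^bsub>G\<^esub> h) \<otimes> gr_star R G a (inv\<^bsub>G\<^esub> (g \<otimes>\<^bsub>G\<^esub> h) \<otimes>\<^bsub>G\<^esub> g))"
      unfolding B
      using True fun_mem[OF assms(2)] fun_mem[OF star_fun[OF assms(1)]]
      by (intro R.finsum_reindex) (auto simp: inj_on_def)
    also have "\<dots> = (\<Oplus>h\<in>?B. gr_star R G x (inv\<^bsub>G\<^esub> h \<otimes>\<^bsub>G\<^esub> inv\<^bsub>G\<^esub> g) \<otimes> a h)"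
    proof (rule R.finsum_cong')
      fix h assume "h \<in> ?B"
      then have h: "h \<in> carrier G" by simp
      show "x (g \<otimes>\<^bsub>G\<^esub> h) \<otimes> gr_star R G a (inv\<^bsub>G\<^esub> (g \<otimes>\<^bsub>G\<^esub> h) \<otimes>\<^bsub>G\<^esub> g)
          = gr_star R G x (inv\<^bsub>G\<^esub> h \<otimes>\<^bsub>G\<^esub> inv\<^bsub>G\<^esub> g) \<otimes> a h"
        using True h by (simp add: star cancel)
    qed (use fun_mem[OF assms(1)] fun_mem[OF star_fun[OF assms(2)]] in auto)
    also have "\<dots> = gr_star R G (convolution (opposite_ring R) G a (gr_star R G x)) g"
      unfolding star_apply[OF True] convolution_def using True by simp
    finally show ?thesis .
  qed (simp add: turned_def convolution_def gr_star_def)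
qed

lemma turned_monomial:
  assumes "s \<in> carrier R" and "h \<in> carrier G" and "x \<in> Fun" and "g \<in> carrier G"
  shows "turned (monomial R s h) x g = x (g \<otimes>\<^bsub>G\<^esub> h) \<otimes> s"
proof -
  interpret op: ring_group "opposite_ring R" G by (rule opposite)
  have "convolution (opposite_ring R) G (monomial R s h) (gr_star R G x) (inv\<^bsub>G\<^esub> g)
      = gr_star R G x (inv\<^bsub>G\<^esub> h \<otimes>\<^bsub>G\<^esub> inv\<^bsub>G\<^esub> g) \<otimes> s"
    using op.convolution_monomial_left[of s h "gr_star R G x" "inv\<^bsub>G\<^esub> g"] assms star_fun[OF assms(3)] by simp
  then show ?thesis
    using assms
    by (simp add: turned_eq_star RG_Fun monoclosed) (simp add: gr_star_def G.inv_mult_group)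
qed

lemma turned_fun: "\<lbrakk>a \<in> RG; x \<in> Fun\<rbrakk> \<Longrightarrow> turned a x \<in> Fun"
  using star_fun ring_group.convolution_fun[OF opposite, of a "gr_star R G x"]
  by (simp add: turned_eq_star RG_Fun)

lemma turned_add_left:
  "\<lbrakk>a \<in> RG; b \<in> RG; x \<in> Fun\<rbrakk> \<Longrightarrow> turned (\<lambda>g. a g \<oplus> b g) x = (\<lambda>g. turned a x g \<oplus> turned b x g)"
  using star_fun ring_group.convolution_fun_add_left[OF opposite, of a b "gr_star R G x"]
  by (simp add: turned_eq_star RG_Fun add_closed star_add)

lemma turned_add_right:
  "\<lbrakk>a \<in> RG; x \<in> Fun; y \<in> Fun\<rbrakk> \<Longrightarrow> turned a (\<lambda>g. x g \<oplus> y g) = (\<lambda>g. turned a x g \<oplus> turned a y g)"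
  using star_fun ring_group.convolution_fun_add_right[OF opposite, of a "gr_star R G x" "gr_star R G y"]
  by (simp add: turned_eq_star RG_Fun fun_add star_add)

text \<open>The two inner involutions cancel, and what remains is associativity of left convolution
  over the opposite ring. The product of scalars is accordingly the opposite one.\<close>

lemma turned_assoc:
  assumes "a \<in> RG" "b \<in> RG" "x \<in> Fun"
  shows "turned (convolution (opposite_ring R) G a b) x = turned a (turned b x)"
proof -
  interpret op: ring_group "opposite_ring R" G by (rule opposite)
  have c: "convolution (opposite_ring R) G b (gr_star R G x) \<in> Fun"
    using op.convolution_fun[of b "gr_star R G x"] assms star_fun by simp
  then show ?thesis
    using assms star_fun[OF assms(3)] op.convolution_fun_assoc[of a b "gr_star R G x"]
      op.convolution_closed[of a b]
    by (simp add: turned_eq_star RG_Fun star_fun star_star)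
qed

lemma turned_one: "x \<in> Fun \<Longrightarrow> turned (monomial R \<one> \<one>\<^bsub>G\<^esub>) x = x"
  by (rule fun_eqI) (simp_all add: turned_monomial turned_fun monoclosed fun_mem)

lemma turned_zero: "turned (\<lambda>_. \<zero>) x = (\<lambda>_. \<zero>)"
  by (simp add: turned_def gr_star_def convolution_zero)

text \<open>After reduction to monomials this says that left and right translations commute, and
  likewise left and right multiplications by elements of \<open>R\<close>.\<close>

lemma turned_convolution:
  assumes a: "a \<in> RG" and t: "t \<in> RG" and x: "x \<in> Fun"
  shows "turned t (convolution R G a x) = convolution R G a (turned t x)"
  using R.ring_axioms a
proof (induction a rule: free_module_induct)
  case zero
  show ?case by (simp add: convolution_zero turned_def)
next
  case (monomial s g)
  note sg = this
  show ?case
    using R.ring_axioms t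
  proof (induction t rule: free_module_induct)
    case zero
    show ?case by (simp add: convolution_zero turned_zero)
  next
    case (monomial r k)
    show ?case
    proof (rule fun_eqI)
      fix h assume "h \<in> carrier G"
      then show "turned (monomial R r k) (convolution R G (monomial R s g) x) h =
          convolution R G (monomial R s g) (turned (monomial R r k) x) h"
        using sg monomial x fun_mem[OF x]
        by (simp add: turned_monomial convolution_monomial_left convolution_fun turned_fun monoclosed
            R.m_assoc G.m_assoc)
    qed (use sg monomial x in \<open>simp_all add: convolution_fun turned_fun monoclosed\<close>)
  next
    case (add t u)
    then show ?case
      using sg x by (simp add: turned_add_left convolution_fun_add_right convolution_fun turned_fun monoclosed)
  qed
next
  case (add a b)
  then show ?case
    using t x by (simp add: turned_add_right convolution_fun_add_left convolution_fun turned_fun)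
qed

lemma turned_support:
  assumes a: "a \<in> RG" and x: "x \<in> Fun"
  shows "{g \<in> carrier G. turned a x g \<noteq> \<zero>} \<subseteq>
    (\<Union>h\<in>{h. a h \<noteq> \<zero>}. (\<lambda>k. k \<otimes>\<^bsub>G\<^esub> inv\<^bsub>G\<^esub> h) ` {k \<in> carrier G. x k \<noteq> \<zero>})"
proof
  fix g assume "g \<in> {g \<in> carrier G. turned a x g \<noteq> \<zero>}"
  then have g: "g \<in> carrier G" "convolution (opposite_ring R) G a (gr_star R G x) (inv\<^bsub>G\<^esub> g) \<noteq> \<zero>"
    using a x by (auto simp: turned_eq_star RG_Fun gr_star_def)
  then obtain h k where h: "a h \<noteq> \<zero>" "k \<in> carrier G" "x (inv\<^bsub>G\<^esub> k) \<noteq> \<zero>" "inv\<^bsub>G\<^esub> g = h \<otimes>\<^bsub>G\<^esub> k"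
    using ring_group.convolution_support[OF opposite, of a "gr_star R G x"] a star_fun[OF x]
    by (auto simp: gr_star_def subset_iff split: if_splits)
  then have hG: "h \<in> carrier G" using RG_support[OF a] by auto
  have "g = inv\<^bsub>G\<^esub> k \<otimes>\<^bsub>G\<^esub> inv\<^bsub>G\<^esub> h"
    using h hG g(1) by (metis G.inv_inv G.inv_mult_group)
  then show "g \<in> (\<Union>h\<in>{h. a h \<noteq> \<zero>}. (\<lambda>k. k \<otimes>\<^bsub>G\<^esub> inv\<^bsub>G\<^esub> h) ` {k \<in> carrier G. x k \<noteq> \<zero>})"
    using h by blast
qed

end

text \<open>Closure under subsets, finite unions and translations on both sides makes the functions
  with support in \<open>P\<close> a bimodule over \<open>RG\<close>. This treats \<open>RG\<close>,
  both Novikov rings and \<open>L\<close> uniformly. Only bimodule structures are derived: for the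
  condition defining \<open>L\<close>, the record \<open>convolution_ring\<close> need not be a
  ring, since the convolution of two such functions may involve infinite sums.\<close>

locale support_family = ring_group R G
  for R :: "('r, 'c) ring_scheme" (structure) and G :: "('g, 'd) monoid_scheme" (structure) +
  fixes P :: "'g set \<Rightarrow> bool"
  assumes P_empty: "P {}"
    and P_subset: "\<lbrakk>P X; Y \<subseteq> X\<rbrakk> \<Longrightarrow> P Y"
    and P_Un: "\<lbrakk>P X; P Y\<rbrakk> \<Longrightarrow> P (X \<union> Y)"
    and P_left: "\<lbrakk>P X; X \<subseteq> carrier G; g \<in> carrier G\<rbrakk> \<Longrightarrow> P ((\<lambda>h. g \<otimes>\<^bsub>G\<^esub> h) ` X)"
    and P_right: "\<lbrakk>P X; X \<subseteq> carrier G; g \<in> carrier G\<rbrakk> \<Longrightarrow> P ((\<lambda>h. h \<otimes>\<^bsub>G\<^esub> g) ` X)"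
begin

lemma P_UN: "\<lbrakk>finite I; \<And>i. i \<in> I \<Longrightarrow> P (X i)\<rbrakk> \<Longrightarrow> P (\<Union>i\<in>I. X i)"
  by (induction I rule: finite_induct) (auto simp: P_empty P_Un)

abbreviation "bimod \<equiv> ring_bimodule (convolution_ring R G P)"

lemma bimod_simps:
  "x \<in> carrier bimod \<longleftrightarrow> x \<in> Fun \<and> P {g \<in> carrier G. x g \<noteq> \<zero>}"
  "x \<oplus>\<^bsub>bimod\<^esub> y = (\<lambda>g. x g \<oplus> y g)" "\<zero>\<^bsub>bimod\<^esub> = (\<lambda>_. \<zero>)" "a \<odot>\<^bsub>bimod\<^esub> x = convolution R G a x"
  "turned_action R G bimod a x = turned a x"
  by (auto simp: ring_bimodule_def convolution_ring_def group_functions_def turned_action_def turned_def)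

lemma bimod_add: "\<lbrakk>x \<in> carrier bimod; y \<in> carrier bimod\<rbrakk> \<Longrightarrow> (\<lambda>g. x g \<oplus> y g) \<in> carrier bimod"
  by (auto simp: bimod_simps fun_add intro: P_subset[OF P_Un[of "{g \<in> carrier G. x g \<noteq> \<zero>}" "{g \<in> carrier G. y g \<noteq> \<zero>}"]])

lemma bimod_zero: "(\<lambda>_. \<zero>) \<in> carrier bimod"
  using P_empty by (simp add: bimod_simps group_functions_def)

lemma bimod_neg:
  assumes "x \<in> carrier bimod"
  shows "\<exists>y\<in>carrier bimod. (\<lambda>g. y g \<oplus> x g) = (\<lambda>_. \<zero>)"
proof (rule bexI)
  have x: "x \<in> Fun" and P: "P {g \<in> carrier G. x g \<noteq> \<zero>}" using assms by (auto simp: bimod_simps)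
  show "(\<lambda>g. \<ominus> x g \<oplus> x g) = (\<lambda>_. \<zero>)" using fun_mem[OF x] by (simp add: R.l_neg)
  have "{g \<in> carrier G. \<ominus> x g \<noteq> \<zero>} \<subseteq> {g \<in> carrier G. x g \<noteq> \<zero>}" by auto
  then show "(\<lambda>g. \<ominus> x g) \<in> carrier bimod"
    using P_subset[OF P] fun_mem[OF x] fun_outside[OF x] by (simp add: bimod_simps group_functions_def)
qed

lemma bimod_convolution:
  assumes "a \<in> RG" "x \<in> carrier bimod"
  shows "convolution R G a x \<in> carrier bimod"
proof -
  have "P (\<Union>h\<in>{h. a h \<noteq> \<zero>}. (\<lambda>k. h \<otimes>\<^bsub>G\<^esub> k) ` {k \<in> carrier G. x k \<noteq> \<zero>})"
    using assms RG_support[OF assms(1)] by (intro P_UN P_left) (auto simp: bimod_simps)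
  then show ?thesis
    using assms P_subset[OF _ convolution_support[of a x]] by (simp add: bimod_simps convolution_fun)
qed

lemma bimod_turned:
  assumes "a \<in> RG" "x \<in> carrier bimod"
  shows "turned a x \<in> carrier bimod"
proof -
  have "P (\<Union>h\<in>{h. a h \<noteq> \<zero>}. (\<lambda>k. k \<otimes>\<^bsub>G\<^esub> inv\<^bsub>G\<^esub> h) ` {k \<in> carrier G. x k \<noteq> \<zero>})"
    using assms RG_support[OF assms(1)] by (intro P_UN P_right) (auto simp: bimod_simps)
  then show ?thesis
    using assms P_subset[OF _ turned_support[of a x]] by (simp add: bimod_simps turned_fun)
qed

lemma bimod_Fun: "x \<in> carrier bimod \<Longrightarrow> x \<in> Fun"
  by (simp add: bimod_simps)

lemma left_module_bimod: "left_module (group_ring R G) bimod"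
  by (rule left_moduleI)
     (use ring_group_ring bimod_add bimod_zero bimod_neg bimod_convolution fun_mem[OF bimod_Fun] in
      \<open>simp_all add: bimod_Fun bimod_simps(2-) carrier_group_ring group_ring_ops group_ring_one R.a_ac
        convolution_fun_add_left convolution_fun_add_right convolution_fun_assoc convolution_one_left\<close>)

lemma commuting_action_bimod:
  "commuting_action (group_ring R G) bimod (group_ring (opposite_ring R) G) (turned_action R G bimod)"
proof -
  interpret op: ring_group "opposite_ring R" G by (rule opposite)
  have "left_module (group_ring (opposite_ring R) G) (with_action bimod (turned_action R G bimod))"
    by (rule left_moduleI)
       (use op.ring_group_ring bimod_add bimod_zero bimod_neg bimod_turned fun_mem[OF bimod_Fun] in
        \<open>simp_all add: bimod_Fun bimod_simps(2-) carrier_group_ring group_ring_ops op.group_ring_one R.a_ac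
          turned_add_left turned_add_right turned_assoc turned_one\<close>)
  then show ?thesis
    using left_module_bimod
    by (intro commuting_action.intro commuting_action_axioms.intro)
       (simp_all add: bimod_Fun bimod_simps(4,5) carrier_group_ring turned_convolution)
qed

end

section \<open>Restriction to a subgroup\<close>

locale ring_subgroup = ring_group R G + K: subgroup K G
  for R :: "('r, 'c) ring_scheme" (structure) and G :: "('g, 'd) monoid_scheme" (structure) and K
begin

abbreviation "GK \<equiv> G\<lparr>carrier := K\<rparr>"

lemma group_GK: "group GK"
  by (rule K.subgroup_is_group) (rule G.group_axioms)

sublocale sub: ring_group R GK
  by (intro ring_group.intro R.ring_axioms group_GK)

lemma opposite_subgroup: "ring_subgroup (opposite_ring R) G K"
  by (intro ring_subgroup.intro opposite K.subgroup_axioms)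

lemma inv_GK: "k \<in> K \<Longrightarrow> inv\<^bsub>GK\<^esub> k = inv\<^bsub>G\<^esub> k"
  by (rule G.m_inv_consistent[OF K.subgroup_axioms])

lemma K_closed: "k \<in> K \<Longrightarrow> k \<in> carrier G" "k \<in> K \<Longrightarrow> inv\<^bsub>G\<^esub> k \<in> K"
  "\<lbrakk>k \<in> K; l \<in> K\<rbrakk> \<Longrightarrow> k \<otimes>\<^bsub>G\<^esub> l \<in> K" "\<one>\<^bsub>G\<^esub> \<in> K"
  using K.subset by auto

lemma mult_mem_K_iff: "\<lbrakk>k \<in> K; g \<in> carrier G\<rbrakk> \<Longrightarrow> k \<otimes>\<^bsub>G\<^esub> g \<in> K \<longleftrightarrow> g \<in> K"
  by (metis G.inv_solve_left' G.m_closed K_closed(1-3) G.inv_closed)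

lemma RK_RG: "a \<in> carrier (free_module R K) \<Longrightarrow> a \<in> RG"
  using free_module_mono[OF R.ring_axioms K.subset] by blast

definition res :: "('g \<Rightarrow> 'r) \<Rightarrow> 'g \<Rightarrow> 'r"
  where "res x = (\<lambda>g. if g \<in> K then x g else \<zero>)"

lemma res_fun: "x \<in> Fun \<Longrightarrow> res x \<in> group_functions R GK"
  using K.subset by (auto simp: group_functions_def res_def)

lemma res_add: "res (\<lambda>g. x g \<oplus> y g) = (\<lambda>g. res x g \<oplus> res y g)"
  by (auto simp: res_def)

lemma res_RK: "a \<in> carrier (free_module R K) \<Longrightarrow> res a = a"
  by (auto simp: res_def free_module_def)

text \<open>For a scalar supported in \<open>K\<close> and an argument in \<open>K\<close>, every
  value of \<open>x\<close> that enters is taken at an element of \<open>K\<close>.\<close>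

lemma res_convolution:
  assumes a: "a \<in> carrier (free_module R K)" and x: "x \<in> Fun"
  shows "res (convolution R G a x) = convolution R GK a (res x)"
proof (rule sub.fun_eqI)
  note F = sub.RG_support[of a, simplified, OF a]
  fix g assume "g \<in> carrier GK"
  then have g: "g \<in> K" by simp
  have "convolution R G a x g = (\<Oplus>h\<in>{g. a g \<noteq> \<zero>}. a h \<otimes> x (inv\<^bsub>G\<^esub> h \<otimes>\<^bsub>G\<^esub> g))"
    using F K.subset g by (intro convolution_sum RK_RG a x) auto
  also have "\<dots> = (\<Oplus>h\<in>{g. a g \<noteq> \<zero>}. a h \<otimes> res x (inv\<^bsub>GK\<^esub> h \<otimes>\<^bsub>GK\<^esub> g))"
    using F g fun_mem[OF x] mem[OF a]
    by (intro R.finsum_cong') (auto simp: inv_GK res_def K_closed subset_iff)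
  also have "\<dots> = convolution R GK a (res x) g"
    using F g a by (intro sub.convolution_sum[symmetric] res_fun x) auto
  finally show "res (convolution R G a x) g = convolution R GK a (res x) g"
    using g by (simp add: res_def)
qed (use a x in \<open>simp_all add: res_fun convolution_fun RK_RG sub.convolution_fun\<close>)

text \<open>With functions extended by zero, \<open>RK\<close> is a subring of \<open>RG\<close>
  literally, without an embedding. Restriction of scalars thus leaves module records
  unchanged.\<close>

lemma convolution_GK:
  assumes a: "a \<in> carrier (free_module R K)" and b: "b \<in> carrier (free_module R K)"
  shows "convolution R GK a b = convolution R G a b"
proof -
  have "convolution R G a b g = \<zero>" if "g \<notin> K" for g
  proof (cases "g \<in> carrier G")
    case True
    note F = sub.RG_support[of a, simplified, OF a]
    have "convolution R G a b g = (\<Oplus>h\<in>{g. a g \<noteq> \<zero>}. a h \<otimes> b (inv\<^bsub>G\<^esub> h \<otimes>\<^bsub>G\<^esub> g))"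
      using F K.subset True by (intro convolution_sum RK_RG RG_Fun a b) auto
    also have "\<dots> = (\<Oplus>h\<in>{g. a g \<noteq> \<zero>}. \<zero>)"
    proof (rule R.finsum_cong')
      fix h assume "h \<in> {g. a g \<noteq> \<zero>}"
      then have "h \<in> K" using F by auto
      then have "inv\<^bsub>G\<^esub> h \<otimes>\<^bsub>G\<^esub> g \<notin> K" using True that by (simp add: mult_mem_K_iff K_closed)
      then have "b (inv\<^bsub>G\<^esub> h \<otimes>\<^bsub>G\<^esub> g) = \<zero>" using b by (simp add: free_module_def)
      then show "a h \<otimes> b (inv\<^bsub>G\<^esub> h \<otimes>\<^bsub>G\<^esub> g) = \<zero>" using mem[OF a] by simp
    qed auto
    finally show ?thesis by simp
  qed (simp add: convolution_def)
  then have "res (convolution R G a b) = convolution R G a b"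
    by (auto simp: res_def)
  then show ?thesis using res_convolution[OF a RG_Fun[OF RK_RG[OF b]]] res_RK[OF b] by simp
qed

lemma carrier_RK_RG: "a \<in> carrier (group_ring R GK) \<Longrightarrow> a \<in> carrier (group_ring R G)"
  by (simp add: carrier_group_ring RK_RG)

lemma group_ring_GK_ops:
  "a \<oplus>\<^bsub>group_ring R GK\<^esub> b = a \<oplus>\<^bsub>group_ring R G\<^esub> b"
  "\<one>\<^bsub>group_ring R GK\<^esub> = \<one>\<^bsub>group_ring R G\<^esub>" "\<zero>\<^bsub>group_ring R GK\<^esub> = \<zero>\<^bsub>group_ring R G\<^esub>"
  "\<lbrakk>a \<in> carrier (group_ring R GK); b \<in> carrier (group_ring R GK)\<rbrakk> \<Longrightarrow>
    a \<otimes>\<^bsub>group_ring R GK\<^esub> b = a \<otimes>\<^bsub>group_ring R G\<^esub> b"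
  by (simp_all add: group_ring_ops group_ring_one sub.group_ring_one group_ring_zero sub.group_ring_zero
      carrier_group_ring convolution_GK)

lemma left_module_restrict:
  assumes "left_module (group_ring R G) M"
  shows "left_module (group_ring R GK) M"
proof -
  interpret left_module "group_ring R G" M by fact
  show ?thesis
    by (intro left_module.intro left_module_axioms.intro sub.ring_group_ring M.abelian_group_axioms)
       (simp_all add: group_ring_GK_ops carrier_RK_RG smult_l_distr smult_r_distr smult_assoc)
qed

lemma lmodule_hom_restrict:
  assumes f: "lmodule_hom (group_ring R G) M N f"
  shows "lmodule_hom (group_ring R GK) M N f"
  using left_module_restrict[OF lmodule_homD(1)[OF f]] left_module_restrict[OF lmodule_homD(2)[OF f]]
    lmodule_homD(3-5)[OF f] carrier_RK_RG
  by (intro lmodule_homI) auto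

lemma commuting_action_restrict:
  assumes "commuting_action S M (group_ring R G) \<alpha>"
  shows "commuting_action S M (group_ring R GK) \<alpha>"
proof -
  interpret commuting_action S M "group_ring R G" \<alpha> by fact
  show ?thesis
    by (intro commuting_action.intro commuting_action_axioms.intro M.left_module_axioms
        left_module_restrict act.left_module_axioms) (simp add: commute carrier_RK_RG)
qed

lemma res_star: "x \<in> Fun \<Longrightarrow> res (gr_star R G x) = gr_star R GK (res x)"
  by (auto simp: gr_star_def res_def fun_eq_iff inv_GK K_closed)

text \<open>The statement about left convolution, applied over the opposite ring and carried over by
  the involution, which commutes with restriction because \<open>K\<close> is closed under
  inverses.\<close>

lemma res_turned:
  assumes t: "t \<in> carrier (free_module R K)" and x: "x \<in> Fun"
  shows "res (turned t x) = sub.turned t (res x)"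
proof -
  interpret op: ring_subgroup "opposite_ring R" G K by (rule opposite_subgroup)
  have [simp]: "op.res = res" by (simp add: op.res_def res_def fun_eq_iff)
  have c: "convolution (opposite_ring R) G t (gr_star R G x) \<in> Fun"
    using op.convolution_fun[of t "gr_star R G x"] RK_RG[OF t] star_fun[OF x] by simp
  have "res (turned t x) = gr_star R GK (res (convolution (opposite_ring R) G t (gr_star R G x)))"
    using t x c by (simp add: turned_eq_star RG_Fun RK_RG res_star)
  also have "\<dots> = gr_star R GK (convolution (opposite_ring R) GK t (gr_star R GK (res x)))"
    using op.res_convolution[of t "gr_star R G x"] t star_fun[OF x] res_star[OF x] by simp
  also have "\<dots> = sub.turned t (res x)"
    using t x by (simp add: sub.turned_eq_star sub.RG_Fun res_fun)
  finally show ?thesis .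
qed

end

section \<open>The kernel of an epimorphism to the integers\<close>

text \<open>Translation by \<open>h\<close> moves the bound \<kappa> to \<open>t h \<kappa>\<close>.
  One shift works for both sides, as \<phi> takes values in a commutative group. The abstract
  predicate \<open>Q\<close> covers single levels as well as both half-lines.\<close>

lemma (in ring_group) support_family_level:
  assumes "\<And>h g \<kappa>. \<lbrakk>h \<in> carrier G; g \<in> carrier G; Q \<kappa> (h \<otimes>\<^bsub>G\<^esub> g)\<rbrakk> \<Longrightarrow> Q (t h \<kappa>) g"
    and "\<And>h g \<kappa>. \<lbrakk>h \<in> carrier G; g \<in> carrier G; Q \<kappa> (g \<otimes>\<^bsub>G\<^esub> h)\<rbrakk> \<Longrightarrow> Q (t h \<kappa>) g"
  shows "support_family R G (\<lambda>X. \<forall>\<kappa>. finite {g \<in> X. Q \<kappa> g})"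
proof
  show "\<forall>\<kappa>. finite {g \<in> Y. Q \<kappa> g}" if "\<forall>\<kappa>. finite {g \<in> X. Q \<kappa> g}" "Y \<subseteq> X" for X Y
  proof
    fix \<kappa>
    have "{g \<in> Y. Q \<kappa> g} \<subseteq> {g \<in> X. Q \<kappa> g}" using that(2) by auto
    then show "finite {g \<in> Y. Q \<kappa> g}" using that(1) finite_subset by blast
  qed
  show "\<forall>\<kappa>. finite {g \<in> X \<union> Y. Q \<kappa> g}"
    if "\<forall>\<kappa>. finite {g \<in> X. Q \<kappa> g}" "\<forall>\<kappa>. finite {g \<in> Y. Q \<kappa> g}" for X Y
  proof
    fix \<kappa>
    have "{g \<in> X \<union> Y. Q \<kappa> g} = {g \<in> X. Q \<kappa> g} \<union> {g \<in> Y. Q \<kappa> g}" by auto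
    then show "finite {g \<in> X \<union> Y. Q \<kappa> g}" using that by simp
  qed
  fix X h assume X: "\<forall>\<kappa>. finite {g \<in> X. Q \<kappa> g}" "X \<subseteq> carrier G" and h: "h \<in> carrier G"
  show "\<forall>\<kappa>. finite {g \<in> (\<lambda>g. h \<otimes>\<^bsub>G\<^esub> g) ` X. Q \<kappa> g}"
  proof
    fix \<kappa>
    have "{g \<in> (\<lambda>g. h \<otimes>\<^bsub>G\<^esub> g) ` X. Q \<kappa> g} \<subseteq> (\<lambda>g. h \<otimes>\<^bsub>G\<^esub> g) ` {g \<in> X. Q (t h \<kappa>) g}"
      using assms(1) X(2) h by auto
    then show "finite {g \<in> (\<lambda>g. h \<otimes>\<^bsub>G\<^esub> g) ` X. Q \<kappa> g}" using X(1) finite_subset by blast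
  qed
  show "\<forall>\<kappa>. finite {g \<in> (\<lambda>g. g \<otimes>\<^bsub>G\<^esub> h) ` X. Q \<kappa> g}"
  proof
    fix \<kappa>
    have "{g \<in> (\<lambda>g. g \<otimes>\<^bsub>G\<^esub> h) ` X. Q \<kappa> g} \<subseteq> (\<lambda>g. g \<otimes>\<^bsub>G\<^esub> h) ` {g \<in> X. Q (t h \<kappa>) g}"
      using assms(2) X(2) h by auto
    then show "finite {g \<in> (\<lambda>g. g \<otimes>\<^bsub>G\<^esub> h) ` X. Q \<kappa> g}" using X(1) finite_subset by blast
  qed
qed auto

lemma (in ring_group) support_family_finite: "support_family R G finite"
  by unfold_locales (auto intro: finite_subset)

locale integer_kernel = ring_group R G
  for R :: "('r, 'c) ring_scheme" (structure) and G :: "('g, 'd) monoid_scheme" (structure) +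
  fixes \<phi> :: "'g \<Rightarrow> int" and K :: "'g set"
  assumes epi: "\<phi> \<in> epi G integer_group" and K_eq: "K = kernel G integer_group \<phi>"
begin

lemma \<phi>_hom: "\<phi> \<in> hom G integer_group"
  using epi by (simp add: epi_def)

lemma \<phi>_mult: "\<lbrakk>g \<in> carrier G; h \<in> carrier G\<rbrakk> \<Longrightarrow> \<phi> (g \<otimes>\<^bsub>G\<^esub> h) = \<phi> g + \<phi> h"
  using \<phi>_hom by (simp add: hom_def)

lemma \<phi>_one: "\<phi> \<one>\<^bsub>G\<^esub> = 0"
  using \<phi>_mult[of "\<one>\<^bsub>G\<^esub>" "\<one>\<^bsub>G\<^esub>"] by simp

lemma \<phi>_inv: "g \<in> carrier G \<Longrightarrow> \<phi> (inv\<^bsub>G\<^esub> g) = - \<phi> g"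
  using \<phi>_mult[of "inv\<^bsub>G\<^esub> g" g] \<phi>_one by simp

lemma mem_K_iff: "g \<in> K \<longleftrightarrow> g \<in> carrier G \<and> \<phi> g = 0"
  by (simp add: K_eq kernel_def)

sublocale ring_subgroup R G K
proof (intro ring_subgroup.intro ring_group_axioms)
  show "subgroup K G"
  proof (rule G.subgroupI)
    have "\<one>\<^bsub>G\<^esub> \<in> K" by (simp add: mem_K_iff \<phi>_one)
    then show "K \<noteq> {}" by blast
  qed (auto simp: mem_K_iff \<phi>_mult \<phi>_inv)
qed

lemma \<phi>_K: "g \<in> K \<Longrightarrow> \<phi> g = 0"
  using mem_K_iff by blast

lemma K_memI: "\<lbrakk>g \<in> carrier G; \<phi> g = 0\<rbrakk> \<Longrightarrow> g \<in> K"
  using mem_K_iff by blast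

text \<open>A set of representatives for the cosets of \<open>K\<close>, indexed by the integers,
  because the cosets are the level sets of \<phi>.\<close>

definition level_rep :: "int \<Rightarrow> 'g"
  where "level_rep n = (SOME g. g \<in> carrier G \<and> \<phi> g = n)"

lemma level_rep: "level_rep n \<in> carrier G" "\<phi> (level_rep n) = n"
proof -
  have "n \<in> \<phi> ` carrier G" using epi by (simp add: epi_def)
  then have "\<exists>g. g \<in> carrier G \<and> \<phi> g = n" by blast
  then have "level_rep n \<in> carrier G \<and> \<phi> (level_rep n) = n" unfolding level_rep_def by (rule someI_ex)
  then show "level_rep n \<in> carrier G" "\<phi> (level_rep n) = n" by auto
qed

lemma support_family_levels: "support_family R G (\<lambda>X. \<forall>n. finite {g \<in> X. \<phi> g = n})"
  by (rule support_family_level[where t = "\<lambda>h n. n - \<phi> h"]) (auto simp: \<phi>_mult)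

lemma support_family_novikov:
  "support_family R G (\<lambda>X. \<forall>\<kappa>. finite {g \<in> X. real_of_int (\<phi> g) \<le> \<kappa>})"
  "support_family R G (\<lambda>X. \<forall>\<kappa>. finite {g \<in> X. - real_of_int (\<phi> g) \<le> \<kappa>})"
  by (rule support_family_level[where t = "\<lambda>h \<kappa>. \<kappa> - real_of_int (\<phi> h)"]; force simp: \<phi>_mult)
     (rule support_family_level[where t = "\<lambda>h \<kappa>. \<kappa> + real_of_int (\<phi> h)"]; force simp: \<phi>_mult)

sublocale level: support_family R G "\<lambda>X. \<forall>n. finite {g \<in> X. \<phi> g = n}"
  by (rule support_family_levels)

sublocale sub_finite: support_family R GK finite
  by (rule sub.support_family_finite)

section \<open>The coinduced bimodule and its universal property\<close>

abbreviation "L \<equiv> ring_bimodule (convolution_ring R G (\<lambda>X. \<forall>n. finite {g \<in> X. \<phi> g = n}))"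
abbreviation "RK \<equiv> ring_bimodule (group_ring R GK)"

lemma RK_eq: "RK = sub_finite.bimod"
  by (simp add: group_ring_def)

lemma carrier_RK: "carrier RK = carrier (free_module R K)"
  by (simp add: ring_bimodule_def carrier_group_ring)

lemma res_level:
  assumes "x \<in> carrier L"
  shows "res x \<in> carrier RK"
proof -
  have "{g \<in> K. res x g \<noteq> \<zero>} \<subseteq> {g \<in> {g \<in> carrier G. x g \<noteq> \<zero>}. \<phi> g = 0}"
    using \<phi>_K by (auto simp: res_def)
  moreover have "finite {g \<in> {g \<in> carrier G. x g \<noteq> \<zero>}. \<phi> g = 0}"
    using assms unfolding level.bimod_simps(1) by blast
  ultimately have "finite {g \<in> K. res x g \<noteq> \<zero>}" by (rule finite_subset)
  then show ?thesis
    using res_fun[OF level.bimod_Fun[OF assms]] by (simp add: RK_eq sub_finite.bimod_simps(1))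
qed

lemma res_hom: "lmodule_hom (group_ring R GK) L RK res"
  by (rule lmodule_homI)
     (use res_level in \<open>simp_all add: left_module_restrict[OF level.left_module_bimod]
        sub_finite.left_module_bimod[folded RK_eq] level.bimod_simps(2-) carrier_group_ring
        sub_finite.bimod_simps(2-)[folded RK_eq] res_add res_convolution level.bimod_Fun\<close>)

lemma res_equivariant:
  "\<lbrakk>t \<in> carrier (group_ring (opposite_ring R) GK); x \<in> carrier L\<rbrakk> \<Longrightarrow>
    res (turned_action R G L t x) = turned_action R GK RK t (res x)"
  by (simp add: level.bimod_simps(5) sub_finite.bimod_simps(5)[folded RK_eq] carrier_group_ring
      res_turned level.bimod_Fun)

text \<open>By linearity, the value of \<open>f x\<close> at \<open>g\<close> is the value at the
  identity of \<open>f\<close> applied to \<open>x\<close> translated by the inverse of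
  \<open>g\<close>. Restriction to \<open>K\<close> sees the identity, so it determines all
  values.\<close>

lemma coinduced_unique:
  assumes f: "lmodule_hom (group_ring R G) M L f" and f': "lmodule_hom (group_ring R G) M L f'"
    and eq: "\<And>x. x \<in> carrier M \<Longrightarrow> res (f x) = res (f' x)" and x: "x \<in> carrier M"
  shows "f x = f' x"
proof (rule fun_eqI)
  interpret M: left_module "group_ring R G" M by (rule lmodule_homD(1)[OF f])
  show "f x \<in> Fun" "f' x \<in> Fun"
    using lmodule_homD(3)[OF f x] lmodule_homD(3)[OF f' x] by (auto intro: level.bimod_Fun)
  fix g assume g: "g \<in> carrier G"
  let ?a = "monomial R \<one> (inv\<^bsub>G\<^esub> g)"
  have a: "?a \<in> carrier (group_ring R G)" using g by (simp add: carrier_group_ring monoclosed)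
  have f_val: "f x g = res (f (?a \<odot>\<^bsub>M\<^esub> x)) \<one>\<^bsub>G\<^esub>" if f: "lmodule_hom (group_ring R G) M L f" for f
    using convolution_monomial_left[of \<one> "inv\<^bsub>G\<^esub> g" "f x" "\<one>\<^bsub>G\<^esub>"] g K_closed(4)
      level.bimod_Fun[OF lmodule_homD(3)[OF f x]] fun_mem[OF level.bimod_Fun[OF lmodule_homD(3)[OF f x]]]
    by (simp add: lmodule_homD(5)[OF f a x] level.bimod_simps(4) res_def)
  show "f x g = f' x g"
    unfolding f_val[OF f] f_val[OF f'] using eq[OF M.smult_closed[OF a x]] by simp
qed

text \<open>The function \<open>f x\<close> is glued from one element of \<open>RK\<close> for each
  coset of \<open>K\<close>, and nothing links different cosets. Finite support on each level is
  precisely what survives, which is why \<open>L\<close> is the right target.\<close>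

lemma coinduced_exists:
  assumes M: "left_module (group_ring R G) M" and h: "lmodule_hom (group_ring R GK) M RK h"
  shows "\<exists>f. lmodule_hom (group_ring R G) M L f \<and> (\<forall>x\<in>carrier M. res (f x) = h x)"
proof -
  interpret M: left_module "group_ring R G" M by fact
  have mono: "monomial R s g \<in> carrier (group_ring R G)" if "s \<in> carrier R" "g \<in> carrier G" for s g
    using that by (simp add: carrier_group_ring monoclosed)
  have monoK: "monomial R s g \<in> carrier (group_ring R GK)" if "s \<in> carrier R" "g \<in> K" for s g
    using that by (simp add: carrier_group_ring monoclosed)
  have h_fun: "h x \<in> group_functions R GK" if "x \<in> carrier M" for x
    using lmodule_homD(3)[OF h that] by (simp add: RK_eq sub_finite.bimod_Fun)
  have h_mem: "h x g \<in> carrier R" if "x \<in> carrier M" for x g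
    by (rule sub.fun_mem[OF h_fun[OF that]])
  have h_monomial: "h (monomial R s k \<odot>\<^bsub>M\<^esub> x) l = s \<otimes> h x (inv\<^bsub>G\<^esub> k \<otimes>\<^bsub>G\<^esub> l)"
    if "s \<in> carrier R" "k \<in> K" "x \<in> carrier M" "l \<in> K" for s k x l
    using lmodule_homD(5)[OF h monoK[OF that(1,2)] that(3)] sub.convolution_monomial_left[of s k "h x" l]
      that h_fun by (simp add: sub_finite.bimod_simps(4)[folded RK_eq] inv_GK)
  have smult_mono: "monomial R s g \<odot>\<^bsub>M\<^esub> (monomial R t k \<odot>\<^bsub>M\<^esub> x) = monomial R (s \<otimes> t) (g \<otimes>\<^bsub>G\<^esub> k) \<odot>\<^bsub>M\<^esub> x"
    if "s \<in> carrier R" "g \<in> carrier G" "t \<in> carrier R" "k \<in> carrier G" "x \<in> carrier M" for s g t k x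
    using that M.smult_assoc[OF mono mono, of s g t k x] by (simp add: group_ring_ops convolution_monomial)
  \<comment> \<open>forced by \<open>f x g = (g\<^sup>-\<^sup>1 (f x)) 1 = f (g\<^sup>-\<^sup>1 x) 1 = h (g\<^sup>-\<^sup>1 x) 1\<close>\<close>
  define f where "f x = (\<lambda>g. if g \<in> carrier G then h (monomial R \<one> (inv\<^bsub>G\<^esub> g) \<odot>\<^bsub>M\<^esub> x) \<one>\<^bsub>G\<^esub> else \<zero>)" for x
  have f_fun: "f x \<in> Fun" if "x \<in> carrier M" for x
    using that h_mem mono by (simp add: group_functions_def f_def)
  have f_L: "f x \<in> carrier L" if x: "x \<in> carrier M" for x
  proof -
    have "finite {g \<in> {g \<in> carrier G. f x g \<noteq> \<zero>}. \<phi> g = n}" for n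
    proof -
      let ?c = "level_rep n"
      let ?y = "monomial R \<one> (inv\<^bsub>G\<^esub> ?c) \<odot>\<^bsub>M\<^esub> x"
      have c: "?c \<in> carrier G" by (rule level_rep)
      then have y: "?y \<in> carrier M" using x mono by simp
      \<comment> \<open>For \<open>g\<close> on level \<open>n\<close>, written as
        \<open>c k\<close> with \<open>c\<close> the representative and \<open>k\<close> in
        \<open>K\<close>, linearity over \<open>RK\<close> turns \<open>f x g\<close> into
        \<open>h y k\<close>, where \<open>y\<close> is \<open>x\<close> translated by the inverse
        of \<open>c\<close>. The support on this level is a translate of the finite support of
        \<open>h y\<close>.\<close>
      have "{g \<in> {g \<in> carrier G. f x g \<noteq> \<zero>}. \<phi> g = n} \<subseteq> (\<lambda>k. ?c \<otimes>\<^bsub>G\<^esub> k) ` {k. h ?y k \<noteq> \<zero>}"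
      proof
        fix g assume "g \<in> {g \<in> {g \<in> carrier G. f x g \<noteq> \<zero>}. \<phi> g = n}"
        then have g: "g \<in> carrier G" "f x g \<noteq> \<zero>" "\<phi> g = n" by auto
        let ?k = "inv\<^bsub>G\<^esub> ?c \<otimes>\<^bsub>G\<^esub> g"
        have k: "?k \<in> K" using g c level_rep by (intro K_memI) (simp_all add: \<phi>_mult \<phi>_inv)
        have "inv\<^bsub>G\<^esub> ?k \<otimes>\<^bsub>G\<^esub> inv\<^bsub>G\<^esub> ?c = inv\<^bsub>G\<^esub> g"
          using g c by (simp add: G.inv_mult_group G.m_assoc)
        then have "monomial R \<one> (inv\<^bsub>G\<^esub> g) \<odot>\<^bsub>M\<^esub> x = monomial R \<one> (inv\<^bsub>G\<^esub> ?k) \<odot>\<^bsub>M\<^esub> ?y"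
          using smult_mono[of \<one> "inv\<^bsub>G\<^esub> ?k" \<one> "inv\<^bsub>G\<^esub> ?c" x] g c x by simp
        then have "f x g = h ?y ?k"
          using g k c y h_mem[OF y] K_closed(4) h_monomial[of \<one> "inv\<^bsub>G\<^esub> ?k" ?y "\<one>\<^bsub>G\<^esub>"]
          by (simp add: f_def K_closed)
        moreover have "g = ?c \<otimes>\<^bsub>G\<^esub> ?k" using g c by (simp flip: G.m_assoc)
        ultimately show "g \<in> (\<lambda>k. ?c \<otimes>\<^bsub>G\<^esub> k) ` {k. h ?y k \<noteq> \<zero>}" using g by auto
      qed
      moreover have "finite {k. h ?y k \<noteq> \<zero>}"
        using lmodule_homD(3)[OF h y] by (simp add: carrier_RK free_module_def)
      ultimately show ?thesis by (rule finite_surj[rotated])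
    qed
    then show ?thesis using f_fun[OF x] by (simp add: level.bimod_simps(1))
  qed
  have f_add: "f (x \<oplus>\<^bsub>M\<^esub> y) = (\<lambda>g. f x g \<oplus> f y g)" if "x \<in> carrier M" "y \<in> carrier M" for x y
    using that mono lmodule_homD(4)[OF h] M.smult_r_distr
    by (auto simp: f_def fun_eq_iff sub_finite.bimod_simps(2)[folded RK_eq])
  have f_smult: "f (a \<odot>\<^bsub>M\<^esub> x) = convolution R G a (f x)" if a: "a \<in> RG" and x: "x \<in> carrier M" for a x
    using R.ring_axioms a
  proof (induction a rule: free_module_induct)
    case zero
    have "h \<zero>\<^bsub>M\<^esub> = (\<lambda>_. \<zero>)"
      using lmodule_hom_zero[OF h] by (simp add: sub_finite.bimod_simps(3)[folded RK_eq])
    then show ?case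
      using M.smult_zero_left[OF x] mono by (auto simp: f_def group_ring_zero convolution_zero)
  next
    case (monomial s g)
    show ?case
    proof (rule fun_eqI)
      fix k assume k: "k \<in> carrier G"
      let ?l = "inv\<^bsub>G\<^esub> k \<otimes>\<^bsub>G\<^esub> g"
      have l: "?l \<in> carrier G" "inv\<^bsub>G\<^esub> (inv\<^bsub>G\<^esub> g \<otimes>\<^bsub>G\<^esub> k) = ?l"
        using k monomial by (simp_all add: G.inv_mult_group)
      \<comment> \<open>The scalar \<open>s\<close> commutes with group elements inside the group
        ring. Moved to the identity, which belongs to \<open>K\<close>, it is extracted by linearity
        of \<open>h\<close>.\<close>
      have "f (monomial R s g \<odot>\<^bsub>M\<^esub> x) k = h (monomial R s \<one>\<^bsub>G\<^esub> \<odot>\<^bsub>M\<^esub> (monomial R \<one> ?l \<odot>\<^bsub>M\<^esub> x)) \<one>\<^bsub>G\<^esub>"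
        using k monomial x l by (simp add: f_def smult_mono)
      also have "\<dots> = s \<otimes> h (monomial R \<one> ?l \<odot>\<^bsub>M\<^esub> x) \<one>\<^bsub>G\<^esub>"
        using h_monomial[OF monomial(1) K_closed(4) M.smult_closed[OF mono[OF R.one_closed l(1)] x] K_closed(4)]
        by simp
      also have "\<dots> = convolution R G (monomial R s g) (f x) k"
        using k monomial x l f_fun by (simp add: convolution_monomial_left) (simp add: f_def)
      finally show "f (monomial R s g \<odot>\<^bsub>M\<^esub> x) k = convolution R G (monomial R s g) (f x) k" .
    qed (use monomial x f_fun mono in \<open>simp_all add: convolution_fun monoclosed\<close>)
  next
    case (add a b)
    then have "a \<in> carrier (group_ring R G)" "b \<in> carrier (group_ring R G)"
      by (simp_all add: carrier_group_ring)
    then show ?case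
      using add x M.smult_l_distr[of a b x] f_add[of "a \<odot>\<^bsub>M\<^esub> x" "b \<odot>\<^bsub>M\<^esub> x"] f_fun
      by (simp add: group_ring_ops convolution_fun_add_left)
  qed
  have "lmodule_hom (group_ring R G) M L f"
    by (rule lmodule_homI)
       (simp_all add: M level.left_module_bimod f_L f_add f_smult level.bimod_simps(2,4) carrier_group_ring)
  moreover have "res (f x) = h x" if x: "x \<in> carrier M" for x
  proof (rule sub.fun_eqI[OF res_fun[OF f_fun[OF x]] h_fun[OF x]])
    fix k assume "k \<in> carrier GK"
    then show "res (f x) k = h x k"
      using x h_monomial[of \<one> "inv\<^bsub>G\<^esub> k" x "\<one>\<^bsub>G\<^esub>"] h_mem[OF x] by (simp add: res_def f_def K_closed)
  qed
  ultimately show ?thesis by blast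
qed

text \<open>
  \<open>RG\<close> is free over \<open>RK\<close> on the elements \<open>level_rep n\<close>; the index \<open>(b, n)\<close> stands for the basis
  element \<open>level_rep n \<cdot> b\<close>.
\<close>

lemma free_module_restrict:
  fixes B :: "'b set"
  shows "\<exists>u v. retract_of_free (group_ring R GK) (free_module (group_ring R G) B) (B \<times> (UNIV :: int set)) u v"
proof -
  let ?F = "free_module (group_ring R G) B" and ?F' = "free_module (group_ring R GK) (B \<times> (UNIV :: int set))"
  \<comment> \<open>The coordinate at \<open>(b, n)\<close> sends \<open>k\<close> in
    \<open>K\<close> to the value of \<open>x b\<close> at \<open>k\<close> times
    \<open>level_rep n\<close>: the part of \<open>x b\<close> on level \<open>n\<close>, translated
    back to \<open>K\<close>. A translation on the right commutes with the left multiplication by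
    \<open>RK\<close>.\<close>
  define u where "u x = (\<lambda>(b, n). res (turned (monomial R \<one> (level_rep n)) (x b)))" for x :: "'b \<Rightarrow> 'g \<Rightarrow> 'r"
  \<comment> \<open>Each \<open>g\<close> is uniquely an element of \<open>K\<close> times the
    representative of its level; the value at \<open>g\<close> is read off from the coordinate of
    that level.\<close>
  define v where "v y = (\<lambda>b g. if g \<in> carrier G then y (b, \<phi> g) (g \<otimes>\<^bsub>G\<^esub> inv\<^bsub>G\<^esub> level_rep (\<phi> g)) else \<zero>)"
    for y :: "'b \<times> int \<Rightarrow> 'g \<Rightarrow> 'r"
  note zero = group_ring_zero sub.group_ring_zero
  have F: "x b \<in> RG" if "x \<in> carrier ?F" for x b
    using free_module_mem[OF ring_group_ring that] by (simp add: carrier_group_ring)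
  have F': "y p \<in> carrier (free_module R K)" if "y \<in> carrier ?F'" for y p
    using free_module_mem[OF sub.ring_group_ring that] by (simp add: carrier_group_ring)
  have u_apply: "u x (b, n) k = (if k \<in> K then x b (k \<otimes>\<^bsub>G\<^esub> level_rep n) else \<zero>)" if "x \<in> carrier ?F" for x b n k
    using F[OF that, of b] K_closed(1) level_rep
    by (simp add: u_def res_def turned_monomial RG_Fun mem)
  have u_closed: "u x \<in> carrier ?F'" if x: "x \<in> carrier ?F" for x
  proof -
    have fin: "finite {g. x b g \<noteq> \<zero>}" for b using F[OF x, of b] by (simp add: free_module_def)
    have "u x (b, n) \<in> carrier (free_module R K)" for b n
    proof (rule free_module_carrierI)
      show "finite ((\<lambda>g. g \<otimes>\<^bsub>G\<^esub> inv\<^bsub>G\<^esub> level_rep n) ` {g. x b g \<noteq> \<zero>})" using fin by simp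
      show "u x (b, n) k = \<zero>" if "k \<notin> (\<lambda>g. g \<otimes>\<^bsub>G\<^esub> inv\<^bsub>G\<^esub> level_rep n) ` {g. x b g \<noteq> \<zero>}" for k
      proof (rule ccontr)
        assume "u x (b, n) k \<noteq> \<zero>"
        then have "k \<in> K" "x b (k \<otimes>\<^bsub>G\<^esub> level_rep n) \<noteq> \<zero>" using u_apply[OF x] by (auto split: if_splits)
        moreover from this have "k = (k \<otimes>\<^bsub>G\<^esub> level_rep n) \<otimes>\<^bsub>G\<^esub> inv\<^bsub>G\<^esub> level_rep n"
          using level_rep K_closed(1) by (simp add: G.m_assoc)
        ultimately show False using that by blast
      qed
    qed (use mem[OF F[OF x]] u_apply[OF x] in auto)
    \<comment> \<open>Only finitely many coordinates are nonzero, because finitely many finite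
      supports meet only finitely many levels.\<close>
    moreover have "u x (b, n) = (\<lambda>_. \<zero>)" if "(b, n) \<notin> (\<Union>b\<in>{b. x b \<noteq> (\<lambda>_. \<zero>)}. {b} \<times> \<phi> ` {g. x b g \<noteq> \<zero>})" for b n
    proof
      fix k
      show "u x (b, n) k = \<zero>"
      proof (rule ccontr)
        assume "u x (b, n) k \<noteq> \<zero>"
        then have k: "k \<in> K" "x b (k \<otimes>\<^bsub>G\<^esub> level_rep n) \<noteq> \<zero>" using u_apply[OF x] by (auto split: if_splits)
        moreover from k have "\<phi> (k \<otimes>\<^bsub>G\<^esub> level_rep n) = n"
          using level_rep K_closed(1) by (simp add: \<phi>_mult \<phi>_K)
        ultimately show False using that by force
      qed
    qed
    moreover have "finite (\<Union>b\<in>{b. x b \<noteq> (\<lambda>_. \<zero>)}. {b} \<times> \<phi> ` {g. x b g \<noteq> \<zero>})"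
      using x fin by (auto simp: free_module_def zero)
    moreover have "x b = (\<lambda>_. \<zero>)" if "b \<notin> B" for b
      using x that by (simp add: free_module_def zero)
    ultimately show ?thesis
      by (intro free_module_carrierI[where F = "\<Union>b\<in>{b. x b \<noteq> (\<lambda>_. \<zero>)}. {b} \<times> \<phi> ` {g. x b g \<noteq> \<zero>}"])
         (auto simp: carrier_group_ring zero)
  qed
  have v_closed: "v y \<in> carrier ?F" if y: "y \<in> carrier ?F'" for y
  proof -
    have fin: "finite {p. y p \<noteq> (\<lambda>_. \<zero>)}" using y by (simp add: free_module_def zero)
    have fin': "finite {k. y p k \<noteq> \<zero>}" for p using F'[OF y, of p] by (simp add: free_module_def)
    have "v y b \<in> RG" for b
    proof (rule free_module_carrierI)
      let ?X = "\<Union>p\<in>{p. y p \<noteq> (\<lambda>_. \<zero>)}. (\<lambda>k. k \<otimes>\<^bsub>G\<^esub> level_rep (snd p)) ` {k. y p k \<noteq> \<zero>}"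
      show "finite ?X" using fin fin' by simp
      show "v y b g = \<zero>" if "g \<notin> ?X" for g
      proof (rule ccontr)
        assume "v y b g \<noteq> \<zero>"
        then have g: "g \<in> carrier G" "y (b, \<phi> g) (g \<otimes>\<^bsub>G\<^esub> inv\<^bsub>G\<^esub> level_rep (\<phi> g)) \<noteq> \<zero>"
          by (auto simp: v_def split: if_splits)
        then have "g = g \<otimes>\<^bsub>G\<^esub> inv\<^bsub>G\<^esub> level_rep (\<phi> g) \<otimes>\<^bsub>G\<^esub> level_rep (\<phi> g)"
          using level_rep by (simp add: G.m_assoc)
        then have "g \<in> ?X" using g by (intro UN_I[of "(b, \<phi> g)"]) auto
        then show False using that by simp
      qed
    qed (use mem[OF F'[OF y]] in \<open>auto simp: v_def\<close>)
    moreover have "v y b = (\<lambda>_. \<zero>)" if "b \<notin> fst ` {p. y p \<noteq> (\<lambda>_. \<zero>)}" for b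
    proof -
      have "y (b, n) = (\<lambda>_. \<zero>)" for n using that by force
      then show ?thesis by (simp add: v_def fun_eq_iff)
    qed
    moreover have "v y b = (\<lambda>_. \<zero>)" if "b \<notin> B" for b
      using y that by (simp add: free_module_def v_def zero fun_eq_iff)
    moreover have "finite (fst ` {p. y p \<noteq> (\<lambda>_. \<zero>)})" using fin by simp
    ultimately show ?thesis
      by (intro free_module_carrierI[where F = "fst ` {p. y p \<noteq> (\<lambda>_. \<zero>)}"]) (auto simp: carrier_group_ring zero)
  qed
  have vu: "v (u x) = x" if x: "x \<in> carrier ?F" for x
  proof (intro ext)
    fix b g
    show "v (u x) b g = x b g"
    proof (cases "g \<in> carrier G")
      case True
      then have "g \<otimes>\<^bsub>G\<^esub> inv\<^bsub>G\<^esub> level_rep (\<phi> g) \<in> K"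
        using level_rep by (intro K_memI) (simp_all add: \<phi>_mult \<phi>_inv)
      moreover have "g \<otimes>\<^bsub>G\<^esub> inv\<^bsub>G\<^esub> level_rep (\<phi> g) \<otimes>\<^bsub>G\<^esub> level_rep (\<phi> g) = g"
        using True level_rep by (simp add: G.m_assoc)
      ultimately show ?thesis using True by (simp add: v_def u_apply[OF x])
    next
      case False
      then show ?thesis using F[OF x, of b] by (simp add: v_def free_module_def)
    qed
  qed
  have uv: "u (v y) = y" if y: "y \<in> carrier ?F'" for y
  proof (intro ext)
    fix p :: "'b \<times> int" and k
    obtain b n where p: "p = (b, n)" by (cases p)
    show "u (v y) p k = y p k"
    proof (cases "k \<in> K")
      case True
      then have "k \<otimes>\<^bsub>G\<^esub> level_rep n \<in> carrier G" "\<phi> (k \<otimes>\<^bsub>G\<^esub> level_rep n) = n"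
        "k \<otimes>\<^bsub>G\<^esub> level_rep n \<otimes>\<^bsub>G\<^esub> inv\<^bsub>G\<^esub> level_rep n = k"
        using level_rep by (simp_all add: \<phi>_K \<phi>_mult G.m_assoc)
      then show ?thesis using True by (simp add: p u_apply[OF v_closed[OF y]]) (simp add: v_def)
    next
      case False
      then show ?thesis using F'[OF y, of p] by (simp add: p u_apply[OF v_closed[OF y]] free_module_def)
    qed
  qed
  have u: "lmodule_hom (group_ring R GK) ?F ?F' u"
  proof (rule lmodule_homI)
    show "left_module (group_ring R GK) ?F"
      by (intro left_module_restrict left_module_free_module ring_group_ring)
    show "left_module (group_ring R GK) ?F'"
      by (intro left_module_free_module sub.ring_group_ring)
    show "u x \<in> carrier ?F'" if "x \<in> carrier ?F" for x by (rule u_closed[OF that])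
    show "u (x \<oplus>\<^bsub>?F\<^esub> y) = u x \<oplus>\<^bsub>?F'\<^esub> u y" if "x \<in> carrier ?F" "y \<in> carrier ?F" for x y
      using F[OF that(1)] F[OF that(2)] level_rep
      by (auto simp: u_def fun_eq_iff group_ring_ops turned_add_right RG_Fun monoclosed res_def)
    show "u (a \<odot>\<^bsub>?F\<^esub> x) = a \<odot>\<^bsub>?F'\<^esub> u x" if a: "a \<in> carrier (group_ring R GK)" and x: "x \<in> carrier ?F" for a x
      using F[OF x] level_rep a
      by (auto simp: u_def fun_eq_iff group_ring_ops carrier_group_ring turned_convolution RG_Fun RK_RG
          monoclosed res_convolution turned_fun)
  qed
  have "lmodule_hom (group_ring R GK) ?F' ?F v"
    by (rule lmodule_hom_inverse[OF u]) (fact v_closed uv vu)+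
  then show ?thesis using u vu unfolding retract_of_free_def by blast
qed

text \<open>Kernels and images do not depend on the scalars, so exactness carries over as it stands.
  Projectivity is the only point that has to be established again.\<close>

lemma projective_resolution_restrict:
  fixes A :: "('g \<Rightarrow> 'r, 'a) module"
  assumes A: "left_module (group_ring R G) A"
  shows "projective_resolution (group_ring R GK) (resolution (group_ring R G) A) (res_diff (group_ring R G)) A
    (res_augmentation (group_ring R G) A)
    (\<lambda>n. (if n < 0 then {} else res_basis (group_ring R G) A (nat n)) \<times> (UNIV :: int set))"
proof -
  interpret projective_resolution "group_ring R G" "resolution (group_ring R G) A" "res_diff (group_ring R G)" A
    "res_augmentation (group_ring R G) A" "\<lambda>n. if n < 0 then {} else res_basis (group_ring R G) A (nat n)"
    by (rule projective_resolution_resolution[OF A])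
  show ?thesis
  proof (intro projective_resolution.intro lmodule_hom_restrict d_hom \<epsilon>_hom)
    show "\<exists>u v. retract_of_free (group_ring R GK) (resolution (group_ring R G) A n)
        ((if n < 0 then {} else res_basis (group_ring R G) A (nat n)) \<times> (UNIV :: int set)) u v" for n
      unfolding resolution_def by (rule free_module_restrict)
  qed (fact d_d d_nonpos trivial_neg \<epsilon>_surj \<epsilon>_d exact_zero exact)+
qed

end

section \<open>Permutation modules\<close>

text \<open>The augmentation, in one form for the group ring and for permutation modules on
  cosets.\<close>

definition total :: "('r, 'c) ring_scheme \<Rightarrow> ('b \<Rightarrow> 'r) \<Rightarrow> 'r"
  where "total R x = (\<Oplus>\<^bsub>R\<^esub>b\<in>{b. x b \<noteq> \<zero>\<^bsub>R\<^esub>}. x b)"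

context ring
begin

lemmas free_mem = free_module_mem[OF ring_axioms]

lemma total_eq:
  assumes "x \<in> carrier (free_module R B)" and "finite F" and "{b. x b \<noteq> \<zero>} \<subseteq> F"
  shows "total R x = (\<Oplus>b\<in>F. x b)"
  unfolding total_def using assms free_mem[OF assms(1)] by (intro finsum_support_eq) auto

lemma total_closed: "x \<in> carrier (free_module R B) \<Longrightarrow> total R x \<in> carrier R"
  unfolding total_def using free_mem by (intro finsum_closed) auto

lemma total_zero: "total R (\<lambda>_. \<zero>) = \<zero>"
  by (simp add: total_def)

lemma total_monomial: "s \<in> carrier R \<Longrightarrow> total R (monomial R s b) = s"
  by (subst total_eq[OF monomial_closed[OF ring_axioms, of s b UNIV], of "{b}"]) (auto simp: monomial_def)

lemma total_add:
  assumes x: "x \<in> carrier (free_module R B)" and y: "y \<in> carrier (free_module R B)"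
  shows "total R (\<lambda>b. x b \<oplus> y b) = total R x \<oplus> total R y"
proof -
  interpret F: left_module R "free_module R B" by (rule left_module_free_module) (rule ring_axioms)
  let ?F = "{b. x b \<noteq> \<zero>} \<union> {b. y b \<noteq> \<zero>}"
  have F: "finite ?F" using x y by (auto simp: free_module_def)
  have xy: "(\<lambda>b. x b \<oplus> y b) \<in> carrier (free_module R B)" using F.M.add.m_closed[OF x y] by simp
  have "total R (\<lambda>b. x b \<oplus> y b) = (\<Oplus>b\<in>?F. x b \<oplus> y b)"
    using F by (intro total_eq[OF xy]) auto
  also have "\<dots> = (\<Oplus>b\<in>?F. x b) \<oplus> (\<Oplus>b\<in>?F. y b)"
    using free_mem[OF x] free_mem[OF y] by (intro finsum_addf) auto
  also have "\<dots> = total R x \<oplus> total R y"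
    using total_eq[OF x F] total_eq[OF y F] by simp
  finally show ?thesis .
qed

lemma total_smult:
  assumes s: "s \<in> carrier R" and x: "x \<in> carrier (free_module R B)"
  shows "total R (\<lambda>b. s \<otimes> x b) = s \<otimes> total R x"
proof -
  interpret F: left_module R "free_module R B" by (rule left_module_free_module) (rule ring_axioms)
  have F: "finite {b. x b \<noteq> \<zero>}" using x by (auto simp: free_module_def)
  have sx: "(\<lambda>b. s \<otimes> x b) \<in> carrier (free_module R B)" using F.smult_closed[OF s x] by simp
  have "total R (\<lambda>b. s \<otimes> x b) = (\<Oplus>b\<in>{b. x b \<noteq> \<zero>}. s \<otimes> x b)"
    using F s by (intro total_eq[OF sx]) auto
  also have "\<dots> = s \<otimes> total R x"
    unfolding total_def using F s free_mem[OF x] by (intro finsum_rdistr[symmetric]) auto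
  finally show ?thesis .
qed

end

lemma free_module_outside: "\<lbrakk>x \<in> carrier (free_module S B); b \<notin> B\<rbrakk> \<Longrightarrow> x b = \<zero>\<^bsub>S\<^esub>"
  by (simp add: free_module_def)

definition pullback :: "('r, 'c) ring_scheme \<Rightarrow> 'a set \<Rightarrow> ('a \<Rightarrow> 'b) \<Rightarrow> ('b \<Rightarrow> 'r) \<Rightarrow> 'a \<Rightarrow> 'r"
  where "pullback R A \<pi> x = (\<lambda>a. if a \<in> A then x (\<pi> a) else \<zero>\<^bsub>R\<^esub>)"

context ring
begin

lemma pullback_closed:
  assumes \<pi>: "bij_betw \<pi> A B" and x: "x \<in> carrier (free_module R B)"
  shows "pullback R A \<pi> x \<in> carrier (free_module R A)"
proof (rule free_module_carrierI)
  show "finite (inv_into A \<pi> ` {b. x b \<noteq> \<zero>})" using x by (simp add: free_module_def)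
  show "pullback R A \<pi> x a = \<zero>" if "a \<notin> inv_into A \<pi> ` {b. x b \<noteq> \<zero>}" for a
    using that bij_betw_inv_into_left[OF \<pi>] by (force simp: pullback_def)
qed (use free_mem[OF x] in \<open>auto simp: pullback_def\<close>)

text \<open>Used for two bijections: translation of cosets, which makes the augmentation linear, and
  the Mackey bijection, which makes the augmentations of the two tuples correspond.\<close>

lemma total_pullback:
  assumes \<pi>: "bij_betw \<pi> A B" and x: "x \<in> carrier (free_module R B)"
  shows "total R (pullback R A \<pi> x) = total R x"
proof -
  let ?F = "{b. x b \<noteq> \<zero>}" and ?E = "{a \<in> A. x (\<pi> a) \<noteq> \<zero>}"
  have F: "?F = \<pi> ` ?E"
  proof -
    have "?F \<subseteq> B" using x by (auto simp: free_module_def)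
    then show ?thesis using \<pi> by (auto simp: bij_betw_def)
  qed
  have inj: "inj_on \<pi> ?E" using \<pi> by (auto simp: bij_betw_def inj_on_def)
  have "total R x = (\<Oplus>b\<in>\<pi> ` ?E. x b)" unfolding total_def by (simp only: F)
  also have "\<dots> = (\<Oplus>a\<in>?E. x (\<pi> a))"
    using free_mem[OF x] inj by (intro finsum_reindex) auto
  also have "\<dots> = (\<Oplus>a\<in>{a. pullback R A \<pi> x a \<noteq> \<zero>}. pullback R A \<pi> x a)"
    using free_mem[OF x] by (intro finsum_cong') (auto simp: pullback_def split: if_splits)
  finally show ?thesis by (simp add: total_def)
qed

lemma pullback_pullback:
  assumes \<pi>: "bij_betw \<pi> A B"
  shows "x \<in> carrier (free_module R A) \<Longrightarrow> pullback R A \<pi> (pullback R B (inv_into A \<pi>) x) = x"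
    and "y \<in> carrier (free_module R B) \<Longrightarrow> pullback R B (inv_into A \<pi>) (pullback R A \<pi> y) = y"
  using bij_betw_inv_into_left[OF \<pi>] bij_betw_inv_into_right[OF \<pi>] bij_betwE[OF \<pi>]
    bij_betwE[OF bij_betw_inv_into[OF \<pi>]]
  by (auto simp: pullback_def fun_eq_iff free_module_def)

lemma finsum_Sigma:
  assumes "finite A" and "\<And>i. i \<in> A \<Longrightarrow> finite (B i)"
    and "\<And>i b. i \<in> A \<Longrightarrow> b \<in> B i \<Longrightarrow> f i b \<in> carrier R"
  shows "(\<Oplus>i\<in>A. \<Oplus>b\<in>B i. f i b) = (\<Oplus>p\<in>Sigma A B. case_prod f p)"
  using assms
proof (induction A rule: finite_induct)
  case (insert i A)
  have eq: "Sigma (insert i A) B = Pair i ` B i \<union> Sigma A B" by auto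
  have "(\<Oplus>p\<in>Sigma (insert i A) B. case_prod f p)
      = (\<Oplus>p\<in>Pair i ` B i. case_prod f p) \<oplus> (\<Oplus>p\<in>Sigma A B. case_prod f p)"
    unfolding eq using insert by (intro finsum_Un_disjoint) auto
  also have "(\<Oplus>p\<in>Pair i ` B i. case_prod f p) = (\<Oplus>b\<in>B i. f i b)"
    using insert by (subst finsum_reindex) (auto simp: inj_on_def)
  finally show ?case using insert by simp
qed simp

end

section \<open>Direct sums of coset modules and the kernel of the augmentation\<close>

lemma left_module_direct_sum:
  assumes "ring S" and M: "\<And>i. i \<in> I \<Longrightarrow> left_module S (M i)"
  shows "left_module S (direct_sum I M)"
proof -
  let ?D = "direct_sum I M"
  have abel: "abelian_group (M i)" if "i \<in> I" for i using M[OF that] by (simp add: left_module_def)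
  have carrierI: "(\<lambda>i\<in>I. f i) \<in> carrier ?D"
    if "\<And>i. i \<in> I \<Longrightarrow> f i \<in> carrier (M i)" "finite F" "\<And>i. i \<in> I \<Longrightarrow> i \<notin> F \<Longrightarrow> f i = \<zero>\<^bsub>M i\<^esub>" for f F
  proof -
    have "{i \<in> I. (\<lambda>i\<in>I. f i) i \<noteq> \<zero>\<^bsub>M i\<^esub>} \<subseteq> F" using that(3) by auto
    then have "finite {i \<in> I. (\<lambda>i\<in>I. f i) i \<noteq> \<zero>\<^bsub>M i\<^esub>}" using that(2) by (rule finite_subset)
    then show ?thesis using that(1) by (simp add: direct_sum_def)
  qed
  have mem: "x i \<in> carrier (M i)" if "x \<in> carrier ?D" "i \<in> I" for x i
    using that by (simp add: direct_sum_def)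
  have fin: "finite {i \<in> I. x i \<noteq> \<zero>\<^bsub>M i\<^esub>}" if "x \<in> carrier ?D" for x
    using that by (simp add: direct_sum_def)
  have eqI: "x = y" if "x \<in> extensional I" "y \<in> extensional I" "\<And>i. i \<in> I \<Longrightarrow> x i = y i" for x y
    using that by (rule extensionalityI)
  have ext: "x \<in> extensional I" if "x \<in> carrier ?D" for x
    using that by (simp add: direct_sum_def)
  have ops: "x \<oplus>\<^bsub>?D\<^esub> y = (\<lambda>i\<in>I. x i \<oplus>\<^bsub>M i\<^esub> y i)" "\<zero>\<^bsub>?D\<^esub> = (\<lambda>i\<in>I. \<zero>\<^bsub>M i\<^esub>)"
    "a \<odot>\<^bsub>?D\<^esub> x = (\<lambda>i\<in>I. a \<odot>\<^bsub>M i\<^esub> x i)" for x y a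
    by (simp_all add: direct_sum_def)
  note MG = abel[THEN abelian_group.axioms(1)]
  show ?thesis
  proof (rule left_moduleI)
    show "x \<oplus>\<^bsub>?D\<^esub> y \<in> carrier ?D" if x: "x \<in> carrier ?D" and y: "y \<in> carrier ?D" for x y
      unfolding ops
      by (rule carrierI[where F = "{i \<in> I. x i \<noteq> \<zero>\<^bsub>M i\<^esub>} \<union> {i \<in> I. y i \<noteq> \<zero>\<^bsub>M i\<^esub>}"])
         (use fin[OF x] fin[OF y] mem[OF x] mem[OF y] MG in
           \<open>auto simp: abelian_monoid.a_closed abelian_monoid.l_zero abelian_monoid.zero_closed\<close>)
    show "\<zero>\<^bsub>?D\<^esub> \<in> carrier ?D"
      unfolding ops by (rule carrierI[where F = "{}"]) (use MG in \<open>auto simp: abelian_monoid.zero_closed\<close>)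
    show "\<exists>y\<in>carrier ?D. y \<oplus>\<^bsub>?D\<^esub> x = \<zero>\<^bsub>?D\<^esub>" if x: "x \<in> carrier ?D" for x
    proof (rule bexI)
      show "(\<lambda>i\<in>I. \<zero>\<^bsub>M i\<^esub> \<ominus>\<^bsub>M i\<^esub> x i) \<oplus>\<^bsub>?D\<^esub> x = \<zero>\<^bsub>?D\<^esub>"
        unfolding ops using mem[OF x] M MG
        by (intro restrict_ext) (simp add: left_module.diff_add_cancel[OF M] abelian_monoid.zero_closed)
      show "(\<lambda>i\<in>I. \<zero>\<^bsub>M i\<^esub> \<ominus>\<^bsub>M i\<^esub> x i) \<in> carrier ?D"
        by (rule carrierI[where F = "{i \<in> I. x i \<noteq> \<zero>\<^bsub>M i\<^esub>}"])
           (use fin[OF x] mem[OF x] M MG abel in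
             \<open>auto simp: left_module.diff_zero[OF M] abelian_monoid.zero_closed abelian_group.minus_closed\<close>)
    qed
    show "a \<odot>\<^bsub>?D\<^esub> x \<in> carrier ?D" if a: "a \<in> carrier S" and x: "x \<in> carrier ?D" for a x
      unfolding ops
      by (rule carrierI[where F = "{i \<in> I. x i \<noteq> \<zero>\<^bsub>M i\<^esub>}"])
         (use fin[OF x] mem[OF x] M a in \<open>auto simp: left_module.smult_closed[OF M] left_module.smult_zero_right[OF M]\<close>)
    show "\<zero>\<^bsub>?D\<^esub> \<oplus>\<^bsub>?D\<^esub> x = x" if x: "x \<in> carrier ?D" for x
      unfolding ops by (rule eqI) (use x mem[OF x] ext[OF x] MG in \<open>auto simp: abelian_monoid.l_zero\<close>)
    show "\<one>\<^bsub>S\<^esub> \<odot>\<^bsub>?D\<^esub> x = x" if x: "x \<in> carrier ?D" for x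
      unfolding ops by (rule eqI) (use x mem[OF x] ext[OF x] M in \<open>auto simp: left_module.smult_one[OF M]\<close>)
  qed (use assms(1) mem MG M in \<open>auto simp: ops abelian_monoid.a_assoc abelian_monoid.a_comm
        left_module.smult_l_distr[OF M] left_module.smult_r_distr[OF M] left_module.smult_assoc[OF M] intro!: restrict_ext\<close>)
qed

context ring_group
begin

lemma total_convolution:
  assumes a: "a \<in> RG" and b: "b \<in> RG"
  shows "total R (convolution R G a b) = total R a \<otimes> total R b"
  using R.ring_axioms a
proof (induction a rule: free_module_induct)
  case zero
  show ?case using R.total_closed[OF b] by (simp add: convolution_zero R.total_zero)
next
  case (monomial s g)
  note sg = this
  show ?case
    using R.ring_axioms b
  proof (induction b rule: free_module_induct)
    case zero
    show ?case using sg by (simp add: convolution_zero R.total_zero R.total_monomial)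
  next
    case (monomial t k)
    then show ?case using sg by (simp add: convolution_monomial R.total_monomial)
  next
    case (add b c)
    then show ?case
      using sg by (simp add: convolution_add_right monoclosed R.total_monomial
          R.total_add[OF convolution_closed convolution_closed] R.total_add[of b "carrier G" c]
          R.total_closed[of b] R.total_closed[of c] R.r_distr)
  qed
next
  case (add a a')
  then show ?case
    using b by (simp add: convolution_add_left R.total_add[OF convolution_closed convolution_closed]
        R.total_add[of a "carrier G" a'] R.total_closed[of _ "carrier G"] R.l_distr)
qed

lemma trivial_module_simps:
  "carrier (trivial_module R G) = carrier R" "x \<oplus>\<^bsub>trivial_module R G\<^esub> y = x \<oplus> y"
  "\<zero>\<^bsub>trivial_module R G\<^esub> = \<zero>"
  "a \<in> RG \<Longrightarrow> a \<odot>\<^bsub>trivial_module R G\<^esub> r = total R a \<otimes> r"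
proof -
  assume "a \<in> RG"
  then have "{g \<in> carrier G. a g \<noteq> \<zero>} = {g. a g \<noteq> \<zero>}" by (auto simp: free_module_def)
  then show "a \<odot>\<^bsub>trivial_module R G\<^esub> r = total R a \<otimes> r" by (simp add: trivial_module_def total_def)
qed (simp_all add: trivial_module_def)

lemma left_module_trivial: "left_module (group_ring R G) (trivial_module R G)"
  by (rule left_moduleI)
     (auto simp: ring_group_ring carrier_group_ring group_ring_ops group_ring_one trivial_module_simps
        R.total_closed[of _ "carrier G"] R.total_add[of _ "carrier G"] total_convolution R.total_monomial
        convolution_closed add_closed monoclosed R.a_ac R.l_distr R.r_distr R.m_assoc
        intro!: bexI[of _ "\<ominus> _"] R.l_neg)

end

context ring_subgroup
begin

lemma coset_setting: "coset_module_setting R G K"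
  by (intro coset_module_setting.intro R.ring_axioms G.group_axioms K.subgroup_axioms)

text \<open>Presents the coset module as a quotient of \<open>RG\<close>, from which closure,
  associativity and the unit law of the action are inherited. In this context \<open>K\<close> is an
  arbitrary subgroup; later it is replaced by the members of a family.\<close>

lemma coset_tensor_surj:
  assumes "x \<in> carrier (free_module R (lcosets\<^bsub>G\<^esub> K))"
  shows "\<exists>b\<in>RG. x = coset_tensor R G K b \<one>"
  using R.ring_axioms assms
proof (induction x rule: free_module_induct)
  case zero
  have "(\<lambda>_. \<zero>) \<in> RG" by (simp add: free_module_def)
  then show ?case
    using coset_module_setting.coset_tensor_zero[OF coset_setting, of \<one>] by (intro bexI[of _ "\<lambda>_. \<zero>"]) simp_all
next
  case (monomial s C)
  then obtain g where g: "g \<in> carrier G" "C = g <#\<^bsub>G\<^esub> K" by (auto simp: LCOSETS_def)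
  then have "monomial R s C = coset_tensor R G K (monomial R s g) \<one>"
    using monomial coset_module_setting.coset_tensor_monomial[OF coset_setting, of s g \<one>] by simp
  then show ?case using monomial(1) g(1) by (intro bexI[of _ "monomial R s g"]) (simp_all add: monoclosed)
next
  case (add x y)
  then obtain b c where "b \<in> RG" "c \<in> RG" "x = coset_tensor R G K b \<one>" "y = coset_tensor R G K c \<one>"
    by blast
  then show ?case
    using coset_module_setting.coset_tensor_add_left[OF coset_setting, of b c \<one>] add_closed[of b "carrier G" c]
    by (intro bexI[of _ "\<lambda>g. b g \<oplus> c g"]) simp_all
qed

lemma left_module_coset_module: "left_module (group_ring R G) (coset_module R G K)"
proof -
  interpret cos: coset_module_setting R G K by (rule coset_setting)
  let ?M = "coset_module R G K"
  interpret F: left_module R "free_module R (lcosets\<^bsub>G\<^esub> K)"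
    by (rule left_module_free_module) (rule R.ring_axioms)
  have zero: "\<zero>\<^bsub>?M\<^esub> = (\<lambda>_. \<zero>)" by (simp add: coset_module_def)
  show ?thesis
  proof (rule left_moduleI)
    show "ring (group_ring R G)" by (rule ring_group_ring)
    show "\<exists>y\<in>carrier ?M. y \<oplus>\<^bsub>?M\<^esub> x = \<zero>\<^bsub>?M\<^esub>" if "x \<in> carrier ?M" for x
      using that F.M.l_neg[of x] F.M.a_inv_closed[of x] by (auto simp: coset_module_simps zero)
    show "\<zero>\<^bsub>?M\<^esub> \<in> carrier ?M" by (simp add: zero coset_module_simps free_module_def)
    fix a x assume a: "a \<in> carrier (group_ring R G)" and x: "x \<in> carrier ?M"
    obtain b where b: "b \<in> RG" "x = coset_tensor R G K b \<one>"
      using coset_tensor_surj[of x] x by (auto simp: coset_module_simps)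
    then have ax: "a \<odot>\<^bsub>?M\<^esub> x = coset_tensor R G K (convolution R G a b) \<one>" if "a \<in> RG" for a
      using that by (simp add: cos.coset_tensor_linear)
    then show "a \<odot>\<^bsub>?M\<^esub> x \<in> carrier ?M"
      using a b by (simp add: carrier_group_ring coset_module_simps cos.coset_tensor_closed convolution_closed)
    show "(a' \<otimes>\<^bsub>group_ring R G\<^esub> a) \<odot>\<^bsub>?M\<^esub> x = a' \<odot>\<^bsub>?M\<^esub> (a \<odot>\<^bsub>?M\<^esub> x)"
      if a': "a' \<in> carrier (group_ring R G)" for a'
      using a a' b by (simp add: ax carrier_group_ring group_ring_ops convolution_closed
          convolution_fun_assoc RG_Fun flip: cos.coset_tensor_linear)
    show "(a \<oplus>\<^bsub>group_ring R G\<^esub> a') \<odot>\<^bsub>?M\<^esub> x = a \<odot>\<^bsub>?M\<^esub> x \<oplus>\<^bsub>?M\<^esub> a' \<odot>\<^bsub>?M\<^esub> x"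
      if a': "a' \<in> carrier (group_ring R G)" for a'
      using a a' x by (simp add: carrier_group_ring group_ring_ops coset_module_simps cos.action_add_left)
    show "a \<odot>\<^bsub>?M\<^esub> (x \<oplus>\<^bsub>?M\<^esub> y) = a \<odot>\<^bsub>?M\<^esub> x \<oplus>\<^bsub>?M\<^esub> a \<odot>\<^bsub>?M\<^esub> y" if y: "y \<in> carrier ?M" for y
      using a x y by (simp add: carrier_group_ring coset_module_simps cos.action_add_right)
  next
    fix x assume x: "x \<in> carrier ?M"
    obtain b where b: "b \<in> RG" "x = coset_tensor R G K b \<one>"
      using coset_tensor_surj[of x] x by (auto simp: coset_module_simps)
    then show "\<one>\<^bsub>group_ring R G\<^esub> \<odot>\<^bsub>?M\<^esub> x = x"
      by (simp add: group_ring_one monoclosed convolution_one_left RG_Fun flip: cos.coset_tensor_linear)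
  qed (use cos.add_closed cos.mem[where B = "lcosets\<^bsub>G\<^esub> K"] in \<open>auto simp: coset_module_simps zero fun_eq_iff R.a_ac\<close>)
qed

end

locale subgroup_family = ring_group R G
  for R :: "('r, 'c) ring_scheme" (structure) and G :: "('g, 'd) monoid_scheme" (structure) +
  fixes I :: "'i set" and H :: "'i \<Rightarrow> 'g set"
  assumes subgroups: "i \<in> I \<Longrightarrow> subgroup (H i) G"
begin

abbreviation "cosets \<equiv> Sigma I (\<lambda>i. lcosets\<^bsub>G\<^esub> (H i))"
abbreviation "M \<equiv> coset_sum R G I H"

text \<open>Views the direct sum as the free \<open>R\<close>-module on the disjoint union of the
  coset spaces. Changing the tuple then becomes a reindexing of a single basis, also when the index
  set is infinite.\<close>

definition flat :: "('i \<Rightarrow> 'g set \<Rightarrow> 'r) \<Rightarrow> 'i \<times> 'g set \<Rightarrow> 'r"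
  where "flat x = (\<lambda>(i, C). if i \<in> I then x i C else \<zero>)"

definition unflat :: "('i \<times> 'g set \<Rightarrow> 'r) \<Rightarrow> 'i \<Rightarrow> 'g set \<Rightarrow> 'r"
  where "unflat y = (\<lambda>i\<in>I. \<lambda>C. y (i, C))"

lemma coset_zero: "\<zero>\<^bsub>coset_module R G (H i)\<^esub> = (\<lambda>_. \<zero>)"
  by (simp add: coset_module_def)

lemma ring_subgroup_H: "i \<in> I \<Longrightarrow> ring_subgroup R G (H i)"
  by (intro ring_subgroup.intro ring_group_axioms subgroups)

lemma left_module_coset_sum: "left_module (group_ring R G) M"
  unfolding coset_sum_def
  by (intro left_module_direct_sum ring_group_ring ring_subgroup.left_module_coset_module ring_subgroup_H)

lemma coset_sum_simps:
  "x \<in> carrier M \<longleftrightarrow> x \<in> extensional I \<and> (\<forall>i\<in>I. x i \<in> carrier (free_module R (lcosets\<^bsub>G\<^esub> (H i)))) \<and>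
    finite {i \<in> I. x i \<noteq> (\<lambda>_. \<zero>)}"
  "x \<oplus>\<^bsub>M\<^esub> y = (\<lambda>i\<in>I. \<lambda>C. x i C \<oplus> y i C)"
  "a \<odot>\<^bsub>M\<^esub> x = (\<lambda>i\<in>I. a \<odot>\<^bsub>coset_module R G (H i)\<^esub> x i)"
  "\<zero>\<^bsub>M\<^esub> = (\<lambda>i\<in>I. \<lambda>_. \<zero>)"
  by (auto simp: coset_sum_def direct_sum_def coset_module_simps coset_zero)

lemma flat_closed:
  assumes x: "x \<in> carrier M"
  shows "flat x \<in> carrier (free_module R cosets)"
proof (rule free_module_carrierI)
  note x' = x[unfolded coset_sum_simps]
  have mem: "i \<in> I \<Longrightarrow> x i C \<in> carrier R" for i C
    using x' R.free_mem[of "x i" "lcosets\<^bsub>G\<^esub> (H i)"] by blast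
  show "p \<in> cosets \<Longrightarrow> flat x p \<in> carrier R" for p using mem by (auto simp: flat_def)
  show "flat x p = \<zero>" if "p \<notin> cosets" for p
  proof -
    obtain i C where p: "p = (i, C)" by (cases p)
    have "x i C = \<zero>" if "i \<in> I"
      using that x' \<open>p \<notin> cosets\<close> p free_module_outside[of "x i" R "lcosets\<^bsub>G\<^esub> (H i)" C] by blast
    then show ?thesis by (simp add: p flat_def)
  qed
  let ?F = "Sigma {i \<in> I. x i \<noteq> (\<lambda>_. \<zero>)} (\<lambda>i. {C. x i C \<noteq> \<zero>})"
  show "finite ?F" using x' by (intro finite_SigmaI) (auto simp: free_module_def)
  show "p \<notin> ?F \<Longrightarrow> flat x p = \<zero>" for p by (cases p) (auto simp: flat_def)
qed

lemma unflat_closed: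
  assumes y: "y \<in> carrier (free_module R cosets)"
  shows "unflat y \<in> carrier M"
proof -
  have fin: "finite {p. y p \<noteq> \<zero>}" using y by (simp add: free_module_def)
  have "(\<lambda>C. y (i, C)) \<in> carrier (free_module R (lcosets\<^bsub>G\<^esub> (H i)))" if "i \<in> I" for i
    by (rule free_module_carrierI[where F = "snd ` {p. y p \<noteq> \<zero>}"])
       (use y that fin R.free_mem[OF y] in \<open>force simp: free_module_def\<close>)+
  moreover have "{i \<in> I. unflat y i \<noteq> (\<lambda>_. \<zero>)} \<subseteq> fst ` {p. y p \<noteq> \<zero>}"
    by (force simp: unflat_def fun_eq_iff)
  then have "finite {i \<in> I. unflat y i \<noteq> (\<lambda>_. \<zero>)}" by (rule finite_subset) (simp add: fin)
  ultimately show ?thesis by (auto simp: coset_sum_simps unflat_def)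
qed

lemma flat_unflat: "y \<in> carrier (free_module R cosets) \<Longrightarrow> flat (unflat y) = y"
  by (auto simp: flat_def unflat_def free_module_def fun_eq_iff)

lemma unflat_flat: "x \<in> carrier M \<Longrightarrow> unflat (flat x) = x"
  by (auto simp: flat_def unflat_def coset_sum_simps extensional_def fun_eq_iff)

lemma flat_eqD: "\<lbrakk>x \<in> carrier M; y \<in> carrier M; flat x = flat y\<rbrakk> \<Longrightarrow> x = y"
  by (metis unflat_flat)

lemma flat_add: "flat (x \<oplus>\<^bsub>M\<^esub> y) = (\<lambda>p. flat x p \<oplus> flat y p)"
  by (auto simp: flat_def coset_sum_simps fun_eq_iff)

lemma flat_smult:
  assumes a: "a \<in> RG" and p: "(i, C) \<in> cosets"
  shows "flat (a \<odot>\<^bsub>M\<^esub> x) (i, C) = (\<Oplus>g\<in>{g. a g \<noteq> \<zero>}. a g \<otimes> flat x (i, inv\<^bsub>G\<^esub> g <#\<^bsub>G\<^esub> C))"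
proof -
  have "{g \<in> carrier G. a g \<noteq> \<zero>} = {g. a g \<noteq> \<zero>}" using a by (auto simp: free_module_def)
  then show ?thesis using p by (simp add: flat_def coset_sum_simps coset_module_def)
qed

lemma l_coset_mem_cosets:
  assumes "(i, C) \<in> cosets" and "g \<in> carrier G"
  shows "(i, g <#\<^bsub>G\<^esub> C) \<in> cosets"
proof -
  obtain k where k: "i \<in> I" "k \<in> carrier G" "C = k <#\<^bsub>G\<^esub> H i" using assms by (auto simp: LCOSETS_def)
  then have "g <#\<^bsub>G\<^esub> C = g \<otimes>\<^bsub>G\<^esub> k <#\<^bsub>G\<^esub> H i"
    using assms subgroup.subset[OF subgroups] by (simp add: G.lcos_m_assoc)
  then show ?thesis using k assms by (auto simp: LCOSETS_def)
qed

lemma coset_carrier: "(i, C) \<in> cosets \<Longrightarrow> C \<subseteq> carrier G"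
  using subgroup.subset[OF subgroups] by (force simp: LCOSETS_def l_coset_def)

lemma translation_bij:
  assumes g: "g \<in> carrier G"
  shows "bij_betw (\<lambda>(i, C). (i, g <#\<^bsub>G\<^esub> C)) cosets cosets"
proof (rule bij_betw_byWitness[where f' = "\<lambda>(i, C). (i, inv\<^bsub>G\<^esub> g <#\<^bsub>G\<^esub> C)"])
  have "inv\<^bsub>G\<^esub> g <#\<^bsub>G\<^esub> (g <#\<^bsub>G\<^esub> C) = C" "g <#\<^bsub>G\<^esub> (inv\<^bsub>G\<^esub> g <#\<^bsub>G\<^esub> C) = C" if "C \<subseteq> carrier G" for C
    using that g by (simp_all add: G.lcos_m_assoc G.lcos_mult_one)
  then show "\<forall>p\<in>cosets. (case case p of (i, C) \<Rightarrow> (i, g <#\<^bsub>G\<^esub> C) of (i, C) \<Rightarrow> (i, inv\<^bsub>G\<^esub> g <#\<^bsub>G\<^esub> C)) = p"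
    "\<forall>p\<in>cosets. (case case p of (i, C) \<Rightarrow> (i, inv\<^bsub>G\<^esub> g <#\<^bsub>G\<^esub> C) of (i, C) \<Rightarrow> (i, g <#\<^bsub>G\<^esub> C)) = p"
    using coset_carrier by force+
qed (use l_coset_mem_cosets g in auto)

lemma coset_augmentation_eq_total:
  assumes x: "x \<in> carrier M"
  shows "coset_augmentation R G I H x = total R (flat x)"
proof -
  note x' = x[unfolded coset_sum_simps]
  let ?A = "{i \<in> I. x i \<noteq> (\<lambda>_. \<zero>)}" and ?B = "\<lambda>i. {C. x i C \<noteq> \<zero>}"
  have mem: "i \<in> I \<Longrightarrow> x i C \<in> carrier R" for i C
    using x' R.free_mem[of "x i" "lcosets\<^bsub>G\<^esub> (H i)"] by blast
  have "coset_augmentation R G I H x = (\<Oplus>i\<in>?A. \<Oplus>C\<in>?B i. x i C)"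
    by (simp add: coset_augmentation_def coset_zero)
  also have "\<dots> = (\<Oplus>p\<in>Sigma ?A ?B. case_prod x p)"
    using x' mem by (intro R.finsum_Sigma) (auto simp: free_module_def)
  also have "\<dots> = (\<Oplus>p\<in>{p. flat x p \<noteq> \<zero>}. flat x p)"
    using mem by (intro R.finsum_cong') (auto simp: flat_def split: if_splits)
  finally show ?thesis by (simp add: total_def)
qed

text \<open>By additivity the scalar may be taken to be a monomial. Its group element permutes the
  cosets of each subgroup and its coefficient scales, so the total changes only by the
  coefficient.\<close>

lemma total_flat_smult:
  assumes a: "a \<in> RG" and x: "x \<in> carrier M"
  shows "total R (flat (a \<odot>\<^bsub>M\<^esub> x)) = total R a \<otimes> total R (flat x)"
proof -
  interpret M: left_module "group_ring R G" M by (rule left_module_coset_sum)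
  note fx = flat_closed[OF x]
  note T = R.total_closed[OF fx]
  show ?thesis
    using R.ring_axioms a
  proof (induction a rule: free_module_induct)
    case zero
    have "flat \<zero>\<^bsub>M\<^esub> = (\<lambda>_. \<zero>)" by (auto simp: flat_def coset_sum_simps fun_eq_iff)
    then show ?case using M.smult_zero_left[OF x] T by (simp add: group_ring_zero R.total_zero)
  next
    case (monomial s g)
    let ?\<pi> = "\<lambda>(i, C). (i, inv\<^bsub>G\<^esub> g <#\<^bsub>G\<^esub> C)"
    have sg: "monomial R s g \<in> RG" using monomial by (simp add: monoclosed)
    then have ax: "monomial R s g \<odot>\<^bsub>M\<^esub> x \<in> carrier M"
      using x by (simp add: carrier_group_ring)
    have "flat (monomial R s g \<odot>\<^bsub>M\<^esub> x) p = s \<otimes> pullback R cosets ?\<pi> (flat x) p" for p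
    proof (cases "p \<in> cosets")
      case True
      obtain i C where p: "p = (i, C)" by (cases p)
      have "flat (monomial R s g \<odot>\<^bsub>M\<^esub> x) p
          = (\<Oplus>h\<in>{h. monomial R s g h \<noteq> \<zero>}. monomial R s g h \<otimes> flat x (i, inv\<^bsub>G\<^esub> h <#\<^bsub>G\<^esub> C))"
        using flat_smult[OF sg] True unfolding p by blast
      also have "\<dots> = (\<Oplus>h\<in>{g}. monomial R s g h \<otimes> flat x (i, inv\<^bsub>G\<^esub> h <#\<^bsub>G\<^esub> C))"
        using monomial R.free_mem[OF fx] by (intro R.finsum_support_eq) (auto simp: monomial_def)
      also have "\<dots> = s \<otimes> pullback R cosets ?\<pi> (flat x) p"
        using True monomial R.free_mem[OF fx] by (simp add: p pullback_def) (simp add: monomial_def)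
      finally show ?thesis .
    next
      case False
      then show ?thesis
        using free_module_outside[OF flat_closed[OF ax]] monomial by (simp add: pullback_def)
    qed
    then have "flat (monomial R s g \<odot>\<^bsub>M\<^esub> x) = (\<lambda>p. s \<otimes> pullback R cosets ?\<pi> (flat x) p)" by blast
    moreover have \<pi>: "bij_betw ?\<pi> cosets cosets" using monomial by (intro translation_bij) simp
    ultimately show ?case
      using monomial R.total_smult[OF _ R.pullback_closed[OF \<pi> fx]] R.total_pullback[OF \<pi> fx]
      by (simp add: R.total_monomial)
  next
    case (add a b)
    then have ab: "a \<in> carrier (group_ring R G)" "b \<in> carrier (group_ring R G)"
      by (simp_all add: carrier_group_ring)
    have "(\<lambda>g. a g \<oplus> b g) \<odot>\<^bsub>M\<^esub> x = a \<odot>\<^bsub>M\<^esub> x \<oplus>\<^bsub>M\<^esub> b \<odot>\<^bsub>M\<^esub> x"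
      using M.smult_l_distr[OF ab x] by (simp add: group_ring_ops)
    then show ?case
      using add T R.total_add[OF flat_closed[OF M.smult_closed[OF ab(1) x]] flat_closed[OF M.smult_closed[OF ab(2) x]]]
        R.total_add[OF add(1,2)] R.total_closed[OF add(1)] R.total_closed[OF add(2)]
      by (simp add: flat_add R.l_distr)
  qed
qed

abbreviation "\<Delta> \<equiv> Delta R G I H"

lemma carrier_Delta: "x \<in> carrier \<Delta> \<longleftrightarrow> x \<in> carrier M \<and> total R (flat x) = \<zero>"
  using coset_augmentation_eq_total by (auto simp: Delta_def a_kernel_def' trivial_module_def)

lemma Delta_ops: "x \<oplus>\<^bsub>\<Delta>\<^esub> y = x \<oplus>\<^bsub>M\<^esub> y" "a \<odot>\<^bsub>\<Delta>\<^esub> x = a \<odot>\<^bsub>M\<^esub> x"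
  by (simp_all add: Delta_def)

lemma left_module_Delta: "left_module (group_ring R G) \<Delta>"
proof -
  interpret M: left_module "group_ring R G" M by (rule left_module_coset_sum)
  have "\<Delta> = M\<lparr>carrier := carrier \<Delta>\<rparr>" by (simp add: Delta_def)
  also have "left_module (group_ring R G) \<dots>"
  proof (rule left_module_subset[OF left_module_coset_sum])
    show "carrier \<Delta> \<subseteq> carrier M" using carrier_Delta by blast
    have "flat \<zero>\<^bsub>M\<^esub> = (\<lambda>_. \<zero>)" by (auto simp: flat_def coset_sum_simps fun_eq_iff)
    then show "\<zero>\<^bsub>M\<^esub> \<in> carrier \<Delta>" by (simp add: carrier_Delta R.total_zero)
    show "x \<oplus>\<^bsub>M\<^esub> y \<in> carrier \<Delta>" if "x \<in> carrier \<Delta>" "y \<in> carrier \<Delta>" for x y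
      using that R.total_add[OF flat_closed flat_closed, of x y] by (simp add: carrier_Delta flat_add)
    show "a \<odot>\<^bsub>M\<^esub> x \<in> carrier \<Delta>" if "a \<in> carrier (group_ring R G)" "x \<in> carrier \<Delta>" for a x
      using that R.total_closed[of a "carrier G"] M.smult_closed[of a x]
      by (simp add: carrier_Delta carrier_group_ring total_flat_smult)
  qed
  finally show ?thesis .
qed

end

section \<open>The Mackey decomposition\<close>

locale mackey = ring_subgroup R G K + fam: subgroup_family R G I H
  for R :: "('r, 'c) ring_scheme" (structure) and G :: "('g, 'd) monoid_scheme" (structure) and K
    and I :: "'i set" and H :: "'i \<Rightarrow> 'g set" +
  fixes T :: "'i \<Rightarrow> 'g set"
  assumes reps: "i \<in> I \<Longrightarrow> double_coset_reps G (H i) K (T i)"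
begin

abbreviation "J \<equiv> Sigma I T"
abbreviation "HK \<equiv> induced_tuple G H K"

lemma T_carrier: "(i, t) \<in> J \<Longrightarrow> t \<in> carrier G"
  using reps by (auto simp: double_coset_reps_def)

lemma H_closed: assumes "i \<in> I"
  shows "h \<in> H i \<Longrightarrow> h \<in> carrier G" "h \<in> H i \<Longrightarrow> inv\<^bsub>G\<^esub> h \<in> H i"
    "\<lbrakk>h \<in> H i; h' \<in> H i\<rbrakk> \<Longrightarrow> h \<otimes>\<^bsub>G\<^esub> h' \<in> H i" "\<one>\<^bsub>G\<^esub> \<in> H i"
proof -
  interpret subgroup "H i" G by (rule fam.subgroups[OF assms])
  show "h \<in> H i \<Longrightarrow> h \<in> carrier G" "h \<in> H i \<Longrightarrow> inv\<^bsub>G\<^esub> h \<in> H i"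
    "\<lbrakk>h \<in> H i; h' \<in> H i\<rbrakk> \<Longrightarrow> h \<otimes>\<^bsub>G\<^esub> h' \<in> H i" "\<one>\<^bsub>G\<^esub> \<in> H i"
    by simp_all
qed

lemma conj_solve:
  assumes "x \<in> carrier G" "t \<in> carrier G" "h \<in> carrier G"
  shows "t \<otimes>\<^bsub>G\<^esub> x \<otimes>\<^bsub>G\<^esub> inv\<^bsub>G\<^esub> t = h \<longleftrightarrow> x = inv\<^bsub>G\<^esub> t \<otimes>\<^bsub>G\<^esub> (h \<otimes>\<^bsub>G\<^esub> t)"
proof
  assume "t \<otimes>\<^bsub>G\<^esub> x \<otimes>\<^bsub>G\<^esub> inv\<^bsub>G\<^esub> t = h"
  then show "x = inv\<^bsub>G\<^esub> t \<otimes>\<^bsub>G\<^esub> (h \<otimes>\<^bsub>G\<^esub> t)"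
    using assms by (auto simp: G.m_assoc) (simp flip: G.m_assoc)
next
  assume "x = inv\<^bsub>G\<^esub> t \<otimes>\<^bsub>G\<^esub> (h \<otimes>\<^bsub>G\<^esub> t)"
  then show "t \<otimes>\<^bsub>G\<^esub> x \<otimes>\<^bsub>G\<^esub> inv\<^bsub>G\<^esub> t = h"
    using assms by (simp flip: G.m_assoc) (simp add: G.m_assoc)
qed

text \<open>These are the elements of \<open>K\<close> that fix the left coset of \<open>H i\<close>
  through the inverse of \<open>t\<close>. Thus \<open>HK (i, t)\<close> is a stabiliser for the
  action of \<open>K\<close> on the cosets.\<close>

lemma mem_HK_iff:
  assumes "(i, t) \<in> J"
  shows "x \<in> HK (i, t) \<longleftrightarrow> x \<in> K \<and> t \<otimes>\<^bsub>G\<^esub> x \<otimes>\<^bsub>G\<^esub> inv\<^bsub>G\<^esub> t \<in> H i"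
proof -
  have i: "i \<in> I" and t: "t \<in> carrier G" using assms T_carrier by auto
  have "x \<in> inv\<^bsub>G\<^esub> t <#\<^bsub>G\<^esub> (H i #>\<^bsub>G\<^esub> t) \<longleftrightarrow> (\<exists>h\<in>H i. x = inv\<^bsub>G\<^esub> t \<otimes>\<^bsub>G\<^esub> (h \<otimes>\<^bsub>G\<^esub> t))"
    by (auto simp: l_coset_def r_coset_def)
  moreover have "(\<exists>h\<in>H i. x = inv\<^bsub>G\<^esub> t \<otimes>\<^bsub>G\<^esub> (h \<otimes>\<^bsub>G\<^esub> t)) \<longleftrightarrow> t \<otimes>\<^bsub>G\<^esub> x \<otimes>\<^bsub>G\<^esub> inv\<^bsub>G\<^esub> t \<in> H i" if "x \<in> K"
    using conj_solve[OF K_closed(1)[OF that] t] H_closed(1)[OF i] by metis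
  ultimately show ?thesis by (auto simp: induced_tuple_def)
qed

lemma subgroup_HK:
  assumes p: "p \<in> J"
  shows "subgroup (HK p) GK"
proof -
  obtain i t where it: "p = (i, t)" "(i, t) \<in> J" using p by (cases p) auto
  have i: "i \<in> I" and t: "t \<in> carrier G" using it T_carrier by auto
  have mult: "t \<otimes>\<^bsub>G\<^esub> (x \<otimes>\<^bsub>G\<^esub> y) \<otimes>\<^bsub>G\<^esub> inv\<^bsub>G\<^esub> t
      = (t \<otimes>\<^bsub>G\<^esub> x \<otimes>\<^bsub>G\<^esub> inv\<^bsub>G\<^esub> t) \<otimes>\<^bsub>G\<^esub> (t \<otimes>\<^bsub>G\<^esub> y \<otimes>\<^bsub>G\<^esub> inv\<^bsub>G\<^esub> t)"
    if "x \<in> carrier G" "y \<in> carrier G" for x y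
  proof -
    have "inv\<^bsub>G\<^esub> t \<otimes>\<^bsub>G\<^esub> (t \<otimes>\<^bsub>G\<^esub> (y \<otimes>\<^bsub>G\<^esub> inv\<^bsub>G\<^esub> t)) = y \<otimes>\<^bsub>G\<^esub> inv\<^bsub>G\<^esub> t"
      using that t by (simp flip: G.m_assoc)
    then show ?thesis using that t by (simp add: G.m_assoc)
  qed
  have inv: "t \<otimes>\<^bsub>G\<^esub> inv\<^bsub>G\<^esub> x \<otimes>\<^bsub>G\<^esub> inv\<^bsub>G\<^esub> t = inv\<^bsub>G\<^esub> (t \<otimes>\<^bsub>G\<^esub> x \<otimes>\<^bsub>G\<^esub> inv\<^bsub>G\<^esub> t)" if "x \<in> carrier G" for x
    using that t by (simp add: G.inv_mult_group G.m_assoc)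
  show ?thesis
    unfolding it
  proof (rule sub.G.subgroupI)
    show "HK (i, t) \<subseteq> carrier GK" using mem_HK_iff[OF it(2)] by auto
    have "\<one>\<^bsub>G\<^esub> \<in> HK (i, t)" using t H_closed(4)[OF i] K_closed by (simp add: mem_HK_iff[OF it(2)])
    then show "HK (i, t) \<noteq> {}" by blast
    show "inv\<^bsub>GK\<^esub> x \<in> HK (i, t)" if "x \<in> HK (i, t)" for x
    proof -
      have x: "x \<in> K" "t \<otimes>\<^bsub>G\<^esub> x \<otimes>\<^bsub>G\<^esub> inv\<^bsub>G\<^esub> t \<in> H i" using that mem_HK_iff[OF it(2)] by auto
      then show ?thesis
        using H_closed(2)[OF i x(2)] inv[OF K_closed(1)[OF x(1)]]
        by (simp add: mem_HK_iff[OF it(2)] inv_GK K_closed)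
    qed
    show "x \<otimes>\<^bsub>GK\<^esub> y \<in> HK (i, t)" if "x \<in> HK (i, t)" "y \<in> HK (i, t)" for x y
    proof -
      have x: "x \<in> K" "t \<otimes>\<^bsub>G\<^esub> x \<otimes>\<^bsub>G\<^esub> inv\<^bsub>G\<^esub> t \<in> H i" and y: "y \<in> K" "t \<otimes>\<^bsub>G\<^esub> y \<otimes>\<^bsub>G\<^esub> inv\<^bsub>G\<^esub> t \<in> H i"
        using that mem_HK_iff[OF it(2)] by auto
      then show ?thesis
        using H_closed(3)[OF i x(2) y(2)] mult[OF K_closed(1)[OF x(1)] K_closed(1)[OF y(1)]]
        by (simp add: mem_HK_iff[OF it(2)] K_closed)
    qed
  qed
qed

sublocale ind: subgroup_family R GK J HK
  by (intro subgroup_family.intro subgroup_family_axioms.intro sub.ring_group_axioms subgroup_HK)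

text \<open>The orbit map of \<open>K\<close> at the coset through the inverse of \<open>t\<close>,
  written as a product of sets so that no representative of \<open>C\<close> has to be
  chosen.\<close>

definition spread :: "'i \<times> 'g \<Rightarrow> 'g set \<Rightarrow> 'g set"
  where "spread = (\<lambda>(i, t) C. C <#>\<^bsub>G\<^esub> (inv\<^bsub>G\<^esub> t <#\<^bsub>G\<^esub> H i))"

lemma l_coset_GK: "x <#\<^bsub>GK\<^esub> C = x <#\<^bsub>G\<^esub> C"
  by (simp add: l_coset_def)

lemma ind_cosetE:
  assumes "q \<in> ind.cosets"
  obtains i t k where "q = ((i, t), k <#\<^bsub>G\<^esub> HK (i, t))" "(i, t) \<in> J" "k \<in> K"
proof -
  obtain p C where q: "q = (p, C)" "p \<in> J" "C \<in> lcosets\<^bsub>GK\<^esub> (HK p)" by (rule SigmaE[OF assms])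
  obtain i t where p: "p = (i, t)" by (cases p)
  obtain k where "k \<in> K" "C = k <#\<^bsub>G\<^esub> HK p" using q(3) by (auto simp: LCOSETS_def l_coset_GK)
  then show ?thesis using that q p by blast
qed

text \<open>An element of \<open>HK (i, t)\<close> moved past the inverse of \<open>t\<close>
  becomes its conjugate, which lies in \<open>H i\<close> and is absorbed there.\<close>

lemma spread_l_coset:
  assumes it: "(i, t) \<in> J" and k: "k \<in> K"
  shows "spread (i, t) (k <#\<^bsub>G\<^esub> HK (i, t)) = k \<otimes>\<^bsub>G\<^esub> inv\<^bsub>G\<^esub> t <#\<^bsub>G\<^esub> H i"
proof -
  have i: "i \<in> I" and t: "t \<in> carrier G" using it T_carrier by auto
  note kG = K_closed(1)[OF k]
  show ?thesis
  proof (intro subset_antisym subsetI)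
    fix x assume "x \<in> spread (i, t) (k <#\<^bsub>G\<^esub> HK (i, t))"
    then obtain s h where s: "s \<in> HK (i, t)" and h: "h \<in> H i"
        and x: "x = k \<otimes>\<^bsub>G\<^esub> s \<otimes>\<^bsub>G\<^esub> (inv\<^bsub>G\<^esub> t \<otimes>\<^bsub>G\<^esub> h)"
      by (auto simp: spread_def set_mult_def l_coset_def)
    let ?h = "t \<otimes>\<^bsub>G\<^esub> s \<otimes>\<^bsub>G\<^esub> inv\<^bsub>G\<^esub> t"
    have sK: "s \<in> carrier G" "?h \<in> H i" using s mem_HK_iff[OF it] K_closed(1) by auto
    have hG: "h \<in> carrier G" by (rule H_closed(1)[OF i h])
    have "x = k \<otimes>\<^bsub>G\<^esub> inv\<^bsub>G\<^esub> t \<otimes>\<^bsub>G\<^esub> (?h \<otimes>\<^bsub>G\<^esub> h)"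
    proof -
      have "inv\<^bsub>G\<^esub> t \<otimes>\<^bsub>G\<^esub> (t \<otimes>\<^bsub>G\<^esub> (s \<otimes>\<^bsub>G\<^esub> (inv\<^bsub>G\<^esub> t \<otimes>\<^bsub>G\<^esub> h))) = s \<otimes>\<^bsub>G\<^esub> (inv\<^bsub>G\<^esub> t \<otimes>\<^bsub>G\<^esub> h)"
        using sK hG t by (simp flip: G.m_assoc)
      then show ?thesis using x sK(1) hG kG t by (simp add: G.m_assoc)
    qed
    then show "x \<in> k \<otimes>\<^bsub>G\<^esub> inv\<^bsub>G\<^esub> t <#\<^bsub>G\<^esub> H i"
      using H_closed(3)[OF i sK(2) h] by (auto simp: l_coset_def)
  next
    fix x assume "x \<in> k \<otimes>\<^bsub>G\<^esub> inv\<^bsub>G\<^esub> t <#\<^bsub>G\<^esub> H i"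
    then obtain h where h: "h \<in> H i" and x: "x = k \<otimes>\<^bsub>G\<^esub> inv\<^bsub>G\<^esub> t \<otimes>\<^bsub>G\<^esub> h" by (auto simp: l_coset_def)
    have "\<one>\<^bsub>G\<^esub> \<in> HK (i, t)" using t H_closed(4)[OF i] K_closed by (simp add: mem_HK_iff[OF it])
    moreover have "x = k \<otimes>\<^bsub>G\<^esub> \<one>\<^bsub>G\<^esub> \<otimes>\<^bsub>G\<^esub> (inv\<^bsub>G\<^esub> t \<otimes>\<^bsub>G\<^esub> h)"
      using x kG t H_closed(1)[OF i h] by (simp add: G.m_assoc)
    ultimately show "x \<in> spread (i, t) (k <#\<^bsub>G\<^esub> HK (i, t))"
      using h by (auto simp: spread_def set_mult_def l_coset_def)
  qed
qed

lemma double_coset_unique: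
  assumes i: "i \<in> I" and "t \<in> T i" "t' \<in> T i" "h \<in> H i" "h' \<in> H i" "k \<in> K" "k' \<in> K"
    and eq: "h \<otimes>\<^bsub>G\<^esub> t \<otimes>\<^bsub>G\<^esub> k = h' \<otimes>\<^bsub>G\<^esub> t' \<otimes>\<^bsub>G\<^esub> k'"
  shows "t = t'"
proof -
  let ?g = "h \<otimes>\<^bsub>G\<^esub> t \<otimes>\<^bsub>G\<^esub> k"
  have "?g \<in> carrier G" 
    using T_carrier[of i t] assms(1,2) K_closed(1)[OF assms(6)] H_closed(1)[OF i assms(4)] by simp
  then have ex: "\<exists>!x. x \<in> T i \<and> ?g \<in> (H i #>\<^bsub>G\<^esub> x) <#>\<^bsub>G\<^esub> K"
    using reps[OF i] unfolding double_coset_reps_def by blast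
  have mem: "h \<otimes>\<^bsub>G\<^esub> t \<otimes>\<^bsub>G\<^esub> k \<in> (H i #>\<^bsub>G\<^esub> t) <#>\<^bsub>G\<^esub> K" if "h \<in> H i" "k \<in> K" for h t k
    unfolding r_coset_def set_mult_def using that by blast
  have "?g \<in> (H i #>\<^bsub>G\<^esub> t) <#>\<^bsub>G\<^esub> K" by (rule mem[OF assms(4,6)])
  moreover have "?g \<in> (H i #>\<^bsub>G\<^esub> t') <#>\<^bsub>G\<^esub> K" unfolding eq by (rule mem[OF assms(5,7)])
  ultimately show ?thesis using ex assms(2,3) by blast
qed

definition spread_pair :: "('i \<times> 'g) \<times> 'g set \<Rightarrow> 'i \<times> 'g set"
  where "spread_pair = (\<lambda>(p, C). (fst p, spread p C))"

text \<open>Different representatives belong to different double cosets and so to different orbits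
  of \<open>K\<close>. Within one orbit, injectivity holds because \<open>HK\<close> is the full
  stabiliser.\<close>

lemma spread_pair_inj: "inj_on spread_pair ind.cosets"
proof (rule inj_onI)
  fix a b assume a: "a \<in> ind.cosets" and b: "b \<in> ind.cosets" and eq: "spread_pair a = spread_pair b"
  obtain i t k where a': "a = ((i, t), k <#\<^bsub>G\<^esub> HK (i, t))" "(i, t) \<in> J" "k \<in> K"
    by (rule ind_cosetE[OF a])
  obtain i' t' l where b': "b = ((i', t'), l <#\<^bsub>G\<^esub> HK (i', t'))" "(i', t') \<in> J" "l \<in> K"
    by (rule ind_cosetE[OF b])
  have i: "i' = i" "i \<in> I" and t: "t \<in> carrier G" "t' \<in> carrier G" "t \<in> T i" "t' \<in> T i"
    using eq a' b' T_carrier by (auto simp: spread_pair_def)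
  note kl = K_closed(1)[OF a'(3)] K_closed(1)[OF b'(3)]
  have "k \<otimes>\<^bsub>G\<^esub> inv\<^bsub>G\<^esub> t <#\<^bsub>G\<^esub> H i = l \<otimes>\<^bsub>G\<^esub> inv\<^bsub>G\<^esub> t' <#\<^bsub>G\<^esub> H i"
    using eq a' b' i by (simp add: spread_pair_def spread_l_coset)
  moreover have "k \<otimes>\<^bsub>G\<^esub> inv\<^bsub>G\<^esub> t \<in> k \<otimes>\<^bsub>G\<^esub> inv\<^bsub>G\<^esub> t <#\<^bsub>G\<^esub> H i"
    using kl t H_closed(4)[OF i(2)] by (force simp: l_coset_def)
  ultimately obtain h where h: "h \<in> H i" "k \<otimes>\<^bsub>G\<^esub> inv\<^bsub>G\<^esub> t = l \<otimes>\<^bsub>G\<^esub> inv\<^bsub>G\<^esub> t' \<otimes>\<^bsub>G\<^esub> h"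
    by (auto simp: l_coset_def)
  note hG = H_closed(1)[OF i(2) h(1)]
  \<comment> \<open>Inversion turns an orbit of \<open>K\<close> on the left cosets of
    \<open>H i\<close> into a double coset of \<open>H i\<close> and \<open>K\<close>, the form in
    which the representatives are given.\<close>
  have "inv\<^bsub>G\<^esub> (k \<otimes>\<^bsub>G\<^esub> inv\<^bsub>G\<^esub> t) = inv\<^bsub>G\<^esub> (l \<otimes>\<^bsub>G\<^esub> inv\<^bsub>G\<^esub> t' \<otimes>\<^bsub>G\<^esub> h)" using h(2) by simp
  then have "\<one>\<^bsub>G\<^esub> \<otimes>\<^bsub>G\<^esub> t \<otimes>\<^bsub>G\<^esub> inv\<^bsub>G\<^esub> k = inv\<^bsub>G\<^esub> h \<otimes>\<^bsub>G\<^esub> t' \<otimes>\<^bsub>G\<^esub> inv\<^bsub>G\<^esub> l"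
    using kl t hG by (simp add: G.inv_mult_group G.m_assoc)
  then have tt: "t = t'"
    using double_coset_unique[OF i(2) t(3,4) H_closed(4)[OF i(2)] H_closed(2)[OF i(2) h(1)]]
      K_closed(2) a'(3) b'(3) by blast
  let ?s = "inv\<^bsub>G\<^esub> l \<otimes>\<^bsub>G\<^esub> k"
  have s_eq: "?s \<otimes>\<^bsub>G\<^esub> inv\<^bsub>G\<^esub> t = inv\<^bsub>G\<^esub> t \<otimes>\<^bsub>G\<^esub> h"
  proof -
    have "inv\<^bsub>G\<^esub> l \<otimes>\<^bsub>G\<^esub> (k \<otimes>\<^bsub>G\<^esub> inv\<^bsub>G\<^esub> t) = inv\<^bsub>G\<^esub> l \<otimes>\<^bsub>G\<^esub> (l \<otimes>\<^bsub>G\<^esub> (inv\<^bsub>G\<^esub> t \<otimes>\<^bsub>G\<^esub> h))"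
      using h(2) kl t hG by (simp add: tt G.m_assoc)
    also have "\<dots> = inv\<^bsub>G\<^esub> t \<otimes>\<^bsub>G\<^esub> h" using kl t hG by (simp flip: G.m_assoc)
    finally show ?thesis using kl t by (simp add: G.m_assoc)
  qed
  have "t \<otimes>\<^bsub>G\<^esub> ?s \<otimes>\<^bsub>G\<^esub> inv\<^bsub>G\<^esub> t = t \<otimes>\<^bsub>G\<^esub> (inv\<^bsub>G\<^esub> t \<otimes>\<^bsub>G\<^esub> h)"
    using s_eq kl t by (simp add: G.m_assoc)
  also have "\<dots> = h" using t hG by (simp flip: G.m_assoc)
  finally have s: "?s \<in> HK (i, t)"
    using h(1) a'(2,3) b'(3) i K_closed by (simp add: mem_HK_iff[OF a'(2)])
  interpret coset_module_setting R GK "HK (i, t)"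
    by (rule ring_subgroup.coset_setting) (rule ind.ring_subgroup_H[OF a'(2)])
  have "k = l \<otimes>\<^bsub>G\<^esub> ?s" using kl by (simp flip: G.m_assoc)
  then have "k \<in> l <#\<^bsub>GK\<^esub> HK (i, t)" using s by (auto simp: l_coset_def)
  then have "k <#\<^bsub>GK\<^esub> HK (i, t) = l <#\<^bsub>GK\<^esub> HK (i, t)"
    using l_coset_eq_iff a'(3) b'(3) by simp
  then show "a = b" using a'(1) b'(1) i tt by (simp add: l_coset_GK)
qed

text \<open>The decomposition of the cosets of \<open>H i\<close> into orbits of \<open>K\<close>:
  the double coset representatives enumerate the orbits, and each orbit is \<open>K\<close> modulo
  the stabiliser of its base point.\<close>

lemma spread_pair_bij: "bij_betw spread_pair ind.cosets fam.cosets"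
  unfolding bij_betw_def
proof (intro conjI spread_pair_inj subset_antisym subsetI)
  fix p assume "p \<in> spread_pair ` ind.cosets"
  then obtain q where q: "q \<in> ind.cosets" "p = spread_pair q" by blast
  obtain i t k where "q = ((i, t), k <#\<^bsub>G\<^esub> HK (i, t))" and p: "(i, t) \<in> J" "k \<in> K"
    by (rule ind_cosetE[OF q(1)])
  then have p: "p = spread_pair ((i, t), k <#\<^bsub>G\<^esub> HK (i, t))" "(i, t) \<in> J" "k \<in> K"
    using q(2) by simp_all
  have "k \<otimes>\<^bsub>G\<^esub> inv\<^bsub>G\<^esub> t \<in> carrier G" "i \<in> I" using p(2,3) T_carrier K_closed(1) by auto
  moreover have "p = (i, k \<otimes>\<^bsub>G\<^esub> inv\<^bsub>G\<^esub> t <#\<^bsub>G\<^esub> H i)"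
    using spread_l_coset[OF p(2,3)] unfolding p(1) spread_pair_def by simp
  ultimately show "p \<in> fam.cosets" unfolding LCOSETS_def by blast
next
  fix p assume "p \<in> fam.cosets"
  then obtain i g where p: "i \<in> I" "g \<in> carrier G" "p = (i, g <#\<^bsub>G\<^esub> H i)" by (auto simp: LCOSETS_def)
  \<comment> \<open>The representatives decompose elements with \<open>H i\<close> on the left and
    \<open>K\<close> on the right, whereas \<open>K\<close> acts on the left of the cosets; hence
    the decomposition is applied to the inverse of \<open>g\<close>.\<close>
  then have "\<exists>t. t \<in> T i \<and> inv\<^bsub>G\<^esub> g \<in> (H i #>\<^bsub>G\<^esub> t) <#>\<^bsub>G\<^esub> K"
    using reps[OF p(1)] by (auto simp: double_coset_reps_def)
  then obtain t h k where t: "t \<in> T i" "h \<in> H i" "k \<in> K" "inv\<^bsub>G\<^esub> g = h \<otimes>\<^bsub>G\<^esub> t \<otimes>\<^bsub>G\<^esub> k"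
    by (auto simp: r_coset_def set_mult_def)
  have it: "(i, t) \<in> J" using p t by simp
  note c = T_carrier[OF it] H_closed(1)[OF p(1) t(2)] K_closed(1)[OF t(3)]
  have "g = inv\<^bsub>G\<^esub> (h \<otimes>\<^bsub>G\<^esub> t \<otimes>\<^bsub>G\<^esub> k)" using p(2) t(4) by (metis G.inv_inv)
  then have g: "g = inv\<^bsub>G\<^esub> k \<otimes>\<^bsub>G\<^esub> inv\<^bsub>G\<^esub> t \<otimes>\<^bsub>G\<^esub> inv\<^bsub>G\<^esub> h" using c by (simp add: G.inv_mult_group G.m_assoc)
  interpret coset_module_setting R G "H i"
    by (rule ring_subgroup.coset_setting) (rule fam.ring_subgroup_H[OF p(1)])
  have "g \<in> inv\<^bsub>G\<^esub> k \<otimes>\<^bsub>G\<^esub> inv\<^bsub>G\<^esub> t <#\<^bsub>G\<^esub> H i"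
    unfolding l_coset_def using H_closed(2)[OF p(1) t(2)] g by blast
  then have "g <#\<^bsub>G\<^esub> H i = inv\<^bsub>G\<^esub> k \<otimes>\<^bsub>G\<^esub> inv\<^bsub>G\<^esub> t <#\<^bsub>G\<^esub> H i"
    using l_coset_eq_iff p(2) c by simp
  then have "p = spread_pair ((i, t), inv\<^bsub>G\<^esub> k <#\<^bsub>GK\<^esub> HK (i, t))"
    using p it t K_closed(2) by (simp add: spread_pair_def spread_l_coset l_coset_GK)
  then show "p \<in> spread_pair ` ind.cosets"
    using it K_closed(2)[OF t(3)] by (force simp: LCOSETS_def)
qed

lemma spread_pair_equivariant:
  assumes g: "g \<in> K" and p: "(p, C) \<in> ind.cosets"
  shows "spread_pair (p, g <#\<^bsub>G\<^esub> C) = (fst p, g <#\<^bsub>G\<^esub> snd (spread_pair (p, C)))"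
proof -
  obtain i t k where "(p, C) = ((i, t), k <#\<^bsub>G\<^esub> HK (i, t))" and itk: "(i, t) \<in> J" "k \<in> K"
    by (rule ind_cosetE[OF p])
  then have it: "p = (i, t)" "C = k <#\<^bsub>G\<^esub> HK (i, t)" "(i, t) \<in> J" "k \<in> K"
    by simp_all
  have i: "i \<in> I" "H i \<subseteq> carrier G" and t: "t \<in> carrier G" using it T_carrier H_closed(1) by auto
  note gk = K_closed(1)[OF g] K_closed(1)[OF it(4)]
  have "HK (i, t) \<subseteq> carrier G" using mem_HK_iff[OF it(3)] K_closed(1) by auto
  then have "g <#\<^bsub>G\<^esub> C = g \<otimes>\<^bsub>G\<^esub> k <#\<^bsub>G\<^esub> HK (i, t)" using gk it by (simp add: G.lcos_m_assoc)
  then show ?thesis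
    using it g gk t i by (simp add: spread_pair_def spread_l_coset K_closed G.lcos_m_assoc G.m_assoc)
qed

text \<open>The coefficient at a coset of the induced tuple is read off at its image under
  \<open>spread_pair\<close>. The inverse map \<open>from_induced\<close> is the pullback along the
  inverse bijection.\<close>

definition to_induced :: "('i \<Rightarrow> 'g set \<Rightarrow> 'r) \<Rightarrow> 'i \<times> 'g \<Rightarrow> 'g set \<Rightarrow> 'r"
  where "to_induced x = ind.unflat (pullback R ind.cosets spread_pair (fam.flat x))"

definition from_induced :: "('i \<times> 'g \<Rightarrow> 'g set \<Rightarrow> 'r) \<Rightarrow> 'i \<Rightarrow> 'g set \<Rightarrow> 'r"
  where "from_induced y = fam.unflat (pullback R fam.cosets (inv_into ind.cosets spread_pair) (ind.flat y))"

lemma flat_to_induced: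
  "x \<in> carrier fam.M \<Longrightarrow> ind.flat (to_induced x) = pullback R ind.cosets spread_pair (fam.flat x)"
  unfolding to_induced_def
  by (intro ind.flat_unflat R.pullback_closed[OF spread_pair_bij] fam.flat_closed)

lemma flat_from_induced:
  "y \<in> carrier ind.M \<Longrightarrow>
    fam.flat (from_induced y) = pullback R fam.cosets (inv_into ind.cosets spread_pair) (ind.flat y)"
  unfolding from_induced_def
  by (intro fam.flat_unflat R.pullback_closed[OF bij_betw_inv_into[OF spread_pair_bij]] ind.flat_closed)

lemma to_induced_closed: "x \<in> carrier fam.M \<Longrightarrow> to_induced x \<in> carrier ind.M"
  unfolding to_induced_def
  by (intro ind.unflat_closed R.pullback_closed[OF spread_pair_bij] fam.flat_closed)

lemma from_induced_closed: "y \<in> carrier ind.M \<Longrightarrow> from_induced y \<in> carrier fam.M"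
  unfolding from_induced_def
  by (intro fam.unflat_closed R.pullback_closed[OF bij_betw_inv_into[OF spread_pair_bij]] ind.flat_closed)

lemma to_from_induced: "y \<in> carrier ind.M \<Longrightarrow> to_induced (from_induced y) = y"
  by (rule ind.flat_eqD)
     (simp_all add: to_induced_closed from_induced_closed flat_to_induced flat_from_induced
        R.pullback_pullback(1)[OF spread_pair_bij ind.flat_closed])

lemma from_to_induced: "x \<in> carrier fam.M \<Longrightarrow> from_induced (to_induced x) = x"
  by (rule fam.flat_eqD)
     (simp_all add: to_induced_closed from_induced_closed flat_to_induced flat_from_induced
        R.pullback_pullback(2)[OF spread_pair_bij fam.flat_closed])

text \<open>The scalar is supported in \<open>K\<close>, and \<open>spread_pair\<close> commutes
  with translations by elements of \<open>K\<close>, so the two sums agree term by term.\<close>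

lemma to_induced_smult:
  assumes a: "a \<in> carrier (group_ring R GK)" and x: "x \<in> carrier fam.M"
  shows "to_induced (a \<odot>\<^bsub>fam.M\<^esub> x) = a \<odot>\<^bsub>ind.M\<^esub> to_induced x"
proof (rule ind.flat_eqD)
  interpret M: left_module "group_ring R G" fam.M by (rule fam.left_module_coset_sum)
  interpret N: left_module "group_ring R GK" ind.M by (rule ind.left_module_coset_sum)
  have aK: "a \<in> carrier (free_module R K)" using a by (simp add: carrier_group_ring)
  have ax: "a \<odot>\<^bsub>fam.M\<^esub> x \<in> carrier fam.M" using carrier_RK_RG[OF a] x by simp
  show "to_induced (a \<odot>\<^bsub>fam.M\<^esub> x) \<in> carrier ind.M" by (rule to_induced_closed[OF ax])
  show ajx: "a \<odot>\<^bsub>ind.M\<^esub> to_induced x \<in> carrier ind.M" using a to_induced_closed[OF x] by simp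
  note mem = R.free_mem[OF fam.flat_closed[OF x]] R.free_mem[OF aK]
  show "ind.flat (to_induced (a \<odot>\<^bsub>fam.M\<^esub> x)) = ind.flat (a \<odot>\<^bsub>ind.M\<^esub> to_induced x)"
  proof
    fix q
    show "ind.flat (to_induced (a \<odot>\<^bsub>fam.M\<^esub> x)) q = ind.flat (a \<odot>\<^bsub>ind.M\<^esub> to_induced x) q"
    proof (cases "q \<in> ind.cosets")
      case True
      obtain p C where q: "q = (p, C)" by (cases q)
      have pC: "(p, C) \<in> ind.cosets" using True q by blast
      have \<pi>: "(fst p, snd (spread_pair (p, C))) \<in> fam.cosets"
        using bij_betwE[OF spread_pair_bij] pC by (auto simp: spread_pair_def)
      have \<pi>_eq: "spread_pair (p, C) = (fst p, snd (spread_pair (p, C)))" by (simp add: spread_pair_def)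
      have "ind.flat (to_induced (a \<odot>\<^bsub>fam.M\<^esub> x)) q = fam.flat (a \<odot>\<^bsub>fam.M\<^esub> x) (fst p, snd (spread_pair (p, C)))"
        using True \<pi>_eq unfolding flat_to_induced[OF ax] q by (simp add: pullback_def)
      also have "\<dots> = (\<Oplus>g\<in>{g. a g \<noteq> \<zero>}. a g \<otimes> fam.flat x (fst p, inv\<^bsub>G\<^esub> g <#\<^bsub>G\<^esub> snd (spread_pair (p, C))))"
        by (rule fam.flat_smult[OF RK_RG[OF aK] \<pi>])
      also have "\<dots> = (\<Oplus>g\<in>{g. a g \<noteq> \<zero>}. a g \<otimes> ind.flat (to_induced x) (p, inv\<^bsub>GK\<^esub> g <#\<^bsub>GK\<^esub> C))"
      proof (rule R.finsum_cong')
        fix g assume "g \<in> {g. a g \<noteq> \<zero>}"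
        then have g: "g \<in> K" using aK by (auto simp: free_module_def)
        then have "(p, inv\<^bsub>G\<^esub> g <#\<^bsub>G\<^esub> C) \<in> ind.cosets"
          using ind.l_coset_mem_cosets[OF pC, of "inv\<^bsub>G\<^esub> g"] K_closed(2) by (simp add: l_coset_GK)
        then show "a g \<otimes> fam.flat x (fst p, inv\<^bsub>G\<^esub> g <#\<^bsub>G\<^esub> snd (spread_pair (p, C)))
            = a g \<otimes> ind.flat (to_induced x) (p, inv\<^bsub>GK\<^esub> g <#\<^bsub>GK\<^esub> C)"
          using g spread_pair_equivariant[OF K_closed(2)[OF g] pC]
          by (simp add: flat_to_induced[OF x] pullback_def inv_GK l_coset_GK)
      qed (use mem R.free_mem[OF ind.flat_closed[OF to_induced_closed[OF x]]] in auto)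
      also have "\<dots> = ind.flat (a \<odot>\<^bsub>ind.M\<^esub> to_induced x) q"
        unfolding q using aK by (intro ind.flat_smult[symmetric] pC) simp
      finally show ?thesis .
    next
      case False
      then show ?thesis
        using free_module_outside[OF ind.flat_closed[OF to_induced_closed[OF ax]] False]
          free_module_outside[OF ind.flat_closed[OF ajx] False] by simp
    qed
  qed
qed

lemma to_induced_Delta: "x \<in> carrier fam.\<Delta> \<Longrightarrow> to_induced x \<in> carrier ind.\<Delta>"
  by (simp add: fam.carrier_Delta ind.carrier_Delta to_induced_closed flat_to_induced
      R.total_pullback[OF spread_pair_bij fam.flat_closed])

lemma from_induced_Delta: "y \<in> carrier ind.\<Delta> \<Longrightarrow> from_induced y \<in> carrier fam.\<Delta>"
  by (simp add: fam.carrier_Delta ind.carrier_Delta from_induced_closed flat_from_induced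
      R.total_pullback[OF bij_betw_inv_into[OF spread_pair_bij] ind.flat_closed])

lemma to_induced_hom: "lmodule_hom (group_ring R GK) fam.\<Delta> ind.\<Delta> to_induced"
proof (rule lmodule_homI)
  show "left_module (group_ring R GK) fam.\<Delta>" by (rule left_module_restrict[OF fam.left_module_Delta])
  show "left_module (group_ring R GK) ind.\<Delta>" by (rule ind.left_module_Delta)
  interpret M: left_module "group_ring R G" fam.M by (rule fam.left_module_coset_sum)
  interpret N: left_module "group_ring R GK" ind.M by (rule ind.left_module_coset_sum)
  show "to_induced (x \<oplus>\<^bsub>fam.\<Delta>\<^esub> y) = to_induced x \<oplus>\<^bsub>ind.\<Delta>\<^esub> to_induced y"
    if "x \<in> carrier fam.\<Delta>" "y \<in> carrier fam.\<Delta>" for x y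
  proof -
    have xy: "x \<in> carrier fam.M" "y \<in> carrier fam.M" using that by (auto simp: fam.carrier_Delta)
    have "to_induced (x \<oplus>\<^bsub>fam.M\<^esub> y) = to_induced x \<oplus>\<^bsub>ind.M\<^esub> to_induced y"
    proof (rule ind.flat_eqD)
      show "ind.flat (to_induced (x \<oplus>\<^bsub>fam.M\<^esub> y)) = ind.flat (to_induced x \<oplus>\<^bsub>ind.M\<^esub> to_induced y)"
        using xy by (auto simp: flat_to_induced fam.flat_add ind.flat_add pullback_def fun_eq_iff)
    qed (use xy to_induced_closed in simp_all)
    then show ?thesis by (simp add: fam.Delta_ops ind.Delta_ops)
  qed
  show "to_induced (a \<odot>\<^bsub>fam.\<Delta>\<^esub> x) = a \<odot>\<^bsub>ind.\<Delta>\<^esub> to_induced x"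
    if "a \<in> carrier (group_ring R GK)" "x \<in> carrier fam.\<Delta>" for a x
    using that by (simp add: fam.Delta_ops ind.Delta_ops to_induced_smult fam.carrier_Delta)
qed (rule to_induced_Delta)

lemma Delta_iso:
  "lmodule_hom (group_ring R GK) fam.\<Delta> ind.\<Delta> to_induced"
  "lmodule_hom (group_ring R GK) ind.\<Delta> fam.\<Delta> from_induced"
  "x \<in> carrier fam.\<Delta> \<Longrightarrow> from_induced (to_induced x) = x"
  "y \<in> carrier ind.\<Delta> \<Longrightarrow> to_induced (from_induced y) = y"
proof -
  show "lmodule_hom (group_ring R GK) fam.\<Delta> ind.\<Delta> to_induced" by (rule to_induced_hom)
  show ft: "from_induced (to_induced x) = x" if "x \<in> carrier fam.\<Delta>" for x
    using that from_to_induced by (simp add: fam.carrier_Delta)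
  show tf: "to_induced (from_induced y) = y" if "y \<in> carrier ind.\<Delta>" for y
    using that to_from_induced by (simp add: ind.carrier_Delta)
  show "lmodule_hom (group_ring R GK) ind.\<Delta> fam.\<Delta> from_induced"
    by (rule lmodule_hom_inverse[OF to_induced_hom]) (fact from_induced_Delta ft tf)+
qed

end

section \<open>The long exact sequence\<close>

lemma bimodule_sum_simps:
  "carrier (bimodule_sum M N) = carrier M \<times> carrier N"
  "(x, y) \<oplus>\<^bsub>bimodule_sum M N\<^esub> (x', y') = (x \<oplus>\<^bsub>M\<^esub> x', y \<oplus>\<^bsub>N\<^esub> y')"
  "\<zero>\<^bsub>bimodule_sum M N\<^esub> = (\<zero>\<^bsub>M\<^esub>, \<zero>\<^bsub>N\<^esub>)"
  "a \<odot>\<^bsub>bimodule_sum M N\<^esub> (x, y) = (a \<odot>\<^bsub>M\<^esub> x, a \<odot>\<^bsub>N\<^esub> y)"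
  "turned_action R G (bimodule_sum M N) t (x, y) = (turned_action R G M t x, turned_action R G N t y)"
  by (simp_all add: bimodule_sum_def turned_action_def)

lemma commuting_action_bimodule_sum:
  assumes M: "commuting_action S M T (turned_action R G M)" and N: "commuting_action S N T (turned_action R G N)"
  shows "commuting_action S (bimodule_sum M N) T (turned_action R G (bimodule_sum M N))"
proof -
  interpret M: commuting_action S M T "turned_action R G M" by fact
  interpret N: commuting_action S N T "turned_action R G N" by fact
  have neg: "\<exists>y\<in>carrier (bimodule_sum M N). y \<oplus>\<^bsub>bimodule_sum M N\<^esub> x = \<zero>\<^bsub>bimodule_sum M N\<^esub>"
    if "x \<in> carrier (bimodule_sum M N)" for x
    using that by (intro bexI[of _ "(\<ominus>\<^bsub>M\<^esub> fst x, \<ominus>\<^bsub>N\<^esub> snd x)"])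
      (auto simp: bimodule_sum_simps M.M.M.l_neg N.M.M.l_neg)
  have "left_module S (bimodule_sum M N)"
    by (rule left_moduleI)
       (use neg in \<open>auto simp: bimodule_sum_simps M.M.S.ring_axioms M.M.M.a_ac N.M.M.a_ac M.M.smult_l_distr
          N.M.smult_l_distr M.M.smult_r_distr N.M.smult_r_distr M.M.smult_assoc N.M.smult_assoc\<close>)
  moreover have "left_module T (with_action (bimodule_sum M N) (turned_action R G (bimodule_sum M N)))"
    by (rule left_moduleI)
       (use neg in \<open>auto simp: bimodule_sum_simps M.act.S.ring_axioms M.M.M.a_ac N.M.M.a_ac
          M.act_simps N.act_simps\<close>)
  ultimately show ?thesis
    by (intro commuting_action.intro commuting_action_axioms.intro)
       (auto simp: bimodule_sum_simps M.commute N.commute)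
qed

context ring_group
begin

lemma fun_neg: "x \<in> Fun \<Longrightarrow> (\<lambda>g. \<ominus> x g) \<in> Fun"
  by (auto simp: group_functions_def)

lemma convolution_neg:
  assumes a: "a \<in> RG" and x: "x \<in> Fun"
  shows "convolution R G a (\<lambda>g. \<ominus> x g) = (\<lambda>g. \<ominus> convolution R G a x g)"
proof
  fix g
  have "(\<lambda>g. \<ominus> x g \<oplus> x g) = (\<lambda>_. \<zero>)" using fun_mem[OF x] by (simp add: R.l_neg)
  then have "convolution R G a (\<lambda>g. \<ominus> x g) g \<oplus> convolution R G a x g = \<zero>"
    using fun_cong[OF convolution_fun_add_right[OF a fun_neg[OF x] x], of g] by (simp add: convolution_zero)
  then show "convolution R G a (\<lambda>g. \<ominus> x g) g = \<ominus> convolution R G a x g"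
    using fun_mem[OF convolution_fun[OF a x]] fun_mem[OF convolution_fun[OF a fun_neg[OF x]]]
    by (simp add: R.minus_equality)
qed

lemma turned_neg:
  assumes a: "a \<in> RG" and x: "x \<in> Fun"
  shows "turned a (\<lambda>g. \<ominus> x g) = (\<lambda>g. \<ominus> turned a x g)"
proof
  fix g
  have "(\<lambda>g. \<ominus> x g \<oplus> x g) = (\<lambda>_. \<zero>)" using fun_mem[OF x] by (simp add: R.l_neg)
  then have "turned a (\<lambda>g. \<ominus> x g) g \<oplus> turned a x g = \<zero>"
    using fun_cong[OF turned_add_right[OF a fun_neg[OF x] x], of g] by (simp add: turned_def convolution_zero)
  then show "turned a (\<lambda>g. \<ominus> x g) g = \<ominus> turned a x g"
    using fun_mem[OF turned_fun[OF a x]] fun_mem[OF turned_fun[OF a fun_neg[OF x]]]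
    by (simp add: R.minus_equality)
qed

end

section \<open>The short exact sequence of Novikov coefficients\<close>

context integer_kernel
begin

abbreviation "RGb \<equiv> ring_bimodule (group_ring R G)"
abbreviation "Nov1 \<equiv> ring_bimodule (novikov_ring R G (\<lambda>g. real_of_int (\<phi> g)))"
abbreviation "Nov2 \<equiv> ring_bimodule (novikov_ring R G (\<lambda>g. - real_of_int (\<phi> g)))"
abbreviation "Nov \<equiv> bimodule_sum Nov1 Nov2"
abbreviation "Sop \<equiv> group_ring (opposite_ring R) GK"

sublocale fin: support_family R G finite
  by (rule support_family_finite)

sublocale nov1: support_family R G "\<lambda>X. \<forall>\<kappa>. finite {g \<in> X. real_of_int (\<phi> g) \<le> \<kappa>}"
  by (rule support_family_novikov)

sublocale nov2: support_family R G "\<lambda>X. \<forall>\<kappa>. finite {g \<in> X. - real_of_int (\<phi> g) \<le> \<kappa>}"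
  by (rule support_family_novikov)

lemma RGb_eq: "RGb = fin.bimod"
  by (simp add: group_ring_def)

lemma Nov_eq: "Nov1 = nov1.bimod" "Nov2 = nov2.bimod"
  by (simp_all add: novikov_ring_def)

lemmas RGb_simps = fin.bimod_simps[folded RGb_eq]
lemmas Nov1_simps = nov1.bimod_simps[folded Nov_eq(1)]
lemmas Nov2_simps = nov2.bimod_simps[folded Nov_eq(2)]

lemma restrict_action:
  "commuting_action S M (group_ring (opposite_ring R) G) \<alpha> \<Longrightarrow> commuting_action S M Sop \<alpha>"
  by (rule ring_subgroup.commuting_action_restrict[OF opposite_subgroup])

lemma commuting_actions:
  "commuting_action (group_ring R G) RGb Sop (turned_action R G RGb)"
  "commuting_action (group_ring R G) Nov Sop (turned_action R G Nov)"
  "commuting_action (group_ring R G) L Sop (turned_action R G L)"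
  "commuting_action (group_ring R GK) RK Sop (turned_action R GK RK)"
proof -
  show "commuting_action (group_ring R G) RGb Sop (turned_action R G RGb)"
    unfolding RGb_eq by (rule restrict_action[OF fin.commuting_action_bimod])
  show "commuting_action (group_ring R G) Nov Sop (turned_action R G Nov)"
    unfolding Nov_eq
    by (intro commuting_action_bimodule_sum restrict_action nov1.commuting_action_bimod nov2.commuting_action_bimod)
  show "commuting_action (group_ring R G) L Sop (turned_action R G L)"
    by (rule restrict_action[OF level.commuting_action_bimod])
  show "commuting_action (group_ring R GK) RK Sop (turned_action R GK RK)"
    unfolding RK_eq by (rule sub_finite.commuting_action_bimod)
qed

lemma op_scalar: "t \<in> carrier Sop \<Longrightarrow> t \<in> RG"
  by (simp add: carrier_group_ring RK_RG)

text \<open>The sign in the second component makes the composite with addition vanish, which leaves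
  addition as the map onto \<open>L\<close>.\<close>

definition diagonal :: "('g \<Rightarrow> 'r) \<Rightarrow> ('g \<Rightarrow> 'r) \<times> ('g \<Rightarrow> 'r)"
  where "diagonal x = (x, \<lambda>g. \<ominus> x g)"

definition sum_map :: "('g \<Rightarrow> 'r) \<times> ('g \<Rightarrow> 'r) \<Rightarrow> 'g \<Rightarrow> 'r"
  where "sum_map = (\<lambda>(x, y) g. x g \<oplus> y g)"

lemma neg_eq_zero_iff: "a \<in> carrier R \<Longrightarrow> \<ominus> a = \<zero> \<longleftrightarrow> a = \<zero>"
  by (metis R.minus_minus R.minus_zero)

lemma support_neg: "x \<in> Fun \<Longrightarrow> {g \<in> carrier G. \<ominus> x g \<noteq> \<zero>} = {g \<in> carrier G. x g \<noteq> \<zero>}"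
  using neg_eq_zero_iff fun_mem by blast

lemma diagonal_hom: "lmodule_hom (group_ring R G) RGb Nov diagonal"
proof (rule lmodule_homI)
  interpret N: commuting_action "group_ring R G" Nov Sop "turned_action R G Nov" by (rule commuting_actions)
  interpret F: commuting_action "group_ring R G" RGb Sop "turned_action R G RGb" by (rule commuting_actions)
  show "left_module (group_ring R G) RGb" "left_module (group_ring R G) Nov"
    by (rule F.M.left_module_axioms, rule N.M.left_module_axioms)
  show "diagonal x \<in> carrier Nov" if "x \<in> carrier RGb" for x
    using that by (auto simp: diagonal_def bimodule_sum_simps RGb_simps(1) Nov1_simps(1) Nov2_simps(1)
        fun_neg support_neg intro: rev_finite_subset)
qed (auto simp: diagonal_def bimodule_sum_simps RGb_simps Nov1_simps(2-) Nov2_simps(2-) carrier_group_ring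
    convolution_neg fun_mem R.minus_add)

lemma finite_level_novikov:
  "\<forall>\<kappa>. finite {g \<in> X. real_of_int (\<phi> g) \<le> \<kappa>} \<Longrightarrow> finite {g \<in> X. \<phi> g = n}"
  "\<forall>\<kappa>. finite {g \<in> X. - real_of_int (\<phi> g) \<le> \<kappa>} \<Longrightarrow> finite {g \<in> X. \<phi> g = n}"
proof -
  have "{g \<in> X. \<phi> g = n} \<subseteq> {g \<in> X. real_of_int (\<phi> g) \<le> real_of_int n}"
    "{g \<in> X. \<phi> g = n} \<subseteq> {g \<in> X. - real_of_int (\<phi> g) \<le> - real_of_int n}" by auto
  then show "\<forall>\<kappa>. finite {g \<in> X. real_of_int (\<phi> g) \<le> \<kappa>} \<Longrightarrow> finite {g \<in> X. \<phi> g = n}"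
    "\<forall>\<kappa>. finite {g \<in> X. - real_of_int (\<phi> g) \<le> \<kappa>} \<Longrightarrow> finite {g \<in> X. \<phi> g = n}"
    using finite_subset by blast+
qed

lemma Nov_level: "x \<in> carrier Nov1 \<Longrightarrow> x \<in> carrier L" "y \<in> carrier Nov2 \<Longrightarrow> y \<in> carrier L"
  using finite_level_novikov(1)[of "{g \<in> carrier G. x g \<noteq> \<zero>}"]
    finite_level_novikov(2)[of "{g \<in> carrier G. y g \<noteq> \<zero>}"]
  unfolding Nov1_simps(1) Nov2_simps(1) level.bimod_simps(1) by blast+

lemma sum_map_hom: "lmodule_hom (group_ring R G) Nov L sum_map"
proof (rule lmodule_homI)
  interpret N: commuting_action "group_ring R G" Nov Sop "turned_action R G Nov" by (rule commuting_actions)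
  show "left_module (group_ring R G) Nov" "left_module (group_ring R G) L"
    by (rule N.M.left_module_axioms, rule level.left_module_bimod)
  show "sum_map p \<in> carrier L" if "p \<in> carrier Nov" for p
    using that level.bimod_add Nov_level by (auto simp: sum_map_def bimodule_sum_simps)
  show "sum_map (p \<oplus>\<^bsub>Nov\<^esub> q) = sum_map p \<oplus>\<^bsub>L\<^esub> sum_map q" if "p \<in> carrier Nov" "q \<in> carrier Nov" for p q
    using that by (auto simp: sum_map_def bimodule_sum_simps level.bimod_simps(2) Nov1_simps(2) Nov2_simps(2)
        fun_mem[OF nov1.bimod_Fun[folded Nov_eq]] fun_mem[OF nov2.bimod_Fun[folded Nov_eq]] R.a_ac)
  show "sum_map (a \<odot>\<^bsub>Nov\<^esub> p) = a \<odot>\<^bsub>L\<^esub> sum_map p" if "a \<in> carrier (group_ring R G)" "p \<in> carrier Nov" for a p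
    using that by (auto simp: sum_map_def bimodule_sum_simps level.bimod_simps(4) Nov1_simps(4) Nov2_simps(4)
        carrier_group_ring convolution_fun_add_right nov1.bimod_Fun[folded Nov_eq] nov2.bimod_Fun[folded Nov_eq])
qed

text \<open>The second component is minus the first, so both Novikov conditions hold for one
  support. At the bound zero they make it finite on the nonpositive and on the nonnegative levels,
  which together exhaust the group.\<close>

lemma sum_map_kernel:
  assumes p: "p \<in> carrier Nov" and 0: "sum_map p = (\<lambda>_. \<zero>)"
  shows "p \<in> diagonal ` carrier RGb"
proof -
  obtain x y where xy: "p = (x, y)" "x \<in> carrier Nov1" "y \<in> carrier Nov2"
    using p by (auto simp: bimodule_sum_simps)
  have F: "x \<in> Fun" "y \<in> Fun"
    using nov1.bimod_Fun[folded Nov_eq, OF xy(2)] nov2.bimod_Fun[folded Nov_eq, OF xy(3)] .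
  have y: "y = (\<lambda>g. \<ominus> x g)"
  proof
    fix g
    have "y g \<oplus> x g = \<zero>"
      using fun_cong[OF 0, of g] fun_mem[OF F(1)] fun_mem[OF F(2)] by (simp add: xy sum_map_def R.a_comm)
    then show "y g = \<ominus> x g" using fun_mem[OF F(1)] fun_mem[OF F(2)] by (simp add: R.minus_equality)
  qed
  let ?X = "{g \<in> carrier G. x g \<noteq> \<zero>}"
  have fin: "finite {g \<in> ?X. real_of_int (\<phi> g) \<le> 0}" "finite {g \<in> ?X. - real_of_int (\<phi> g) \<le> 0}"
    using xy(2,3) unfolding Nov1_simps(1) Nov2_simps(1) y support_neg[OF F(1)] by blast+
  have "?X \<subseteq> {g \<in> ?X. real_of_int (\<phi> g) \<le> 0} \<union> {g \<in> ?X. - real_of_int (\<phi> g) \<le> 0}" by auto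
  then have "finite ?X" by (rule finite_subset) (intro finite_UnI fin)
  then have "x \<in> carrier RGb" using F by (simp add: RGb_simps(1))
  then show ?thesis using y xy by (auto simp: diagonal_def)
qed

lemma sum_map_surj:
  assumes z: "z \<in> carrier L"
  shows "z \<in> sum_map ` carrier Nov"
proof -
  have zF: "z \<in> Fun" and fin: "\<And>n. finite {g \<in> {g \<in> carrier G. z g \<noteq> \<zero>}. \<phi> g = n}"
    using z by (auto simp: level.bimod_simps(1))
  define x where "x g = (if 0 \<le> \<phi> g then z g else \<zero>)" for g
  define y where "y g = (if 0 \<le> \<phi> g then \<zero> else z g)" for g
  have F: "x \<in> Fun" "y \<in> Fun" using zF by (auto simp: x_def y_def group_functions_def)
  \<comment> \<open>Between zero and \<kappa> there are finitely many integers, and \<open>z\<close>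
    has finite support on each of these levels.\<close>
  have "finite {g \<in> {g \<in> carrier G. x g \<noteq> \<zero>}. real_of_int (\<phi> g) \<le> \<kappa>}" for \<kappa>
  proof (rule finite_subset)
    show "{g \<in> {g \<in> carrier G. x g \<noteq> \<zero>}. real_of_int (\<phi> g) \<le> \<kappa>}
        \<subseteq> (\<Union>n\<in>{0..\<lfloor>\<kappa>\<rfloor>}. {g \<in> {g \<in> carrier G. z g \<noteq> \<zero>}. \<phi> g = n})"
      by (auto simp: x_def le_floor_iff split: if_splits)
  qed (use fin in blast)
  then have x: "x \<in> carrier Nov1" using F by (simp add: Nov1_simps(1))
  have "finite {g \<in> {g \<in> carrier G. y g \<noteq> \<zero>}. - real_of_int (\<phi> g) \<le> \<kappa>}" for \<kappa>
  proof (rule finite_subset)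
    show "{g \<in> {g \<in> carrier G. y g \<noteq> \<zero>}. - real_of_int (\<phi> g) \<le> \<kappa>}
        \<subseteq> (\<Union>n\<in>{\<lceil>- \<kappa>\<rceil>..0}. {g \<in> {g \<in> carrier G. z g \<noteq> \<zero>}. \<phi> g = n})"
      by (auto simp: y_def ceiling_le_iff split: if_splits)
  qed (use fin in blast)
  then have y: "y \<in> carrier Nov2" using F by (simp add: Nov2_simps(1))
  have "sum_map (x, y) = z" using fun_mem[OF zF] by (auto simp: sum_map_def x_def y_def)
  then show ?thesis using x y by (force simp: bimodule_sum_simps)
qed

section \<open>Assembly of the long exact sequence\<close>

lemma long_exact_sequence_Ext:
  fixes A :: "('g \<Rightarrow> 'r, 'a) module"
  assumes A: "left_module (group_ring R G) A"
  shows "long_exact_sequence Sop (Ext (group_ring R G) A RGb (turned_action R G RGb))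
    (Ext (group_ring R G) A Nov (turned_action R G Nov)) (Ext (group_ring R G) A L (turned_action R G L))"
proof -
  interpret projective_resolution "group_ring R G" "resolution (group_ring R G) A" "res_diff (group_ring R G)" A
    "res_augmentation (group_ring R G) A" "\<lambda>n. if n < 0 then {} else res_basis (group_ring R G) A (nat n)"
    by (rule projective_resolution_resolution[OF A])
  show ?thesis
    unfolding Ext_eq_cohomology
  proof (rule long_exact_sequence_hom[OF commuting_actions(1-3) diagonal_hom sum_map_hom])
    show "diagonal (turned_action R G RGb t x) = turned_action R G Nov t (diagonal x)"
      if "t \<in> carrier Sop" "x \<in> carrier RGb" for t x
      using that op_scalar by (simp add: diagonal_def bimodule_sum_simps RGb_simps Nov1_simps(5) Nov2_simps(5)
          turned_neg)
    show "sum_map (turned_action R G Nov t p) = turned_action R G L t (sum_map p)"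
      if "t \<in> carrier Sop" "p \<in> carrier Nov" for t p
      using that op_scalar[OF that(1)] nov1.bimod_Fun[folded Nov_eq] nov2.bimod_Fun[folded Nov_eq]
      by (auto simp: sum_map_def bimodule_sum_simps level.bimod_simps(5) Nov1_simps(5) Nov2_simps(5)
          turned_add_right)
    show "x = \<zero>\<^bsub>RGb\<^esub>" if "diagonal x = \<zero>\<^bsub>Nov\<^esub>" for x
      using that by (simp add: diagonal_def bimodule_sum_simps Nov1_simps(3) RGb_simps(3))
    show "sum_map (diagonal x) = \<zero>\<^bsub>L\<^esub>" if "x \<in> carrier RGb" for x
      using that fun_mem[of x] by (simp add: diagonal_def sum_map_def level.bimod_simps(3) RGb_simps(1) R.r_neg)
    show "p \<in> diagonal ` carrier RGb" if "p \<in> carrier Nov" "sum_map p = \<zero>\<^bsub>L\<^esub>" for p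
      using that by (intro sum_map_kernel) (simp_all add: level.bimod_simps(3))
  qed (rule sum_map_surj)
qed

text \<open>An isomorphism over \<open>RK\<close> between \<open>A\<close> and \<open>B\<close> is
  allowed, rather than equality, because the two kernels of augmentation live over different index
  types.\<close>

lemma Ext_L_iso:
  fixes A :: "('g \<Rightarrow> 'r, 'a) module" and B :: "('g \<Rightarrow> 'r, 'b) module"
  assumes A: "left_module (group_ring R G) A"
    and j: "lmodule_hom (group_ring R GK) A B j" and j': "lmodule_hom (group_ring R GK) B A j'"
    and j'_j: "\<And>a. a \<in> carrier A \<Longrightarrow> j' (j a) = a" and j_j': "\<And>b. b \<in> carrier B \<Longrightarrow> j (j' b) = b"
  shows "\<exists>h. lmodule_hom Sop (Ext (group_ring R G) A L (turned_action R G L) n)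
      (Ext (group_ring R GK) B RK (turned_action R GK RK) n) h \<and>
    bij_betw h (carrier (Ext (group_ring R G) A L (turned_action R G L) n))
      (carrier (Ext (group_ring R GK) B RK (turned_action R GK RK) n))"
proof -
  interpret P: projective_resolution "group_ring R G" "resolution (group_ring R G) A" "res_diff (group_ring R G)" A
    "res_augmentation (group_ring R G) A" "\<lambda>n. if n < 0 then {} else res_basis (group_ring R G) A (nat n)"
    by (rule projective_resolution_resolution[OF A])
  interpret coinduction_setting
    "group_ring R G" "resolution (group_ring R G) A" "res_diff (group_ring R G)" A
    "res_augmentation (group_ring R G) A" "\<lambda>n. if n < 0 then {} else res_basis (group_ring R G) A (nat n)"
    "group_ring R GK" A "res_augmentation (group_ring R G) A"
    "\<lambda>n. (if n < 0 then {} else res_basis (group_ring R G) A (nat n)) \<times> (UNIV :: int set)"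
    "resolution (group_ring R GK) B" "res_diff (group_ring R GK)" B "res_augmentation (group_ring R GK) B"
    "\<lambda>n. if n < 0 then {} else res_basis (group_ring R GK) B (nat n)"
    L Sop "turned_action R G L" RK "turned_action R GK RK" res j j'
  proof (intro coinduction_setting.intro projective_resolution_pair.intro coinduction_setting_axioms.intro
      P.projective_resolution_axioms projective_resolution_restrict[OF A] projective_resolution_resolution
      lmodule_homD(2)[OF j] commuting_actions res_hom res_equivariant j j' j'_j j_j')
    show "\<exists>f. lmodule_hom (group_ring R G) (resolution (group_ring R G) A n) L f \<and>
        (\<forall>x\<in>carrier (resolution (group_ring R G) A n). res (f x) = h x)"
      if "lmodule_hom (group_ring R GK) (resolution (group_ring R G) A n) RK h" for n h
      by (rule coinduced_exists[OF P.module that])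
    show "f x = f' x"
      if "lmodule_hom (group_ring R G) (resolution (group_ring R G) A n) L f"
        "lmodule_hom (group_ring R G) (resolution (group_ring R G) A n) L f'"
        "\<And>x. x \<in> carrier (resolution (group_ring R G) A n) \<Longrightarrow> res (f x) = res (f' x)"
        "x \<in> carrier (resolution (group_ring R G) A n)" for n f f' x
      using that by (rule coinduced_unique)
    show "lmodule_hom (group_ring R GK) (resolution (group_ring R G) A n) L f"
      if "lmodule_hom (group_ring R G) (resolution (group_ring R G) A n) L f" for n f
      by (rule lmodule_hom_restrict[OF that])
  qed
  show ?thesis unfolding Ext_eq_cohomology by (rule cohomology_iso_coinduced)
qed

lemma long_exact_sequence_kernel:
  fixes A :: "('g \<Rightarrow> 'r, 'a) module" and B :: "('g \<Rightarrow> 'r, 'b) module"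
  assumes "left_module (group_ring R G) A"
    and "lmodule_hom (group_ring R GK) A B j" and "lmodule_hom (group_ring R GK) B A j'"
    and "\<And>a. a \<in> carrier A \<Longrightarrow> j' (j a) = a" and "\<And>b. b \<in> carrier B \<Longrightarrow> j (j' b) = b"
  shows "long_exact_sequence Sop (Ext (group_ring R G) A RGb (turned_action R G RGb))
    (Ext (group_ring R G) A Nov (turned_action R G Nov)) (Ext (group_ring R GK) B RK (turned_action R GK RK))"
  by (rule long_exact_sequence_iso[OF long_exact_sequence_Ext[OF assms(1)]]) (rule Ext_L_iso[OF assms])

text \<open>Both modules have carrier \<open>R\<close> with the action through the augmentation,
  which does not change when a function on \<open>K\<close> is extended by zero. The identity thus
  serves in both directions.\<close>

lemma trivial_module_restrict:
  "lmodule_hom (group_ring R GK) (trivial_module R G) (trivial_module R GK) (\<lambda>x. x)"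
  "lmodule_hom (group_ring R GK) (trivial_module R GK) (trivial_module R G) (\<lambda>x. x)"
  using left_module_restrict[OF left_module_trivial] sub.left_module_trivial
  by (intro lmodule_homI; simp add: trivial_module_simps sub.trivial_module_simps carrier_group_ring RK_RG)+

end

text \<open>Accounts for the degree convention of group pairs, whose cohomology in degree
  \<open>n\<close> is Ext in degree \<open>n - 1\<close>.\<close>

lemma long_exact_sequence_shift:
  assumes "long_exact_sequence S A B C"
  shows "long_exact_sequence S (\<lambda>n. A (n - 1)) (\<lambda>n. B (n - 1)) (\<lambda>n. C (n - 1))"
proof -
  obtain f g \<delta> where ex: "\<And>n. exact_at S (A n) (B n) (C n) (f n) (g n)"
      "\<And>n. exact_at S (B n) (C n) (A (n + 1)) (g n) (\<delta> n)"
      "\<And>n. exact_at S (C n) (A (n + 1)) (B (n + 1)) (\<delta> n) (f (n + 1))"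
    using assms unfolding long_exact_sequence_def by blast
  show ?thesis
    unfolding long_exact_sequence_def
    by (rule exI[of _ "\<lambda>n. f (n - 1)"], rule exI[of _ "\<lambda>n. g (n - 1)"], rule exI[of _ "\<lambda>n. \<delta> (n - 1)"])
       (use ex(1)[of "_ - 1"] ex(2)[of "_ - 1"] ex(3)[of "_ - 1"] in simp)
qed

theorem proposition3p4:
  fixes R :: "('r, 'c) ring_scheme"
    and G :: "('g, 'd) monoid_scheme"
    and \<phi> :: "'g \<Rightarrow> int"
    and I :: "'i set"
    and H :: "'i \<Rightarrow> 'g set"
    and T :: "'i \<Rightarrow> 'g set"
  assumes "ring R" and "\<one>\<^bsub>R\<^esub> \<noteq> \<zero>\<^bsub>R\<^esub>"
    and "group G"
    and "\<phi> \<in> epi G integer_group"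
    and "K = kernel G integer_group \<phi>"
    and "\<And>i. i \<in> I \<Longrightarrow> subgroup (H i) G"
    and "\<And>i. i \<in> I \<Longrightarrow> double_coset_reps G (H i) K (T i)"
    and "RG = ring_bimodule (group_ring R G)"
    and "Nov = bimodule_sum (ring_bimodule (novikov_ring R G (\<lambda>g. real_of_int (\<phi> g))))
                            (ring_bimodule (novikov_ring R G (\<lambda>g. - real_of_int (\<phi> g))))"
    and "GK = G\<lparr>carrier := K\<rparr>"
    and "RK = ring_bimodule (group_ring R GK)"
  shows "(I = {} \<longrightarrow>
      long_exact_sequence (group_ring (opposite_ring R) GK)
        (group_cohomology R G RG)
        (group_cohomology R G Nov)
        (group_cohomology R GK RK)) \<and>
    (I \<noteq> {} \<longrightarrow>
      long_exact_sequence (group_ring (opposite_ring R) GK)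
        (pair_cohomology R G I H RG)
        (pair_cohomology R G I H Nov)
        (pair_cohomology R GK (Sigma I T) (induced_tuple G H K) RK))"
proof -
  interpret ik: integer_kernel R G \<phi> K
    by (intro integer_kernel.intro ring_group.intro integer_kernel_axioms.intro assms(1,3-5))
  interpret mackey R G K I H T
    by (intro mackey.intro ik.ring_subgroup_axioms subgroup_family.intro ik.ring_group_axioms
        subgroup_family_axioms.intro mackey_axioms.intro assms(6,7))
  note eqs = assms(8-11)
  have "long_exact_sequence (group_ring (opposite_ring R) GK) (group_cohomology R G RG)
      (group_cohomology R G Nov) (group_cohomology R GK RK)"
    unfolding eqs group_cohomology_def
    by (rule ik.long_exact_sequence_kernel[OF ik.left_module_trivial ik.trivial_module_restrict]) simp_all
  moreover have "long_exact_sequence (group_ring (opposite_ring R) GK) (pair_cohomology R G I H RG)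
      (pair_cohomology R G I H Nov) (pair_cohomology R GK (Sigma I T) (induced_tuple G H K) RK)"
    unfolding eqs pair_cohomology_def
    by (rule long_exact_sequence_shift,
        rule ik.long_exact_sequence_kernel[OF fam.left_module_Delta Delta_iso(1,2)])
       (fact Delta_iso(3,4))+
  ultimately show ?thesis by blast
qed

end
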